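(* Let $L=-\mathrm{div}(a(x)\nabla)+c(x)$ be as in the context, $H=\partial_t+L$, $0<s<1$. If $u,v\in\mathrm{Dom}(H^s)$ (real-valued) then $$\begin{aligned}\langle H^su,v\rangle&=\int_0^\infty\!\!\int_{\mathbb{R}}\iint_\Omega K_s(\tau,x,z)\big(u(t-\tau,x)-u(t-\tau,z)\big)\big(v(t,x)-v(t,z)\big)\,dz\,dx\,dt\,d\tau\\&\quad+\int_0^\infty\bigg[\int_{\mathbb{R}}\int_\Omega\frac{1-e^{-\tau L}1(x)}{|\Gamma(-s)|\tau^{1+s}}u(t,x)v(t,x)\,dx\,dt-\int_{\mathbb{R}}\int_\Omega e^{-\tau L}1(x)\frac{u(t-\tau,x)-u(t,x)}{|\Gamma(-s)|\tau^{1+s}}v(t,x)\,dx\,dt\bigg]d\tau,\end{aligned}$$ where $K_s(\tau,x,z)=\dfrac{W_\tau(x,z)}{2|\Gamma(-s)|\tau^{1+s}}$ and $e^{-\tau L}1(x)=\int_\Omega W_\tau(x,z)\,dz$.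
   Context: $\Omega\subset\mathbb{R}^n$ is a bounded domain and $L=-\mathrm{div}(a(x)\nabla)+c(x)$ with homogeneous Dirichlet or Neumann (conormal) boundary condition, where $a=(a^{ij})$ is bounded, measurable, symmetric with $\Lambda^{-1}|\xi|^2\le a^{ij}(x)\xi_i\xi_j\le\Lambda|\xi|^2$, and $0\le c\in L^\infty(\Omega)$. $L$ has eigenvalues $0\le\lambda_0<\lambda_1\le\cdots\to\infty$ with eigenfunctions $\{\phi_k\}$ an orthonormal basis of $L^2(\Omega)$; if $\lambda_0=0$ functions are assumed to have zero mean over $\Omega$. $W_\tau(x,z)=W_\tau(z,x)\ge0$ is the heat kernel of $e^{-\tau L}$. For $u\in L^2(\mathbb{R}\times\Omega)$, $u_k(t)=\int_\Omega u\phi_k\,dx$, $\widehat{u_k}$ its Fourier transform in $t$; for $H=\partial_t+L$, $\mathrm{Dom}(H^s)=\{u:\int_{\mathbb{R}}\sum_k|i\rho+\lambda_k|^s|\widehat{u_k}(\rho)|^2d\rho<\infty\}$ and $\langle H^su,v\rangle=\int_{\mathbb{R}}\sum_k(i\rho+\lambda_k)^s\widehat{u_k}(\rho)\overline{\widehat{v_k}(\rho)}\,d\rho$ (principal branch). *)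

theory Defs
  imports "HOL-Analysis.Analysis"
begin

definition L2_on :: "'a::euclidean_space set \<Rightarrow> ('a \<Rightarrow> real) \<Rightarrow> bool" where
  "L2_on \<Omega> f \<longleftrightarrow> f \<in> borel_measurable (lebesgue_on \<Omega>)
      \<and> integrable (lebesgue_on \<Omega>) (\<lambda>x. (f x)\<^sup>2)"

definition pder :: "'n::finite \<Rightarrow> (real^'n \<Rightarrow> real) \<Rightarrow> real^'n \<Rightarrow> real" where
  "pder i f x = frechet_derivative f (at x) (axis i 1)"

text \<open>C^infinity functions: differentiable everywhere, with all partial derivatives again C^infinity
  (greatest fixed point, i.e. all iterated partial derivatives exist)\<close>
coinductive smooth_fun :: "(real^'n::finite \<Rightarrow> real) \<Rightarrow> bool" where
  "(\<forall>x. f differentiable (at x)) \<Longrightarrow> (\<forall>i. smooth_fun (pder i f)) \<Longrightarrow> smooth_fun f"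

definition test_fun :: "(real^'n::finite) set \<Rightarrow> (real^'n \<Rightarrow> real) \<Rightarrow> bool" where
  "test_fun \<Omega> \<psi> \<longleftrightarrow> smooth_fun \<psi> \<and> (\<exists>K. compact K \<and> K \<subseteq> \<Omega> \<and> (\<forall>x. x \<notin> K \<longrightarrow> \<psi> x = 0))"

definition H1_grad :: "(real^'n::finite) set \<Rightarrow> (real^'n \<Rightarrow> real) \<Rightarrow> (real^'n \<Rightarrow> real^'n) \<Rightarrow> bool" where
  "H1_grad \<Omega> f g \<longleftrightarrow> L2_on \<Omega> f \<and> (\<forall>i. L2_on \<Omega> (\<lambda>x. g x $ i)) \<and>
     (\<forall>\<psi>. test_fun \<Omega> \<psi> \<longrightarrow> (\<forall>i.
        (\<integral>x. f x * pder i \<psi> x \<partial>lebesgue_on \<Omega>) = - (\<integral>x. g x $ i * \<psi> x \<partial>lebesgue_on \<Omega>)))"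

definition H1 :: "(real^'n::finite) set \<Rightarrow> (real^'n \<Rightarrow> real) set" where
  "H1 \<Omega> = {f. \<exists>g. H1_grad \<Omega> f g}"

definition wgrad :: "(real^'n::finite) set \<Rightarrow> (real^'n \<Rightarrow> real) \<Rightarrow> real^'n \<Rightarrow> real^'n" where
  "wgrad \<Omega> f = (SOME g. H1_grad \<Omega> f g)"

definition H1_dist :: "(real^'n::finite) set \<Rightarrow> (real^'n \<Rightarrow> real) \<Rightarrow> (real^'n \<Rightarrow> real) \<Rightarrow> real" where
  "H1_dist \<Omega> f h = sqrt ((\<integral>x. (f x - h x)\<^sup>2 \<partial>lebesgue_on \<Omega>)
      + (\<Sum>i\<in>UNIV. \<integral>x. (wgrad \<Omega> f x $ i - wgrad \<Omega> h x $ i)\<^sup>2 \<partial>lebesgue_on \<Omega>))"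

definition H1_0 :: "(real^'n::finite) set \<Rightarrow> (real^'n \<Rightarrow> real) set" where
  "H1_0 \<Omega> = {f \<in> H1 \<Omega>. \<exists>\<psi>. (\<forall>m. test_fun \<Omega> (\<psi> m)) \<and> (\<lambda>m. H1_dist \<Omega> (\<psi> m) f) \<longlonglongrightarrow> 0}"

text \<open>form domain: Dirichlet (dir = True) uses H^1_0, Neumann (conormal) uses H^1\<close>
definition form_dom :: "bool \<Rightarrow> (real^'n::finite) set \<Rightarrow> (real^'n \<Rightarrow> real) set" where
  "form_dom dir \<Omega> = (if dir then H1_0 \<Omega> else H1 \<Omega>)"

definition Lform :: "(real^'n::finite \<Rightarrow> real^'n^'n) \<Rightarrow> (real^'n \<Rightarrow> real) \<Rightarrow> (real^'n) set
    \<Rightarrow> (real^'n \<Rightarrow> real) \<Rightarrow> (real^'n \<Rightarrow> real) \<Rightarrow> real" where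
  "Lform a c \<Omega> f h = (\<integral>x. (a x *v wgrad \<Omega> f x) \<bullet> wgrad \<Omega> h x + c x * f x * h x \<partial>lebesgue_on \<Omega>)"

definition is_eigenpair :: "(real^'n::finite \<Rightarrow> real^'n^'n) \<Rightarrow> (real^'n \<Rightarrow> real) \<Rightarrow> bool \<Rightarrow> (real^'n) set
    \<Rightarrow> real \<Rightarrow> (real^'n \<Rightarrow> real) \<Rightarrow> bool" where
  "is_eigenpair a c dir \<Omega> lam \<phi> \<longleftrightarrow> \<phi> \<in> form_dom dir \<Omega> \<and>
     (\<forall>\<psi>\<in>form_dom dir \<Omega>. Lform a c \<Omega> \<phi> \<psi> = lam * (\<integral>x. \<phi> x * \<psi> x \<partial>lebesgue_on \<Omega>))"

definition L2_onb :: "(real^'n::finite) set \<Rightarrow> (nat \<Rightarrow> real^'n \<Rightarrow> real) \<Rightarrow> bool" where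
  "L2_onb \<Omega> \<phi> \<longleftrightarrow> (\<forall>k. L2_on \<Omega> (\<phi> k)) \<and>
     (\<forall>j k. (\<integral>x. \<phi> j x * \<phi> k x \<partial>lebesgue_on \<Omega>) = (if j = k then 1 else 0)) \<and>
     (\<forall>f. L2_on \<Omega> f \<and> (\<forall>k. (\<integral>x. f x * \<phi> k x \<partial>lebesgue_on \<Omega>) = 0)
          \<longrightarrow> (AE x in lebesgue_on \<Omega>. f x = 0))"

definition heat_kernel :: "(real^'n::finite) set \<Rightarrow> (nat \<Rightarrow> real) \<Rightarrow> (nat \<Rightarrow> real^'n \<Rightarrow> real)
    \<Rightarrow> (real \<Rightarrow> real^'n \<Rightarrow> real^'n \<Rightarrow> real) \<Rightarrow> bool" where
  "heat_kernel \<Omega> lam \<phi> W \<longleftrightarrow> (\<forall>\<tau>>0.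
     (\<lambda>(x,z). W \<tau> x z) \<in> borel_measurable (lebesgue_on \<Omega> \<Otimes>\<^sub>M lebesgue_on \<Omega>) \<and>
     (\<forall>f. L2_on \<Omega> f \<longrightarrow>
        (AE x in lebesgue_on \<Omega>. integrable (lebesgue_on \<Omega>) (\<lambda>z. W \<tau> x z * f z)) \<and>
        L2_on \<Omega> (\<lambda>x. \<integral>z. W \<tau> x z * f z \<partial>lebesgue_on \<Omega>) \<and>
        (\<lambda>N. \<integral>x. ((\<integral>z. W \<tau> x z * f z \<partial>lebesgue_on \<Omega>)
              - (\<Sum>k<N. exp (- \<tau> * lam k) * (\<integral>y. f y * \<phi> k y \<partial>lebesgue_on \<Omega>) * \<phi> k x))\<^sup>2
            \<partial>lebesgue_on \<Omega>) \<longlonglongrightarrow> 0))"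

definition L2_st :: "(real^'n::finite) set \<Rightarrow> (real \<Rightarrow> real^'n \<Rightarrow> real) \<Rightarrow> bool" where
  "L2_st \<Omega> u \<longleftrightarrow> (\<lambda>(t,x). u t x) \<in> borel_measurable (lborel \<Otimes>\<^sub>M lebesgue_on \<Omega>) \<and>
     integrable (lborel \<Otimes>\<^sub>M lebesgue_on \<Omega>) (\<lambda>(t,x). (u t x)\<^sup>2)"

definition coef :: "(real^'n::finite) set \<Rightarrow> (nat \<Rightarrow> real^'n \<Rightarrow> real) \<Rightarrow> (real \<Rightarrow> real^'n \<Rightarrow> real)
    \<Rightarrow> nat \<Rightarrow> real \<Rightarrow> real" where
  "coef \<Omega> \<phi> u k t = (\<integral>x. u t x * \<phi> k x \<partial>lebesgue_on \<Omega>)"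

definition fourier_L2 :: "(real \<Rightarrow> real) \<Rightarrow> (real \<Rightarrow> complex) \<Rightarrow> bool" where
  "fourier_L2 f g \<longleftrightarrow> g \<in> borel_measurable lborel \<and>
     ((\<lambda>R. \<integral>\<^sup>+\<rho>. ennreal ((cmod (g \<rho> - complex_of_real (1 / sqrt (2 * pi)) *
            (LINT t:{-R..R}|lborel. exp (- \<i> * complex_of_real (\<rho> * t)) * complex_of_real (f t))))\<^sup>2)
         \<partial>lborel) \<longlongrightarrow> 0) at_top"

definition hat :: "(real^'n::finite) set \<Rightarrow> (nat \<Rightarrow> real^'n \<Rightarrow> real) \<Rightarrow> (real \<Rightarrow> real^'n \<Rightarrow> real)
    \<Rightarrow> nat \<Rightarrow> real \<Rightarrow> complex" where
  "hat \<Omega> \<phi> u k = (SOME g. fourier_L2 (coef \<Omega> \<phi> u k) g)"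

definition Dom_Hs :: "(real^'n::finite) set \<Rightarrow> (nat \<Rightarrow> real) \<Rightarrow> (nat \<Rightarrow> real^'n \<Rightarrow> real) \<Rightarrow> real
    \<Rightarrow> (real \<Rightarrow> real^'n \<Rightarrow> real) set" where
  "Dom_Hs \<Omega> lam \<phi> s = {u. L2_st \<Omega> u \<and>
     (\<integral>\<^sup>+\<rho>. (\<Sum>k. ennreal (cmod (\<i> * complex_of_real \<rho> + complex_of_real (lam k)) powr s
                             * (cmod (hat \<Omega> \<phi> u k \<rho>))\<^sup>2)) \<partial>lborel) < \<infinity>}"

text \<open><H^s u, v> with the principal branch of (i \<rho> + \<lambda>_k)^s\<close>
definition Hs_pair :: "(real^'n::finite) set \<Rightarrow> (nat \<Rightarrow> real) \<Rightarrow> (nat \<Rightarrow> real^'n \<Rightarrow> real) \<Rightarrow> real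
    \<Rightarrow> (real \<Rightarrow> real^'n \<Rightarrow> real) \<Rightarrow> (real \<Rightarrow> real^'n \<Rightarrow> real) \<Rightarrow> complex" where
  "Hs_pair \<Omega> lam \<phi> s u v = (\<integral>\<rho>. (\<Sum>k. (\<i> * complex_of_real \<rho> + complex_of_real (lam k)) powr complex_of_real s
        * hat \<Omega> \<phi> u k \<rho> * cnj (hat \<Omega> \<phi> v k \<rho>)) \<partial>lborel)"

definition heat1 :: "(real^'n::finite) set \<Rightarrow> (real \<Rightarrow> real^'n \<Rightarrow> real^'n \<Rightarrow> real) \<Rightarrow> real \<Rightarrow> real^'n \<Rightarrow> real" where
  "heat1 \<Omega> W \<tau> x = (\<integral>z. W \<tau> x z \<partial>lebesgue_on \<Omega>)"

definition Ks :: "(real \<Rightarrow> 'a \<Rightarrow> 'a \<Rightarrow> real) \<Rightarrow> real \<Rightarrow> real \<Rightarrow> 'a \<Rightarrow> 'a \<Rightarrow> real" where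
  "Ks W s \<tau> x z = W \<tau> x z / (2 * \<bar>Gamma (- s)\<bar> * \<tau> powr (1 + s))"

end

theory Submission
  imports Defs "HOL-Probability.Probability" "HOL-Complex_Analysis.Complex_Analysis"
begin

text \<open>
  Write \<open>h \<tau> = exp (- \<tau> L) 1\<close>. Expanding the product in the first integral and using the symmetry of
  \<open>W\<close>, the two integrands at time lag \<open>\<tau>\<close> add up to \<open>\<langle>u - exp (- \<tau> H) u, v\<rangle> / (\<bar>\<Gamma>(-s)\<bar> \<tau>\<^bsup>1+s\<^esup>)\<close>.
  By Plancherel in time and Parseval in space this is an integral of \<open>1 - exp (- \<tau> (i\<rho> + \<lambda>\<^sub>k))\<close> against
  \<open>u\<^sub>k\<close> and \<open>v\<^sub>k\<close> on the Fourier side, and integrating in \<open>\<tau>\<close> produces \<open>(i\<rho> + \<lambda>\<^sub>k)\<^bsup>s\<^esup>\<close>, first for real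
  arguments by Euler's integral and then on the closed right half-plane by analytic continuation.

  That each of the two integrals converges separately rests on \<open>h \<tau> \<le> 1\<close>: then the jump form of \<open>u\<close> at
  time lag \<open>\<tau>\<close> is at most \<open>\<Sum>\<^sub>k (1 - exp (- \<tau> \<lambda>\<^sub>k)) \<parallel>u\<^sub>k\<parallel>\<^sup>2\<close>, whose weighted integral is bounded by the energy in
  the domain of \<open>H\<^sup>s\<close>. For the Neumann condition \<open>h \<tau> \<le> 1\<close> follows from \<open>L 1 = c \<ge> 0\<close> and positivity of \<open>W\<close>; for the
  Dirichlet condition it is dual to the \<open>L\<^sup>1\<close> contractivity of the resolvent, proved by testing with a
  smooth approximation of the sign function, and of its powers, which approximate the semigroup.
\<close>

section \<open>Square integrable functions and orthonormal expansions\<close>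

text \<open>The heat kernel is given lag by lag: \<open>W \<tau>\<close> is measurable in its two
  space variables for each fixed \<tau>, and no joint measurability with \<tau> is assumed.
  Functions of \<tau> that have to be integrated are therefore rewritten as series in eigenvalues
  and coefficients, from which measurability in \<tau> can be read off.

  Of the two final integrals only the jump integral is estimated directly. The sum of both is
  absolutely integrable by Fubini on lag, index and frequency, and the bracket is integrable as the
  difference; its two terms are never separated in \<tau>.

  The nonlinearity is instead applied to smooth functions of compact support only; the mismatch
  between their gradients and the true ones is quadratic, by polarisation, and vanishes in the
  limit.

  The transform \<open>hat\<close> is selected by choice, so its properties are proved for every
  function related to the coefficient by \<open>fourier_L2\<close>.\<close>

definition sqint :: "'a measure \<Rightarrow> ('a \<Rightarrow> 'b::real_normed_vector) \<Rightarrow> bool" where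
  "sqint M f \<longleftrightarrow> f \<in> borel_measurable M \<and> integrable M (\<lambda>x. (norm (f x))\<^sup>2)"

lemma L2_on_iff_sqint: "L2_on \<Omega> f \<longleftrightarrow> sqint (lebesgue_on \<Omega>) f"
  by (simp add: L2_on_def sqint_def)

lemma sqint_measurable [measurable_dest]: "sqint M f \<Longrightarrow> f \<in> borel_measurable M"
  by (simp add: sqint_def)

lemma sqint_integrable: "sqint M f \<Longrightarrow> integrable M (\<lambda>x. (norm (f x))\<^sup>2)"
  by (simp add: sqint_def)

lemma power2_norm_add_le: "(norm (a + b :: 'b::real_normed_vector))\<^sup>2 \<le> 2 * (norm a)\<^sup>2 + 2 * (norm b)\<^sup>2"
proof -
  have "(norm (a + b))\<^sup>2 \<le> (norm a + norm b)\<^sup>2"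
    by (simp add: norm_triangle_ineq power_mono)
  also have "\<dots> \<le> 2 * (norm a)\<^sup>2 + 2 * (norm b)\<^sup>2"
    using sum_squares_bound[of "norm a" "norm b"] by (simp add: power2_sum)
  finally show ?thesis .
qed

lemma power2_norm_diff_le: "(norm (a - b :: 'b::real_normed_vector))\<^sup>2 \<le> 2 * (norm a)\<^sup>2 + 2 * (norm b)\<^sup>2"
  using power2_norm_add_le[of a "- b"] by simp

lemma sqint_bound:
  fixes f :: "'a \<Rightarrow> 'b::{second_countable_topology, real_normed_vector}"
  assumes "f \<in> borel_measurable M" "integrable M g" "AE x in M. (norm (f x))\<^sup>2 \<le> g x"
  shows "sqint M f"
  unfolding sqint_def
proof
  show "integrable M (\<lambda>x. (norm (f x))\<^sup>2)"
    using assms by (intro Bochner_Integration.integrable_bound[OF assms(2)]) auto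
qed (fact assms)

lemma sqint_add:
  fixes f g :: "'a \<Rightarrow> 'b::{second_countable_topology, real_normed_vector}"
  assumes "sqint M f" "sqint M g"
  shows "sqint M (\<lambda>x. f x + g x)"
  using assms
  by (intro sqint_bound[where g = "\<lambda>x. 2 * (norm (f x))\<^sup>2 + 2 * (norm (g x))\<^sup>2"])
     (auto simp: power2_norm_add_le sqint_def)

lemma sqint_diff:
  fixes f g :: "'a \<Rightarrow> 'b::{second_countable_topology, real_normed_vector}"
  assumes "sqint M f" "sqint M g"
  shows "sqint M (\<lambda>x. f x - g x)"
  using assms
  by (intro sqint_bound[where g = "\<lambda>x. 2 * (norm (f x))\<^sup>2 + 2 * (norm (g x))\<^sup>2"])
     (auto simp: power2_norm_diff_le sqint_def)

lemma sqint_cmult: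
  fixes f :: "'a \<Rightarrow> 'b::{second_countable_topology, real_normed_algebra}"
  assumes "sqint M f"
  shows "sqint M (\<lambda>x. c * f x)"
proof (rule sqint_bound[where g = "\<lambda>x. (norm c)\<^sup>2 * (norm (f x))\<^sup>2"])
  have "(norm (c * f x))\<^sup>2 \<le> (norm c)\<^sup>2 * (norm (f x))\<^sup>2" for x
    by (metis norm_ge_zero norm_mult_ineq power_mono power_mult_distrib)
  then show "AE x in M. (norm (c * f x))\<^sup>2 \<le> (norm c)\<^sup>2 * (norm (f x))\<^sup>2" by simp
qed (use assms in \<open>auto simp: sqint_def\<close>)

lemma sqint_sum:
  fixes f :: "'i \<Rightarrow> 'a \<Rightarrow> 'b::{second_countable_topology, real_normed_vector}"
  assumes "\<And>i. i \<in> I \<Longrightarrow> sqint M (f i)"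
  shows "sqint M (\<lambda>x. \<Sum>i\<in>I. f i x)"
  using assms
proof (induction I rule: infinite_finite_induct)
  case (insert i I)
  then show ?case by (auto intro: sqint_add)
qed (auto simp: sqint_def)

lemma sqint_mult_integrable:
  fixes f g :: "'a \<Rightarrow> 'b::{second_countable_topology, real_normed_algebra, banach}"
  assumes "sqint M f" "sqint M g"
  shows "integrable M (\<lambda>x. f x * g x)"
proof (rule Bochner_Integration.integrable_bound[where f = "\<lambda>x. (norm (f x))\<^sup>2 + (norm (g x))\<^sup>2"])
  have "norm (f x * g x) \<le> (norm (f x))\<^sup>2 + (norm (g x))\<^sup>2" for x
  proof -
    have "norm (f x * g x) \<le> norm (f x) * norm (g x)" by (rule norm_mult_ineq)
    moreover have "0 \<le> norm (f x) * norm (g x)" by simp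
    ultimately show ?thesis using sum_squares_bound[of "norm (f x)" "norm (g x)"] by linarith
  qed
  then show "AE x in M. norm (f x * g x) \<le> norm ((norm (f x))\<^sup>2 + (norm (g x))\<^sup>2)" by simp
qed (use assms in \<open>auto simp: sqint_def\<close>)

lemma sqint_norm: "sqint M f \<Longrightarrow> sqint M (\<lambda>x. norm (f x))"
  by (auto simp: sqint_def)

text \<open>Only norms enter, so the plain product is used, without conjugation. The inequality for
  nonnegative integrals carries over to Bochner integrals because all integrals involved are
  finite.\<close>

lemma sqint_Cauchy_Schwarz:
  fixes f g :: "'a \<Rightarrow> 'b::{second_countable_topology, real_normed_algebra, banach}"
  assumes f: "sqint M f" and g: "sqint M g"
  shows "norm (\<integral>x. f x * g x \<partial>M) \<le> sqrt (\<integral>x. (norm (f x))\<^sup>2 \<partial>M) * sqrt (\<integral>x. (norm (g x))\<^sup>2 \<partial>M)"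
proof -
  have [measurable]: "f \<in> borel_measurable M" "g \<in> borel_measurable M"
    using f g by (auto simp: sqint_def)
  have i: "integrable M (\<lambda>x. norm (f x) * norm (g x))"
    by (intro sqint_mult_integrable sqint_norm f g)
  have "(\<integral>\<^sup>+x. ennreal (norm (f x)) * ennreal (norm (g x)) \<partial>M)\<^sup>2
      \<le> (\<integral>\<^sup>+x. (ennreal (norm (f x)))\<^sup>2 \<partial>M) * (\<integral>\<^sup>+x. (ennreal (norm (g x)))\<^sup>2 \<partial>M)"
    by (intro Cauchy_Schwarz_nn_integral) auto
  also have "(\<integral>\<^sup>+x. (ennreal (norm (f x)))\<^sup>2 \<partial>M) = ennreal (\<integral>x. (norm (f x))\<^sup>2 \<partial>M)"
    using f by (subst nn_integral_eq_integral[symmetric]) (auto simp: sqint_def ennreal_power)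
  also have "(\<integral>\<^sup>+x. (ennreal (norm (g x)))\<^sup>2 \<partial>M) = ennreal (\<integral>x. (norm (g x))\<^sup>2 \<partial>M)"
    using g by (subst nn_integral_eq_integral[symmetric]) (auto simp: sqint_def ennreal_power)
  also have "(\<integral>\<^sup>+x. ennreal (norm (f x)) * ennreal (norm (g x)) \<partial>M) = ennreal (\<integral>x. norm (f x) * norm (g x) \<partial>M)"
    using i by (subst nn_integral_eq_integral[symmetric]) (auto simp: ennreal_mult)
  finally have "(\<integral>x. norm (f x) * norm (g x) \<partial>M)\<^sup>2 \<le> (\<integral>x. (norm (f x))\<^sup>2 \<partial>M) * (\<integral>x. (norm (g x))\<^sup>2 \<partial>M)"
    by (subst (asm) ennreal_power, simp, subst (asm) ennreal_mult[symmetric]) auto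
  then have "(\<integral>x. norm (f x) * norm (g x) \<partial>M) \<le> sqrt (\<integral>x. (norm (f x))\<^sup>2 \<partial>M) * sqrt (\<integral>x. (norm (g x))\<^sup>2 \<partial>M)"
    by (metis real_le_rsqrt real_sqrt_mult)
  moreover have "norm (\<integral>x. f x * g x \<partial>M) \<le> (\<integral>x. norm (f x) * norm (g x) \<partial>M)"
    using i by (intro order_trans[OF integral_norm_bound] Bochner_Integration.integral_mono' norm_mult_ineq) auto
  ultimately show ?thesis by linarith
qed

text \<open>Expand the difference of the products into a product of two differences plus two terms
  with one difference each, and apply the Cauchy-Schwarz inequality to the three. The filter is
  arbitrary because limits are taken along sequences as well as along real radii tending to
  infinity.\<close>

lemma sqint_tendsto_mult:
  fixes f g :: "'a \<Rightarrow> 'b::{second_countable_topology, real_normed_algebra, banach}"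
  assumes f: "sqint M f" and g: "sqint M g"
    and fn: "\<And>n. sqint M (fn n)" and gn: "\<And>n. sqint M (gn n)"
    and limf: "((\<lambda>n. \<integral>x. (norm (fn n x - f x))\<^sup>2 \<partial>M) \<longlongrightarrow> 0) F"
    and limg: "((\<lambda>n. \<integral>x. (norm (gn n x - g x))\<^sup>2 \<partial>M) \<longlongrightarrow> 0) F"
  shows "((\<lambda>n. \<integral>x. fn n x * gn n x \<partial>M) \<longlongrightarrow> (\<integral>x. f x * g x \<partial>M)) F"
proof -
  define a where "a n = sqrt (\<integral>x. (norm (fn n x - f x))\<^sup>2 \<partial>M)" for n
  define b where "b n = sqrt (\<integral>x. (norm (gn n x - g x))\<^sup>2 \<partial>M)" for n
  define A where "A = sqrt (\<integral>x. (norm (f x))\<^sup>2 \<partial>M)"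
  define B where "B = sqrt (\<integral>x. (norm (g x))\<^sup>2 \<partial>M)"
  have a: "(a \<longlongrightarrow> 0) F" and b: "(b \<longlongrightarrow> 0) F"
    unfolding a_def b_def using tendsto_real_sqrt[OF limf] tendsto_real_sqrt[OF limg] by auto
  have df: "sqint M (\<lambda>x. fn n x - f x)" and dg: "sqint M (\<lambda>x. gn n x - g x)" for n
    by (intro sqint_diff f g fn gn)+
  have le: "norm ((\<integral>x. fn n x * gn n x \<partial>M) - (\<integral>x. f x * g x \<partial>M)) \<le> a n * b n + a n * B + A * b n" for n
  proof -
    have "(\<integral>x. fn n x * gn n x \<partial>M) - (\<integral>x. f x * g x \<partial>M) = (\<integral>x. fn n x * gn n x - f x * g x \<partial>M)"
      by (intro Bochner_Integration.integral_diff[symmetric] sqint_mult_integrable f g fn gn)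
    also have "\<dots> = (\<integral>x. ((fn n x - f x) * (gn n x - g x) + (fn n x - f x) * g x) + f x * (gn n x - g x) \<partial>M)"
      by (simp add: algebra_simps)
    also have "\<dots> = (\<integral>x. (fn n x - f x) * (gn n x - g x) \<partial>M) + (\<integral>x. (fn n x - f x) * g x \<partial>M)
        + (\<integral>x. f x * (gn n x - g x) \<partial>M)"
      by (subst Bochner_Integration.integral_add, (intro Bochner_Integration.integrable_add sqint_mult_integrable f g df dg)+)
         (subst Bochner_Integration.integral_add, (intro sqint_mult_integrable f g df dg)+, simp)
    finally show ?thesis
      unfolding a_def b_def A_def B_def
      using sqint_Cauchy_Schwarz[OF df[of n] dg[of n]] sqint_Cauchy_Schwarz[OF df[of n] g]
        sqint_Cauchy_Schwarz[OF f dg[of n]]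
      by (smt (verit) norm_triangle_ineq)
  qed
  have "((\<lambda>n. a n * b n + a n * B + A * b n) \<longlongrightarrow> 0 * 0 + 0 * B + A * 0) F"
    by (intro tendsto_intros a b)
  then have "((\<lambda>n. (\<integral>x. fn n x * gn n x \<partial>M) - (\<integral>x. f x * g x \<partial>M)) \<longlongrightarrow> 0) F"
    by (intro Lim_null_comparison[OF always_eventually[OF allI[OF le]]]) simp
  then show ?thesis by (simp add: LIM_zero_iff)
qed

text \<open>Distances stay squared, at the price of the factor 2 from
  \<open>power2_norm_add_le\<close>; this spares square roots in the approximation
  arguments.\<close>

lemma sqint_dist_triangle:
  fixes f g h :: "'a \<Rightarrow> 'b::{second_countable_topology, real_normed_vector}"
  assumes "sqint M f" "sqint M g" "sqint M h"
  shows "(\<integral>x. (norm (f x - h x))\<^sup>2 \<partial>M) \<le> 2 * (\<integral>x. (norm (f x - g x))\<^sup>2 \<partial>M) + 2 * (\<integral>x. (norm (g x - h x))\<^sup>2 \<partial>M)"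
proof -
  have i: "integrable M (\<lambda>x. (norm (f x - h x))\<^sup>2)" "integrable M (\<lambda>x. (norm (f x - g x))\<^sup>2)"
    "integrable M (\<lambda>x. (norm (g x - h x))\<^sup>2)"
    by (intro sqint_integrable sqint_diff assms)+
  have "(\<integral>x. (norm (f x - h x))\<^sup>2 \<partial>M) \<le> (\<integral>x. 2 * (norm (f x - g x))\<^sup>2 + 2 * (norm (g x - h x))\<^sup>2 \<partial>M)"
  proof (intro integral_mono)
    show "(norm (f x - h x))\<^sup>2 \<le> 2 * (norm (f x - g x))\<^sup>2 + 2 * (norm (g x - h x))\<^sup>2" for x
      using power2_norm_add_le[of "f x - g x" "g x - h x"] by simp
  qed (use i in auto)
  then show ?thesis using i by simp
qed

text \<open>The geometric rate makes the increments summable almost everywhere, by monotone convergence.\<close>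
lemma sqint_complete_fast:
  fixes f :: "nat \<Rightarrow> 'a \<Rightarrow> 'b::{second_countable_topology, banach}"
  assumes f: "\<And>n. sqint M (f n)"
    and fast: "\<And>n. (\<integral>x. (norm (f (Suc n) x - f n x))\<^sup>2 \<partial>M) \<le> (1/8) ^ n"
  shows "\<exists>g. g \<in> borel_measurable M \<and> (AE x in M. (\<lambda>n. f n x) \<longlonglongrightarrow> g x)"
proof -
  have [measurable]: "f n \<in> borel_measurable M" for n using f by (auto simp: sqint_def)
  \<comment> \<open>Against the rate \<open>(1/8) ^ n\<close> the weight \<open>2 ^ n\<close> still
    leaves \<open>(1/4) ^ n\<close>, so the weighted squares are summable a.e. Conversely,
    \<open>D n x < 1\<close> bounds the increment by \<open>(1 / sqrt 2) ^ n\<close>, a geometric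
    series.\<close>
  define D where "D n x = 2 ^ n * (norm (f (Suc n) x - f n x))\<^sup>2" for n x
  have [measurable]: "D n \<in> borel_measurable M" for n unfolding D_def by measurable
  have "(\<integral>\<^sup>+x. (\<Sum>n. ennreal (D n x)) \<partial>M) = (\<Sum>n. \<integral>\<^sup>+x. ennreal (D n x) \<partial>M)"
    by (intro nn_integral_suminf) auto
  also have "\<dots> \<le> (\<Sum>n. ennreal ((1/4)^n))"
  proof (intro suminf_le allI)
    fix n
    have "(\<integral>\<^sup>+x. ennreal (D n x) \<partial>M) = ennreal (\<integral>x. D n x \<partial>M)"
      unfolding D_def by (intro nn_integral_eq_integral integrable_mult_right sqint_integrable sqint_diff f) auto
    also have "(\<integral>x. D n x \<partial>M) \<le> 2 ^ n * (1/8)^n"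
      unfolding D_def using fast[of n] by simp
    also have "(2::real) ^ n * (1/8)^n = (1/4)^n" by (simp flip: power_mult_distrib)
    finally show "(\<integral>\<^sup>+x. ennreal (D n x) \<partial>M) \<le> ennreal ((1/4)^n)" by (simp add: ennreal_leI)
  qed auto
  also have "\<dots> = ennreal (\<Sum>n. (1/4)^n)"
    by (intro suminf_ennreal2) auto
  finally have "(\<integral>\<^sup>+x. (\<Sum>n. ennreal (D n x)) \<partial>M) \<noteq> \<infinity>" by (auto simp: top_unique)
  then have "AE x in M. (\<Sum>n. ennreal (D n x)) \<noteq> \<infinity>"
    by (intro nn_integral_PInf_AE) auto
  then have conv: "AE x in M. convergent (\<lambda>n. f n x)"
  proof eventually_elim
    case (elim x)
    have Dpos: "0 \<le> D n x" for n by (simp add: D_def)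
    have "summable (\<lambda>n. D n x)"
      using elim Dpos by (intro summable_suminf_not_top) auto
    then have "(\<lambda>n. D n x) \<longlonglongrightarrow> 0" by (rule summable_LIMSEQ_zero)
    then have "\<forall>\<^sub>F n in sequentially. D n x < 1" by (rule order_tendstoD) simp
    then have "\<forall>\<^sub>F n in sequentially. norm (f (Suc n) x - f n x) \<le> (1 / sqrt 2) ^ n"
    proof eventually_elim
      case (elim n)
      then have "(norm (f (Suc n) x - f n x))\<^sup>2 \<le> 1 / 2 ^ n"
        by (simp add: D_def field_simps)
      also have "\<dots> = ((1 / sqrt 2) ^ n)\<^sup>2"
        by (simp add: power_divide power_mult[symmetric] mult.commute[of n 2] power_mult[of "sqrt 2" 2 n])
      finally show ?case by (rule power2_le_imp_le) simp
    qed
    then have "summable (\<lambda>n. f (Suc n) x - f n x)"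
      by (rule summable_comparison_test_ev) (auto simp: summable_geometric)
    then have "convergent (\<lambda>n. \<Sum>k<n. f (Suc k) x - f k x)" by (simp add: summable_iff_convergent)
    then have "convergent (\<lambda>n. f n x - f 0 x)"
      by (simp only: sum_lessThan_telescope[of "\<lambda>n. f n x"])
    then have "convergent (\<lambda>n. (f n x - f 0 x) + f 0 x)"
      by (rule convergent_add) (rule convergent_const)
    then show ?case by simp
  qed
  show ?thesis
  proof (intro exI conjI)
    show "(\<lambda>x. lim (\<lambda>n. f n x)) \<in> borel_measurable M" by measurable
    show "AE x in M. (\<lambda>n. f n x) \<longlonglongrightarrow> lim (\<lambda>n. f n x)"
      using conv by eventually_elim (simp add: convergent_LIMSEQ_iff)
  qed
qed

text \<open>Fatou's lemma. Together with \<open>sqint_complete_fast\<close> it turns a pointwise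
  limit into a limit in L2, before \<open>g\<close> is known to be square integrable.\<close>

lemma nn_integral_norm_limit_le:
  fixes f :: "nat \<Rightarrow> 'a \<Rightarrow> 'b::{second_countable_topology, banach}"
  assumes [measurable]: "\<And>n. f n \<in> borel_measurable M" "g \<in> borel_measurable M" "h \<in> borel_measurable M"
    and lim: "AE x in M. (\<lambda>n. f n x) \<longlonglongrightarrow> g x"
    and le: "\<forall>\<^sub>F n in sequentially. (\<integral>\<^sup>+x. ennreal ((norm (f n x - h x))\<^sup>2) \<partial>M) \<le> B"
  shows "(\<integral>\<^sup>+x. ennreal ((norm (g x - h x))\<^sup>2) \<partial>M) \<le> B"
proof -
  have "(\<integral>\<^sup>+x. ennreal ((norm (g x - h x))\<^sup>2) \<partial>M) = (\<integral>\<^sup>+x. liminf (\<lambda>n. ennreal ((norm (f n x - h x))\<^sup>2)) \<partial>M)"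
    using lim
  proof (intro nn_integral_cong_AE, eventually_elim)
    case (elim x)
    then have "(\<lambda>n. ennreal ((norm (f n x - h x))\<^sup>2)) \<longlonglongrightarrow> ennreal ((norm (g x - h x))\<^sup>2)"
      by (intro tendsto_ennrealI tendsto_intros)
    then show ?case by (rule lim_imp_Liminf[OF trivial_limit_sequentially, symmetric])
  qed
  also have "\<dots> \<le> liminf (\<lambda>n. \<integral>\<^sup>+x. ennreal ((norm (f n x - h x))\<^sup>2) \<partial>M)"
    by (rule nn_integral_liminf) simp
  also have "\<dots> \<le> limsup (\<lambda>n. \<integral>\<^sup>+x. ennreal ((norm (f n x - h x))\<^sup>2) \<partial>M)"
    by (rule Liminf_le_Limsup) simp
  also have "\<dots> \<le> B" using le by (rule Limsup_bounded)
  finally show ?thesis .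
qed

definition orthonormal_in :: "'a measure \<Rightarrow> (nat \<Rightarrow> 'a \<Rightarrow> real) \<Rightarrow> bool" where
  "orthonormal_in M \<phi> \<longleftrightarrow> (\<forall>k. sqint M (\<phi> k)) \<and> (\<forall>j k. (\<integral>x. \<phi> j x * \<phi> k x \<partial>M) = (if j = k then 1 else 0))"

lemma orthonormal_in_sqint: "orthonormal_in M \<phi> \<Longrightarrow> sqint M (\<phi> k)"
  by (simp add: orthonormal_in_def)

lemma sqint_lincomb: "orthonormal_in M \<phi> \<Longrightarrow> sqint M (\<lambda>x. \<Sum>k\<in>I. b k * \<phi> k x)"
  by (intro sqint_sum sqint_cmult) (simp add: orthonormal_in_def)

lemma integral_lincomb_mult:
  assumes "orthonormal_in M \<phi>" "sqint M f"
  shows "(\<integral>x. (\<Sum>k\<in>I. b k * \<phi> k x) * f x \<partial>M) = (\<Sum>k\<in>I. b k * (\<integral>x. f x * \<phi> k x \<partial>M))"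
proof -
  have i: "integrable M (\<lambda>x. b k * (f x * \<phi> k x))" for k
    using assms by (intro integrable_mult_right sqint_mult_integrable) (auto simp: orthonormal_in_def)
  have "(\<integral>x. (\<Sum>k\<in>I. b k * \<phi> k x) * f x \<partial>M) = (\<integral>x. (\<Sum>k\<in>I. b k * (f x * \<phi> k x)) \<partial>M)"
    by (simp add: sum_distrib_right mult.assoc mult.commute[of "f _"])
  then show ?thesis using i by (subst (asm) Bochner_Integration.integral_sum) simp_all
qed

lemma integral_lincomb_sq:
  assumes "orthonormal_in M \<phi>" "finite I"
  shows "(\<integral>x. (\<Sum>k\<in>I. b k * \<phi> k x)\<^sup>2 \<partial>M) = (\<Sum>k\<in>I. (b k)\<^sup>2)"
proof -
  have "(\<integral>x. (\<Sum>k\<in>I. b k * \<phi> k x) * \<phi> j x \<partial>M) = b j" if "j \<in> I" for j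
  proof -
    have "(\<integral>x. (\<Sum>k\<in>I. b k * \<phi> k x) * \<phi> j x \<partial>M) = (\<Sum>k\<in>I. b k * (\<integral>x. \<phi> j x * \<phi> k x \<partial>M))"
      using assms by (intro integral_lincomb_mult) (auto simp: orthonormal_in_def)
    also have "\<dots> = (\<Sum>k\<in>I. if j = k then b k else 0)"
      using assms by (intro sum.cong) (auto simp: orthonormal_in_def)
    also have "\<dots> = b j" using that assms by simp
    finally show ?thesis .
  qed
  then show ?thesis
    using integral_lincomb_mult[OF assms(1) sqint_lincomb[OF assms(1), of b I], of b I]
    by (simp add: power2_eq_square)
qed

text \<open>Pythagoras for the projection onto finitely many basis functions. Nonnegativity of the
  left side is Bessel's inequality, and the right side shows that the error decreases as indices are
  added.\<close>

lemma integral_sq_diff_lincomb: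
  fixes f :: "'a \<Rightarrow> real"
  assumes on: "orthonormal_in M \<phi>" and f: "sqint M f" and I: "finite I"
  shows "(\<integral>x. (f x - (\<Sum>k\<in>I. (\<integral>y. f y * \<phi> k y \<partial>M) * \<phi> k x))\<^sup>2 \<partial>M)
      = (\<integral>x. (f x)\<^sup>2 \<partial>M) - (\<Sum>k\<in>I. (\<integral>y. f y * \<phi> k y \<partial>M)\<^sup>2)"
proof -
  define S where "S x = (\<Sum>k\<in>I. (\<integral>y. f y * \<phi> k y \<partial>M) * \<phi> k x)" for x
  have S: "sqint M S" unfolding S_def by (rule sqint_lincomb[OF on])
  have i: "integrable M (\<lambda>x. (f x)\<^sup>2)" "integrable M (\<lambda>x. (S x)\<^sup>2)" "integrable M (\<lambda>x. 2 * (S x * f x))"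
    using sqint_integrable[OF f] sqint_integrable[OF S] sqint_mult_integrable[OF S f] by auto
  have "(\<integral>x. (f x - S x)\<^sup>2 \<partial>M) = (\<integral>x. ((f x)\<^sup>2 + (S x)\<^sup>2) - 2 * (S x * f x) \<partial>M)"
    by (intro Bochner_Integration.integral_cong) (auto simp: power2_diff algebra_simps)
  also have "\<dots> = (\<integral>x. (f x)\<^sup>2 \<partial>M) + (\<integral>x. (S x)\<^sup>2 \<partial>M) - 2 * (\<integral>x. S x * f x \<partial>M)"
    using i by simp
  also have "(\<integral>x. S x * f x \<partial>M) = (\<Sum>k\<in>I. (\<integral>y. f y * \<phi> k y \<partial>M)\<^sup>2)"
    unfolding S_def by (subst integral_lincomb_mult[OF on f]) (simp add: power2_eq_square)
  also have "(\<integral>x. (S x)\<^sup>2 \<partial>M) = (\<Sum>k\<in>I. (\<integral>y. f y * \<phi> k y \<partial>M)\<^sup>2)"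
    unfolding S_def by (rule integral_lincomb_sq[OF on I])
  finally show ?thesis by (simp add: S_def)
qed

lemma Bessel_summable:
  fixes f :: "'a \<Rightarrow> real"
  assumes on: "orthonormal_in M \<phi>" and f: "sqint M f"
  shows "summable (\<lambda>k. (\<integral>y. f y * \<phi> k y \<partial>M)\<^sup>2)"
proof (rule summableI_nonneg_bounded)
  show "(\<Sum>k<n. (\<integral>y. f y * \<phi> k y \<partial>M)\<^sup>2) \<le> (\<integral>x. (f x)\<^sup>2 \<partial>M)" for n
  proof -
    have "0 \<le> (\<integral>x. (f x - (\<Sum>k<n. (\<integral>y. f y * \<phi> k y \<partial>M) * \<phi> k x))\<^sup>2 \<partial>M)" by simp
    then show ?thesis by (simp only: integral_sq_diff_lincomb[OF on f finite_lessThan]) 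
  qed
qed simp

text \<open>Supplies indices along which the partial sums of an expansion are Cauchy at a prescribed
  rate, as \<open>sqint_complete_fast\<close> demands.\<close>

lemma summable_tail_bounded_subseq:
  fixes a e :: "nat \<Rightarrow> real"
  assumes a: "summable a" "\<And>k. 0 \<le> a k" and e: "\<And>n. 0 < e n"
  shows "\<exists>r. strict_mono r \<and> (\<forall>n m. r n \<le> m \<longrightarrow> (\<Sum>k\<in>{r n..<m}. a k) \<le> e n)"
proof -
  have "\<exists>N. \<forall>m\<ge>N. \<forall>l\<ge>m. (\<Sum>k\<in>{m..<l}. a k) \<le> e n" for n
  proof -
    obtain N where N: "\<And>m l. N \<le> m \<Longrightarrow> norm (sum a {m..<l}) < e n"
      using a(1) e[of n] unfolding summable_Cauchy by meson
    show ?thesis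
    proof (intro exI[of _ N] allI impI)
      fix m l assume "N \<le> m" "m \<le> l"
      then show "(\<Sum>k\<in>{m..<l}. a k) \<le> e n" using N[of m l] by simp
    qed
  qed
  then obtain N where N: "\<And>n m l. N n \<le> m \<Longrightarrow> m \<le> l \<Longrightarrow> (\<Sum>k\<in>{m..<l}. a k) \<le> e n" by metis
  \<comment> \<open>A running sum of \<open>N i + 1\<close> is strictly increasing and dominates
    each \<open>N n\<close>, so one definition serves both demands.\<close>
  define r where "r n = (\<Sum>i\<le>n. N i + 1)" for n
  have "strict_mono r" by (rule strict_monoI, rule lift_Suc_mono_less[of r]) (simp_all add: r_def)
  moreover have "N n \<le> r n" for n
    unfolding r_def by (cases n) (auto simp: atMost_Suc)
  ultimately show ?thesis using N by blast
qed

text \<open>Riesz-Fischer: partial sums along a fast subsequence have a limit \<open>g\<close> in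
  L2, the difference \<open>f - g\<close> is orthogonal to every basis function, and completeness
  forces \<open>f = g\<close> a.e. The full sequence follows because the error decreases with the
  number of terms.\<close>

lemma orthonormal_expansion:
  fixes f :: "'a \<Rightarrow> real"
  assumes on: "orthonormal_in M \<phi>" and f: "sqint M f"
    and complete: "\<And>g. sqint M g \<Longrightarrow> (\<forall>k. (\<integral>x. g x * \<phi> k x \<partial>M) = 0) \<Longrightarrow> AE x in M. g x = 0"
  shows "(\<lambda>N. \<integral>x. (f x - (\<Sum>k<N. (\<integral>y. f y * \<phi> k y \<partial>M) * \<phi> k x))\<^sup>2 \<partial>M) \<longlonglongrightarrow> 0"
proof -
  define b where "b k = (\<integral>y. f y * \<phi> k y \<partial>M)" for k
  define S where "S N x = (\<Sum>k<N. b k * \<phi> k x)" for N x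
  have S: "sqint M (S N)" for N unfolding S_def by (rule sqint_lincomb[OF on])
  have sm: "summable (\<lambda>k. (b k)\<^sup>2)" unfolding b_def by (rule Bessel_summable[OF on f])
  obtain r where r: "strict_mono r" and tail: "\<And>n m. r n \<le> m \<Longrightarrow> (\<Sum>k\<in>{r n..<m}. (b k)\<^sup>2) \<le> (1/8)^n"
    using summable_tail_bounded_subseq[OF sm, of "\<lambda>n. (1/8)^n"] by auto
  have Sdiff: "(\<integral>x. (S m x - S l x)\<^sup>2 \<partial>M) = (\<Sum>k\<in>{l..<m}. (b k)\<^sup>2)" if "l \<le> m" for l m
  proof -
    have "S m x - S l x = (\<Sum>k\<in>{l..<m}. b k * \<phi> k x)" for x
      using that unfolding S_def atLeast0LessThan[symmetric]
      using sum_diff_nat_ivl[of 0 l m "\<lambda>k. b k * \<phi> k x"] by simp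
    then show ?thesis using integral_lincomb_sq[OF on] by simp
  qed
  have "\<exists>g. g \<in> borel_measurable M \<and> (AE x in M. (\<lambda>n. S (r n) x) \<longlonglongrightarrow> g x)"
  proof (rule sqint_complete_fast)
    show "(\<integral>x. (norm (S (r (Suc n)) x - S (r n) x))\<^sup>2 \<partial>M) \<le> (1/8)^n" for n
      using tail[of n "r (Suc n)"] Sdiff[of "r n" "r (Suc n)"] r
      by (simp add: strict_mono_less_eq)
  qed (rule S)
  then obtain g where [measurable]: "g \<in> borel_measurable M"
    and gl: "AE x in M. (\<lambda>n. S (r n) x) \<longlonglongrightarrow> g x" by auto
  have [measurable]: "S N \<in> borel_measurable M" for N using S by (auto simp: sqint_def)
  have gS: "(\<integral>\<^sup>+x. ennreal ((norm (g x - S (r i) x))\<^sup>2) \<partial>M) \<le> ennreal ((1/8)^i)" for i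
  proof (rule nn_integral_norm_limit_le[OF _ _ _ gl])
    have "(\<integral>\<^sup>+x. ennreal ((norm (S (r n) x - S (r i) x))\<^sup>2) \<partial>M) \<le> ennreal ((1/8)^i)" if "i \<le> n" for n
    proof -
      have "r i \<le> r n" using r that by (simp add: strict_mono_less_eq)
      then show ?thesis
        using tail[of i "r n"] Sdiff[of "r i" "r n"]
        by (subst nn_integral_eq_integral[OF sqint_integrable[OF sqint_diff[OF S S]]]) (simp_all add: ennreal_leI)
    qed
    then show "\<forall>\<^sub>F n in sequentially. (\<integral>\<^sup>+x. ennreal ((norm (S (r n) x - S (r i) x))\<^sup>2) \<partial>M) \<le> ennreal ((1/8)^i)"
      by (rule eventually_sequentiallyI)
  qed auto
  have gSi: "sqint M (\<lambda>x. g x - S (r i) x)" for i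
    unfolding sqint_def
  proof
    show "integrable M (\<lambda>x. (norm (g x - S (r i) x))\<^sup>2)"
      using order_le_less_trans[OF gS[of i]] by (intro integrableI_bounded) auto
  qed simp
  have g: "sqint M g" using sqint_add[OF gSi[of 0] S[of "r 0"]] by simp
  have gSlim: "(\<lambda>i. \<integral>x. (norm (S (r i) x - g x))\<^sup>2 \<partial>M) \<longlonglongrightarrow> 0"
  proof (rule tendsto_sandwich[OF _ _ tendsto_const])
    show "\<forall>\<^sub>F i in sequentially. (\<integral>x. (norm (S (r i) x - g x))\<^sup>2 \<partial>M) \<le> (1/8)^i"
    proof (intro always_eventually allI)
      fix i
      have "ennreal (\<integral>x. (norm (g x - S (r i) x))\<^sup>2 \<partial>M) \<le> ennreal ((1/8)^i)"
        using gS[of i] by (subst nn_integral_eq_integral[OF sqint_integrable[OF gSi], symmetric]) simp_all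
      then show "(\<integral>x. (norm (S (r i) x - g x))\<^sup>2 \<partial>M) \<le> (1/8)^i"
        by (simp add: norm_minus_commute power2_commute)
    qed
    show "(\<lambda>i. (1/8)^i :: real) \<longlonglongrightarrow> 0" by (rule LIMSEQ_realpow_zero) auto
  qed auto
  have "(\<integral>x. (f x - g x) * \<phi> k x \<partial>M) = 0" for k
  proof -
    have phi: "sqint M (\<phi> k)" using on by (simp add: orthonormal_in_def)
    have "(\<lambda>i. \<integral>x. S (r i) x * \<phi> k x \<partial>M) \<longlonglongrightarrow> (\<integral>x. g x * \<phi> k x \<partial>M)"
      by (intro sqint_tendsto_mult g phi S gSlim) simp
    moreover have "(\<lambda>i. \<integral>x. S (r i) x * \<phi> k x \<partial>M) \<longlonglongrightarrow> b k"
    proof (rule tendsto_eventually, rule eventually_sequentiallyI[of "Suc k"])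
      fix i assume "Suc k \<le> i"
      then have k: "k < r i" using strict_mono_imp_increasing[OF r, of i] by simp
      have "(\<integral>x. S (r i) x * \<phi> k x \<partial>M) = (\<Sum>j<r i. b j * (\<integral>x. \<phi> k x * \<phi> j x \<partial>M))"
        unfolding S_def by (rule integral_lincomb_mult[OF on phi])
      also have "\<dots> = (\<Sum>j<r i. if k = j then b j else 0)"
        using on by (intro sum.cong) (auto simp: orthonormal_in_def)
      finally show "(\<integral>x. S (r i) x * \<phi> k x \<partial>M) = b k" using k by simp
    qed
    ultimately have "(\<integral>x. g x * \<phi> k x \<partial>M) = b k"
      by (rule LIMSEQ_unique)
    moreover have "(\<integral>x. (f x - g x) * \<phi> k x \<partial>M) = (\<integral>x. f x * \<phi> k x \<partial>M) - (\<integral>x. g x * \<phi> k x \<partial>M)"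
      using sqint_mult_integrable[OF f phi] sqint_mult_integrable[OF g phi] by (simp add: left_diff_distrib)
    ultimately show ?thesis by (simp add: b_def)
  qed
  then have "AE x in M. f x - g x = 0" by (intro complete sqint_diff f g) auto
  then have fg: "(\<integral>x. (f x - S (r i) x)\<^sup>2 \<partial>M) = (\<integral>x. (norm (S (r i) x - g x))\<^sup>2 \<partial>M)" for i
    using f by (intro integral_cong_AE) (auto simp: sqint_def power2_commute)
  have eq: "(\<integral>x. (f x - S N x)\<^sup>2 \<partial>M) = (\<integral>x. (f x)\<^sup>2 \<partial>M) - (\<Sum>k<N. (b k)\<^sup>2)" for N
    unfolding S_def b_def by (rule integral_sq_diff_lincomb[OF on f]) simp
  have dec: "decseq (\<lambda>N. \<integral>x. (f x - S N x)\<^sup>2 \<partial>M)"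
    unfolding eq by (rule decseq_SucI) simp
  have "convergent (\<lambda>N. \<integral>x. (f x - S N x)\<^sup>2 \<partial>M)"
    using decseq_convergent[OF dec, of 0] by (auto simp: convergent_def)
  then obtain L where L: "(\<lambda>N. \<integral>x. (f x - S N x)\<^sup>2 \<partial>M) \<longlonglongrightarrow> L" by (auto simp: convergent_def)
  have "(\<lambda>i. \<integral>x. (f x - S (r i) x)\<^sup>2 \<partial>M) \<longlonglongrightarrow> L"
    using LIMSEQ_subseq_LIMSEQ[OF L r] by (simp add: o_def)
  moreover have "(\<lambda>i. \<integral>x. (f x - S (r i) x)\<^sup>2 \<partial>M) \<longlonglongrightarrow> 0" unfolding fg by (rule gSlim)
  ultimately have "L = 0" by (rule LIMSEQ_unique)
  then show ?thesis using L by (simp add: S_def b_def)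
qed

lemma L2_onb_orthonormal: "L2_onb \<Omega> \<phi> \<Longrightarrow> orthonormal_in (lebesgue_on \<Omega>) \<phi>"
  by (simp add: L2_onb_def orthonormal_in_def L2_on_iff_sqint)

lemma L2_onb_expansion:
  assumes "L2_onb \<Omega> \<phi>" "sqint (lebesgue_on \<Omega>) f"
  shows "(\<lambda>N. \<integral>x. (f x - (\<Sum>k<N. (\<integral>y. f y * \<phi> k y \<partial>lebesgue_on \<Omega>) * \<phi> k x))\<^sup>2 \<partial>lebesgue_on \<Omega>) \<longlonglongrightarrow> 0"
  using assms by (intro orthonormal_expansion L2_onb_orthonormal) (auto simp: L2_onb_def L2_on_iff_sqint)

text \<open>The numbers \<open>b k\<close> are arbitrary. With the coefficients of \<open>w\<close>
  themselves this is Parseval's identity; with coefficients damped by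
  \<open>exp (- \<tau> * lam k)\<close> it expands pairings with the heat semigroup.\<close>

lemma sums_multiplier:
  fixes g w :: "'a \<Rightarrow> real"
  assumes on: "orthonormal_in M \<phi>" and w: "sqint M w" and g: "sqint M g"
    and lim: "(\<lambda>N. \<integral>x. (w x - (\<Sum>k<N. b k * \<phi> k x))\<^sup>2 \<partial>M) \<longlonglongrightarrow> 0"
  shows "(\<lambda>k. b k * (\<integral>x. g x * \<phi> k x \<partial>M)) sums (\<integral>x. w x * g x \<partial>M)"
proof -
  have "(\<lambda>N. \<integral>x. (\<Sum>k<N. b k * \<phi> k x) * g x \<partial>M) \<longlonglongrightarrow> (\<integral>x. w x * g x \<partial>M)"
    using lim by (intro sqint_tendsto_mult w g sqint_lincomb[OF on]) (auto simp: power2_commute)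
  then show ?thesis
    unfolding sums_def by (subst (asm) integral_lincomb_mult[OF on g])
qed

text \<open>Bessel's inequality for both factors. Absolute convergence is what later permits
  exchanging such series with integrals in time.\<close>

lemma summable_coef_mult:
  fixes f g :: "'a \<Rightarrow> real"
  assumes on: "orthonormal_in M \<phi>" and f: "sqint M f" and g: "sqint M g"
  shows "summable (\<lambda>k. \<bar>(\<integral>x. f x * \<phi> k x \<partial>M) * (\<integral>x. g x * \<phi> k x \<partial>M)\<bar>)"
proof (rule summable_comparison_test')
  show "summable (\<lambda>k. (\<integral>x. f x * \<phi> k x \<partial>M)\<^sup>2 + (\<integral>x. g x * \<phi> k x \<partial>M)\<^sup>2)"
    by (intro summable_add Bessel_summable[OF on] f g)
  show "norm \<bar>(\<integral>x. f x * \<phi> n x \<partial>M) * (\<integral>x. g x * \<phi> n x \<partial>M)\<bar>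
      \<le> (\<integral>x. f x * \<phi> n x \<partial>M)\<^sup>2 + (\<integral>x. g x * \<phi> n x \<partial>M)\<^sup>2" for n
    using sum_squares_bound[of "\<bar>\<integral>x. f x * \<phi> n x \<partial>M\<bar>" "\<bar>\<integral>x. g x * \<phi> n x \<partial>M\<bar>"]
      mult_nonneg_nonneg[OF abs_ge_zero[of "\<integral>x. f x * \<phi> n x \<partial>M"] abs_ge_zero[of "\<integral>x. g x * \<phi> n x \<partial>M"]]
    unfolding real_norm_def abs_abs abs_mult power2_abs by linarith
qed

section \<open>Plancherel's theorem on the line\<close>

lemma integrable_lborel_indicator_Icc [simp]: "integrable lborel (indicator {a..b::real} :: real \<Rightarrow> real)"
  by (intro integrable_real_indicator) (auto simp: emeasure_lborel_Icc_eq)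

section \<open>Continuity of translations in L2 of the line\<close>

lemma sqint_translate:
  fixes f :: "real \<Rightarrow> 'b::{second_countable_topology, banach}"
  assumes "sqint lborel f"
  shows "sqint lborel (\<lambda>t. f (t + h))"
  using assms lborel_integrable_real_affine[of "\<lambda>t. (norm (f t))\<^sup>2" 1 h]
  by (auto simp: sqint_def add.commute)

lemma integral_lborel_translate:
  fixes f :: "real \<Rightarrow> 'b::{second_countable_topology, banach}"
  shows "(\<integral>t. f (t + h) \<partial>lborel) = (\<integral>t. f t \<partial>lborel)"
  using lborel_integral_real_affine[of 1 f h] by (simp add: add.commute)

lemma sqint_truncate_tendsto:
  fixes f :: "real \<Rightarrow> real"
  assumes f: "sqint lborel f"
  shows "(\<lambda>n. \<integral>t. (f t - (if \<bar>t\<bar> \<le> real n \<and> \<bar>f t\<bar> \<le> real n then f t else 0))\<^sup>2 \<partial>lborel) \<longlonglongrightarrow> 0"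
proof -
  have [measurable]: "f \<in> borel_measurable borel" using f by (auto simp: sqint_def)
  have "(\<lambda>n. \<integral>t. (f t - (if \<bar>t\<bar> \<le> real n \<and> \<bar>f t\<bar> \<le> real n then f t else 0))\<^sup>2 \<partial>lborel)
      \<longlonglongrightarrow> integral\<^sup>L lborel (\<lambda>t::real. 0)"
  proof (rule integral_dominated_convergence[where w = "\<lambda>t. (f t)\<^sup>2"])
    show "AE t in lborel. (\<lambda>n. (f t - (if \<bar>t\<bar> \<le> real n \<and> \<bar>f t\<bar> \<le> real n then f t else 0))\<^sup>2) \<longlonglongrightarrow> 0"
    proof (intro AE_I2 tendsto_eventually)
      fix t
      show "\<forall>\<^sub>F n in sequentially. (f t - (if \<bar>t\<bar> \<le> real n \<and> \<bar>f t\<bar> \<le> real n then f t else 0))\<^sup>2 = 0"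
        using eventually_ge_at_top[of "nat \<lceil>\<bar>t\<bar> + \<bar>f t\<bar>\<rceil>"]
      proof eventually_elim
        case (elim n)
        then have "\<bar>t\<bar> + \<bar>f t\<bar> \<le> real n" by linarith
        then show ?case by auto
      qed
    qed
  qed (use sqint_integrable[OF f] in auto)
  then show ?thesis by simp
qed

text \<open>Truncation reduces to a bounded function on a bounded interval, which is an a.e. limit
  of continuous functions by \<open>measurable_on\<close>. Continuity a.e. of the approximant,
  rather than everywhere, is all that dominated convergence for translates requires.\<close>

lemma sqint_bounded_ae_continuous_dense:
  fixes f :: "real \<Rightarrow> real"
  assumes f: "sqint lborel f" and e: "0 < e"
  obtains k B R where "k \<in> borel_measurable borel" "\<And>t. \<bar>k t\<bar> \<le> B" "\<And>t. \<bar>t\<bar> > R \<Longrightarrow> k t = 0"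
    "AE t in lborel. isCont k t" "(\<integral>t. (f t - k t)\<^sup>2 \<partial>lborel) < e"
proof -
  have [measurable]: "f \<in> borel_measurable borel" using f by (auto simp: sqint_def)
  obtain n where n: "(\<integral>t. (f t - (if \<bar>t\<bar> \<le> real n \<and> \<bar>f t\<bar> \<le> real n then f t else 0))\<^sup>2 \<partial>lborel) < e / 4"
    using order_tendstoD(2)[OF sqint_truncate_tendsto[OF f], of "e / 4"] e
    by (auto dest: eventually_happens)
  define R where "R = real n"
  define b where "b t = (if \<bar>t\<bar> \<le> R \<and> \<bar>f t\<bar> \<le> R then f t else 0)" for t
  have [measurable]: "b \<in> borel_measurable borel" unfolding b_def by measurable
  have bR: "\<bar>b t\<bar> \<le> R" for t by (simp add: b_def R_def)
  have "b measurable_on UNIV"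
    by (intro lebesgue_measurable_imp_measurable_on_real measurable_completion) auto
  then obtain N g where N: "negligible N" and g: "\<And>m. continuous_on UNIV (g m)"
    and lim: "\<And>t. t \<notin> N \<Longrightarrow> (\<lambda>m. g m t) \<longlonglongrightarrow> b t"
    unfolding measurable_on_def by auto
  have [measurable]: "g m \<in> borel_measurable borel" for m
    using g by (rule borel_measurable_continuous_onI)
  \<comment> \<open>Clamping the values provides a common majorant. Cutting off outside
    \<open>[-R, R]\<close> costs continuity only at the two endpoints, a null set.\<close>
  define k where "k m t = (if \<bar>t\<bar> \<le> R then max (- R) (min R (g m t)) else 0)" for m t
  have [measurable]: "k m \<in> borel_measurable borel" for m unfolding k_def by measurable
  have kR: "\<bar>k m t\<bar> \<le> R" for m t by (auto simp: k_def R_def)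
  have k0: "k m t = 0" if "\<bar>t\<bar> > R" for m t using that by (simp add: k_def)
  have "(\<lambda>m. \<integral>t. (b t - k m t)\<^sup>2 \<partial>lborel) \<longlonglongrightarrow> integral\<^sup>L lborel (\<lambda>t::real. 0)"
  proof (rule integral_dominated_convergence[where w = "\<lambda>t. (2 * R)\<^sup>2 * indicator {-R..R} t"])
    have "AE t in lebesgue. t \<notin> N" using N by (simp add: negligible_iff_null_sets AE_not_in)
    then have N': "AE t in lborel. t \<notin> N" by (simp add: AE_completion_iff)
    then show "AE t in lborel. (\<lambda>m. (b t - k m t)\<^sup>2) \<longlonglongrightarrow> 0"
    proof eventually_elim
      case (elim t)
      show ?case
      proof (cases "\<bar>t\<bar> \<le> R")
        case True
        have "(\<lambda>m. max (- R) (min R (g m t))) \<longlonglongrightarrow> max (- R) (min R (b t))"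
          by (intro tendsto_max tendsto_min tendsto_const lim elim)
        also have "max (- R) (min R (b t)) = b t" using bR[of t] by auto
        finally have "(\<lambda>m. b t - k m t) \<longlonglongrightarrow> b t - b t" using True
          by (intro tendsto_diff tendsto_const) (simp add: k_def)
        then show ?thesis using tendsto_power[of "\<lambda>m. b t - k m t" 0 _ 2] by simp
      qed (simp add: k_def b_def)
    qed
    show "AE t in lborel. norm ((b t - k m t)\<^sup>2) \<le> (2 * R)\<^sup>2 * indicator {-R..R} t" for m
    proof (rule AE_I2)
      fix t
      have "\<bar>b t - k m t\<bar> \<le> \<bar>2 * R\<bar>" using bR[of t] kR[of m t] by linarith
      then have "(b t - k m t)\<^sup>2 \<le> (2 * R)\<^sup>2" by (simp add: abs_le_square_iff)
      then show "norm ((b t - k m t)\<^sup>2) \<le> (2 * R)\<^sup>2 * indicator {-R..R} t"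
        by (cases "\<bar>t\<bar> \<le> R") (auto simp: k_def b_def indicator_def abs_le_iff)
    qed
  qed auto
  then have "(\<lambda>m. \<integral>t. (b t - k m t)\<^sup>2 \<partial>lborel) \<longlonglongrightarrow> 0" by simp
  then obtain m where m: "(\<integral>t. (b t - k m t)\<^sup>2 \<partial>lborel) < e / 4"
    using order_tendstoD(2)[of _ 0 _ "e / 4"] e by (metis (no_types, lifting) eventually_happens trivial_limit_sequentially zero_less_divide_iff zero_less_numeral)
  have sb: "sqint lborel b"
    using sqint_integrable[OF f] by (intro sqint_bound[where g = "\<lambda>t. (f t)\<^sup>2"]) (auto simp: b_def)
  have sk: "sqint lborel (k m)"
  proof (rule sqint_bound[where g = "\<lambda>t. R\<^sup>2 * indicator {-R..R} t"])
    show "AE t in lborel. (norm (k m t))\<^sup>2 \<le> R\<^sup>2 * indicator {-R..R} t"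
    proof (rule AE_I2)
      fix t
      have "(k m t)\<^sup>2 \<le> R\<^sup>2" using kR[of m t] by (intro power2_le_iff_abs_le[THEN iffD2]) (auto simp: R_def)
      then show "(norm (k m t))\<^sup>2 \<le> R\<^sup>2 * indicator {-R..R} t"
        by (cases "\<bar>t\<bar> \<le> R") (auto simp: k0 indicator_def abs_le_iff)
    qed
  qed auto
  have "(\<integral>t. (f t - k m t)\<^sup>2 \<partial>lborel) < e"
    using sqint_dist_triangle[OF f sb sk] n m unfolding b_def R_def by simp
  moreover have "AE t in lborel. isCont (k m) t"
  proof -
    have "AE t in lborel. t \<noteq> R \<and> t \<noteq> - R"
      using AE_lborel_singleton[of R] AE_lborel_singleton[of "-R"] by eventually_elim auto
    then show ?thesis
    proof eventually_elim
      case (elim t)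
      show ?case
      proof (cases "\<bar>t\<bar> < R")
        case True
        have "\<forall>\<^sub>F x in nhds t. k m x = max (- R) (min R (g m x))"
          using True by (intro eventually_mono[OF eventually_nhds_in_open[of "{-R<..<R}"]]) (auto simp: k_def)
        then have "isCont (k m) t \<longleftrightarrow> isCont (\<lambda>x. max (- R) (min R (g m x))) t" by (rule isCont_cong)
        moreover have "isCont (\<lambda>x. max (- R) (min R (g m x))) t"
          using g[of m] by (intro continuous_intros) (simp add: continuous_on_eq_continuous_at)
        ultimately show ?thesis by simp
      next
        case False
        then have "\<forall>\<^sub>F x in nhds t. k m x = 0"
          using elim by (intro eventually_mono[OF eventually_nhds_in_open[of "- {-R..R}"]]) (auto simp: k_def)
        then have "isCont (k m) t \<longleftrightarrow> isCont (\<lambda>x. 0::real) t" by (rule isCont_cong)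
        then show ?thesis by simp
      qed
    qed
  qed
  ultimately show ?thesis using kR k0 by (intro that[of "k m" R R]) auto
qed

text \<open>Replace \<open>f\<close> by an a.e. continuous \<open>k\<close> with bounded support,
  for which dominated convergence applies. Translation is an isometry, so the replacement costs the
  same before and after the shift. In squared distances the budget is
  \<open>4 * (e/16) + 4 * (e/8) + 2 * (e/16)\<close>, which is below \<open>e\<close>.\<close>

lemma L2_translation_continuous:
  fixes f :: "real \<Rightarrow> real"
  assumes f: "sqint lborel f" and h: "h \<longlonglongrightarrow> 0"
  shows "(\<lambda>n. \<integral>t. (f (t + h n) - f t)\<^sup>2 \<partial>lborel) \<longlonglongrightarrow> 0"
proof (rule tendstoI)
  fix e :: real assume e: "0 < e"
  obtain k B R where [measurable]: "k \<in> borel_measurable borel" and kB: "\<And>t. \<bar>k t\<bar> \<le> B"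
    and k0: "\<And>t. \<bar>t\<bar> > R \<Longrightarrow> k t = 0" and cont: "AE t in lborel. isCont k t"
    and fk: "(\<integral>t. (f t - k t)\<^sup>2 \<partial>lborel) < e / 16"
    using sqint_bounded_ae_continuous_dense[OF f, of "e / 16"] e by auto
  have B0: "0 \<le> B" using kB[of 0] by linarith
  have kle: "(k t)\<^sup>2 \<le> B\<^sup>2" for t using kB[of t] B0 by (simp add: power2_le_iff_abs_le)
  have sk: "sqint lborel k"
  proof (rule sqint_bound[where g = "\<lambda>t. B\<^sup>2 * indicator {-R..R} t"])
    show "AE t in lborel. (norm (k t))\<^sup>2 \<le> B\<^sup>2 * indicator {-R..R} t"
    proof (rule AE_I2)
      fix t show "(norm (k t))\<^sup>2 \<le> B\<^sup>2 * indicator {-R..R} t"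
        using kle[of t] by (cases "\<bar>t\<bar> \<le> R") (auto simp: k0 indicator_def abs_le_iff)
    qed
  qed auto
  \<comment> \<open>The indicator discards shifts larger than 1, so that all remaining translates
    live on \<open>{-R-1..R+1}\<close> and share one majorant. It equals 1 for large
    \<open>n\<close>.\<close>
  have "(\<lambda>n. \<integral>t. (k (t + h n) - k t)\<^sup>2 * indicator {-1..1} (h n) \<partial>lborel) \<longlonglongrightarrow> integral\<^sup>L lborel (\<lambda>t::real. 0)"
  proof (rule integral_dominated_convergence[where w = "\<lambda>t. (4 * B\<^sup>2) * indicator {-R-1..R+1} t"])
    show "AE t in lborel. (\<lambda>n. (k (t + h n) - k t)\<^sup>2 * indicator {-1..1} (h n)) \<longlonglongrightarrow> 0"
      using cont
    proof eventually_elim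
      case (elim t)
      have "(\<lambda>n. t + h n) \<longlonglongrightarrow> t + 0" by (intro tendsto_intros h)
      then have "(\<lambda>n. k (t + h n)) \<longlonglongrightarrow> k t" using isCont_tendsto_compose[OF elim] by simp
      then have "(\<lambda>n. (k (t + h n) - k t)\<^sup>2) \<longlonglongrightarrow> (k t - k t)\<^sup>2" by (intro tendsto_intros)
      then have *: "(\<lambda>n. (k (t + h n) - k t)\<^sup>2) \<longlonglongrightarrow> 0" by simp
      show ?case by (rule Lim_null_comparison[OF _ *]) (auto simp: indicator_def)
    qed
    show "AE t in lborel. norm ((k (t + h n) - k t)\<^sup>2 * indicator {-1..1} (h n)) \<le> (4 * B\<^sup>2) * indicator {-R-1..R+1} t" for n
    proof (rule AE_I2)
      fix t
      have "(k (t + h n) - k t)\<^sup>2 \<le> 4 * B\<^sup>2"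
        using power2_norm_diff_le[of "k (t + h n)" "k t"] kle[of t] kle[of "t + h n"] by simp
      moreover have "k (t + h n) = 0 \<and> k t = 0" if "h n \<in> {-1..1}" "t \<notin> {-R-1..R+1}"
        using that by (intro conjI k0) (auto simp: abs_le_iff)
      ultimately show "norm ((k (t + h n) - k t)\<^sup>2 * indicator {-1..1} (h n)) \<le> (4 * B\<^sup>2) * indicator {-R-1..R+1} t"
        by (auto simp: indicator_def)
    qed
  qed auto
  then have "\<forall>\<^sub>F n in sequentially. (\<integral>t. (k (t + h n) - k t)\<^sup>2 * indicator {-1..1} (h n) \<partial>lborel) < e / 8"
    using e by (intro order_tendstoD(2)[of _ 0]) auto
  moreover have "\<forall>\<^sub>F n in sequentially. \<bar>h n\<bar> < 1"
    using tendstoD[OF h, of 1] by simp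
  ultimately show "\<forall>\<^sub>F n in sequentially. dist (\<integral>t. (f (t + h n) - f t)\<^sup>2 \<partial>lborel) 0 < e"
  proof eventually_elim
    case (elim n)
    have s: "sqint lborel (\<lambda>t. f (t + h n))" "sqint lborel (\<lambda>t. k (t + h n))"
      using f sk by (auto intro: sqint_translate)
    have "(\<integral>t. (f (t + h n) - f t)\<^sup>2 \<partial>lborel)
        \<le> 2 * (\<integral>t. (f (t + h n) - k t)\<^sup>2 \<partial>lborel) + 2 * (\<integral>t. (k t - f t)\<^sup>2 \<partial>lborel)"
      using sqint_dist_triangle[OF s(1) sk f] by simp
    moreover have "(\<integral>t. (f (t + h n) - k t)\<^sup>2 \<partial>lborel)
        \<le> 2 * (\<integral>t. (f (t + h n) - k (t + h n))\<^sup>2 \<partial>lborel) + 2 * (\<integral>t. (k (t + h n) - k t)\<^sup>2 \<partial>lborel)"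
      using sqint_dist_triangle[OF s sk] by simp
    moreover have "(\<integral>t. (f (t + h n) - k (t + h n))\<^sup>2 \<partial>lborel) = (\<integral>t. (f t - k t)\<^sup>2 \<partial>lborel)"
      by (rule integral_lborel_translate[of "\<lambda>t. (f t - k t)\<^sup>2"])
    moreover have "(\<integral>t. (k t - f t)\<^sup>2 \<partial>lborel) = (\<integral>t. (f t - k t)\<^sup>2 \<partial>lborel)"
      by (simp add: power2_commute)
    moreover have "(\<integral>t. (k (t + h n) - k t)\<^sup>2 \<partial>lborel) < e / 8"
      using elim by (simp add: indicator_def abs_less_iff)
    ultimately have "(\<integral>t. (f (t + h n) - f t)\<^sup>2 \<partial>lborel) < e"
      using fk e by linarith
    then show ?case by simp
  qed
qed

text \<open>Tonelli in the form needed for Gaussian regularisation: under a product majorant the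
  iterated integral of the norm factors.\<close>

lemma (in pair_sigma_finite) integrable_dominated_product:
  fixes F :: "_ \<Rightarrow> 'c::{second_countable_topology, banach}"
  assumes [measurable]: "F \<in> borel_measurable (M1 \<Otimes>\<^sub>M M2)"
    and f: "integrable M1 f" and g: "integrable M2 g"
    and le: "\<And>x y. x \<in> space M1 \<Longrightarrow> y \<in> space M2 \<Longrightarrow> norm (F (x, y)) \<le> f x * g y"
  shows "integrable (M1 \<Otimes>\<^sub>M M2) F"
proof (rule integrableI_bounded)
  have [measurable]: "f \<in> borel_measurable M1" "g \<in> borel_measurable M2" using f g by auto
  have "(\<integral>\<^sup>+z. ennreal (norm (F z)) \<partial>(M1 \<Otimes>\<^sub>M M2)) = (\<integral>\<^sup>+x. \<integral>\<^sup>+y. ennreal (norm (F (x, y))) \<partial>M2 \<partial>M1)"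
    by (rule M2.nn_integral_fst[symmetric]) simp
  also have "\<dots> \<le> (\<integral>\<^sup>+x. \<integral>\<^sup>+y. ennreal (norm (f x)) * ennreal (norm (g y)) \<partial>M2 \<partial>M1)"
  proof (intro nn_integral_mono)
    fix x y assume "x \<in> space M1" "y \<in> space M2"
    from le[OF this] have "norm (F (x, y)) \<le> norm (f x) * norm (g y)"
      by (metis abs_ge_self abs_mult dual_order.trans real_norm_def)
    then show "ennreal (norm (F (x, y))) \<le> ennreal (norm (f x)) * ennreal (norm (g y))"
      by (simp add: ennreal_mult[symmetric] ennreal_leI)
  qed
  also have "\<dots> = (\<integral>\<^sup>+x. ennreal (norm (f x)) \<partial>M1) * (\<integral>\<^sup>+y. ennreal (norm (g y)) \<partial>M2)"
    by (simp add: nn_integral_cmult nn_integral_multc)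
  also have "\<dots> < \<infinity>"
    using f g unfolding integrable_iff_bounded by (simp add: ennreal_mult_less_top)
  finally show "(\<integral>\<^sup>+z. ennreal (norm (F z)) \<partial>(M1 \<Otimes>\<^sub>M M2)) < \<infinity>" .
qed simp


section \<open>The Fourier integral and Plancherel's identity by Gaussian regularisation\<close>

definition FT :: "(real \<Rightarrow> real) \<Rightarrow> real \<Rightarrow> complex" where
  "FT f \<rho> = complex_of_real (1 / sqrt (2 * pi)) * (\<integral>t. exp (- \<i> * complex_of_real (\<rho> * t)) * complex_of_real (f t) \<partial>lborel)"

lemma norm_exp_i_mult [simp]: "norm (exp (\<i> * complex_of_real a)) = 1" "norm (exp (- (\<i> * complex_of_real a))) = 1"
  by (simp_all add: norm_exp_eq_Re)

lemma integrable_exp_mult: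
  assumes "integrable lborel f"
  shows "integrable lborel (\<lambda>t. exp (- \<i> * complex_of_real (\<rho> * t)) * complex_of_real (f t))"
  using assms by (intro Bochner_Integration.integrable_bound[OF assms]) (auto simp: norm_mult)

lemma FT_measurable:
  assumes [measurable]: "f \<in> borel_measurable borel"
  shows "FT f \<in> borel_measurable borel"
proof -
  have "(\<lambda>\<rho>. \<integral>t. exp (- \<i> * complex_of_real (\<rho> * t)) * complex_of_real (f t) \<partial>lborel) \<in> borel_measurable borel"
    by (rule lborel.borel_measurable_lebesgue_integral) measurable
  then show ?thesis unfolding FT_def by measurable
qed

lemma FT_bounded:
  assumes "integrable lborel f"
  shows "norm (FT f \<rho>) \<le> (\<integral>t. \<bar>f t\<bar> \<partial>lborel)"
proof -
  have "norm (\<integral>t. exp (- \<i> * complex_of_real (\<rho> * t)) * complex_of_real (f t) \<partial>lborel)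
      \<le> (\<integral>t. norm (exp (- \<i> * complex_of_real (\<rho> * t)) * complex_of_real (f t)) \<partial>lborel)"
    by (rule integral_norm_bound)
  also have "\<dots> = (\<integral>t. \<bar>f t\<bar> \<partial>lborel)" by (simp add: norm_mult)
  finally have *: "norm (\<integral>t. exp (- \<i> * complex_of_real (\<rho> * t)) * complex_of_real (f t) \<partial>lborel) \<le> (\<integral>t. \<bar>f t\<bar> \<partial>lborel)" .
  have "1 \<le> sqrt (2 * pi)" using pi_gt3 by simp
  then have "1 / sqrt (2 * pi) \<le> 1" by simp
  then have "norm (FT f \<rho>) \<le> 1 * norm (\<integral>t. exp (- \<i> * complex_of_real (\<rho> * t)) * complex_of_real (f t) \<partial>lborel)"
    unfolding FT_def norm_mult by (intro mult_right_mono) (auto simp: norm_divide)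
  with * show ?thesis by simp
qed

text \<open>Up to normalisation the Gaussian is its own Fourier transform; in probabilistic terms
  this is the characteristic function of the standard normal distribution.\<close>

lemma std_normal_integral_exp:
  "(\<integral>x. complex_of_real (std_normal_density x) * exp (\<i> * complex_of_real (x * t)) \<partial>lborel) = complex_of_real (exp (- t\<^sup>2 / 2))"
proof -
  have "complex_of_real (exp (- t\<^sup>2 / 2)) = char std_normal_distribution t"
    by (simp add: char_std_normal_distribution)
  also have "\<dots> = (\<integral>x. std_normal_density x *\<^sub>R exp (\<i> * complex_of_real (t * x)) \<partial>lborel)"
    unfolding char_def by (subst integral_density) (auto simp: normal_density_nonneg)
  finally show ?thesis by (simp add: scaleR_conv_of_real mult.commute)
qed

text \<open>The Gaussian factor makes the double integral absolutely convergent, hence the order exchangeable.\<close>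
lemma FT_gaussian_inner:
  assumes f: "integrable lborel f" and e: "0 < e"
  shows "(\<integral>\<rho>. complex_of_real (std_normal_density (e * \<rho>)) * FT f \<rho> * exp (\<i> * complex_of_real (\<rho> * r)) \<partial>lborel)
     = complex_of_real (\<integral>y. f (r + e * y) * std_normal_density y \<partial>lborel)"
proof -
  have [measurable]: "f \<in> borel_measurable borel" using f by auto
  define c where "c = 1 / sqrt (2 * pi)"
  define N where "N = std_normal_density"
  have [measurable]: "N \<in> borel_measurable borel" unfolding N_def by simp
  have N0: "0 \<le> N x" for x by (simp add: N_def normal_density_nonneg)
  have iN: "integrable lborel N" unfolding N_def by simp
  have iNe: "integrable lborel (\<lambda>\<rho>. N (e * \<rho>))"
    using lborel_integrable_real_affine[OF iN, of e 0] e by simp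
  define F where "F \<rho> t = complex_of_real (N (e * \<rho>)) * exp (\<i> * complex_of_real (\<rho> * (r - t))) * complex_of_real (f t)" for \<rho> t
  have F: "integrable (lborel \<Otimes>\<^sub>M lborel) (\<lambda>(\<rho>, t). F \<rho> t)"
  proof (rule lborel_pair.integrable_dominated_product[where f = "\<lambda>\<rho>. N (e * \<rho>)" and g = "\<lambda>t. \<bar>f t\<bar>"])
    show "(\<lambda>(\<rho>, t). F \<rho> t) \<in> borel_measurable (lborel \<Otimes>\<^sub>M lborel)" unfolding F_def by measurable
    show "integrable lborel (\<lambda>t. \<bar>f t\<bar>)" using f by simp
    show "norm (case (x, y) of (\<rho>, t) \<Rightarrow> F \<rho> t) \<le> N (e * x) * \<bar>f y\<bar>" for x y
      by (simp add: F_def norm_mult N0)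
  qed (rule iNe)
  have "(\<integral>\<rho>. complex_of_real (N (e * \<rho>)) * FT f \<rho> * exp (\<i> * complex_of_real (\<rho> * r)) \<partial>lborel)
      = complex_of_real c * (\<integral>\<rho>. (\<integral>t. F \<rho> t \<partial>lborel) \<partial>lborel)"
  proof -
    have "complex_of_real (N (e * \<rho>)) * FT f \<rho> * exp (\<i> * complex_of_real (\<rho> * r)) = complex_of_real c * (\<integral>t. F \<rho> t \<partial>lborel)" for \<rho>
    proof -
      have "(\<integral>t. F \<rho> t \<partial>lborel) = (\<integral>t. (complex_of_real (N (e * \<rho>)) * exp (\<i> * complex_of_real (\<rho> * r)))
          * (exp (- \<i> * complex_of_real (\<rho> * t)) * complex_of_real (f t)) \<partial>lborel)"
        unfolding F_def by (intro Bochner_Integration.integral_cong refl) (simp add: algebra_simps exp_diff exp_minus field_simps)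
      also have "\<dots> = (complex_of_real (N (e * \<rho>)) * exp (\<i> * complex_of_real (\<rho> * r)))
          * (\<integral>t. exp (- \<i> * complex_of_real (\<rho> * t)) * complex_of_real (f t) \<partial>lborel)"
        by (rule integral_mult_right_zero)
      finally show ?thesis by (simp add: FT_def c_def mult_ac)
    qed
    then show ?thesis by (simp only: integral_mult_right_zero)
  qed
  also have "(\<integral>\<rho>. (\<integral>t. F \<rho> t \<partial>lborel) \<partial>lborel) = (\<integral>t. (\<integral>\<rho>. F \<rho> t \<partial>lborel) \<partial>lborel)"
    by (rule lborel_pair.Fubini_integral[OF F, symmetric])
  also have "\<dots> = (\<integral>t. complex_of_real (f t * (exp (- ((r - t) / e)\<^sup>2 / 2) / e)) \<partial>lborel)"
  proof (intro Bochner_Integration.integral_cong refl)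
    fix t
    have "(\<integral>\<rho>. F \<rho> t \<partial>lborel) = (\<integral>\<rho>. complex_of_real (N (e * \<rho>)) * exp (\<i> * complex_of_real (e * \<rho> * ((r - t) / e))) \<partial>lborel) * complex_of_real (f t)"
      unfolding F_def using e by simp
    also have "(\<integral>\<rho>. complex_of_real (N (e * \<rho>)) * exp (\<i> * complex_of_real (e * \<rho> * ((r - t) / e))) \<partial>lborel)
       = (\<integral>x. complex_of_real (N x) * exp (\<i> * complex_of_real (x * ((r - t) / e))) \<partial>lborel) / complex_of_real e"
      using lborel_integral_real_affine[of e "\<lambda>x. complex_of_real (N x) * exp (\<i> * complex_of_real (x * ((r - t) / e)))" 0] e
      by (simp add: scaleR_conv_of_real)
    also have "\<dots> = complex_of_real (exp (- ((r - t) / e)\<^sup>2 / 2) / e)"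
      unfolding N_def by (subst std_normal_integral_exp) simp
    finally show "(\<integral>\<rho>. F \<rho> t \<partial>lborel) = complex_of_real (f t * (exp (- ((r - t) / e)\<^sup>2 / 2) / e))"
      by (simp add: mult.commute)
  qed
  also have "\<dots> = complex_of_real (\<integral>t. f t * (exp (- ((r - t) / e)\<^sup>2 / 2) / e) \<partial>lborel)"
    by (rule integral_complex_of_real)
  also have "(\<integral>t. f t * (exp (- ((r - t) / e)\<^sup>2 / 2) / e) \<partial>lborel) = (\<integral>y. f (r + e * y) * exp (- y\<^sup>2 / 2) \<partial>lborel)"
    using lborel_integral_real_affine[of e "\<lambda>t. f t * (exp (- ((r - t) / e)\<^sup>2 / 2) / e)" r] e
    by simp
  also have "complex_of_real c * complex_of_real (\<integral>y. f (r + e * y) * exp (- y\<^sup>2 / 2) \<partial>lborel)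
     = complex_of_real (\<integral>y. f (r + e * y) * N y \<partial>lborel)"
    unfolding of_real_mult[symmetric] integral_mult_right_zero[symmetric]
    by (simp add: N_def std_normal_density_def c_def mult_ac)
  finally show ?thesis by (simp add: N_def)
qed

lemma FT_cnj: "cnj (FT f \<rho>) = complex_of_real (1 / sqrt (2 * pi)) * (\<integral>t. exp (\<i> * complex_of_real (\<rho> * t)) * complex_of_real (f t) \<partial>lborel)"
  unfolding FT_def complex_cnj_mult complex_cnj_complex_of_real
  by (simp add: exp_cnj flip: Bochner_Integration.integral_cnj)

text \<open>This is \<open>FT_gaussian_inner\<close> multiplied by \<open>f r\<close> and integrated
  in \<open>r\<close>. The factor \<open>sqrt (2 * pi)\<close> turns the density into the weight
  \<open>exp (- (e * \<rho>)\<^sup>2 / 2)\<close>, and the right side averages the autocorrelation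
  of \<open>f\<close> over lags of size \<open>e\<close>.\<close>

lemma FT_gaussian_norm:
  assumes f: "integrable lborel f" and f2: "sqint lborel f" and e: "0 < e"
  shows "(\<integral>\<rho>. sqrt (2 * pi) * std_normal_density (e * \<rho>) * (cmod (FT f \<rho>))\<^sup>2 \<partial>lborel)
     = (\<integral>y. std_normal_density y * (\<integral>r. f r * f (r + e * y) \<partial>lborel) \<partial>lborel)"
proof -
  have [measurable]: "f \<in> borel_measurable borel" using f by auto
  have [measurable]: "FT f \<in> borel_measurable borel" by (rule FT_measurable) simp
  define N where "N = std_normal_density"
  have [measurable]: "N \<in> borel_measurable borel" unfolding N_def by simp
  have N0: "0 \<le> N x" for x by (simp add: N_def normal_density_nonneg)
  have iN: "integrable lborel N" unfolding N_def by simp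
  have iNe: "integrable lborel (\<lambda>\<rho>. N (e * \<rho>))"
    using lborel_integrable_real_affine[OF iN, of e 0] e by simp
  define B where "B = (\<integral>t. \<bar>f t\<bar> \<partial>lborel)"
  define F where "F \<rho> r = complex_of_real (N (e * \<rho>)) * FT f \<rho> * exp (\<i> * complex_of_real (\<rho> * r)) * complex_of_real (f r)" for \<rho> r
  have F: "integrable (lborel \<Otimes>\<^sub>M lborel) (\<lambda>(\<rho>, r). F \<rho> r)"
  proof (rule lborel_pair.integrable_dominated_product[where f = "\<lambda>\<rho>. N (e * \<rho>)" and g = "\<lambda>t. B * \<bar>f t\<bar>"])
    show "(\<lambda>(\<rho>, t). F \<rho> t) \<in> borel_measurable (lborel \<Otimes>\<^sub>M lborel)" unfolding F_def by measurable
    show "integrable lborel (\<lambda>t. B * \<bar>f t\<bar>)" using f by simp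
    show "norm (case (x, y) of (\<rho>, t) \<Rightarrow> F \<rho> t) \<le> N (e * x) * (B * \<bar>f y\<bar>)" for x y
      using FT_bounded[OF f, of x]
      by (auto simp add: F_def norm_mult N0 B_def mult.assoc intro!: mult_left_mono mult_right_mono)
  qed (rule iNe)
  have iA: "integrable (lborel \<Otimes>\<^sub>M lborel) (\<lambda>(r, y). f r * f (r + e * y) * N y)"
  proof -
    have m: "(\<lambda>(r, y). f r * f (r + e * y) * N y) \<in> borel_measurable (lborel \<Otimes>\<^sub>M lborel)" by measurable
    have "integrable (lborel \<Otimes>\<^sub>M lborel) (\<lambda>(y, r). f r * f (r + e * y) * N y)"
    proof (rule lborel_pair.Fubini_integrable)
      show "(\<lambda>(y, r). f r * f (r + e * y) * N y) \<in> borel_measurable (lborel \<Otimes>\<^sub>M lborel)" by measurable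
      have s: "sqint lborel (\<lambda>r. f (r + e * y))" for y by (rule sqint_translate[OF f2])
      have i: "integrable lborel (\<lambda>r. f r * f (r + e * y))" for y by (rule sqint_mult_integrable[OF f2 s])
      then show "AE y in lborel. integrable lborel (\<lambda>r. case (y, r) of (y, r) \<Rightarrow> f r * f (r + e * y) * N y)" by simp
      show "integrable lborel (\<lambda>y. \<integral>r. norm (case (y, r) of (y, r) \<Rightarrow> f r * f (r + e * y) * N y) \<partial>lborel)"
      proof (rule Bochner_Integration.integrable_bound)
        show "integrable lborel (\<lambda>y. (\<integral>t. (f t)\<^sup>2 \<partial>lborel) * N y)" using iN by simp
        show "AE y in lborel. norm (\<integral>r. norm (case (y, r) of (y, r) \<Rightarrow> f r * f (r + e * y) * N y) \<partial>lborel)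
            \<le> norm ((\<integral>t. (f t)\<^sup>2 \<partial>lborel) * N y)"
        proof (rule AE_I2)
          fix y
          have "(\<integral>r. \<bar>f r\<bar> * \<bar>f (r + e * y)\<bar> \<partial>lborel) \<le> (\<integral>t. (f t)\<^sup>2 \<partial>lborel)"
            using sqint_Cauchy_Schwarz[OF sqint_norm[OF f2] sqint_norm[OF s[of y]]]
              integral_lborel_translate[of "\<lambda>t. (f t)\<^sup>2" "e * y"] by simp
          then have "(\<integral>r. \<bar>f r\<bar> * \<bar>f (r + e * y)\<bar> \<partial>lborel) * N y \<le> (\<integral>t. (f t)\<^sup>2 \<partial>lborel) * N y"
            using N0 by (rule mult_right_mono)
          then show "norm (\<integral>r. norm (case (y, r) of (y, r) \<Rightarrow> f r * f (r + e * y) * N y) \<partial>lborel)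
            \<le> norm ((\<integral>t. (f t)\<^sup>2 \<partial>lborel) * N y)" by (simp add: abs_mult N0)
        qed
      qed measurable
    qed
    then show ?thesis by (subst lborel_pair.integrable_product_swap_iff[symmetric]) (simp add: case_prod_beta')
  qed
  have "complex_of_real (\<integral>\<rho>. sqrt (2 * pi) * N (e * \<rho>) * (cmod (FT f \<rho>))\<^sup>2 \<partial>lborel)
      = (\<integral>\<rho>. complex_of_real (sqrt (2 * pi)) * (complex_of_real (N (e * \<rho>)) * (FT f \<rho> * cnj (FT f \<rho>))) \<partial>lborel)"
    by (simp add: integral_complex_of_real[symmetric] complex_norm_square mult.assoc flip: complex_norm_square del: integral_complex_of_real)
  also have "\<dots> = (\<integral>\<rho>. (\<integral>r. F \<rho> r \<partial>lborel) \<partial>lborel)"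
  proof (intro Bochner_Integration.integral_cong refl)
    fix \<rho>
    have "(\<integral>r. F \<rho> r \<partial>lborel) = complex_of_real (N (e * \<rho>)) * FT f \<rho> * (\<integral>r. exp (\<i> * complex_of_real (\<rho> * r)) * complex_of_real (f r) \<partial>lborel)"
      unfolding F_def by (simp add: mult.assoc)
    also have "(\<integral>r. exp (\<i> * complex_of_real (\<rho> * r)) * complex_of_real (f r) \<partial>lborel) = complex_of_real (sqrt (2 * pi)) * cnj (FT f \<rho>)"
      unfolding FT_cnj by (simp add: mult.assoc[symmetric] del: real_sqrt_mult)
    finally show "complex_of_real (sqrt (2 * pi)) * (complex_of_real (N (e * \<rho>)) * (FT f \<rho> * cnj (FT f \<rho>))) = (\<integral>r. F \<rho> r \<partial>lborel)"
      by (simp add: mult_ac)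
  qed
  also have "\<dots> = (\<integral>r. (\<integral>\<rho>. F \<rho> r \<partial>lborel) \<partial>lborel)"
    by (rule lborel_pair.Fubini_integral[OF F, symmetric])
  also have "\<dots> = (\<integral>r. complex_of_real (\<integral>y. f r * f (r + e * y) * N y \<partial>lborel) \<partial>lborel)"
  proof (intro Bochner_Integration.integral_cong refl)
    fix r
    have "(\<integral>\<rho>. F \<rho> r \<partial>lborel) = complex_of_real (\<integral>y. f (r + e * y) * N y \<partial>lborel) * complex_of_real (f r)"
      unfolding F_def N_def by (simp only: integral_mult_left_zero FT_gaussian_inner[OF f e])
    also have "\<dots> = complex_of_real (f r * (\<integral>y. f (r + e * y) * N y \<partial>lborel))" by simp
    finally show "(\<integral>\<rho>. F \<rho> r \<partial>lborel) = complex_of_real (\<integral>y. f r * f (r + e * y) * N y \<partial>lborel)"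
      by (simp add: mult.assoc)
  qed
  also have "\<dots> = complex_of_real (\<integral>r. \<integral>y. f r * f (r + e * y) * N y \<partial>lborel \<partial>lborel)"
    by (rule integral_complex_of_real)
  also have "(\<integral>r. \<integral>y. f r * f (r + e * y) * N y \<partial>lborel \<partial>lborel) = (\<integral>y. \<integral>r. f r * f (r + e * y) * N y \<partial>lborel \<partial>lborel)"
    by (rule lborel_pair.Fubini_integral[OF iA, symmetric])
  also have "\<dots> = (\<integral>y. N y * (\<integral>r. f r * f (r + e * y) \<partial>lborel) \<partial>lborel)"
    by (simp add: mult.commute)
  finally show ?thesis unfolding N_def of_real_eq_iff .
qed


text \<open>Let \<open>e\<close> tend to 0 in \<open>FT_gaussian_norm\<close>. On the frequency side
  the weights increase to 1, so monotone convergence works before \<open>FT f\<close> is known to be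
  square integrable; on the time side the autocorrelation is continuous at lag 0 by
  \<open>L2_translation_continuous\<close>.\<close>

theorem Plancherel_nn_integral:
  assumes f: "integrable lborel f" and f2: "sqint lborel f"
  shows "(\<integral>\<^sup>+\<rho>. ennreal ((cmod (FT f \<rho>))\<^sup>2) \<partial>lborel) = ennreal (\<integral>t. (f t)\<^sup>2 \<partial>lborel)"
proof -
  have [measurable]: "f \<in> borel_measurable borel" using f by auto
  have [measurable]: "FT f \<in> borel_measurable borel" by (rule FT_measurable) simp
  define N where "N = std_normal_density"
  have [measurable]: "N \<in> borel_measurable borel" unfolding N_def by simp
  have N0: "0 \<le> N x" for x by (simp add: N_def normal_density_nonneg)
  have iN: "integrable lborel N" unfolding N_def by simp
  have N1: "(\<integral>y. N y \<partial>lborel) = 1" unfolding N_def by simp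
  have Neq: "sqrt (2 * pi) * N x = exp (- x\<^sup>2 / 2)" for x
    by (simp add: N_def std_normal_density_def del: real_sqrt_mult)
  define e where "e n = 1 / real (Suc n)" for n
  have e0: "0 < e n" for n by (simp add: e_def)
  have elim: "e \<longlonglongrightarrow> 0" unfolding e_def by (rule LIMSEQ_inverse_real_of_nat[unfolded inverse_eq_divide])
  define A where "A h = (\<integral>r. f r * f (r + h) \<partial>lborel)" for h
  have Abd: "\<bar>A h\<bar> \<le> (\<integral>t. (f t)\<^sup>2 \<partial>lborel)" for h
    using sqint_Cauchy_Schwarz[OF f2 sqint_translate[OF f2, of h]]
      integral_lborel_translate[of "\<lambda>t. (f t)\<^sup>2" h] unfolding A_def by simp
  have [measurable]: "(\<lambda>y. A (c * y)) \<in> borel_measurable borel" for c unfolding A_def by measurable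
  have Alim: "(\<lambda>n. A (e n * y)) \<longlonglongrightarrow> A 0" for y
    unfolding A_def
  proof (rule sqint_tendsto_mult[OF f2 _ f2])
    have "(\<lambda>n. e n * y) \<longlonglongrightarrow> 0" using tendsto_mult_right[OF elim, of y] by simp
    from L2_translation_continuous[OF f2 this]
    show "(\<lambda>n. \<integral>r. (norm (f (r + e n * y) - f (r + 0)))\<^sup>2 \<partial>lborel) \<longlonglongrightarrow> 0" by simp
  qed (use f2 in \<open>auto intro: sqint_translate\<close>)
  have "(\<lambda>n. \<integral>y. N y * A (e n * y) \<partial>lborel) \<longlonglongrightarrow> (\<integral>y. N y * A 0 \<partial>lborel)"
  proof (rule integral_dominated_convergence[where w = "\<lambda>y. N y * (\<integral>t. (f t)\<^sup>2 \<partial>lborel)"])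
    show "AE y in lborel. (\<lambda>n. N y * A (e n * y)) \<longlonglongrightarrow> N y * A 0"
      by (intro AE_I2 tendsto_mult tendsto_const Alim)
    show "AE y in lborel. norm (N y * A (e n * y)) \<le> N y * (\<integral>t. (f t)\<^sup>2 \<partial>lborel)" for n
      using Abd by (auto simp: abs_mult N0 intro!: mult_left_mono)
  qed (use iN in auto)
  then have lim1: "(\<lambda>n. \<integral>y. N y * A (e n * y) \<partial>lborel) \<longlonglongrightarrow> (\<integral>t. (f t)\<^sup>2 \<partial>lborel)"
    by (simp add: N1 A_def power2_eq_square)
  define G where "G n \<rho> = sqrt (2 * pi) * N (e n * \<rho>) * (cmod (FT f \<rho>))\<^sup>2" for n \<rho>
  have [measurable]: "G n \<in> borel_measurable borel" for n unfolding G_def by measurable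
  have G0: "0 \<le> G n \<rho>" for n \<rho> by (simp add: G_def N0)
  have iG: "integrable lborel (G n)" for n
  proof (rule Bochner_Integration.integrable_bound)
    show "integrable lborel (\<lambda>\<rho>. N (e n * \<rho>) * (sqrt (2 * pi) * (\<integral>t. \<bar>f t\<bar> \<partial>lborel)\<^sup>2))"
      using lborel_integrable_real_affine[OF iN, of "e n" 0] e0[of n] by simp
    show "AE \<rho> in lborel. norm (G n \<rho>) \<le> norm (N (e n * \<rho>) * (sqrt (2 * pi) * (\<integral>t. \<bar>f t\<bar> \<partial>lborel)\<^sup>2))"
    proof (rule AE_I2)
      fix \<rho>
      have "(cmod (FT f \<rho>))\<^sup>2 \<le> (\<integral>t. \<bar>f t\<bar> \<partial>lborel)\<^sup>2"
        using FT_bounded[OF f] by (intro power_mono) auto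
      then have "G n \<rho> \<le> sqrt (2 * pi) * N (e n * \<rho>) * (\<integral>t. \<bar>f t\<bar> \<partial>lborel)\<^sup>2"
        unfolding G_def by (intro mult_left_mono) (auto simp: N0)
      then show "norm (G n \<rho>) \<le> norm (N (e n * \<rho>) * (sqrt (2 * pi) * (\<integral>t. \<bar>f t\<bar> \<partial>lborel)\<^sup>2))"
        using G0[of n \<rho>] by (simp add: N0 mult_ac)
    qed
  qed simp
  have Geq: "(\<integral>\<^sup>+\<rho>. ennreal (G n \<rho>) \<partial>lborel) = ennreal (\<integral>y. N y * A (e n * y) \<partial>lborel)" for n
  proof -
    have "(\<integral>\<^sup>+\<rho>. ennreal (G n \<rho>) \<partial>lborel) = ennreal (\<integral>\<rho>. G n \<rho> \<partial>lborel)"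
      by (rule nn_integral_eq_integral[OF iG]) (simp add: G0)
    also have "(\<integral>\<rho>. G n \<rho> \<partial>lborel) = (\<integral>y. N y * A (e n * y) \<partial>lborel)"
      unfolding G_def N_def A_def by (rule FT_gaussian_norm[OF f f2 e0])
    finally show ?thesis .
  qed
  have "(\<lambda>n. \<integral>\<^sup>+\<rho>. ennreal (G n \<rho>) \<partial>lborel) \<longlonglongrightarrow> (\<integral>\<^sup>+\<rho>. ennreal ((cmod (FT f \<rho>))\<^sup>2) \<partial>lborel)"
  proof (rule nn_integral_LIMSEQ)
    show "incseq (\<lambda>n \<rho>. ennreal (G n \<rho>))"
    proof (intro incseq_SucI le_funI ennreal_leI)
      fix n \<rho>
      have "(e (Suc n) * \<rho>)\<^sup>2 \<le> (e n * \<rho>)\<^sup>2"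
        unfolding power_mult_distrib by (intro mult_right_mono power_mono) (auto simp: e_def field_simps)
      then show "G n \<rho> \<le> G (Suc n) \<rho>"
        unfolding G_def Neq by (intro mult_right_mono) auto
    qed
    show "(\<lambda>n. ennreal (G n \<rho>)) \<longlonglongrightarrow> ennreal ((cmod (FT f \<rho>))\<^sup>2)" for \<rho>
    proof (rule tendsto_ennrealI)
      have "(\<lambda>n. exp (- (e n * \<rho>)\<^sup>2 / 2) * (cmod (FT f \<rho>))\<^sup>2) \<longlonglongrightarrow> exp (- (0 * \<rho>)\<^sup>2 / 2) * (cmod (FT f \<rho>))\<^sup>2"
        by (intro tendsto_intros elim) simp
      then show "(\<lambda>n. G n \<rho>) \<longlonglongrightarrow> (cmod (FT f \<rho>))\<^sup>2" unfolding G_def Neq by simp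
    qed
  qed simp
  moreover have "(\<lambda>n. \<integral>\<^sup>+\<rho>. ennreal (G n \<rho>) \<partial>lborel) \<longlonglongrightarrow> ennreal (\<integral>t. (f t)\<^sup>2 \<partial>lborel)"
    unfolding Geq by (rule tendsto_ennrealI[OF lim1])
  ultimately show ?thesis by (rule LIMSEQ_unique)
qed

lemma sqint_FT:
  assumes f: "integrable lborel f" and f2: "sqint lborel f"
  shows "sqint lborel (FT f)"
  unfolding sqint_def
proof
  show "FT f \<in> borel_measurable lborel" using f by (simp add: FT_measurable)
  then show "integrable lborel (\<lambda>\<rho>. (norm (FT f \<rho>))\<^sup>2)"
    using Plancherel_nn_integral[OF f f2] by (intro integrableI_bounded) auto
qed

lemma Plancherel_integral:
  assumes f: "integrable lborel f" and f2: "sqint lborel f"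
  shows "(\<integral>\<rho>. (cmod (FT f \<rho>))\<^sup>2 \<partial>lborel) = (\<integral>t. (f t)\<^sup>2 \<partial>lborel)"
  using Plancherel_nn_integral[OF f f2] sqint_integrable[OF sqint_FT[OF f f2]]
  by (subst (asm) nn_integral_eq_integral) auto

lemma FT_add:
  assumes "integrable lborel f" "integrable lborel g"
  shows "FT (\<lambda>t. f t + g t) \<rho> = FT f \<rho> + FT g \<rho>"
  unfolding FT_def of_real_add distrib_left
  by (subst Bochner_Integration.integral_add[OF integrable_exp_mult[OF assms(1)] integrable_exp_mult[OF assms(2)]])
     (simp add: distrib_left)

lemma FT_diff:
  assumes "integrable lborel f" "integrable lborel g"
  shows "FT (\<lambda>t. f t - g t) \<rho> = FT f \<rho> - FT g \<rho>"
  unfolding FT_def of_real_diff right_diff_distrib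
  by (subst Bochner_Integration.integral_diff[OF integrable_exp_mult[OF assms(1)] integrable_exp_mult[OF assms(2)]])
     (simp add: right_diff_distrib)

lemma FT_translate: "FT (\<lambda>t. f (t - \<tau>)) \<rho> = exp (- \<i> * complex_of_real (\<rho> * \<tau>)) * FT f \<rho>"
proof -
  have "(\<integral>t. exp (- \<i> * complex_of_real (\<rho> * t)) * complex_of_real (f (t - \<tau>)) \<partial>lborel)
      = (\<integral>t. exp (- \<i> * complex_of_real (\<rho> * (t + \<tau>))) * complex_of_real (f (t + \<tau> - \<tau>)) \<partial>lborel)"
    by (rule integral_lborel_translate[symmetric])
  also have "\<dots> = (\<integral>t. exp (- \<i> * complex_of_real (\<rho> * \<tau>)) * (exp (- \<i> * complex_of_real (\<rho> * t)) * complex_of_real (f t)) \<partial>lborel)"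
    by (intro Bochner_Integration.integral_cong refl) (simp add: algebra_simps exp_diff exp_minus field_simps)
  finally show ?thesis unfolding FT_def integral_mult_right_zero by (simp only: mult_ac)
qed

lemma FT_reflect: "FT f (- \<rho>) = cnj (FT f \<rho>)"
  unfolding FT_cnj by (simp add: FT_def)

lemma sqint_cnj: "sqint M f \<Longrightarrow> sqint M (\<lambda>x. cnj (f x))"
  unfolding sqint_def
  using borel_measurable_continuous_on[of cnj f M] continuous_on_cnj[of UNIV "\<lambda>x. x"] by auto

text \<open>Polarisation with real scalars determines the real part. The functions are real valued,
  so reflecting the frequency conjugates both transforms, and the imaginary part vanishes.\<close>

lemma Parseval_FT:
  assumes f: "integrable lborel f" "sqint lborel f" and g: "integrable lborel g" "sqint lborel g"
  shows "(\<integral>\<rho>. FT f \<rho> * cnj (FT g \<rho>) \<partial>lborel) = complex_of_real (\<integral>t. f t * g t \<partial>lborel)"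
proof -
  have sf: "sqint lborel (FT f)" and sg: "sqint lborel (\<lambda>\<rho>. cnj (FT g \<rho>))"
    using sqint_FT[OF f] sqint_cnj[OF sqint_FT[OF g]] by auto
  have i: "integrable lborel (\<lambda>\<rho>. FT f \<rho> * cnj (FT g \<rho>))" by (rule sqint_mult_integrable[OF sf sg])
  have p: "integrable lborel (\<lambda>t. f t + g t)" "sqint lborel (\<lambda>t. f t + g t)"
    "integrable lborel (\<lambda>t. f t - g t)" "sqint lborel (\<lambda>t. f t - g t)"
    using f g by (auto intro: sqint_add sqint_diff)
  have "4 * Re (\<integral>\<rho>. FT f \<rho> * cnj (FT g \<rho>) \<partial>lborel) = (\<integral>\<rho>. 4 * Re (FT f \<rho> * cnj (FT g \<rho>)) \<partial>lborel)"
    by (simp only: integral_mult_right_zero integral_Re[OF i])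
  also have "\<dots> = (\<integral>\<rho>. (cmod (FT (\<lambda>t. f t + g t) \<rho>))\<^sup>2 - (cmod (FT (\<lambda>t. f t - g t) \<rho>))\<^sup>2 \<partial>lborel)"
    unfolding FT_add[OF f(1) g(1)] FT_diff[OF f(1) g(1)] cmod_power2
    by (intro Bochner_Integration.integral_cong refl) (simp add: power2_eq_square algebra_simps)
  also have "\<dots> = (\<integral>\<rho>. (cmod (FT (\<lambda>t. f t + g t) \<rho>))\<^sup>2 \<partial>lborel) - (\<integral>\<rho>. (cmod (FT (\<lambda>t. f t - g t) \<rho>))\<^sup>2 \<partial>lborel)"
    by (intro Bochner_Integration.integral_diff sqint_integrable sqint_FT p)
  also have "\<dots> = (\<integral>t. (f t + g t)\<^sup>2 \<partial>lborel) - (\<integral>t. (f t - g t)\<^sup>2 \<partial>lborel)"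
    by (simp only: Plancherel_integral[OF p(1,2)] Plancherel_integral[OF p(3,4)])
  also have "\<dots> = (\<integral>t. (f t + g t)\<^sup>2 - (f t - g t)\<^sup>2 \<partial>lborel)"
    using sqint_integrable[OF p(2)] sqint_integrable[OF p(4)]
    by (intro Bochner_Integration.integral_diff[symmetric]) auto
  also have "\<dots> = (\<integral>t. 4 * (f t * g t) \<partial>lborel)"
    by (intro Bochner_Integration.integral_cong refl) (simp add: power2_eq_square algebra_simps)
  finally have re: "Re (\<integral>\<rho>. FT f \<rho> * cnj (FT g \<rho>) \<partial>lborel) = (\<integral>t. f t * g t \<partial>lborel)" by simp
  have "(\<integral>\<rho>. FT f \<rho> * cnj (FT g \<rho>) \<partial>lborel) = (\<integral>\<rho>. FT f (- \<rho>) * cnj (FT g (- \<rho>)) \<partial>lborel)"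
    using lborel_integral_real_affine[of "-1" "\<lambda>\<rho>. FT f \<rho> * cnj (FT g \<rho>)" 0] by simp
  also have "\<dots> = cnj (\<integral>\<rho>. FT f \<rho> * cnj (FT g \<rho>) \<partial>lborel)"
    unfolding FT_reflect by (simp flip: Bochner_Integration.integral_cnj)
  finally have im: "Im (\<integral>\<rho>. FT f \<rho> * cnj (FT g \<rho>) \<partial>lborel) = 0"
    by (metis complex_cnj_cancel_iff Reals_cnj_iff complex_is_Real_iff)
  show ?thesis using re im by (simp add: complex_eq_iff)
qed


section \<open>The Fourier transform in L2 as a limit over cut-offs in time\<close>

definition cutoff :: "real \<Rightarrow> (real \<Rightarrow> real) \<Rightarrow> real \<Rightarrow> real" where
  "cutoff R f t = indicator {-R..R} t * f t"

lemma cutoff_measurable: "f \<in> borel_measurable lborel \<Longrightarrow> cutoff R f \<in> borel_measurable lborel"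
  unfolding cutoff_def[abs_def] by simp

lemma fourier_L2_iff: "fourier_L2 f g \<longleftrightarrow> g \<in> borel_measurable lborel \<and>
    ((\<lambda>R. \<integral>\<^sup>+\<rho>. ennreal ((cmod (g \<rho> - FT (cutoff R f) \<rho>))\<^sup>2) \<partial>lborel) \<longlongrightarrow> 0) at_top"
proof -
  have "FT (cutoff R f) \<rho> = complex_of_real (1 / sqrt (2 * pi)) *
      (LINT t:{-R..R}|lborel. exp (- \<i> * complex_of_real (\<rho> * t)) * complex_of_real (f t))" for R \<rho>
    unfolding FT_def set_lebesgue_integral_def cutoff_def
    by (intro arg_cong2[where f = "(*)"] refl Bochner_Integration.integral_cong) (simp add: indicator_def)
  then show ?thesis unfolding fourier_L2_def by simp
qed

lemma cutoff_integrable: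
  assumes f: "sqint lborel f"
  shows "integrable lborel (cutoff R f)"
proof (rule Bochner_Integration.integrable_bound)
  show "integrable lborel (\<lambda>t. indicator {-R..R} t + (f t)\<^sup>2)"
    using sqint_integrable[OF f] by simp
  show "cutoff R f \<in> borel_measurable lborel" using sqint_measurable[OF f] by (rule cutoff_measurable)
  show "AE t in lborel. norm (cutoff R f t) \<le> norm (indicator {-R..R} t + (f t)\<^sup>2)"
  proof (rule AE_I2)
    fix t
    have "\<bar>f t\<bar> \<le> 1 + (f t)\<^sup>2" using sum_squares_bound[of "\<bar>f t\<bar>" 1] by (simp add: power2_abs)
    then show "norm (cutoff R f t) \<le> norm (indicator {-R..R} t + (f t)\<^sup>2)"
      by (auto simp: cutoff_def indicator_def)
  qed
qed

lemma cutoff_sqint: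
  assumes f: "sqint lborel f"
  shows "sqint lborel (cutoff R f)"
  using sqint_integrable[OF f] cutoff_measurable[OF sqint_measurable[OF f]]
  by (intro sqint_bound[where g = "\<lambda>t. (f t)\<^sup>2"]) (auto simp: cutoff_def indicator_def)

lemma cutoff_tendsto:
  assumes f: "sqint lborel f"
  shows "((\<lambda>R. \<integral>t. (f t - cutoff R f t)\<^sup>2 \<partial>lborel) \<longlongrightarrow> 0) at_top"
proof -
  have [measurable]: "f \<in> borel_measurable borel" using f by (auto simp: sqint_def)
  have "((\<lambda>R. \<integral>t. (f t - cutoff R f t)\<^sup>2 \<partial>lborel) \<longlongrightarrow> integral\<^sup>L lborel (\<lambda>t::real. 0)) at_top"
  proof (rule integral_dominated_convergence_at_top[where w = "\<lambda>t. (f t)\<^sup>2"])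
    show "AE t in lborel. ((\<lambda>R. (f t - cutoff R f t)\<^sup>2) \<longlongrightarrow> 0) at_top"
    proof (intro AE_I2 tendsto_eventually)
      fix t show "\<forall>\<^sub>F R in at_top. (f t - cutoff R f t)\<^sup>2 = 0"
        using eventually_ge_at_top[of "\<bar>t\<bar>"] by eventually_elim (auto simp: cutoff_def indicator_def abs_le_iff)
    qed
    show "\<forall>\<^sub>F R in at_top. AE t in lborel. norm ((f t - cutoff R f t)\<^sup>2) \<le> (f t)\<^sup>2"
      by (auto simp: cutoff_def indicator_def)
  qed (use sqint_integrable[OF f] in \<open>auto simp: cutoff_def\<close>)
  then show ?thesis by simp
qed

text \<open>Plancherel for the difference of two cut-offs. The bound is free of \<open>S\<close> and
  hence survives letting the outer radius tend to infinity.\<close>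

lemma FT_cutoff_dist:
  assumes f: "sqint lborel f" and SR: "R \<le> S"
  shows "(\<integral>\<^sup>+\<rho>. ennreal ((cmod (FT (cutoff S f) \<rho> - FT (cutoff R f) \<rho>))\<^sup>2) \<partial>lborel) \<le> ennreal (\<integral>t. (f t - cutoff R f t)\<^sup>2 \<partial>lborel)"
proof -
  have i: "integrable lborel (\<lambda>t. cutoff S f t - cutoff R f t)" using cutoff_integrable[OF f] by simp
  have s: "sqint lborel (\<lambda>t. cutoff S f t - cutoff R f t)" by (intro sqint_diff cutoff_sqint f)
  have "(\<integral>\<^sup>+\<rho>. ennreal ((cmod (FT (cutoff S f) \<rho> - FT (cutoff R f) \<rho>))\<^sup>2) \<partial>lborel) = ennreal (\<integral>t. (cutoff S f t - cutoff R f t)\<^sup>2 \<partial>lborel)"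
    using Plancherel_nn_integral[OF i s] by (simp add: FT_diff[OF cutoff_integrable[OF f] cutoff_integrable[OF f]])
  also have "\<dots> \<le> ennreal (\<integral>t. (f t - cutoff R f t)\<^sup>2 \<partial>lborel)"
    using sqint_integrable[OF s] sqint_integrable[OF sqint_diff[OF f cutoff_sqint[OF f, of R]]] SR
    by (intro ennreal_leI integral_mono) (auto simp: cutoff_def indicator_def)
  finally show ?thesis .
qed

text \<open>Existence matters because \<open>hat\<close> is defined by choice. The transforms of the
  cut-offs are Cauchy in L2; a fast sequence of radii gives a pointwise limit, and Fatou's lemma
  bounds its distance from the transform at every radius.\<close>

theorem fourier_L2_exists:
  assumes f: "sqint lborel f"
  shows "\<exists>g. fourier_L2 f g"
proof -
  define d where "d R = (\<integral>t. (f t - cutoff R f t)\<^sup>2 \<partial>lborel)" for R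
  have dlim: "(d \<longlongrightarrow> 0) at_top" unfolding d_def by (rule cutoff_tendsto[OF f])
  have "\<exists>R. \<forall>S\<ge>R. d S \<le> (1/8)^n" for n
    using order_tendstoD(2)[OF dlim, of "(1/8)^n"] by (force simp: eventually_at_top_linorder intro: less_imp_le)
  then obtain Q where Q: "\<And>n S. Q n \<le> S \<Longrightarrow> d S \<le> (1/8)^n" by metis
  \<comment> \<open>The running sum makes the radii increasing, at least \<open>Q n\<close>, and at
    least \<open>n\<close>, so that they eventually exceed any given \<open>R\<close>.\<close>
  define S where "S n = (\<Sum>i\<le>n. \<bar>Q i\<bar> + 1)" for n
  have mono: "S n \<le> S m" if "n \<le> m" for n m
    unfolding S_def using that by (intro sum_mono2) auto
  have SQ: "Q n \<le> S n" for n
  proof -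
    have "\<bar>Q n\<bar> + 1 \<le> S n" unfolding S_def by (rule member_le_sum) auto
    then show ?thesis by linarith
  qed
  have Sn: "real n \<le> S n" for n
  proof -
    have "real n \<le> (\<Sum>i\<le>n. 1)" by simp
    also have "\<dots> \<le> S n" unfolding S_def by (intro sum_mono) auto
    finally show ?thesis .
  qed
  have sF: "sqint lborel (FT (cutoff R f))" for R by (intro sqint_FT cutoff_integrable cutoff_sqint f)
  have [measurable]: "FT (cutoff R f) \<in> borel_measurable borel" for R using sF by (auto simp: sqint_def)
  have "\<exists>g. g \<in> borel_measurable lborel \<and> (AE \<rho> in lborel. (\<lambda>n. FT (cutoff (S n) f) \<rho>) \<longlonglongrightarrow> g \<rho>)"
  proof (rule sqint_complete_fast[OF sF])
    fix n
    have "ennreal (\<integral>\<rho>. (cmod (FT (cutoff (S (Suc n)) f) \<rho> - FT (cutoff (S n) f) \<rho>))\<^sup>2 \<partial>lborel) \<le> ennreal (d (S n))"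
      using FT_cutoff_dist[OF f mono[of n "Suc n"]]
      by (subst nn_integral_eq_integral[OF sqint_integrable[OF sqint_diff[OF sF sF]], symmetric]) (auto simp: d_def)
    then have "(\<integral>\<rho>. (cmod (FT (cutoff (S (Suc n)) f) \<rho> - FT (cutoff (S n) f) \<rho>))\<^sup>2 \<partial>lborel) \<le> d (S n)"
      by (simp add: ennreal_le_iff d_def)
    then show "(\<integral>\<rho>. (norm (FT (cutoff (S (Suc n)) f) \<rho> - FT (cutoff (S n) f) \<rho>))\<^sup>2 \<partial>lborel) \<le> (1/8)^n"
      using Q[OF SQ[of n]] by linarith
  qed
  then obtain g where [measurable]: "g \<in> borel_measurable lborel"
    and g: "AE \<rho> in lborel. (\<lambda>n. FT (cutoff (S n) f) \<rho>) \<longlonglongrightarrow> g \<rho>" by auto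
  have le: "(\<integral>\<^sup>+\<rho>. ennreal ((cmod (g \<rho> - FT (cutoff R f) \<rho>))\<^sup>2) \<partial>lborel) \<le> ennreal (d R)" for R
  proof (rule nn_integral_norm_limit_le[OF _ _ _ g])
    show "\<forall>\<^sub>F n in sequentially. (\<integral>\<^sup>+\<rho>. ennreal ((cmod (FT (cutoff (S n) f) \<rho> - FT (cutoff R f) \<rho>))\<^sup>2) \<partial>lborel) \<le> ennreal (d R)"
      using eventually_ge_at_top[of "nat \<lceil>R\<rceil>"]
    proof eventually_elim
      case (elim n)
      then have "R \<le> S n" using Sn[of n] by linarith
      then show ?case unfolding d_def by (rule FT_cutoff_dist[OF f])
    qed
  qed auto
  have "((\<lambda>R. \<integral>\<^sup>+\<rho>. ennreal ((cmod (g \<rho> - FT (cutoff R f) \<rho>))\<^sup>2) \<partial>lborel) \<longlongrightarrow> 0) at_top"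
    by (rule tendsto_sandwich[OF _ always_eventually[OF allI[OF le]] tendsto_const])
       (use tendsto_ennrealI[OF dlim] in auto)
  then show ?thesis by (intro exI[of _ g]) (simp add: fourier_L2_iff)
qed

text \<open>Valid for any \<open>g\<close> related to \<open>f\<close> by \<open>fourier_L2\<close>,
  hence for whichever representative \<open>hat\<close> picks. A single radius at finite distance
  already gives square integrability.\<close>

lemma fourier_L2_sqint:
  assumes f: "sqint lborel f" and g: "fourier_L2 f g"
  shows "sqint lborel g" "((\<lambda>R. \<integral>\<rho>. (cmod (FT (cutoff R f) \<rho> - g \<rho>))\<^sup>2 \<partial>lborel) \<longlongrightarrow> 0) at_top"
proof -
  have [measurable]: "g \<in> borel_measurable borel"
    and lim: "((\<lambda>R. \<integral>\<^sup>+\<rho>. ennreal ((cmod (g \<rho> - FT (cutoff R f) \<rho>))\<^sup>2) \<partial>lborel) \<longlongrightarrow> 0) at_top"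
    using g by (auto simp: fourier_L2_iff)
  have sF: "sqint lborel (FT (cutoff R f))" for R by (intro sqint_FT cutoff_integrable cutoff_sqint f)
  have [measurable]: "FT (cutoff R f) \<in> borel_measurable borel" for R using sF by (auto simp: sqint_def)
  obtain R where "(\<integral>\<^sup>+\<rho>. ennreal ((cmod (g \<rho> - FT (cutoff R f) \<rho>))\<^sup>2) \<partial>lborel) < 1"
    using order_tendstoD(2)[OF lim, of 1] by (auto dest: eventually_happens)
  then have "(\<integral>\<^sup>+\<rho>. ennreal ((cmod (g \<rho> - FT (cutoff R f) \<rho>))\<^sup>2) \<partial>lborel) < \<infinity>"
    by (rule order_less_trans) simp
  then have "integrable lborel (\<lambda>\<rho>. (cmod (g \<rho> - FT (cutoff R f) \<rho>))\<^sup>2)"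
    by (intro integrableI_bounded) auto
  then have "sqint lborel (\<lambda>\<rho>. g \<rho> - FT (cutoff R f) \<rho>)" by (simp add: sqint_def)
  from sqint_add[OF this sF[of R]] show "sqint lborel g" by simp
  have "((\<lambda>R. enn2real (\<integral>\<^sup>+\<rho>. ennreal ((cmod (g \<rho> - FT (cutoff R f) \<rho>))\<^sup>2) \<partial>lborel)) \<longlongrightarrow> 0) at_top"
    using lim by (intro tendsto_enn2real) simp_all
  then show "((\<lambda>R. \<integral>\<rho>. (cmod (FT (cutoff R f) \<rho> - g \<rho>))\<^sup>2 \<partial>lborel) \<longlongrightarrow> 0) at_top"
    by (subst integral_eq_nn_integral) (auto simp: norm_minus_commute)
qed

text \<open>The modulation has modulus one and so preserves limits in L2; on the time side it is the
  shift by \<tau>. Lag 0 gives the ordinary identity, and general \<tau> produces the shifted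
  argument \<open>t - \<tau>\<close> of the theorem.\<close>

theorem Parseval_fourier_L2:
  assumes f: "sqint lborel f" and g: "sqint lborel g" and F: "fourier_L2 f F" and G: "fourier_L2 g G"
  shows "(\<integral>\<rho>. exp (- \<i> * complex_of_real (\<rho> * \<tau>)) * F \<rho> * cnj (G \<rho>) \<partial>lborel)
      = complex_of_real (\<integral>t. f (t - \<tau>) * g t \<partial>lborel)"
proof -
  define E where "E \<rho> = exp (- \<i> * complex_of_real (\<rho> * \<tau>))" for \<rho>
  have [measurable]: "E \<in> borel_measurable borel" unfolding E_def by measurable
  have jump_part: "norm (E \<rho>) = 1" for \<rho> by (simp add: E_def norm_exp_eq_Re)
  have sE: "sqint lborel (\<lambda>\<rho>. E \<rho> * h \<rho>)" if "sqint lborel h" for h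
    using that by (auto simp: sqint_def norm_mult jump_part)
  have tr: "sqint lborel (\<lambda>t. h (t - \<tau>))" if "sqint lborel h" for h :: "real \<Rightarrow> real"
    using sqint_translate[OF that, of "- \<tau>"] by simp
  have tri: "integrable lborel (\<lambda>t. h (t - \<tau>))" if "integrable lborel h" for h :: "real \<Rightarrow> real"
    using lborel_integrable_real_affine[OF that, of 1 "- \<tau>"] by simp
  have "((\<lambda>R. \<integral>\<rho>. (E \<rho> * FT (cutoff R f) \<rho>) * cnj (FT (cutoff R g) \<rho>) \<partial>lborel)
      \<longlongrightarrow> (\<integral>\<rho>. (E \<rho> * F \<rho>) * cnj (G \<rho>) \<partial>lborel)) at_top"
  proof (rule sqint_tendsto_mult)
    have "norm (E \<rho> * FT (cutoff R f) \<rho> - E \<rho> * F \<rho>) = norm (FT (cutoff R f) \<rho> - F \<rho>)" for R \<rho>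
      by (simp add: norm_mult jump_part flip: right_diff_distrib)
    then show "((\<lambda>R. \<integral>\<rho>. (norm (E \<rho> * FT (cutoff R f) \<rho> - E \<rho> * F \<rho>))\<^sup>2 \<partial>lborel) \<longlongrightarrow> 0) at_top"
      using fourier_L2_sqint(2)[OF f F] by simp
    have "norm (cnj (FT (cutoff R g) \<rho>) - cnj (G \<rho>)) = norm (FT (cutoff R g) \<rho> - G \<rho>)" for R \<rho>
      by (metis complex_cnj_diff complex_mod_cnj)
    then show "((\<lambda>R. \<integral>\<rho>. (norm (cnj (FT (cutoff R g) \<rho>) - cnj (G \<rho>)))\<^sup>2 \<partial>lborel) \<longlongrightarrow> 0) at_top"
      using fourier_L2_sqint(2)[OF g G] by simp
  qed (intro sE sqint_cnj fourier_L2_sqint(1)[OF f F] fourier_L2_sqint(1)[OF g G] sqint_FT cutoff_integrable cutoff_sqint f g)+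
  moreover have "(\<integral>\<rho>. (E \<rho> * FT (cutoff R f) \<rho>) * cnj (FT (cutoff R g) \<rho>) \<partial>lborel) = complex_of_real (\<integral>t. cutoff R f (t - \<tau>) * cutoff R g t \<partial>lborel)" for R
    unfolding E_def FT_translate[symmetric]
    by (intro Parseval_FT tri tr cutoff_integrable cutoff_sqint f g)
  moreover have "((\<lambda>R. complex_of_real (\<integral>t. cutoff R f (t - \<tau>) * cutoff R g t \<partial>lborel)) \<longlongrightarrow> complex_of_real (\<integral>t. f (t - \<tau>) * g t \<partial>lborel)) at_top"
  proof (rule tendsto_of_real, rule sqint_tendsto_mult)
    have "(\<integral>t. (cutoff R f (t - \<tau>) - f (t - \<tau>))\<^sup>2 \<partial>lborel) = (\<integral>t. (f t - cutoff R f t)\<^sup>2 \<partial>lborel)" for R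
      using integral_lborel_translate[of "\<lambda>t. (cutoff R f t - f t)\<^sup>2" "- \<tau>"] by (simp add: power2_commute)
    then show "((\<lambda>R. \<integral>t. (norm (cutoff R f (t - \<tau>) - f (t - \<tau>)))\<^sup>2 \<partial>lborel) \<longlongrightarrow> 0) at_top"
      using cutoff_tendsto[OF f] by simp
    show "((\<lambda>R. \<integral>t. (norm (cutoff R g t - g t))\<^sup>2 \<partial>lborel) \<longlongrightarrow> 0) at_top"
      using cutoff_tendsto[OF g] by (simp add: power2_commute)
  qed (intro tr cutoff_sqint f g)+
  ultimately show ?thesis
    unfolding E_def by (simp add: tendsto_unique[OF trivial_limit_at_top_linorder])
qed

section \<open>The integral formula for fractional powers\<close>

text \<open>The indicator lets integrals over positive lags be written over the whole line, where
  Fubini with \<open>lborel\<close> applies directly.\<close>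

definition frac_kernel :: "real \<Rightarrow> real \<Rightarrow> real" where
  "frac_kernel s \<tau> = indicator {0<..} \<tau> * \<tau> powr (- 1 - s)"

lemma frac_kernel_nonneg [simp]: "0 \<le> frac_kernel s \<tau>"
  by (simp add: frac_kernel_def)

lemma frac_kernel_measurable [measurable]: "frac_kernel s \<in> borel_measurable borel"
  unfolding frac_kernel_def[abs_def] by measurable

lemma frac_kernel_nonpos [simp]: "\<tau> \<le> 0 \<Longrightarrow> frac_kernel s \<tau> = 0"
  by (simp add: frac_kernel_def)

lemma frac_kernel_pos: "0 < \<tau> \<Longrightarrow> frac_kernel s \<tau> = 1 / \<tau> powr (1 + s)"
  using powr_minus_divide[of \<tau> "1 + s"] by (simp add: frac_kernel_def)

text \<open>Bridge from Lebesgue integrals on the line to the gauge integral over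
  \<open>{0<..}\<close> in the theorem. The values of \<open>f\<close> at nonpositive arguments are
  left free, since nothing is known there about the heat kernel.\<close>

lemma has_integral_pos_lborel:
  fixes f g :: "real \<Rightarrow> real"
  assumes g: "integrable lborel g" and pos: "\<And>\<tau>. 0 < \<tau> \<Longrightarrow> f \<tau> = g \<tau>" and neg: "\<And>\<tau>. \<tau> \<le> 0 \<Longrightarrow> g \<tau> = 0"
  shows "(f has_integral (\<integral>\<tau>. g \<tau> \<partial>lborel)) {0<..}"
proof -
  have eq: "(\<lambda>\<tau>. if \<tau> \<in> {0<..} then f \<tau> else 0) = g" using pos neg by (auto simp: fun_eq_iff)
  have "((\<lambda>\<tau>. if \<tau> \<in> {0<..} then f \<tau> else 0) has_integral (\<integral>\<tau>. g \<tau> \<partial>lborel)) UNIV"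
    unfolding eq by (rule has_integral_integral_lborel[OF g])
  then show ?thesis by (simp only: has_integral_restrict_UNIV)
qed

text \<open>The recurrence gives \<open>Gamma (1 - s) = - s * Gamma (- s)\<close>. The left side is
  positive, so \<open>Gamma (- s)\<close> is negative, which explains the absolute value in the
  constants.\<close>

lemma abs_Gamma_neg:
  assumes "0 < s" "s < (1::real)"
  shows "\<bar>Gamma (- s)\<bar> = Gamma (1 - s) / s"
proof -
  have "- s \<notin> \<int>\<^sub>\<le>\<^sub>0"
  proof
    assume "- s \<in> \<int>\<^sub>\<le>\<^sub>0"
    then obtain n :: int where n: "- s = of_int n" by (auto elim: nonpos_Ints_cases)
    then have "-1 < n" "n < 0" using assms by linarith+
    then show False by simp
  qed
  then have "Gamma (- s + 1) = - s * Gamma (- s)" by (rule Gamma_plus1)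
  then have "Gamma (1 - s) = - s * Gamma (- s)" by (simp add: add.commute)
  then have "Gamma (- s) = - (Gamma (1 - s) / s)" using assms by (simp add: field_simps)
  then show ?thesis using assms Gamma_real_pos[of "1 - s"] by (simp add: abs_div)
qed

lemma nn_integral_powr_tail:
  assumes "0 < s" "0 < q"
  shows "(\<integral>\<^sup>+r. ennreal (indicator {q..} r * r powr (- 1 - s)) \<partial>lborel) = ennreal (q powr (- s) / s)"
proof -
  have "((\<lambda>x. x powr (- 1 - s)) has_integral - (q powr (- 1 - s + 1)) / (- 1 - s + 1)) {q..}"
    using assms by (intro has_integral_powr_to_inf) auto
  then have "((\<lambda>x. if x \<in> {q..} then x powr (- 1 - s) else 0) has_integral (q powr (- s) / s)) UNIV"
    by (subst has_integral_restrict_UNIV) simp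
  also have "(\<lambda>x. if x \<in> {q..} then x powr (- 1 - s) else 0) = (\<lambda>x. indicator {q..} x * x powr (- 1 - s))"
    by (auto simp: indicator_def)
  finally have "((\<lambda>x. indicator {q..} x * x powr (- 1 - s)) has_integral (q powr (- s) / s)) UNIV" .
  then show ?thesis by (intro nn_integral_has_integral_lborel) auto
qed

text \<open>Write \<open>1 - exp (- r)\<close> as the integral of \<open>exp (- q)\<close> over
  \<open>[0, r]\<close> and exchange the order. The tail integral in \<open>r\<close> contributes
  \<open>q powr (- s) / s\<close>, and Euler's integral for \<open>Gamma (1 - s)\<close>
  remains.\<close>

lemma nn_integral_frac_kernel_1:
  assumes s: "0 < s" "s < (1::real)"
  shows "(\<integral>\<^sup>+r. ennreal ((1 - exp (- r)) * frac_kernel s r) \<partial>lborel) = ennreal \<bar>Gamma (- s)\<bar>"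
proof -
  have "(\<integral>\<^sup>+r. ennreal ((1 - exp (- r)) * frac_kernel s r) \<partial>lborel)
      = (\<integral>\<^sup>+r. \<integral>\<^sup>+q. ennreal (exp (- q)) * indicator {0..r} q * ennreal (frac_kernel s r) \<partial>lborel \<partial>lborel)"
  proof (intro nn_integral_cong)
    fix r :: real
    show "ennreal ((1 - exp (- r)) * frac_kernel s r) = (\<integral>\<^sup>+q. ennreal (exp (- q)) * indicator {0..r} q * ennreal (frac_kernel s r) \<partial>lborel)"
    proof (cases "0 < r")
      case True
      have "(\<integral>\<^sup>+q. ennreal (exp (- q)) * indicator {0..r} q \<partial>lborel) = ennreal (- exp (- r) - (- exp (- 0)))"
        using True by (intro nn_integral_FTC_Icc) (auto intro!: derivative_eq_intros)
      then show ?thesis using True by (simp add: nn_integral_multc ennreal_mult)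
    qed (simp add: frac_kernel_def)
  qed
  also have "\<dots> = (\<integral>\<^sup>+q. \<integral>\<^sup>+r. ennreal (exp (- q)) * indicator {0..r} q * ennreal (frac_kernel s r) \<partial>lborel \<partial>lborel)"
  proof (rule lborel_pair.Fubini')
    have [measurable]: "(\<lambda>x. frac_kernel s (snd x)) \<in> borel_measurable ((lborel :: real measure) \<Otimes>\<^sub>M lborel)"
      by (rule measurable_compose[OF measurable_snd]) simp
    have eq: "(\<lambda>(q, r). ennreal (exp (- q)) * indicator {0..r} q * ennreal (frac_kernel s r))
        = (\<lambda>x. ennreal (exp (- fst x)) * (if 0 \<le> fst x \<and> fst x \<le> snd x then 1 else 0) * ennreal (frac_kernel s (snd x)))"
      by (auto simp: indicator_def fun_eq_iff)
    show "(\<lambda>(q, r). ennreal (exp (- q)) * indicator {0..r} q * ennreal (frac_kernel s r)) \<in> borel_measurable (lborel \<Otimes>\<^sub>M lborel)"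
      unfolding eq by measurable
  qed
  also have "\<dots> = (\<integral>\<^sup>+q. ennreal (1 / s) * ennreal (indicator {0..} q * q powr (1 - s - 1) / exp q) \<partial>lborel)"
  proof (rule nn_integral_cong_AE)
    show "AE q in lborel. (\<integral>\<^sup>+r. ennreal (exp (- q)) * indicator {0..r} q * ennreal (frac_kernel s r) \<partial>lborel)
        = ennreal (1 / s) * ennreal (indicator {0..} q * q powr (1 - s - 1) / exp q)"
      using AE_lborel_singleton[of 0]
    proof eventually_elim
      case (elim q)
      show ?case
      proof (cases "0 < q")
        case True
        have "(\<integral>\<^sup>+r. ennreal (exp (- q)) * indicator {0..r} q * ennreal (frac_kernel s r) \<partial>lborel)
            = (\<integral>\<^sup>+r. ennreal (exp (- q)) * ennreal (indicator {q..} r * r powr (- 1 - s)) \<partial>lborel)"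
          using True by (intro nn_integral_cong) (auto simp: frac_kernel_def indicator_def)
        also have "\<dots> = ennreal (exp (- q)) * ennreal (q powr (- s) / s)"
          using True s by (simp add: nn_integral_cmult nn_integral_powr_tail)
        finally show ?thesis using True s by (simp add: ennreal_mult[symmetric] exp_minus field_simps)
      next
        case False
        then have "q < 0" using elim by simp
        then have "(\<integral>\<^sup>+r. ennreal (exp (- q)) * indicator {0..r} q * ennreal (frac_kernel s r) \<partial>lborel) = 0"
          by (simp add: indicator_def)
        then show ?thesis using \<open>q < 0\<close> by simp
      qed
    qed
  qed
  also have "\<dots> = ennreal (1 / s) * ennreal (Gamma (1 - s))"
    using s by (simp add: nn_integral_cmult Gamma_conv_nn_integral_real del: diff_diff_eq)
  also have "\<dots> = ennreal \<bar>Gamma (- s)\<bar>"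
    using s by (simp add: abs_Gamma_neg ennreal_mult[symmetric] less_imp_le Gamma_real_pos)
  finally show ?thesis .
qed

text \<open>The substitution \<open>r\<close> to \<open>x * r\<close> reproduces the kernel up to
  the factor \<open>x powr (- s)\<close> and reduces to \<open>x = 1\<close>. For
  \<open>x = 0\<close> both sides vanish.\<close>

lemma nn_integral_frac_kernel:
  assumes s: "0 < s" "s < (1::real)" and x: "0 \<le> x"
  shows "(\<integral>\<^sup>+r. ennreal ((1 - exp (- r * x)) * frac_kernel s r) \<partial>lborel) = ennreal (\<bar>Gamma (- s)\<bar> * x powr s)"
proof (cases "x = 0")
  case False
  with x have x: "0 < x" by simp
  have "(\<integral>\<^sup>+r. ennreal ((1 - exp (- r)) * frac_kernel s r) \<partial>lborel)
      = ennreal \<bar>x\<bar> * (\<integral>\<^sup>+r. ennreal ((1 - exp (- (0 + x * r))) * frac_kernel s (0 + x * r)) \<partial>lborel)"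
    using x by (intro nn_integral_real_affine) auto
  also have "\<dots> = (\<integral>\<^sup>+r. ennreal (x powr (- s)) * ennreal ((1 - exp (- r * x)) * frac_kernel s r) \<partial>lborel)"
  proof (subst nn_integral_cmult[symmetric], simp, intro nn_integral_cong)
    fix r :: real
    have "x * frac_kernel s (x * r) = x powr (- s) * frac_kernel s r"
    proof (cases "0 < r")
      case True
      have "x * x powr (- 1 - s) = x powr (- s)"
        using x powr_add[of x 1 "- 1 - s"] by simp
      then show ?thesis using x True by (simp add: frac_kernel_def powr_mult zero_less_mult_iff)
    qed (use x in \<open>simp add: frac_kernel_def zero_less_mult_iff\<close>)
    then have eq: "x * ((1 - exp (- (x * r))) * frac_kernel s (x * r)) = x powr (- s) * ((1 - exp (- r * x)) * frac_kernel s r)"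
      by (simp add: mult.left_commute[of x] mult.left_commute[of "x powr - s"] mult.commute[of r])
    show "ennreal \<bar>x\<bar> * ennreal ((1 - exp (- (0 + x * r))) * frac_kernel s (0 + x * r))
        = ennreal (x powr (- s)) * ennreal ((1 - exp (- r * x)) * frac_kernel s r)"
      using x eq by (simp only: add_0 abs_of_pos flip: ennreal_mult'[OF less_imp_le[OF x]] ennreal_mult'[OF powr_ge_zero])
  qed
  finally have "ennreal (x powr s) * ennreal \<bar>Gamma (- s)\<bar> = ennreal (x powr s) * (ennreal (x powr (- s)) * (\<integral>\<^sup>+r. ennreal ((1 - exp (- r * x)) * frac_kernel s r) \<partial>lborel))"
    by (simp add: nn_integral_frac_kernel_1[OF s] nn_integral_cmult)
  also have "\<dots> = (\<integral>\<^sup>+r. ennreal ((1 - exp (- r * x)) * frac_kernel s r) \<partial>lborel)"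
    using x by (simp add: mult.assoc[symmetric] ennreal_mult[symmetric] powr_add[symmetric])
  finally show ?thesis by (simp add: ennreal_mult[symmetric] mult.commute)
qed simp

lemma one_minus_exp_nonneg_mult: "0 \<le> x \<Longrightarrow> 0 \<le> (1 - exp (- r * x)) * frac_kernel s r"
  by (cases "0 < r") (auto simp: frac_kernel_def)

lemma integrable_frac_kernel:
  assumes s: "0 < s" "s < (1::real)" and x: "0 \<le> x"
  shows "integrable lborel (\<lambda>r. (1 - exp (- r * x)) * frac_kernel s r)"
proof (rule integrableI_bounded)
  have "(\<integral>\<^sup>+r. ennreal (norm ((1 - exp (- r * x)) * frac_kernel s r)) \<partial>lborel) = (\<integral>\<^sup>+r. ennreal ((1 - exp (- r * x)) * frac_kernel s r) \<partial>lborel)"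
    using one_minus_exp_nonneg_mult[OF x] by (intro nn_integral_cong) (simp only: real_norm_def abs_of_nonneg)
  then show "(\<integral>\<^sup>+r. ennreal (norm ((1 - exp (- r * x)) * frac_kernel s r)) \<partial>lborel) < \<infinity>"
    using nn_integral_frac_kernel[OF s x] by simp
qed measurable

lemma integral_frac_kernel:
  assumes s: "0 < s" "s < (1::real)" and x: "0 \<le> x"
  shows "(\<integral>r. (1 - exp (- r * x)) * frac_kernel s r \<partial>lborel) = \<bar>Gamma (- s)\<bar> * x powr s"
  using nn_integral_frac_kernel[OF s x] one_minus_exp_nonneg_mult[OF x]
  by (subst integral_eq_nn_integral) auto

text \<open>The constant 4 comes from \<open>x > 1\<close>, where the left side may be 2 while
  \<open>1 - exp (- x)\<close> is only bounded below by \<open>1/2\<close>. For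
  \<open>x \<le> 1\<close> the bound is \<open>1 - exp (- x) \<ge> x / 2\<close>.\<close>

lemma min_le_one_minus_exp: "0 \<le> (x::real) \<Longrightarrow> min 2 x \<le> 4 * (1 - exp (- x))"
proof (cases "x \<le> 1")
  case True
  assume x: "0 \<le> x"
  have "1 + x \<le> exp x" by (rule exp_ge_add_one_self)
  then have "exp (- x) \<le> 1 / (1 + x)" using x by (simp add: exp_minus field_simps)
  also have "\<dots> \<le> 1 - x / 2" using x True by (simp add: field_simps) (simp add: mult_left_le)
  finally show ?thesis using x by simp
next
  case False
  assume x: "0 \<le> x"
  have "1 + x \<le> exp x" by (rule exp_ge_add_one_self)
  then have "2 \<le> exp x" using False by linarith
  then have "exp (- x) \<le> 1 / 2" by (simp add: exp_minus field_simps)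
  then show ?thesis by simp
qed

text \<open>On the left half-plane the exponential is bounded by 1 and has Lipschitz constant 1, so
  the left side is at most \<open>min 2 (\<tau> * norm z)\<close>. The complex integrand is thereby
  dominated by the real one at \<open>norm z\<close>, whose integral is known exactly.\<close>

lemma norm_one_minus_exp_le:
  fixes z :: complex
  assumes "0 \<le> \<tau>" "0 \<le> Re z"
  shows "norm (1 - exp (- complex_of_real \<tau> * z)) \<le> 4 * (1 - exp (- \<tau> * norm z))"
proof -
  have re: "norm (exp (- complex_of_real \<tau> * z)) \<le> 1" using assms by (simp add: norm_exp_eq_Re)
  then have "norm (1 - exp (- complex_of_real \<tau> * z)) \<le> 2"
    using norm_triangle_ineq4[of 1 "exp (- complex_of_real \<tau> * z)"] by (simp only: norm_one)
  moreover have "norm (1 - exp (- complex_of_real \<tau> * z)) \<le> \<tau> * norm z"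
  proof -
    have "norm (exp (- complex_of_real \<tau> * z) - exp 0) \<le> 1 * norm (- complex_of_real \<tau> * z - 0)"
    proof (rule field_differentiable_bound[where S = "{w. Re w \<le> 0}" and f = exp and f' = exp])
      show "convex {w. Re w \<le> 0}" by (rule convex_halfspace_Re_le)
      show "(exp has_field_derivative exp w) (at w within {w. Re w \<le> 0})" for w :: complex
        by (rule DERIV_exp[THEN has_field_derivative_at_within])
    qed (use assms in \<open>auto simp: norm_exp_eq_Re\<close>)
    then show ?thesis using assms by (simp add: norm_mult norm_minus_commute)
  qed
  ultimately have "norm (1 - exp (- complex_of_real \<tau> * z)) \<le> min 2 (\<tau> * norm z)" by simp
  also have "\<dots> \<le> 4 * (1 - exp (- (\<tau> * norm z)))" using assms by (intro min_le_one_minus_exp) simp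
  finally show ?thesis by simp
qed

section \<open>Truncation and analytic continuation in the right half-plane\<close>

definition frac_integrand :: "real \<Rightarrow> complex \<Rightarrow> real \<Rightarrow> complex" where
  "frac_integrand s z \<tau> = (1 - exp (- complex_of_real \<tau> * z)) * complex_of_real (frac_kernel s \<tau>)"

lemma frac_integrand_measurable [measurable]: "frac_integrand s z \<in> borel_measurable borel"
  unfolding frac_integrand_def[abs_def] by measurable

text \<open>The bound depends on \<open>z\<close> only through \<open>B\<close>, so one majorant
  serves a whole bounded part of the closed half-plane.\<close>

lemma norm_frac_integrand_le:
  assumes "0 \<le> Re z" "norm z \<le> B"
  shows "norm (frac_integrand s z \<tau>) \<le> 4 * ((1 - exp (- \<tau> * B)) * frac_kernel s \<tau>)"
proof (cases "0 \<le> \<tau>")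
  case True
  have "exp (- \<tau> * B) \<le> exp (- \<tau> * norm z)" using True assms by (simp add: mult_left_mono)
  then have "4 * (1 - exp (- \<tau> * norm z)) \<le> 4 * (1 - exp (- \<tau> * B))" by simp
  from order_trans[OF norm_one_minus_exp_le[OF True assms(1)] this]
  have "norm (1 - exp (- complex_of_real \<tau> * z)) \<le> 4 * (1 - exp (- \<tau> * B))" .
  then have "norm (1 - exp (- complex_of_real \<tau> * z)) * frac_kernel s \<tau> \<le> 4 * (1 - exp (- \<tau> * B)) * frac_kernel s \<tau>"
    by (rule mult_right_mono) simp
  moreover have "norm (frac_integrand s z \<tau>) = norm (1 - exp (- complex_of_real \<tau> * z)) * frac_kernel s \<tau>"
    by (simp add: frac_integrand_def norm_mult)
  ultimately show ?thesis by (simp only: mult.assoc)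
qed (simp add: frac_integrand_def)

lemma integrable_frac_integrand:
  assumes s: "0 < s" "s < 1" and z: "0 \<le> Re z"
  shows "integrable lborel (frac_integrand s z)"
proof (rule Bochner_Integration.integrable_bound)
  show "integrable lborel (\<lambda>\<tau>. 4 * ((1 - exp (- \<tau> * norm z)) * frac_kernel s \<tau>))"
    using integrable_frac_kernel[OF s, of "norm z"] by simp
  show "AE \<tau> in lborel. norm (frac_integrand s z \<tau>) \<le> norm (4 * ((1 - exp (- \<tau> * norm z)) * frac_kernel s \<tau>))"
    unfolding real_norm_def by (intro AE_I2 order_trans[OF norm_frac_integrand_le[OF z order_refl] abs_ge_self])
qed simp

text \<open>The factor \<open>norm z powr s\<close>, taken at the spectral points, is the weight in
  \<open>Dom_Hs\<close>; this is where the domain of the operator meets the lag integral.\<close>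

lemma nn_integral_norm_frac_integrand_le:
  assumes s: "0 < s" "s < 1" and z: "0 \<le> Re z"
  shows "(\<integral>\<^sup>+\<tau>. ennreal (norm (frac_integrand s z \<tau>)) \<partial>lborel) \<le> ennreal (4 * \<bar>Gamma (- s)\<bar> * norm z powr s)"
proof -
  have "(\<integral>\<^sup>+\<tau>. ennreal (norm (frac_integrand s z \<tau>)) \<partial>lborel) \<le> (\<integral>\<^sup>+\<tau>. ennreal 4 * ennreal ((1 - exp (- \<tau> * norm z)) * frac_kernel s \<tau>) \<partial>lborel)"
    using norm_frac_integrand_le[OF z order_refl, of s] one_minus_exp_nonneg_mult[OF norm_ge_zero[of z], of _ s]
    by (intro nn_integral_mono) (subst ennreal_mult[symmetric], auto intro!: ennreal_leI)
  also have "\<dots> = ennreal 4 * ennreal (\<bar>Gamma (- s)\<bar> * norm z powr s)"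
    by (subst nn_integral_cmult) (use nn_integral_frac_kernel[OF s norm_ge_zero[of z]] in simp_all)
  also have "\<dots> = ennreal (4 * \<bar>Gamma (- s)\<bar> * norm z powr s)"
    by (subst ennreal_mult[symmetric]) (simp_all add: mult.assoc)
  finally show ?thesis .
qed


text \<open>On a bounded part of the closed right half-plane the truncations converge uniformly,
  since the tail is controlled by a single integrable function.\<close>
lemma frac_integral_truncation_uniform:
  assumes s: "0 < s" "s < 1" and S: "\<And>z. z \<in> S \<Longrightarrow> 0 \<le> Re z \<and> norm z \<le> B"
  shows "uniform_limit S (\<lambda>n z. \<integral>\<tau>. indicator {1 / real (Suc n)..real (Suc n)} \<tau> *\<^sub>R frac_integrand s z \<tau> \<partial>lborel)
      (\<lambda>z. \<integral>\<tau>. frac_integrand s z \<tau> \<partial>lborel) sequentially"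
proof (cases "S = {}")
  case False
  then have B: "0 \<le> B" using S norm_ge_zero order_trans by blast
  define A where "A n = {1 / real (Suc n)..real (Suc n)}" for n
  have [measurable]: "A n \<in> sets borel" for n by (simp add: A_def)
  define w where "w \<tau> = 4 * ((1 - exp (- \<tau> * B)) * frac_kernel s \<tau>)" for \<tau>
  have iw: "integrable lborel w" unfolding w_def using integrable_frac_kernel[OF s B] by simp
  have w0: "0 \<le> w \<tau>" for \<tau> unfolding w_def using one_minus_exp_nonneg_mult[OF B] by simp
  have wn: "w \<tau> = 0" if "\<tau> \<le> 0" for \<tau> using that by (simp add: w_def)
  have iwA: "integrable lborel (\<lambda>\<tau>. indicator (- A n) \<tau> *\<^sub>R w \<tau>)" for n
    using iw by (intro integrable_mult_indicator) auto
  have "(\<lambda>n. \<integral>\<tau>. indicator (- A n) \<tau> *\<^sub>R w \<tau> \<partial>lborel) \<longlonglongrightarrow> integral\<^sup>L lborel (\<lambda>\<tau>::real. 0)"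
  proof (rule integral_dominated_convergence[where w = w])
    show "AE \<tau> in lborel. (\<lambda>n. indicator (- A n) \<tau> *\<^sub>R w \<tau>) \<longlonglongrightarrow> 0"
    proof (intro AE_I2 tendsto_eventually)
      fix \<tau> :: real
      show "\<forall>\<^sub>F n in sequentially. indicator (- A n) \<tau> *\<^sub>R w \<tau> = 0"
      proof (cases "0 < \<tau>")
        case True
        show ?thesis using eventually_ge_at_top[of "nat \<lceil>\<tau> + 1 / \<tau>\<rceil>"]
        proof eventually_elim
          case (elim n)
          then have n: "\<tau> + 1 / \<tau> \<le> real n" by linarith
          have "0 < 1 / \<tau>" using True by simp
          then have "\<tau> \<le> real (Suc n)" "1 / \<tau> \<le> real (Suc n)" using n True by linarith+
          then have "\<tau> \<in> A n" using True by (auto simp: A_def field_simps)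
          then show ?case by simp
        qed
      qed (simp add: wn)
    qed
    show "AE \<tau> in lborel. norm (indicator (- A n) \<tau> *\<^sub>R w \<tau>) \<le> w \<tau>" for n
      by (intro AE_I2) (auto simp: indicator_def w0)
  qed (use iw in auto)
  then have lim: "(\<lambda>n. \<integral>\<tau>. indicator (- A n) \<tau> *\<^sub>R w \<tau> \<partial>lborel) \<longlonglongrightarrow> 0" by simp
  have le: "norm ((\<integral>\<tau>. indicator (A n) \<tau> *\<^sub>R frac_integrand s z \<tau> \<partial>lborel) - (\<integral>\<tau>. frac_integrand s z \<tau> \<partial>lborel))
      \<le> (\<integral>\<tau>. indicator (- A n) \<tau> *\<^sub>R w \<tau> \<partial>lborel)" if "z \<in> S" for z n
  proof -
    have i: "integrable lborel (frac_integrand s z)" using S[OF that] by (intro integrable_frac_integrand s) auto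
    have iA: "integrable lborel (\<lambda>\<tau>. indicator (A n) \<tau> *\<^sub>R frac_integrand s z \<tau>)"
      using i by (intro integrable_mult_indicator) auto
    have "norm ((\<integral>\<tau>. indicator (A n) \<tau> *\<^sub>R frac_integrand s z \<tau> \<partial>lborel) - (\<integral>\<tau>. frac_integrand s z \<tau> \<partial>lborel))
        = norm (\<integral>\<tau>. indicator (A n) \<tau> *\<^sub>R frac_integrand s z \<tau> - frac_integrand s z \<tau> \<partial>lborel)"
      using i iA by simp
    also have "\<dots> \<le> (\<integral>\<tau>. indicator (- A n) \<tau> *\<^sub>R w \<tau> \<partial>lborel)"
    proof (rule Bochner_Integration.integral_norm_bound_integral)
      show "norm (indicator (A n) \<tau> *\<^sub>R frac_integrand s z \<tau> - frac_integrand s z \<tau>) \<le> indicator (- A n) \<tau> *\<^sub>R w \<tau>" for \<tau>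
        using norm_frac_integrand_le[of z B s \<tau>] S[OF that] by (auto simp: indicator_def w_def)
    qed (use i iA iwA in auto)
    finally show ?thesis .
  qed
  show ?thesis
    unfolding A_def[symmetric]
  proof (rule uniform_limitI)
    fix e :: real assume "0 < e"
    then have "\<forall>\<^sub>F n in sequentially. (\<integral>\<tau>. indicator (- A n) \<tau> *\<^sub>R w \<tau> \<partial>lborel) < e"
      by (rule order_tendstoD(2)[OF lim])
    then show "\<forall>\<^sub>F n in sequentially. \<forall>z\<in>S. dist (\<integral>\<tau>. indicator (A n) \<tau> *\<^sub>R frac_integrand s z \<tau> \<partial>lborel) (\<integral>\<tau>. frac_integrand s z \<tau> \<partial>lborel) < e"
      by eventually_elim (auto simp: dist_norm intro: le_less_trans[OF le])
  qed
qed simp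

text \<open>For \<open>a > 0\<close> the singularity at lag 0 is cut away: the integrand is
  continuous on a compact interval and entire in \<open>z\<close>, so differentiation under the
  integral is justified.\<close>

lemma frac_integral_truncation_holomorphic:
  assumes a: "0 < a"
  shows "(\<lambda>z. \<integral>\<tau>. indicator {a..b} \<tau> *\<^sub>R frac_integrand s z \<tau> \<partial>lborel) holomorphic_on UNIV"
proof -
  define f where "f z \<tau> = (1 - exp (- complex_of_real \<tau> * z)) * complex_of_real (\<tau> powr (- 1 - s))" for z \<tau>
  have cont: "continuous_on {a..b} (f z)" for z
    unfolding f_def using a by (intro continuous_intros) auto
  have eq: "(\<integral>\<tau>. indicator {a..b} \<tau> *\<^sub>R frac_integrand s z \<tau> \<partial>lborel) = integral (cbox a b) (f z)" for z
  proof -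
    have "(\<integral>\<tau>. indicator {a..b} \<tau> *\<^sub>R frac_integrand s z \<tau> \<partial>lborel) = (LINT \<tau>:{a..b}|lborel. f z \<tau>)"
      unfolding set_lebesgue_integral_def using a
      by (intro Bochner_Integration.integral_cong refl) (auto simp: indicator_def frac_integrand_def f_def frac_kernel_def)
    also have "\<dots> = integral {a..b} (f z)"
      by (intro set_borel_integral_eq_integral borel_integrable_atLeastAtMost' cont)
    finally show ?thesis by simp
  qed
  have "(\<lambda>z. integral (cbox a b) (f z)) holomorphic_on UNIV"
  proof (rule leibniz_rule_holomorphic[where fx = "\<lambda>z \<tau>. exp (- complex_of_real \<tau> * z) * complex_of_real \<tau> * complex_of_real (\<tau> powr (- 1 - s))"])
    show "((\<lambda>z. f z \<tau>) has_field_derivative exp (- complex_of_real \<tau> * z) * complex_of_real \<tau> * complex_of_real (\<tau> powr (- 1 - s))) (at z within UNIV)" for z \<tau>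
      unfolding f_def by (auto intro!: derivative_eq_intros)
    show "f z integrable_on cbox a b" for z using cont[of z] by (simp add: integrable_continuous_interval)
    show "continuous_on (UNIV \<times> cbox a b) (\<lambda>(z, \<tau>). exp (- complex_of_real \<tau> * z) * complex_of_real \<tau> * complex_of_real (\<tau> powr (- 1 - s)))"
      unfolding case_prod_beta using a by (intro continuous_intros) auto
  qed simp
  then show ?thesis unfolding eq .
qed

lemma powr_continuous_seq:
  assumes "z \<notin> \<real>\<^sub>\<le>\<^sub>0" "X \<longlonglongrightarrow> z"
  shows "(\<lambda>n. X n powr (w::complex)) \<longlonglongrightarrow> z powr w"
  using isCont_tendsto_compose[OF DERIV_isCont[OF has_field_derivative_powr[OF assms(1)]] assms(2)] by simp

text \<open>Two holomorphic functions on the open half-plane that agree on the positive reals are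
  equal. Nonzero points of the imaginary axis are reached from the right by dominated convergence;
  they lie off the branch cut, where the principal power is continuous.\<close>

theorem frac_power_integral:
  assumes s: "0 < s" "s < 1" and z: "0 \<le> Re z" "z \<noteq> 0"
  shows "(\<integral>\<tau>. frac_integrand s z \<tau> \<partial>lborel) = complex_of_real \<bar>Gamma (- s)\<bar> * z powr complex_of_real s"
proof -
  define J where "J z = (\<integral>\<tau>. frac_integrand s z \<tau> \<partial>lborel)" for z
  define H where "H = {z. 0 < Re z}"
  have oH: "open H" unfolding H_def by (rule open_halfspace_Re_gt)
  have cH: "connected H" unfolding H_def by (intro convex_connected convex_halfspace_Re_gt)
  have holJ: "J holomorphic_on H"
  proof (rule holomorphic_uniform_sequence[OF oH])
    show "(\<lambda>z. \<integral>\<tau>. indicator {1 / real (Suc n)..real (Suc n)} \<tau> *\<^sub>R frac_integrand s z \<tau> \<partial>lborel) holomorphic_on H" for n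
      by (rule holomorphic_on_subset[OF frac_integral_truncation_holomorphic]) auto
    fix x assume "x \<in> H"
    then obtain d where d: "0 < d" "cball x d \<subseteq> H" using oH open_contains_cball by blast
    have "uniform_limit (cball x d) (\<lambda>n z. \<integral>\<tau>. indicator {1 / real (Suc n)..real (Suc n)} \<tau> *\<^sub>R frac_integrand s z \<tau> \<partial>lborel) J sequentially"
      unfolding J_def
    proof (rule frac_integral_truncation_uniform[OF s, where B = "norm x + d"])
      fix z assume z: "z \<in> cball x d"
      then have "norm z \<le> norm x + d"
        using norm_triangle_ineq2[of z x] by (simp add: dist_norm norm_minus_commute)
      with z d show "0 \<le> Re z \<and> norm z \<le> norm x + d" by (auto simp: H_def)
    qed
    with d show "\<exists>d. 0 < d \<and> cball x d \<subseteq> H \<and> uniform_limit (cball x d)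
        (\<lambda>n z. \<integral>\<tau>. indicator {1 / real (Suc n)..real (Suc n)} \<tau> *\<^sub>R frac_integrand s z \<tau> \<partial>lborel) J sequentially"
      by blast
  qed
  have real: "J (complex_of_real x) = complex_of_real \<bar>Gamma (- s)\<bar> * complex_of_real x powr complex_of_real s" if "0 < x" for x
  proof -
    have "J (complex_of_real x) = (\<integral>\<tau>. complex_of_real ((1 - exp (- \<tau> * x)) * frac_kernel s \<tau>) \<partial>lborel)"
      unfolding J_def frac_integrand_def by (simp flip: exp_of_real)
    also have "\<dots> = complex_of_real (\<bar>Gamma (- s)\<bar> * x powr s)"
      using integral_frac_kernel[OF s, of x] that by (simp only: integral_complex_of_real)
    finally show ?thesis using that by (simp add: powr_of_real)
  qed
  have H: "J w = complex_of_real \<bar>Gamma (- s)\<bar> * w powr complex_of_real s" if "w \<in> H" for w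
  proof -
    have "J w - complex_of_real \<bar>Gamma (- s)\<bar> * w powr complex_of_real s = 0"
    proof (rule analytic_continuation[where f = "\<lambda>w. J w - complex_of_real \<bar>Gamma (- s)\<bar> * w powr complex_of_real s"
          and S = H and U = "complex_of_real ` {0<..}" and \<xi> = 1])
      show "(\<lambda>w. J w - complex_of_real \<bar>Gamma (- s)\<bar> * w powr complex_of_real s) holomorphic_on H"
        by (intro holomorphic_intros holJ) (auto simp: H_def complex_nonpos_Reals_iff)
      show "1 islimpt complex_of_real ` {0<..}"
        unfolding islimpt_sequential
      proof (intro exI conjI allI)
        show "complex_of_real (1 + 1 / real (Suc n)) \<in> complex_of_real ` {0<..} - {1}" for n
        proof -
          have "complex_of_real (1 + 1 / real (Suc n)) \<noteq> complex_of_real 1"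
            unfolding of_real_eq_iff by simp
          moreover have "0 < 1 + 1 / real (Suc n)" by (simp add: add_pos_pos)
          ultimately show ?thesis by (metis DiffI singletonD imageI greaterThan_iff of_real_1)
        qed
        have "(\<lambda>n. complex_of_real (1 + 1 / real (Suc n))) \<longlonglongrightarrow> complex_of_real (1 + 0)"
          by (intro tendsto_intros LIMSEQ_inverse_real_of_nat[unfolded inverse_eq_divide])
        then show "(\<lambda>n. complex_of_real (1 + 1 / real (Suc n))) \<longlonglongrightarrow> 1" by simp
      qed
    qed (use oH cH that real in \<open>auto simp: H_def\<close>)
    then show ?thesis by simp
  qed
  show ?thesis
  proof (cases "Re z = 0")
    case False
    then show ?thesis using H[of z] z by (simp add: H_def J_def)
  next
    case True
    then have nz: "z \<notin> \<real>\<^sub>\<le>\<^sub>0" using z by (auto simp: complex_nonpos_Reals_iff complex_eq_iff)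
    define X where "X n = z + complex_of_real (1 / real (Suc n))" for n
    have "X \<longlonglongrightarrow> z + complex_of_real 0"
      unfolding X_def by (intro tendsto_intros LIMSEQ_inverse_real_of_nat[unfolded inverse_eq_divide])
    then have X: "X \<longlonglongrightarrow> z" by simp
    have XH: "X n \<in> H" for n using True by (simp add: X_def H_def)
    have XB: "norm (X n) \<le> norm z + 1" for n
      unfolding X_def by (rule order_trans[OF norm_triangle_ineq]) (simp only: norm_of_real, simp)
    have "(\<lambda>n. J (X n)) \<longlonglongrightarrow> J z"
      unfolding J_def
    proof (rule integral_dominated_convergence[where w = "\<lambda>\<tau>. 4 * ((1 - exp (- \<tau> * (norm z + 1))) * frac_kernel s \<tau>)"])
      show "integrable lborel (\<lambda>\<tau>. 4 * ((1 - exp (- \<tau> * (norm z + 1))) * frac_kernel s \<tau>))"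
        using integrable_frac_kernel[OF s, of "norm z + 1"] by simp
      show "AE \<tau> in lborel. (\<lambda>n. frac_integrand s (X n) \<tau>) \<longlonglongrightarrow> frac_integrand s z \<tau>"
        unfolding frac_integrand_def by (intro AE_I2 tendsto_intros X)
      show "AE \<tau> in lborel. norm (frac_integrand s (X n) \<tau>) \<le> 4 * ((1 - exp (- \<tau> * (norm z + 1))) * frac_kernel s \<tau>)" for n
        using XH[of n] XB[of n] by (intro AE_I2 norm_frac_integrand_le) (auto simp: H_def)
    qed auto
    moreover have "(\<lambda>n. J (X n)) \<longlonglongrightarrow> complex_of_real \<bar>Gamma (- s)\<bar> * z powr complex_of_real s"
      unfolding H[OF XH] by (intro tendsto_mult tendsto_const powr_continuous_seq nz X)
    ultimately show ?thesis unfolding J_def by (rule LIMSEQ_unique)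
  qed
qed

section \<open>Smooth test functions and weak gradients\<close>

text \<open>The classical flat function \<open>exp (- 1 / y)\<close> divided by powers of
  \<open>y\<close>. All \<open>k\<close> are treated together because differentiation leads from
  \<open>k\<close> to \<open>k + 1\<close> and \<open>k + 2\<close>.\<close>

definition exp_cutoff :: "nat \<Rightarrow> real \<Rightarrow> real" where
  "exp_cutoff k y = (if 0 < y then exp (- 1 / y) / y ^ k else 0)"

lemma exp_ge_power_div_fact:
  fixes y :: real
  assumes "0 \<le> y"
  shows "y ^ n / fact n \<le> exp y"
proof -
  have s: "(\<lambda>n. y ^ n /\<^sub>R fact n) sums exp y" by (rule exp_converges)
  have "sum (\<lambda>n. y ^ n /\<^sub>R fact n) {n} \<le> (\<Sum>n. y ^ n /\<^sub>R fact n)"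
    using s assms by (intro sum_le_suminf) (auto simp: sums_iff)
  then show ?thesis using s by (simp add: sums_iff divide_inverse mult.commute)
qed

text \<open>A single term of the exponential series,
  \<open>(1 / y) ^ (k + 2) / fact (k + 2)\<close>, lies below \<open>exp (1 / y)\<close>. Quadratic
  decay makes the difference quotient at 0 vanish for every \<open>k\<close>.\<close>

lemma exp_cutoff_quadratic_bound: "\<bar>exp_cutoff k y\<bar> \<le> fact (k + 2) * y\<^sup>2"
proof (cases "0 < y")
  case True
  have "(1 / y) ^ (k + 2) / fact (k + 2) \<le> exp (1 / y)"
    using True by (intro exp_ge_power_div_fact) auto
  then have "(1 / y) ^ (k + 2) * exp (- 1 / y) \<le> fact (k + 2)"
    using True by (simp add: exp_minus field_simps del: fact_Suc power_Suc add_2_eq_Suc')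
  then have "(1 / y) ^ (k + 2) * exp (- 1 / y) * y\<^sup>2 \<le> fact (k + 2) * y\<^sup>2"
    by (rule mult_right_mono) simp
  moreover have "(1 / y) ^ (k + 2) * exp (- 1 / y) * y\<^sup>2 = exp (- 1 / y) / y ^ k"
    using True by (simp add: power_add power_divide power2_eq_square del: add_2_eq_Suc')
  ultimately have "exp (- 1 / y) / y ^ k \<le> fact (k + 2) * y\<^sup>2" by simp
  then show ?thesis using True by (simp add: exp_cutoff_def)
qed (simp add: exp_cutoff_def)

text \<open>The derivative is again a combination of members of the family, which is what the
  coinduction for smoothness needs. At the origin both sides are 0 by the quadratic bound.\<close>

lemma DERIV_exp_cutoff:
  "DERIV (exp_cutoff k) y :> exp_cutoff (k + 2) y - real k * exp_cutoff (k + 1) y"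
proof -
  consider "0 < y" | "y < 0" | "y = 0" by linarith
  then show ?thesis
  proof cases
    case 1
    have d1: "DERIV (\<lambda>y. exp (- inverse y)) y :> exp (- inverse y) * (inverse y * inverse y)"
      using 1 by (auto intro!: derivative_eq_intros)
    have d2: "DERIV (\<lambda>y. inverse y ^ k) y :> - (real k * (inverse y ^ k * inverse y))"
    proof (cases k)
      case (Suc m)
      have "DERIV inverse y :> - (inverse y ^ Suc (Suc 0))" using 1 by (intro DERIV_inverse) simp
      from DERIV_power[OF this, of "Suc m"]
      have "DERIV (\<lambda>y. inverse y ^ Suc m) y :> of_nat (Suc m) * (- (inverse y ^ Suc (Suc 0)) * inverse y ^ m)" by simp
      then show ?thesis unfolding Suc by (rule DERIV_cong) (simp add: algebra_simps)
    qed simp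
    have "DERIV (\<lambda>y. exp (- inverse y) * inverse y ^ k) y :> exp_cutoff (k + 2) y - real k * exp_cutoff (k + 1) y"
      using DERIV_mult[OF d1 d2]
      by (rule DERIV_cong) (use 1 in \<open>simp add: exp_cutoff_def divide_inverse power_inverse algebra_simps\<close>)
    then have "DERIV (\<lambda>y. exp (- 1 / y) / y ^ k) y :> exp_cutoff (k + 2) y - real k * exp_cutoff (k + 1) y"
      by (simp add: divide_inverse power_inverse)
    moreover have "\<forall>\<^sub>F x in nhds y. exp_cutoff k x = exp (- 1 / x) / x ^ k"
      using 1 by (intro eventually_mono[OF eventually_nhds_in_open[of "{0<..}"]]) (auto simp: exp_cutoff_def)
    ultimately show ?thesis
      using DERIV_cong_ev[OF refl, of "exp_cutoff k" "\<lambda>x. exp (- 1 / x) / x ^ k" y, OF _ refl] by simp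
  next
    case 2
    have "\<forall>\<^sub>F x in nhds y. exp_cutoff k x = 0"
      using 2 by (intro eventually_mono[OF eventually_nhds_in_open[of "{..<0}"]]) (auto simp: exp_cutoff_def)
    then have "DERIV (exp_cutoff k) y :> 0 \<longleftrightarrow> DERIV (\<lambda>x. 0 :: real) y :> 0" by (intro DERIV_cong_ev) auto
    then show ?thesis using 2 by (simp add: exp_cutoff_def)
  next
    case 3
    have "(\<lambda>h. (exp_cutoff k (0 + h) - exp_cutoff k 0) / h) \<midarrow>0\<rightarrow> 0"
    proof (rule Lim_null_comparison)
      show "\<forall>\<^sub>F h in at 0. norm ((exp_cutoff k (0 + h) - exp_cutoff k 0) / h) \<le> fact (k + 2) * \<bar>h\<bar>"
      proof (rule always_eventually, rule allI)
        fix h :: real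
        have "\<bar>exp_cutoff k h\<bar> \<le> fact (k + 2) * \<bar>h\<bar> * \<bar>h\<bar>"
          using exp_cutoff_quadratic_bound[of k h] by (simp add: power2_eq_square mult.assoc)
        then show "norm ((exp_cutoff k (0 + h) - exp_cutoff k 0) / h) \<le> fact (k + 2) * \<bar>h\<bar>"
          by (cases "h = 0") (auto simp: exp_cutoff_def[of _ 0] abs_divide divide_le_eq)
      qed
      have "((\<lambda>h::real. fact (k + 2) * \<bar>h\<bar>) \<longlongrightarrow> fact (k + 2) * \<bar>0\<bar>) (at 0)" by (intro tendsto_intros)
      then show "((\<lambda>h::real. fact (k + 2) * \<bar>h\<bar>) \<longlongrightarrow> 0) (at 0)" by simp
    qed
    then have "DERIV (exp_cutoff k) 0 :> 0" by (simp add: DERIV_def)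
    then show ?thesis using 3 by (simp add: exp_cutoff_def)
  qed
qed

lemma exp_cutoff_0_range: "0 \<le> exp_cutoff 0 y" "exp_cutoff 0 y \<le> 1"
  by (auto simp: exp_cutoff_def)

lemma exp_cutoff_0_tendsto: "(exp_cutoff 0 \<longlongrightarrow> 1) at_top"
proof -
  have "((\<lambda>y::real. exp (- (inverse y))) \<longlongrightarrow> exp (- 0)) at_top"
    by (intro tendsto_intros tendsto_inverse_0_at_top filterlim_ident)
  moreover have "\<forall>\<^sub>F y in at_top. exp (- (inverse y)) = exp_cutoff 0 y"
    using eventually_gt_at_top[of 0] by eventually_elim (simp add: exp_cutoff_def divide_inverse)
  ultimately show ?thesis by (simp add: tendsto_cong)
qed

section \<open>Partial derivatives and closure properties of smooth functions\<close>

lemma pder_eqI: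
  assumes "(f has_derivative f') (at x)"
  shows "pder i f x = f' (axis i 1)"
  using frechet_derivative_at[OF assms] by (simp add: pder_def)

lemma smooth_fun_differentiable: "smooth_fun f \<Longrightarrow> f differentiable (at x)"
  by (auto elim: smooth_fun.cases)

lemma smooth_fun_pder: "smooth_fun f \<Longrightarrow> smooth_fun (pder i f)"
  by (auto elim: smooth_fun.cases)

lemma smooth_fun_continuous: "smooth_fun f \<Longrightarrow> continuous_on UNIV f"
  by (simp add: continuous_at_imp_continuous_on differentiable_imp_continuous_within smooth_fun_differentiable)

text \<open>A class closed under partial derivatives, hence an admissible invariant for coinduction.\<close>
inductive smooth_cl :: "(real^'n::finite \<Rightarrow> real) \<Rightarrow> bool" where
  base: "smooth_fun f \<Longrightarrow> smooth_cl f"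
| const: "smooth_cl (\<lambda>x. c)"
| cutoff: "smooth_cl (\<lambda>x. exp_cutoff k (a * x $ i + b))"
| add: "smooth_cl f \<Longrightarrow> smooth_cl g \<Longrightarrow> smooth_cl (\<lambda>x. f x + g x)"
| mult: "smooth_cl f \<Longrightarrow> smooth_cl g \<Longrightarrow> smooth_cl (\<lambda>x. f x * g x)"
| inv_sqrt: "smooth_cl f \<Longrightarrow> smooth_cl (\<lambda>x. 1 / sqrt (1 + (f x)\<^sup>2))"

lemma pder_works: "f differentiable (at x) \<Longrightarrow> (f has_derivative frechet_derivative f (at x)) (at x)"
  by (simp add: frechet_derivative_works)

lemma pder_add:
  assumes "f differentiable (at x)" "g differentiable (at x)"
  shows "pder i (\<lambda>x. f x + g x) x = pder i f x + pder i g x"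
  using pder_eqI[OF has_derivative_add[OF pder_works[OF assms(1)] pder_works[OF assms(2)]]] by (simp add: pder_def)

lemma pder_mult:
  assumes "f differentiable (at x)" "g differentiable (at x)"
  shows "pder i (\<lambda>x. f x * g x) x = f x * pder i g x + pder i f x * g x"
  using pder_eqI[OF has_derivative_mult[OF pder_works[OF assms(1)] pder_works[OF assms(2)]]] by (simp add: pder_def)

lemma has_derivative_DERIV_compose:
  assumes "DERIV F (f x) :> d" "f differentiable (at x)"
  shows "((\<lambda>x. F (f x)) has_derivative (\<lambda>h. d * frechet_derivative f (at x) h)) (at x)"
  using has_derivative_compose[OF pder_works[OF assms(2)] assms(1)[unfolded has_field_derivative_def]] by simp

lemma pder_DERIV_compose:
  assumes "DERIV F (f x) :> d" "f differentiable (at x)"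
  shows "pder i (\<lambda>x. F (f x)) x = d * pder i f x"
  using pder_eqI[OF has_derivative_DERIV_compose[OF assms]] by (simp add: pder_def)

text \<open>The derivative is spelled as a product of factors that \<open>smooth_cl\<close>
  generates, so that it visibly stays in the class.\<close>

lemma DERIV_inv_sqrt: "DERIV (\<lambda>r. 1 / sqrt (1 + r\<^sup>2)) r :> - r * (1 / sqrt (1 + r\<^sup>2)) * (1 / sqrt (1 + r\<^sup>2)) * (1 / sqrt (1 + r\<^sup>2))"
proof -
  have p: "0 < 1 + r\<^sup>2" by (simp add: add_pos_nonneg)
  have "DERIV (\<lambda>r. 1 + r\<^sup>2) r :> 2 * r" by (auto intro!: derivative_eq_intros)
  from DERIV_chain2[OF DERIV_real_sqrt[OF p] this]
  have "DERIV (\<lambda>r. sqrt (1 + r\<^sup>2)) r :> inverse (sqrt (1 + r\<^sup>2)) / 2 * (2 * r)" .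
  from DERIV_inverse'[OF this] p show ?thesis
    by (simp add: inverse_eq_divide algebra_simps)
qed

text \<open>One differentiation inside the class. Rule induction suffices since each constructor has
  an explicit derivative built from the same constructors and from the derivatives of its
  arguments.\<close>

lemma smooth_cl_step:
  fixes f :: "real^'n::finite \<Rightarrow> real"
  shows "smooth_cl f \<Longrightarrow> (\<forall>x. f differentiable (at x)) \<and> (\<forall>i. smooth_cl (pder i f))"
proof (induction rule: smooth_cl.induct)
  case (base f)
  then show ?case by (auto intro: smooth_cl.base smooth_fun_pder smooth_fun_differentiable)
next
  case (const c)
  have "pder i (\<lambda>x::real^'n. c) = (\<lambda>x. 0)" for i by (rule ext) (simp add: pder_eqI[OF has_derivative_const])
  then show ?case by (simp add: smooth_cl.const)
next
  case (cutoff k a i b)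
  have d: "((\<lambda>x. a * x $ i + b) has_derivative (\<lambda>h. a * h $ i)) (at x)" for x :: "real^'n"
    using has_derivative_add[OF has_derivative_mult_right[OF bounded_linear.has_derivative[OF bounded_linear_vec_nth has_derivative_ident]] has_derivative_const]
    by simp
  have D: "((\<lambda>x. exp_cutoff k (a * x $ i + b)) has_derivative
      (\<lambda>h. (exp_cutoff (k + 2) (a * x $ i + b) - real k * exp_cutoff (k + 1) (a * x $ i + b)) * (a * h $ i))) (at x)" for x :: "real^'n"
    using has_derivative_compose[OF d DERIV_exp_cutoff[unfolded has_field_derivative_def]] by simp
  \<comment> \<open>Subtraction is written as adding a multiple by a negative constant, so that the
    introduction rules of \<open>smooth_cl\<close> apply literally.\<close>
  have "pder j (\<lambda>x. exp_cutoff k (a * x $ i + b)) = (\<lambda>x. (exp_cutoff (k + 2) (a * x $ i + b)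
      + - real k * exp_cutoff (k + 1) (a * x $ i + b)) * (a * axis j 1 $ i))" for j :: 'n
    by (rule ext) (simp add: pder_eqI[OF D])
  moreover have "smooth_cl (\<lambda>x. (exp_cutoff (k + 2) (a * x $ i + b)
      + - real k * exp_cutoff (k + 1) (a * x $ i + b)) * (a * axis j 1 $ i))" for j :: 'n
    by (intro smooth_cl.intros)
  ultimately show ?case using D by (auto simp: differentiable_def)
next
  case (add f g)
  have "pder i (\<lambda>x. f x + g x) = (\<lambda>x. pder i f x + pder i g x)" for i
    using add by (intro ext pder_add) auto
  then show ?case using add by (auto intro: smooth_cl.intros)
next
  case (mult f g)
  have "pder i (\<lambda>x. f x * g x) = (\<lambda>x. f x * pder i g x + pder i f x * g x)" for i
    using mult by (intro ext pder_mult) auto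
  moreover have "smooth_cl (\<lambda>x. f x * pder i g x + pder i f x * g x)" for i
    using mult by (intro smooth_cl.add smooth_cl.mult) auto
  ultimately show ?case using mult by auto
next
  case (inv_sqrt f)
  have D: "((\<lambda>x. 1 / sqrt (1 + (f x)\<^sup>2)) has_derivative (\<lambda>h. (- f x * (1 / sqrt (1 + (f x)\<^sup>2)) * (1 / sqrt (1 + (f x)\<^sup>2)) * (1 / sqrt (1 + (f x)\<^sup>2)))
      * frechet_derivative f (at x) h)) (at x)" for x
    using inv_sqrt by (intro has_derivative_DERIV_compose[where F = "\<lambda>r. 1 / sqrt (1 + r\<^sup>2)"] DERIV_inv_sqrt) auto
  have "pder i (\<lambda>x. 1 / sqrt (1 + (f x)\<^sup>2)) = (\<lambda>x. ((((- 1) * f x) * (1 / sqrt (1 + (f x)\<^sup>2))) * (1 / sqrt (1 + (f x)\<^sup>2)) * (1 / sqrt (1 + (f x)\<^sup>2))) * pder i f x)" for i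
    by (rule ext) (simp add: pder_eqI[OF D] pder_def)
  moreover have "smooth_cl (\<lambda>x. ((((- 1) * f x) * (1 / sqrt (1 + (f x)\<^sup>2))) * (1 / sqrt (1 + (f x)\<^sup>2)) * (1 / sqrt (1 + (f x)\<^sup>2))) * pder i f x)" for i
    using inv_sqrt by (intro smooth_cl.mult smooth_cl.const smooth_cl.inv_sqrt) auto
  ultimately show ?case using D by (auto simp: differentiable_def)
qed

text \<open>The inductively generated class is a post-fixed point of the coinductive definition,
  hence its closure rules hold for smooth functions.\<close>

lemma smooth_fun_iff_smooth_cl: "smooth_fun f \<longleftrightarrow> smooth_cl f"
proof
  assume "smooth_cl f"
  then show "smooth_fun f"
    by (rule smooth_fun.coinduct) (use smooth_cl_step in blast)
qed (rule smooth_cl.base)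

lemma smooth_fun_add: "smooth_fun f \<Longrightarrow> smooth_fun g \<Longrightarrow> smooth_fun (\<lambda>x. f x + g x)"
  unfolding smooth_fun_iff_smooth_cl by (rule smooth_cl.add)

lemma smooth_fun_mult: "smooth_fun f \<Longrightarrow> smooth_fun g \<Longrightarrow> smooth_fun (\<lambda>x. f x * g x)"
  unfolding smooth_fun_iff_smooth_cl by (rule smooth_cl.mult)

lemma smooth_fun_const: "smooth_fun (\<lambda>x. c)"
  unfolding smooth_fun_iff_smooth_cl by (rule smooth_cl.const)

lemma smooth_fun_cmult: "smooth_fun f \<Longrightarrow> smooth_fun (\<lambda>x. c * f x)"
  by (intro smooth_fun_mult smooth_fun_const)

lemma smooth_fun_prod: "(\<And>k. k \<in> I \<Longrightarrow> smooth_fun (f k)) \<Longrightarrow> smooth_fun (\<lambda>x. \<Prod>k\<in>I. f k x)"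
  by (induction I rule: infinite_finite_induct) (auto intro: smooth_fun_mult smooth_fun_const)

section \<open>Test functions and their integrals\<close>

lemma test_funI: "smooth_fun \<psi> \<Longrightarrow> compact K \<Longrightarrow> K \<subseteq> \<Omega> \<Longrightarrow> (\<And>x. x \<notin> K \<Longrightarrow> \<psi> x = 0) \<Longrightarrow> test_fun \<Omega> \<psi>"
  unfolding test_fun_def by blast

lemma test_fun_add:
  assumes "test_fun \<Omega> f" "test_fun \<Omega> g"
  shows "test_fun \<Omega> (\<lambda>x. f x + g x)"
proof -
  obtain K L where "compact K" "K \<subseteq> \<Omega>" "\<forall>x. x \<notin> K \<longrightarrow> f x = 0" "compact L" "L \<subseteq> \<Omega>" "\<forall>x. x \<notin> L \<longrightarrow> g x = 0"
    using assms by (auto simp: test_fun_def)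
  then show ?thesis
    using assms by (intro test_funI[where K = "K \<union> L"]) (auto intro: smooth_fun_add simp: test_fun_def)
qed

lemma test_fun_zero: "test_fun \<Omega> (\<lambda>x. 0)"
  by (rule test_funI[where K = "{}"]) (auto intro: smooth_fun_const)

lemma test_fun_mult_left: "smooth_fun f \<Longrightarrow> test_fun \<Omega> g \<Longrightarrow> test_fun \<Omega> (\<lambda>x. f x * g x)"
proof -
  assume f: "smooth_fun f" and "test_fun \<Omega> g"
  then obtain K where "smooth_fun g" "compact K" "K \<subseteq> \<Omega>" "\<And>x. x \<notin> K \<Longrightarrow> g x = 0"
    by (auto simp: test_fun_def)
  with f show ?thesis by (intro test_funI[where K = K] smooth_fun_mult) auto
qed

lemma test_fun_sum: "(\<And>k. k \<in> I \<Longrightarrow> test_fun \<Omega> (f k)) \<Longrightarrow> test_fun \<Omega> (\<lambda>x. \<Sum>k\<in>I. f k x)"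
  by (induction I rule: infinite_finite_induct) (auto intro: test_fun_add test_fun_zero)

lemma test_fun_lincomb: "(\<And>k. k \<in> I \<Longrightarrow> test_fun \<Omega> (f k)) \<Longrightarrow> test_fun \<Omega> (\<lambda>x. \<Sum>k\<in>I. b k * f k x)"
  by (intro test_fun_sum test_fun_mult_left smooth_fun_const)

text \<open>A compact set is closed, so \<open>f\<close> vanishes in a whole neighbourhood of
  \<open>x\<close>.\<close>

lemma pder_zero_outside:
  assumes K: "compact K" and f: "\<And>x. x \<notin> K \<Longrightarrow> f x = 0" and x: "x \<notin> K"
  shows "pder i f x = 0"
proof -
  have "(f has_derivative (\<lambda>h. 0)) (at x)"
  proof (rule has_derivative_transform_within_open[where f = "\<lambda>x. 0" and s = "- K"])
    show "open (- K)" using compact_imp_closed[OF K] by auto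
  qed (use f x in auto)
  from pder_eqI[OF this] show ?thesis by simp
qed

lemma test_fun_pder: "test_fun \<Omega> \<psi> \<Longrightarrow> test_fun \<Omega> (pder i \<psi>)"
proof -
  assume "test_fun \<Omega> \<psi>"
  then obtain K where "smooth_fun \<psi>" "compact K" "K \<subseteq> \<Omega>" "\<And>x. x \<notin> K \<Longrightarrow> \<psi> x = 0"
    by (auto simp: test_fun_def)
  then show ?thesis by (intro test_funI[where K = K] smooth_fun_pder pder_zero_outside[where f = \<psi> and K = K])
qed

lemma test_fun_bounded:
  assumes "test_fun \<Omega> \<psi>"
  shows "\<exists>M\<ge>0. \<forall>x. \<bar>\<psi> x\<bar> \<le> M"
proof -
  obtain K where K: "compact K" "\<And>x. x \<notin> K \<Longrightarrow> \<psi> x = 0" and s: "smooth_fun \<psi>"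
    using assms by (auto simp: test_fun_def)
  have "bounded (\<psi> ` K)"
    by (intro compact_imp_bounded compact_continuous_image K continuous_on_subset[OF smooth_fun_continuous[OF s]]) auto
  then obtain M where "\<And>x. x \<in> K \<Longrightarrow> \<bar>\<psi> x\<bar> \<le> M" by (auto simp: bounded_iff)
  with K have "\<bar>\<psi> x\<bar> \<le> max M 0" for x by (cases "x \<in> K") (simp_all add: le_max_iff_disj)
  then show ?thesis by (intro exI[of _ "max M 0"]) auto
qed

lemma test_fun_borel: "test_fun \<Omega> \<psi> \<Longrightarrow> \<psi> \<in> borel_measurable borel"
  by (auto simp: test_fun_def intro: borel_measurable_continuous_onI smooth_fun_continuous)

lemma borel_imp_lebesgue_on: "f \<in> borel_measurable borel \<Longrightarrow> f \<in> borel_measurable (lebesgue_on S)"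
  by (intro measurable_restrict_space1 measurable_completion) auto

lemma test_fun_lebesgue_on: "test_fun \<Omega> \<psi> \<Longrightarrow> \<psi> \<in> borel_measurable (lebesgue_on S)"
  by (intro borel_imp_lebesgue_on test_fun_borel)

lemma DERIV_along_axis:
  assumes "smooth_fun \<psi>"
  shows "DERIV (\<lambda>t. \<psi> (x + t *\<^sub>R axis i 1)) t :> pder i \<psi> (x + t *\<^sub>R axis i 1)"
proof -
  have "((\<lambda>t. x + t *\<^sub>R axis i 1) has_derivative (\<lambda>h. h *\<^sub>R axis i 1)) (at t)"
    by (auto intro!: derivative_eq_intros)
  from has_derivative_compose[OF this pder_works[OF smooth_fun_differentiable[OF assms]]]
  have "((\<lambda>t. \<psi> (x + t *\<^sub>R axis i 1)) has_derivative (\<lambda>h. frechet_derivative \<psi> (at (x + t *\<^sub>R axis i 1)) (h *\<^sub>R axis i 1))) (at t)" .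
  moreover have "linear (frechet_derivative \<psi> (at (x + t *\<^sub>R axis i 1)))"
    using assms by (intro linear_frechet_derivative smooth_fun_differentiable)
  ultimately have "((\<lambda>t. \<psi> (x + t *\<^sub>R axis i 1)) has_derivative (\<lambda>h. h * pder i \<psi> (x + t *\<^sub>R axis i 1))) (at t)"
    by (simp add: pder_def linear_cmul)
  also have "(\<lambda>h. h * pder i \<psi> (x + t *\<^sub>R axis i 1)) = (*) (pder i \<psi> (x + t *\<^sub>R axis i 1))"
    by (rule ext) (rule mult.commute)
  finally show ?thesis by (simp add: has_field_derivative_def)
qed

lemma integral_lborel_translate_euclidean:
  fixes f :: "'a::euclidean_space \<Rightarrow> real"
  assumes [measurable]: "f \<in> borel_measurable borel"
  shows "(\<integral>x. f (c + x) \<partial>lborel) = (\<integral>x. f x \<partial>lborel)"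
  by (subst (2) lborel_distr_plus[of c, symmetric], subst integral_distr) auto

text \<open>Difference quotients integrate to zero by translation invariance.\<close>
lemma integral_pder_test_fun:
  assumes \<psi>: "test_fun \<Omega> \<psi>"
  shows "(\<integral>x. pder i \<psi> x \<partial>lborel) = 0"
proof -
  obtain K where K: "compact K" "\<And>x. x \<notin> K \<Longrightarrow> \<psi> x = 0" and s: "smooth_fun \<psi>"
    using \<psi> by (auto simp: test_fun_def)
  obtain R where R: "\<And>x. x \<in> K \<Longrightarrow> norm x \<le> R" using compact_imp_bounded[OF K(1)] by (auto simp: bounded_iff)
  obtain M where M0: "0 \<le> M" and M: "\<And>x. \<bar>pder i \<psi> x\<bar> \<le> M" using test_fun_bounded[OF test_fun_pder[OF \<psi>]] by metis
  have [measurable]: "\<psi> \<in> borel_measurable borel" "pder i \<psi> \<in> borel_measurable borel"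
    by (rule test_fun_borel[OF \<psi>], rule test_fun_borel[OF test_fun_pder[OF \<psi>]])
  define h where "h n = 1 / real (Suc n)" for n
  have h0: "0 < h n" "h n \<le> 1" for n by (auto simp: h_def)
  have hlim: "h \<longlonglongrightarrow> 0" unfolding h_def by (rule LIMSEQ_inverse_real_of_nat[unfolded inverse_eq_divide])
  define e :: "real^'a" where "e = axis i 1"
  have ne: "norm e = 1" by (simp add: e_def norm_axis_1)
  define Q where "Q n x = (\<psi> (h n *\<^sub>R e + x) - \<psi> x) / h n" for n x
  have mvt: "\<exists>t. 0 < t \<and> t < h n \<and> Q n x = pder i \<psi> (x + t *\<^sub>R e)" for n x
  proof -
    have "\<exists>z. 0 < z \<and> z < h n \<and> \<psi> (x + h n *\<^sub>R e) - \<psi> (x + 0 *\<^sub>R e) = (h n - 0) * pder i \<psi> (x + z *\<^sub>R e)"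
      unfolding e_def using h0[of n] by (intro MVT2[where f = "\<lambda>t. \<psi> (x + t *\<^sub>R axis i 1)"] DERIV_along_axis s) auto
    then show ?thesis using h0[of n] by (auto simp: Q_def add.commute field_simps)
  qed
  obtain B where B: "\<And>x. \<bar>\<psi> x\<bar> \<le> B" using test_fun_bounded[OF \<psi>] by metis
  have int: "integrable lborel \<psi>"
  proof (rule Bochner_Integration.integrable_bound)
    from B have "\<bar>\<psi> x\<bar> \<le> \<bar>B * indicator (cball 0 R) x\<bar>" for x
      using K(2)[of x] R[of x] by (cases "x \<in> K") (auto simp: indicator_def intro: order_trans[OF _ abs_ge_self])
    then show "AE x in lborel. norm (\<psi> x) \<le> norm (B * indicator (cball 0 R) x)" by simp
  qed (auto intro!: integrable_real_indicator emeasure_bounded_finite)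
  have "integrable lborel (\<lambda>x. \<psi> (c + x))" for c
    using int by (subst (asm) lborel_distr_plus[of c, symmetric], subst (asm) integrable_distr_eq) auto
  then have "(\<integral>x. Q n x \<partial>lborel) = ((\<integral>x. \<psi> (h n *\<^sub>R e + x) \<partial>lborel) - (\<integral>x. \<psi> x \<partial>lborel)) / h n" for n
    unfolding Q_def using int by simp
  then have Q0: "(\<integral>x. Q n x \<partial>lborel) = 0" for n
    by (simp add: integral_lborel_translate_euclidean)
  \<comment> \<open>By the mean value theorem each quotient is a value of
    \<open>pder i \<psi>\<close> at a point less than 1 away, hence bounded by \<open>M\<close> and
    supported in the ball of radius \<open>R + 1\<close>.\<close>
  have "(\<lambda>n. \<integral>x. Q n x \<partial>lborel) \<longlonglongrightarrow> (\<integral>x. pder i \<psi> x \<partial>lborel)"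
  proof (rule integral_dominated_convergence[where w = "\<lambda>x. M * indicator (cball 0 (R + 1)) x"])
    show "AE x in lborel. (\<lambda>n. Q n x) \<longlonglongrightarrow> pder i \<psi> x"
    proof (rule AE_I2)
      fix x
      have "DERIV (\<lambda>t. \<psi> (x + t *\<^sub>R e)) 0 :> pder i \<psi> x"
        using DERIV_along_axis[OF s, of x i 0] by (simp add: e_def)
      then have "((\<lambda>t. (\<psi> (x + t *\<^sub>R e) - \<psi> x) / t) \<longlongrightarrow> pder i \<psi> x) (at 0)"
        by (simp add: DERIV_def)
      moreover have "filterlim h (at 0) sequentially"
        unfolding filterlim_at using hlim h0(1) by (simp add: less_imp_neq[THEN not_sym])
      ultimately have "(\<lambda>n. (\<psi> (x + h n *\<^sub>R e) - \<psi> x) / h n) \<longlonglongrightarrow> pder i \<psi> x"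
        by (rule filterlim_compose)
      then show "(\<lambda>n. Q n x) \<longlonglongrightarrow> pder i \<psi> x" by (simp add: Q_def add.commute)
    qed
    show "AE x in lborel. norm (Q n x) \<le> M * indicator (cball 0 (R + 1)) x" for n
    proof (rule AE_I2)
      fix x
      obtain t where t: "0 < t" "t < h n" "Q n x = pder i \<psi> (x + t *\<^sub>R e)" using mvt by blast
      have "Q n x = 0" if "norm x > R + 1"
      proof -
        have "norm (x + t *\<^sub>R e) > R"
          using norm_triangle_ineq4[of "x + t *\<^sub>R e" "t *\<^sub>R e"] that t h0[of n] by (simp add: ne)
        then have "x + t *\<^sub>R e \<notin> K" using R by force
        then show ?thesis using t pder_zero_outside[OF K(1,2)] by simp
      qed
      then show "norm (Q n x) \<le> M * indicator (cball 0 (R + 1)) x"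
        using M[of "x + t *\<^sub>R e"] t M0 by (auto simp: indicator_def)
    qed
  qed (auto simp: Q_def intro!: integrable_real_indicator emeasure_bounded_finite)
  then show ?thesis unfolding Q0 by (simp add: LIMSEQ_const_iff)
qed


lemma integral_lebesgue_on_eq_lborel:
  fixes f :: "'a::euclidean_space \<Rightarrow> real"
  assumes [measurable]: "f \<in> borel_measurable borel" and \<Omega>: "\<Omega> \<in> sets lebesgue" and f: "\<And>x. x \<notin> \<Omega> \<Longrightarrow> f x = 0"
  shows "(\<integral>x. f x \<partial>lebesgue_on \<Omega>) = (\<integral>x. f x \<partial>lborel)"
proof -
  have "(\<integral>x. f x \<partial>lebesgue_on \<Omega>) = (\<integral>x. indicator \<Omega> x *\<^sub>R f x \<partial>lebesgue)"
    using \<Omega> by (intro integral_restrict_space) auto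
  also have "\<dots> = (\<integral>x. f x \<partial>lebesgue)"
    using f by (intro Bochner_Integration.integral_cong) (auto simp: indicator_def)
  also have "\<dots> = (\<integral>x. f x \<partial>lborel)" by (intro integral_completion) simp
  finally show ?thesis .
qed

lemma integral_pder_lebesgue_on:
  assumes \<psi>: "test_fun \<Omega> \<psi>" and \<Omega>: "open \<Omega>"
  shows "(\<integral>x. pder i \<psi> x \<partial>lebesgue_on \<Omega>) = 0"
proof -
  have "pder i \<psi> x = 0" if "x \<notin> \<Omega>" for x
    using test_fun_pder[OF \<psi>, of i] that by (auto simp: test_fun_def)
  then have "(\<integral>x. pder i \<psi> x \<partial>lebesgue_on \<Omega>) = (\<integral>x. pder i \<psi> x \<partial>lborel)"
    using \<Omega> by (intro integral_lebesgue_on_eq_lborel test_fun_borel[OF test_fun_pder[OF \<psi>]]) auto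
  then show ?thesis using integral_pder_test_fun[OF \<psi>] by simp
qed

section \<open>Bounded domains and the fundamental lemma of the calculus of variations\<close>

lemma finite_measure_lebesgue_on_open_bounded:
  fixes \<Omega> :: "'a::euclidean_space set"
  assumes "open \<Omega>" "bounded \<Omega>"
  shows "finite_measure (lebesgue_on \<Omega>)"
  using assms by (intro finite_measure_lebesgue_on lmeasurable_open)

lemma sqint_bounded:
  fixes f :: "'a \<Rightarrow> real"
  assumes "finite_measure M" "f \<in> borel_measurable M" "AE x in M. \<bar>f x\<bar> \<le> B"
  shows "sqint M f"
proof -
  interpret finite_measure M by fact
  show ?thesis
  proof (rule sqint_bound[where g = "\<lambda>_. B\<^sup>2"])
    show "AE x in M. (norm (f x))\<^sup>2 \<le> B\<^sup>2"
      using assms(3) by eventually_elim (simp add: abs_le_square_iff[symmetric] power_mono)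
  qed (use assms in auto)
qed

lemma sqint_imp_integrable:
  fixes f :: "'a \<Rightarrow> real"
  assumes "finite_measure M" "sqint M f"
  shows "integrable M f"
  using sqint_mult_integrable[OF assms(2) sqint_bounded[OF assms(1), of "\<lambda>x. 1" 1]] by simp

text \<open>A product of two one-sided cut-offs per coordinate. For positive \<open>m\<close> it is
  nonzero exactly at points further than \<open>1 / m\<close> from all faces, and its arguments grow
  linearly in \<open>m\<close> inside the open box; hence the compact support and the pointwise
  limit 1 there.\<close>

definition box_bump :: "real^'n::finite \<Rightarrow> real^'n \<Rightarrow> nat \<Rightarrow> real^'n \<Rightarrow> real" where
  "box_bump a b m x = (\<Prod>i\<in>UNIV. exp_cutoff 0 (real m * x $ i + (- real m * a $ i - 1)) * exp_cutoff 0 (- real m * x $ i + (real m * b $ i - 1)))"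

lemma smooth_box_bump: "smooth_fun (box_bump a b m)"
  unfolding box_bump_def[abs_def]
  by (intro smooth_fun_prod smooth_fun_mult) (simp_all only: smooth_fun_iff_smooth_cl smooth_cl.cutoff)

lemma box_bump_range: "0 \<le> box_bump a b m x" "box_bump a b m x \<le> 1"
  unfolding box_bump_def by (auto intro!: prod_nonneg prod_le_1 mult_le_one simp: exp_cutoff_0_range)

lemma box_bump_support:
  assumes "box_bump a b m x \<noteq> 0"
  shows "x \<in> cbox (a + (\<chi> i. 1 / real m)) (b - (\<chi> i. 1 / real m))" "0 < m"
proof -
  have nz: "exp_cutoff 0 (real m * x $ i + (- real m * a $ i - 1)) \<noteq> 0" "exp_cutoff 0 (- real m * x $ i + (real m * b $ i - 1)) \<noteq> 0" for i
    using assms by (auto simp: box_bump_def)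
  then have p: "0 < real m * x $ i + (- real m * a $ i - 1)" "0 < - real m * x $ i + (real m * b $ i - 1)" for i
    unfolding exp_cutoff_def by (metis (full_types))+
  show m: "0 < m" using p(1)[of undefined] by (cases m) auto
  show "x \<in> cbox (a + (\<chi> i. 1 / real m)) (b - (\<chi> i. 1 / real m))"
    using p m by (auto simp: mem_box_cart field_simps less_imp_le) 
qed

lemma box_bump_support_box:
  "0 < m \<Longrightarrow> cbox (a + (\<chi> i. 1 / real m)) (b - (\<chi> i. 1 / real m)) \<subseteq> box a b"
proof
  fix x assume m: "0 < m" and x: "x \<in> cbox (a + (\<chi> i. 1 / real m)) (b - (\<chi> i. 1 / real m))"
  have "a $ i < x $ i \<and> x $ i < b $ i" for i
  proof -
    have "a $ i + 1 / real m \<le> x $ i" "x $ i \<le> b $ i - 1 / real m" using x by (auto simp: mem_box_cart)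
    moreover have "0 < 1 / real m" using m by simp
    ultimately show ?thesis by linarith
  qed
  then show "x \<in> box a b" by (simp add: mem_box_cart)
qed

lemma box_bump_tendsto:
  assumes "x \<in> box a b"
  shows "(\<lambda>m. box_bump a b m x) \<longlonglongrightarrow> 1"
proof -
  have lin: "filterlim (\<lambda>m. - 1 + d * real m) at_top sequentially" if "0 < d" for d :: real
    by (intro filterlim_tendsto_add_at_top[OF tendsto_const] filterlim_tendsto_pos_mult_at_top[OF tendsto_const that]
        filterlim_real_sequentially)
  have "(\<lambda>m. \<Prod>i\<in>UNIV. exp_cutoff 0 (real m * x $ i + (- real m * a $ i - 1)) * exp_cutoff 0 (- real m * x $ i + (real m * b $ i - 1)))
      \<longlonglongrightarrow> (\<Prod>i\<in>(UNIV :: 'a set). 1 * 1)"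
  proof (intro tendsto_prod tendsto_mult)
    fix i
    have "(\<lambda>m. exp_cutoff 0 (- 1 + (x $ i - a $ i) * real m)) \<longlonglongrightarrow> 1"
      using assms by (intro filterlim_compose[OF exp_cutoff_0_tendsto] lin) (simp add: mem_box_cart)
    then show "(\<lambda>m. exp_cutoff 0 (real m * x $ i + (- real m * a $ i - 1))) \<longlonglongrightarrow> 1"
      by (simp add: algebra_simps)
    have "(\<lambda>m. exp_cutoff 0 (- 1 + (b $ i - x $ i) * real m)) \<longlonglongrightarrow> 1"
      using assms by (intro filterlim_compose[OF exp_cutoff_0_tendsto] lin) (simp add: mem_box_cart)
    then show "(\<lambda>m. exp_cutoff 0 (- real m * x $ i + (real m * b $ i - 1))) \<longlonglongrightarrow> 1"
      by (simp add: algebra_simps)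
  qed
  then show ?thesis by (simp add: box_bump_def)
qed

text \<open>Exhaust \<open>U\<close> by countably many boxes. The product of
  \<open>1 - box_bump\<close> over the first \<open>m\<close> boxes is a smooth substitute for the
  indicator of the complement. As \<open>m\<close> governs both the number of boxes and the
  sharpness, every support is contained in a finite union of closed boxes inside
  \<open>U\<close>.\<close>

lemma open_indicator_limit_test_fun:
  fixes U :: "(real^'n::finite) set"
  assumes "open U"
  obtains \<psi> where "\<And>m. test_fun U (\<psi> m)" "\<And>m x. 0 \<le> \<psi> m x \<and> \<psi> m x \<le> 1" "\<And>x. (\<lambda>m. \<psi> m x) \<longlonglongrightarrow> indicator U x"
proof -
  obtain D where D: "countable D" "D \<subseteq> Pow U" "\<And>X. X \<in> D \<Longrightarrow> \<exists>a b. X = box a b" "\<Union>D = U"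
    using open_countable_Union_open_box[OF assms] by metis
  \<comment> \<open>The empty box is added so that the enumeration \<open>from_nat_into\<close> is
    meaningful even for empty \<open>U\<close>.\<close>
  define D' where "D' = insert {} D"
  have box_e: "\<exists>a b::real^'n. {} = box a b" by (rule exI[of _ 0], rule exI[of _ 0]) simp
  have D': "countable D'" "D' \<noteq> {}" "\<And>X. X \<in> D' \<Longrightarrow> \<exists>a b. X = box a b" "\<Union>D' = U"
    using D box_e unfolding D'_def by auto
  have "from_nat_into D' n \<in> D'" for n using D'(2) by (rule from_nat_into)
  then have "\<exists>a b. from_nat_into D' n = box a b" for n using D'(3) by blast
  then obtain a b where ab: "\<And>n. from_nat_into D' n = box (a n) (b n)" by metis
  have U: "(\<Union>n. box (a n) (b n)) = U"
    unfolding ab[symmetric] using range_from_nat_into[OF D'(2,1)] D'(4) by simp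
  define P where "P m x = (\<Prod>n<m. 1 - box_bump (a n) (b n) m x)" for m x
  have P: "0 \<le> P m x" "P m x \<le> 1" for m x
    unfolding P_def using box_bump_range by (auto intro!: prod_nonneg prod_le_1)
  show ?thesis
  proof (rule that[of "\<lambda>m x. 1 - P m x"])
    fix m
    show "test_fun U (\<lambda>x. 1 - P m x)"
    proof (rule test_funI[where K = "\<Union>n<m. cbox (a n + (\<chi> i. 1 / real m)) (b n - (\<chi> i. 1 / real m))"])
      have "smooth_fun (\<lambda>x. 1 + (-1) * (\<Prod>n<m. 1 + (-1) * box_bump (a n) (b n) m x))"
        by (intro smooth_fun_add smooth_fun_const smooth_fun_cmult smooth_fun_prod smooth_box_bump)
      then show "smooth_fun (\<lambda>x. 1 - P m x)" by (simp add: P_def)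
      show "compact (\<Union>n<m. cbox (a n + (\<chi> i. 1 / real m)) (b n - (\<chi> i. 1 / real m)))"
        by (intro compact_UN) auto
      show "(\<Union>n<m. cbox (a n + (\<chi> i. 1 / real m)) (b n - (\<chi> i. 1 / real m))) \<subseteq> U"
        using box_bump_support_box[of m] U by (cases "m = 0") fastforce+
      fix x assume x: "x \<notin> (\<Union>n<m. cbox (a n + (\<chi> i. 1 / real m)) (b n - (\<chi> i. 1 / real m)))"
      then have "box_bump (a n) (b n) m x = 0" if "n < m" for n
        using box_bump_support(1)[of "a n" "b n" m x] that by blast
      then show "1 - P m x = 0" by (simp add: P_def)
    qed
  next
    fix m x show "0 \<le> 1 - P m x \<and> 1 - P m x \<le> 1" using P[of m x] by simp
  next
    fix x
    show "(\<lambda>m. 1 - P m x) \<longlonglongrightarrow> indicator U x"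
    proof (cases "x \<in> U")
      case True
      then obtain k where k: "x \<in> box (a k) (b k)" using U by auto
      have "(\<lambda>m. P m x) \<longlonglongrightarrow> 0"
      proof (rule tendsto_sandwich[OF _ _ tendsto_const])
        show "\<forall>\<^sub>F m in sequentially. P m x \<le> 1 - box_bump (a k) (b k) m x"
          using eventually_gt_at_top[of k]
        proof eventually_elim
          case (elim m)
          have "P m x = (1 - box_bump (a k) (b k) m x) * (\<Prod>n\<in>{..<m} - {k}. 1 - box_bump (a n) (b n) m x)"
            unfolding P_def using elim by (intro prod.remove) auto
          also have "\<dots> \<le> (1 - box_bump (a k) (b k) m x) * 1"
            using box_bump_range by (intro mult_left_mono prod_le_1) (auto simp: box_bump_range)
          finally show ?case by simp
        qed
        show "(\<lambda>m. 1 - box_bump (a k) (b k) m x) \<longlonglongrightarrow> 0"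
          using tendsto_diff[OF tendsto_const[of 1] box_bump_tendsto[OF k]] by simp
      qed (use P in auto)
      from tendsto_diff[OF tendsto_const[of 1] this] show ?thesis using True by simp
    next
      case False
      have "box_bump (a n) (b n) m x = 0" for n m
        using box_bump_support[of "a n" "b n" m x] box_bump_support_box[of m "a n" "b n"] U False by blast
      then show ?thesis using False by (simp add: P_def)
    qed
  qed
qed

text \<open>Orthogonality to test functions passes to indicators of open sets and, through countable
  intersections of open sets, to all Lebesgue measurable sets up to null sets. The sets where
  \<open>g\<close> is positive and where it is negative are then admissible.\<close>

theorem fundamental_lemma_variations:
  fixes g :: "real^'n::finite \<Rightarrow> real"
  assumes \<Omega>: "open \<Omega>" and g: "integrable (lebesgue_on \<Omega>) g"
    and orth: "\<And>\<psi>. test_fun \<Omega> \<psi> \<Longrightarrow> (\<integral>x. g x * \<psi> x \<partial>lebesgue_on \<Omega>) = 0"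
  shows "AE x in lebesgue_on \<Omega>. g x = 0"
proof -
  let ?M = "lebesgue_on \<Omega>"
  have [measurable]: "g \<in> borel_measurable ?M" using g by auto
  have sp: "space ?M = \<Omega>" by simp
  have mI: "indicator V \<in> borel_measurable ?M" if "V \<in> sets borel" for V :: "(real^'n) set"
    using that by (intro borel_imp_lebesgue_on) auto
  have op: "(\<integral>x. g x * indicator V x \<partial>?M) = 0" if "open V" "V \<subseteq> \<Omega>" for V
  proof -
    obtain \<psi> where \<psi>: "\<And>m. test_fun V (\<psi> m)" "\<And>m x. 0 \<le> \<psi> m x \<and> \<psi> m x \<le> 1" "\<And>x. (\<lambda>m. \<psi> m x) \<longlonglongrightarrow> indicator V x"
      using open_indicator_limit_test_fun[OF \<open>open V\<close>] by metis
    have t: "test_fun \<Omega> (\<psi> m)" for m using \<psi>(1)[of m] that unfolding test_fun_def by blast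
    have [measurable]: "\<psi> m \<in> borel_measurable ?M" for m using t by (rule test_fun_lebesgue_on)
    have [measurable]: "indicator V \<in> borel_measurable ?M" using that by (intro mI) auto
    have "(\<lambda>m. \<integral>x. g x * \<psi> m x \<partial>?M) \<longlonglongrightarrow> (\<integral>x. g x * indicator V x \<partial>?M)"
    proof (rule integral_dominated_convergence[where w = "\<lambda>x. \<bar>g x\<bar>"])
      show "AE x in ?M. (\<lambda>m. g x * \<psi> m x) \<longlonglongrightarrow> g x * indicator V x"
        by (intro AE_I2 tendsto_mult tendsto_const \<psi>)
      show "AE x in ?M. norm (g x * \<psi> m x) \<le> \<bar>g x\<bar>" for m
        using \<psi>(2)[of m] by (intro AE_I2) (auto simp: abs_mult intro: mult_left_le)
    qed (use g in auto)
    then show ?thesis using orth[OF t] by (simp add: LIMSEQ_const_iff)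
  qed
  have meas: "(\<integral>x. g x * indicator A x \<partial>?M) = 0" if A: "A \<in> sets lebesgue" "A \<subseteq> \<Omega>" for A
  proof -
    obtain C T where C: "gdelta C" and T: "T \<in> null_sets lebesgue" and AT: "A \<union> T = C"
      using lebesgue_set_almost_gdelta[OF A(1)] by metis
    obtain F :: "nat \<Rightarrow> (real^'n) set" where F: "C = \<Inter>(range F)" "\<And>n. open (F n)" using C by (auto elim: gdelta.cases)
    \<comment> \<open>Finite intersections within \<Omega> stay open, and their indicators decrease
      to that of the part of \<open>C\<close> inside \<Omega>.\<close>
    define V where "V n = \<Omega> \<inter> (\<Inter>i\<le>n. F i)" for n
    have V: "open (V n)" "V n \<subseteq> \<Omega>" for n unfolding V_def using F(2) \<Omega> by auto
    have [measurable]: "indicator (V n) \<in> borel_measurable ?M" for n using V by (intro mI) auto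
    have [measurable]: "indicator A \<in> borel_measurable ?M"
      using A by (intro measurable_restrict_space1 borel_measurable_indicator) auto
    have "AE x in lebesgue. x \<notin> T" using T by (rule AE_not_in)
    then have nT: "AE x in ?M. x \<notin> T" using \<Omega> by (subst AE_restrict_space_iff) auto
    have "(\<lambda>n. \<integral>x. g x * indicator (V n) x \<partial>?M) \<longlonglongrightarrow> (\<integral>x. g x * indicator A x \<partial>?M)"
    proof (rule integral_dominated_convergence[where w = "\<lambda>x. \<bar>g x\<bar>"])
      show "AE x in ?M. (\<lambda>n. g x * indicator (V n) x) \<longlonglongrightarrow> g x * indicator A x"
        using nT AE_space
      proof eventually_elim
        case (elim x)
        show ?case
        proof (cases "x \<in> A")
          case True
          then have "x \<in> V n" for n using A AT F by (auto simp: V_def)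
          then show ?thesis using True by simp
        next
          case False
          then have "x \<notin> C" using elim AT by auto
          then obtain i where i: "x \<notin> F i" using F by auto
          show ?thesis
          proof (rule tendsto_eventually)
            show "\<forall>\<^sub>F n in sequentially. g x * indicator (V n) x = g x * indicator A x"
              using eventually_ge_at_top[of i] 
            proof eventually_elim
              case (elim n)
              then have "x \<notin> V n" using i by (auto simp: V_def)
              then show ?case using False by simp
            qed
          qed
        qed
      qed
      show "AE x in ?M. norm (g x * indicator (V n) x) \<le> \<bar>g x\<bar>" for n
        by (intro AE_I2) (auto simp: indicator_def)
    qed (use g in auto)
    then show ?thesis using op[OF V] by (simp add: LIMSEQ_const_iff)
  qed
  have sgn: "AE x in ?M. \<not> (0 < c * g x)" for c :: real
  proof -
    define A where "A = {x \<in> \<Omega>. 0 < c * g x}"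
    have "A \<in> sets ?M" unfolding A_def by (subst sp[symmetric]) measurable
    then have A: "A \<in> sets lebesgue" "A \<subseteq> \<Omega>" using \<Omega> by (auto simp: sets_restrict_space_iff A_def)
    have [measurable]: "indicator A \<in> borel_measurable ?M"
      using A by (intro measurable_restrict_space1 borel_measurable_indicator) auto
    have iA: "integrable ?M (\<lambda>x. c * (g x * indicator A x))"
    proof (intro integrable_mult_right Bochner_Integration.integrable_bound[OF g])
      show "AE x in ?M. norm (g x * indicator A x) \<le> norm (g x)" by (intro AE_I2) (simp add: indicator_def)
    qed measurable
    have "(\<integral>x. c * (g x * indicator A x) \<partial>?M) = 0" using meas[OF A] by simp
    moreover have "AE x in ?M. 0 \<le> c * (g x * indicator A x)"
      by (intro AE_I2) (auto simp: indicator_def A_def)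
    ultimately have "AE x in ?M. c * (g x * indicator A x) = 0"
      using integral_nonneg_eq_0_iff_AE[OF iA] by simp
    then show ?thesis using AE_space by eventually_elim (auto simp: A_def indicator_def split: if_splits)
  qed
  show ?thesis using sgn[of 1] sgn[of "-1"] by eventually_elim auto
qed

section \<open>Weak gradients\<close>

lemma sqint_test_fun:
  assumes \<Omega>: "open \<Omega>" "bounded \<Omega>" and \<psi>: "test_fun \<Omega> \<psi>"
  shows "sqint (lebesgue_on \<Omega>) \<psi>"
proof -
  obtain M where "\<And>x. \<bar>\<psi> x\<bar> \<le> M" using test_fun_bounded[OF \<psi>] by metis
  then show ?thesis
    by (intro sqint_bounded[where B = M] finite_measure_lebesgue_on_open_bounded \<Omega> test_fun_lebesgue_on[OF \<psi>]) auto
qed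

lemma H1_grad_sqint:
  fixes g :: "real^'n::finite \<Rightarrow> real^'n"
  assumes "H1_grad \<Omega> f g"
  shows "sqint (lebesgue_on \<Omega>) f" "sqint (lebesgue_on \<Omega>) (\<lambda>x. g x $ i)"
  using assms by (auto simp: H1_grad_def L2_on_iff_sqint)

text \<open>The fundamental lemma applied to each component of the difference. It makes the choice
  in \<open>wgrad\<close> harmless, as any weak gradient agrees with the chosen one a.e.\<close>

lemma H1_grad_unique:
  fixes \<Omega> :: "(real^'n::finite) set"
  assumes \<Omega>: "open \<Omega>" "bounded \<Omega>" and g: "H1_grad \<Omega> f g" and h: "H1_grad \<Omega> f h"
  shows "AE x in lebesgue_on \<Omega>. g x = h x"
proof -
  have fin: "finite_measure (lebesgue_on \<Omega>)" by (rule finite_measure_lebesgue_on_open_bounded[OF \<Omega>])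
  have "AE x in lebesgue_on \<Omega>. g x $ i - h x $ i = 0" for i
  proof (rule fundamental_lemma_variations[OF \<Omega>(1)])
    show "integrable (lebesgue_on \<Omega>) (\<lambda>x. g x $ i - h x $ i)"
      by (intro Bochner_Integration.integrable_diff sqint_imp_integrable[OF fin] H1_grad_sqint(2)[OF g] H1_grad_sqint(2)[OF h])
    fix \<psi> :: "real^'n \<Rightarrow> real" assume \<psi>: "test_fun \<Omega> \<psi>"
    have "(\<integral>x. (g x $ i - h x $ i) * \<psi> x \<partial>lebesgue_on \<Omega>) = (\<integral>x. g x $ i * \<psi> x \<partial>lebesgue_on \<Omega>) - (\<integral>x. h x $ i * \<psi> x \<partial>lebesgue_on \<Omega>)"
      unfolding left_diff_distrib
      by (intro Bochner_Integration.integral_diff sqint_mult_integrable H1_grad_sqint(2)[OF g] H1_grad_sqint(2)[OF h] sqint_test_fun[OF \<Omega> \<psi>])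
    also have "\<dots> = 0" using g h \<psi> by (auto simp: H1_grad_def) 
    finally show "(\<integral>x. (g x $ i - h x $ i) * \<psi> x \<partial>lebesgue_on \<Omega>) = 0" .
  qed
  then have "AE x in lebesgue_on \<Omega>. \<forall>i\<in>UNIV. g x $ i - h x $ i = 0"
    by (intro AE_finite_allI) auto
  then show ?thesis by eventually_elim (simp add: vec_eq_iff)
qed

lemma H1_grad_wgrad: "f \<in> H1 \<Omega> \<Longrightarrow> H1_grad \<Omega> f (wgrad \<Omega> f)"
  unfolding H1_def wgrad_def mem_Collect_eq by (rule someI_ex[of "H1_grad \<Omega> f"])

lemma wgrad_eq_AE:
  assumes "open \<Omega>" "bounded \<Omega>" "H1_grad \<Omega> f g"
  shows "AE x in lebesgue_on \<Omega>. wgrad \<Omega> f x = g x"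
proof (rule H1_grad_unique[OF assms(1,2) _ assms(3)])
  show "H1_grad \<Omega> f (wgrad \<Omega> f)" using assms(3) by (intro H1_grad_wgrad) (auto simp: H1_def)
qed

text \<open>Integration by parts is the vanishing of the integral of a partial derivative, for the
  product \<open>f x * \<psi> x\<close>, which is again a test function.\<close>

lemma H1_grad_test_fun:
  fixes \<Omega> :: "(real^'n::finite) set"
  assumes \<Omega>: "open \<Omega>" "bounded \<Omega>" and f: "test_fun \<Omega> f"
  shows "H1_grad \<Omega> f (\<lambda>x. \<chi> i. pder i f x)"
  unfolding H1_grad_def L2_on_iff_sqint vec_lambda_beta
proof (intro conjI allI impI)
  show "sqint (lebesgue_on \<Omega>) f" by (rule sqint_test_fun[OF \<Omega> f])
  show "sqint (lebesgue_on \<Omega>) (pder i f)" for i by (rule sqint_test_fun[OF \<Omega> test_fun_pder[OF f]])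
  fix \<psi> :: "real^'n \<Rightarrow> real" and i assume \<psi>: "test_fun \<Omega> \<psi>"
  have "pder i (\<lambda>x. f x * \<psi> x) x = f x * pder i \<psi> x + pder i f x * \<psi> x" for x
    using f \<psi> by (intro pder_mult smooth_fun_differentiable) (auto simp: test_fun_def)
  moreover have "test_fun \<Omega> (\<lambda>x. f x * \<psi> x)" using f \<psi> by (intro test_fun_mult_left) (auto simp: test_fun_def)
  ultimately have "0 = (\<integral>x. f x * pder i \<psi> x + pder i f x * \<psi> x \<partial>lebesgue_on \<Omega>)"
    using integral_pder_lebesgue_on[OF _ \<Omega>(1), of "\<lambda>x. f x * \<psi> x" i] by simp
  also have "\<dots> = (\<integral>x. f x * pder i \<psi> x \<partial>lebesgue_on \<Omega>) + (\<integral>x. pder i f x * \<psi> x \<partial>lebesgue_on \<Omega>)"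
    by (intro Bochner_Integration.integral_add sqint_mult_integrable sqint_test_fun[OF \<Omega>] test_fun_pder f \<psi>)
  finally show "(\<integral>x. f x * pder i \<psi> x \<partial>lebesgue_on \<Omega>) = - (\<integral>x. pder i f x * \<psi> x \<partial>lebesgue_on \<Omega>)" by linarith
qed

lemma H1_grad_const:
  fixes \<Omega> :: "(real^'n::finite) set"
  assumes \<Omega>: "open \<Omega>" "bounded \<Omega>"
  shows "H1_grad \<Omega> (\<lambda>x. c) (\<lambda>x. 0)"
  unfolding H1_grad_def L2_on_iff_sqint
proof (intro conjI allI impI)
  show "sqint (lebesgue_on \<Omega>) (\<lambda>x. c)" "sqint (lebesgue_on \<Omega>) (\<lambda>x. (0::real^'n) $ i)" for i
    using finite_measure_lebesgue_on_open_bounded[OF \<Omega>] by (auto intro!: sqint_bounded[where B = "\<bar>c\<bar>"])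
  fix \<psi> :: "real^'n \<Rightarrow> real" and i assume \<psi>: "test_fun \<Omega> \<psi>"
  show "(\<integral>x. c * pder i \<psi> x \<partial>lebesgue_on \<Omega>) = - (\<integral>x. (0::real^'n) $ i * \<psi> x \<partial>lebesgue_on \<Omega>)"
    using integral_pder_lebesgue_on[OF \<psi> \<Omega>(1), of i] by simp
qed

section \<open>The heat semigroup is sub-Markovian\<close>

lemma inner_matrix_vector_expand:
  fixes A :: "real^'n::finite^'n"
  shows "(A *v p) \<bullet> q = (\<Sum>i\<in>UNIV. (\<Sum>j\<in>UNIV. A $ i $ j * p $ j) * q $ i)"
  by (simp add: inner_vec_def matrix_vector_mult_def)

lemma inner_matrix_vector_sym:
  fixes A :: "real^'n::finite^'n"
  assumes "transpose A = A"
  shows "(A *v p) \<bullet> q = p \<bullet> (A *v q)"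
proof -
  have "(A *v p) \<bullet> q = (transpose A *v p) \<bullet> q" by (simp only: assms)
  also have "\<dots> = p \<bullet> (A *v q)" by (simp only: transpose_matrix_vector dot_lmul_matrix)
  finally show ?thesis .
qed

text \<open>In the polarisation identity, the nonnegative term at \<open>p + q\<close> is dropped for the lower bound.\<close>
lemma elliptic_lower_bound:
  fixes A :: "real^'n::finite^'n"
  assumes sym: "transpose A = A" and ell: "\<And>\<xi>. 0 \<le> \<xi> \<bullet> (A *v \<xi>) \<and> \<xi> \<bullet> (A *v \<xi>) \<le> \<Lambda> * (norm \<xi>)\<^sup>2"
  shows "- (\<Lambda> / 4) * (norm (p - q))\<^sup>2 \<le> (A *v p) \<bullet> q"
    and "\<bar>(A *v p) \<bullet> q\<bar> \<le> \<Lambda> / 2 * ((norm p)\<^sup>2 + (norm q)\<^sup>2)"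
proof -
  have comm: "q \<bullet> (A *v p) = p \<bullet> (A *v q)"
    using inner_matrix_vector_sym[OF sym, of p q] by (simp add: inner_commute)
  have "(p + q) \<bullet> (A *v (p + q)) - (p - q) \<bullet> (A *v (p - q)) = 4 * ((A *v p) \<bullet> q)"
    using comm by (simp add: matrix_vector_right_distrib matrix_vector_mult_diff_distrib inner_add_left inner_add_right
        inner_diff_left inner_diff_right inner_commute[of "A *v p" q])
  then have eq: "(A *v p) \<bullet> q = ((p + q) \<bullet> (A *v (p + q)) - (p - q) \<bullet> (A *v (p - q))) / 4" by simp
  show "- (\<Lambda> / 4) * (norm (p - q))\<^sup>2 \<le> (A *v p) \<bullet> q"
    unfolding eq using ell[of "p + q"] ell[of "p - q"] by simp
  have "(norm (p + q))\<^sup>2 + (norm (p - q))\<^sup>2 = 2 * ((norm p)\<^sup>2 + (norm q)\<^sup>2)"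
    by (simp add: power2_norm_eq_inner inner_add_left inner_add_right inner_diff_left inner_diff_right)
  then have "\<Lambda> * (norm (p + q))\<^sup>2 + \<Lambda> * (norm (p - q))\<^sup>2 = 2 * \<Lambda> * ((norm p)\<^sup>2 + (norm q)\<^sup>2)"
    by (metis distrib_left mult.left_commute mult.assoc)
  moreover have "\<bar>(p + q) \<bullet> (A *v (p + q)) - (p - q) \<bullet> (A *v (p - q))\<bar> \<le> \<Lambda> * (norm (p + q))\<^sup>2 + \<Lambda> * (norm (p - q))\<^sup>2"
    using ell[of "p + q"] ell[of "p - q"] by linarith
  ultimately show "\<bar>(A *v p) \<bullet> q\<bar> \<le> \<Lambda> / 2 * ((norm p)\<^sup>2 + (norm q)\<^sup>2)"
    unfolding eq by simp
qed

lemma sqint_lincomb_tendsto: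
  fixes f :: "'i \<Rightarrow> 'a \<Rightarrow> real"
  assumes fn: "\<And>k m. k \<in> I \<Longrightarrow> sqint M (fn k m)" and f: "\<And>k. k \<in> I \<Longrightarrow> sqint M (f k)"
    and lim: "\<And>k. k \<in> I \<Longrightarrow> (\<lambda>m. \<integral>x. (fn k m x - f k x)\<^sup>2 \<partial>M) \<longlonglongrightarrow> 0"
  shows "(\<lambda>m. \<integral>x. ((\<Sum>k\<in>I. b k * fn k m x) - (\<Sum>k\<in>I. b k * f k x))\<^sup>2 \<partial>M) \<longlonglongrightarrow> 0"
  using assms
proof (induction I rule: infinite_finite_induct)
  case (insert j I)
  define A where "A m x = (\<Sum>k\<in>I. b k * fn k m x) - (\<Sum>k\<in>I. b k * f k x)" for m x
  define B where "B m x = b j * (fn j m x - f j x)" for m x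
  have sA: "sqint M (A m)" for m
    unfolding A_def using insert by (intro sqint_diff sqint_sum sqint_cmult) auto
  have sB: "sqint M (B m)" for m
    unfolding B_def using insert by (intro sqint_diff sqint_cmult) auto
  have le: "(\<integral>x. (B m x + A m x)\<^sup>2 \<partial>M) \<le> 2 * (\<integral>x. (B m x)\<^sup>2 \<partial>M) + 2 * (\<integral>x. (A m x)\<^sup>2 \<partial>M)" for m
  proof -
    have i: "integrable M (\<lambda>x. (B m x)\<^sup>2)" "integrable M (\<lambda>x. (A m x)\<^sup>2)" "integrable M (\<lambda>x. (B m x + A m x)\<^sup>2)"
      using sqint_integrable[OF sA[of m]] sqint_integrable[OF sB[of m]] sqint_integrable[OF sqint_add[OF sB[of m] sA[of m]]] by auto
    have "(\<integral>x. (B m x + A m x)\<^sup>2 \<partial>M) \<le> (\<integral>x. 2 * (B m x)\<^sup>2 + 2 * (A m x)\<^sup>2 \<partial>M)"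
      using i power2_norm_add_le[of "B m _" "A m _"] by (intro integral_mono) auto
    then show ?thesis using i by simp
  qed
  have "(\<lambda>m. \<integral>x. (B m x)\<^sup>2 \<partial>M) \<longlonglongrightarrow> (b j)\<^sup>2 * 0"
    unfolding B_def power_mult_distrib integral_mult_right_zero using insert by (intro tendsto_intros) auto
  moreover have "(\<lambda>m. \<integral>x. (A m x)\<^sup>2 \<partial>M) \<longlonglongrightarrow> 0" unfolding A_def using insert by auto
  ultimately have "(\<lambda>m. 2 * (\<integral>x. (B m x)\<^sup>2 \<partial>M) + 2 * (\<integral>x. (A m x)\<^sup>2 \<partial>M)) \<longlonglongrightarrow> 2 * ((b j)\<^sup>2 * 0) + 2 * 0"
    by (intro tendsto_intros)
  then have "(\<lambda>m. 2 * (\<integral>x. (B m x)\<^sup>2 \<partial>M) + 2 * (\<integral>x. (A m x)\<^sup>2 \<partial>M)) \<longlonglongrightarrow> 0" by simp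
  then have "(\<lambda>m. \<integral>x. (B m x + A m x)\<^sup>2 \<partial>M) \<longlonglongrightarrow> 0"
    by (intro tendsto_sandwich[OF _ always_eventually[OF allI[OF le]] tendsto_const]) auto
  moreover have "B m x + A m x = (\<Sum>k\<in>insert j I. b k * fn k m x) - (\<Sum>k\<in>insert j I. b k * f k x)" for m x
    using insert by (simp add: A_def B_def algebra_simps)
  ultimately show ?case by simp
qed auto

text \<open>The function \<open>y / sqrt (1 + y\<^sup>2)\<close> at \<open>y = K * r\<close>:
  smooth, odd, bounded by 1, and approaching the sign as \<open>K\<close> grows. The product form
  fits the closure rules for test functions.\<close>

definition soft_sgn :: "real \<Rightarrow> real \<Rightarrow> real" where
  "soft_sgn K r = K * r * (1 / sqrt (1 + (K * r)\<^sup>2))"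

lemma soft_sgn_bounded: "\<bar>soft_sgn K r\<bar> \<le> 1"
proof -
  have "\<bar>K * r\<bar> \<le> sqrt (1 + (K * r)\<^sup>2)" by (simp add: real_le_rsqrt)
  moreover have "0 < sqrt (1 + (K * r)\<^sup>2)" by (simp add: add_pos_nonneg)
  ultimately show ?thesis by (simp add: soft_sgn_def abs_divide divide_le_eq)
qed

definition soft_sgn_deriv :: "real \<Rightarrow> real \<Rightarrow> real" where
  "soft_sgn_deriv K r = K * (1 / sqrt (1 + (K * r)\<^sup>2)) ^ 3"

lemma DERIV_soft_sgn: "DERIV (soft_sgn K) r :> soft_sgn_deriv K r"
proof -
  define y where "y = K * r"
  define q where "q = 1 / sqrt (1 + y\<^sup>2)"
  have p: "0 < 1 + y\<^sup>2" by (simp add: add_pos_nonneg)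
  then have q2: "q * q = 1 / (1 + y\<^sup>2)" by (simp add: q_def)
  have d: "DERIV (\<lambda>r. K * r) r :> K" by (auto intro!: derivative_eq_intros)
  have "DERIV (\<lambda>r. 1 / sqrt (1 + (K * r)\<^sup>2)) r :> (- y * q * q * q) * K"
    using DERIV_chain2[OF DERIV_inv_sqrt[of "K * r"] d] by (simp add: y_def q_def)
  from DERIV_mult[OF d this] have "DERIV (soft_sgn K) r :> K * q + (- y * q * q * q) * K * y"
    unfolding soft_sgn_def[abs_def] by (simp add: y_def q_def)
  moreover have "K * q + (- y * q * q * q) * K * y = K * q * (1 - y * y * (q * q))" by (simp add: algebra_simps)
  moreover have "1 - y * y * (q * q) = q * q" unfolding q2 using p by (simp add: field_simps power2_eq_square)
  ultimately show ?thesis by (simp add: soft_sgn_deriv_def y_def q_def power3_eq_cube mult.assoc)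
qed

lemma soft_sgn_deriv_bounds:
  assumes "0 \<le> K"
  shows "0 \<le> soft_sgn_deriv K r" "soft_sgn_deriv K r \<le> K"
proof -
  have "1 \<le> sqrt (1 + (K * r)\<^sup>2)" by simp
  then have "1 / sqrt (1 + (K * r)\<^sup>2) \<le> 1" by (subst divide_le_eq_1_pos) linarith+
  then have "(1 / sqrt (1 + (K * r)\<^sup>2)) ^ 3 \<le> 1" by (intro power_le_one) auto
  then show "soft_sgn_deriv K r \<le> K" using assms by (simp add: soft_sgn_deriv_def mult_left_le)
  show "0 \<le> soft_sgn_deriv K r" using assms by (simp add: soft_sgn_deriv_def)
qed

text \<open>The constant grows with \<open>K\<close>. Approximation of the argument is therefore
  carried out at fixed \<open>K\<close>, and \<open>K\<close> tends to infinity only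
  afterwards.\<close>

lemma soft_sgn_Lipschitz:
  assumes "0 \<le> K"
  shows "\<bar>soft_sgn K r - soft_sgn K r'\<bar> \<le> K * \<bar>r - r'\<bar>"
proof -
  have "norm (soft_sgn K r - soft_sgn K r') \<le> K * norm (r - r')"
    by (rule field_differentiable_bound[where S = UNIV and f' = "soft_sgn_deriv K"])
       (use DERIV_soft_sgn soft_sgn_deriv_bounds[OF assms] in \<open>auto simp: abs_of_nonneg\<close>)
  then show ?thesis by simp
qed

lemma soft_sgn_measurable [measurable]: "soft_sgn K \<in> borel_measurable borel"
  unfolding soft_sgn_def[abs_def] by measurable

text \<open>The factor \<open>r\<close> removes the ambiguity of the sign at 0, so the limit holds
  everywhere and dominated convergence produces the L1 norm.\<close>

lemma soft_sgn_tendsto: "(\<lambda>n. r * soft_sgn (real n) r) \<longlonglongrightarrow> \<bar>r\<bar>"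
proof (cases "r = 0")
  case False
  have "(\<lambda>n. \<bar>r\<bar> * (1 / sqrt (1 + (inverse (real n * r))\<^sup>2))) \<longlonglongrightarrow> \<bar>r\<bar> * (1 / sqrt (1 + 0\<^sup>2))"
  proof (intro tendsto_intros)
    have "(\<lambda>n. inverse (real n) * inverse r) \<longlonglongrightarrow> 0 * inverse r"
      by (intro tendsto_mult tendsto_const lim_inverse_n)
    then show "(\<lambda>n. inverse (real n * r)) \<longlonglongrightarrow> 0" by simp
  qed auto
  moreover have "\<forall>\<^sub>F n in sequentially. \<bar>r\<bar> * (1 / sqrt (1 + (inverse (real n * r))\<^sup>2)) = r * soft_sgn (real n) r"
    using eventually_gt_at_top[of 0]
  proof eventually_elim
    case (elim n)
    define y where "y = real n * r"
    have y: "y \<noteq> 0" using elim False by (simp add: y_def)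
    have "sqrt (1 + y\<^sup>2) = sqrt (y\<^sup>2 * (1 + (inverse y)\<^sup>2))" using y by (simp add: field_simps power2_eq_square)
    also have "\<dots> = \<bar>y\<bar> * sqrt (1 + (inverse y)\<^sup>2)" by (simp add: real_sqrt_mult)
    finally have "r * soft_sgn (real n) r = r * (y / (\<bar>y\<bar> * sqrt (1 + (inverse y)\<^sup>2)))"
      by (simp add: soft_sgn_def y_def)
    also have "\<dots> = (r * y / \<bar>y\<bar>) * (1 / sqrt (1 + (inverse y)\<^sup>2))" by simp
    also have "r * y / \<bar>y\<bar> = \<bar>r\<bar>" using elim False by (auto simp: y_def abs_if divide_simps mult_less_0_iff)
    finally show ?case by (simp add: y_def)
  qed
  ultimately show ?thesis by (simp add: tendsto_cong)
qed simp

lemma test_fun_soft_sgn: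
  assumes "test_fun \<Omega> \<psi>"
  shows "test_fun \<Omega> (\<lambda>x. soft_sgn K (\<psi> x))"
proof -
  have s: "smooth_fun (\<lambda>x. K * \<psi> x)" using assms by (intro smooth_fun_cmult) (auto simp: test_fun_def)
  have "test_fun \<Omega> (\<lambda>x. (K * (1 / sqrt (1 + (K * \<psi> x)\<^sup>2))) * \<psi> x)"
  proof (rule test_fun_mult_left[OF smooth_fun_cmult assms])
    show "smooth_fun (\<lambda>x. 1 / sqrt (1 + (K * \<psi> x)\<^sup>2))"
      using s unfolding smooth_fun_iff_smooth_cl by (rule smooth_cl.inv_sqrt)
  qed
  then show ?thesis by (simp add: soft_sgn_def mult_ac)
qed

lemma pder_soft_sgn:
  assumes "test_fun \<Omega> \<psi>"
  shows "pder i (\<lambda>x. soft_sgn K (\<psi> x)) x = soft_sgn_deriv K (\<psi> x) * pder i \<psi> x"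
  using assms by (intro pder_DERIV_compose DERIV_soft_sgn smooth_fun_differentiable) (auto simp: test_fun_def)

lemma pder_lincomb:
  assumes "\<And>k. k \<in> I \<Longrightarrow> test_fun \<Omega> (f k)"
  shows "pder i (\<lambda>x. \<Sum>k\<in>I. b k * f k x) x = (\<Sum>k\<in>I. b k * pder i (f k) x)"
proof -
  have "((\<lambda>x. \<Sum>k\<in>I. b k * f k x) has_derivative (\<lambda>h. \<Sum>k\<in>I. b k * frechet_derivative (f k) (at x) h)) (at x)"
    using assms by (intro has_derivative_sum has_derivative_mult_right pder_works smooth_fun_differentiable) (auto simp: test_fun_def)
  from pder_eqI[OF this] show ?thesis by (simp add: pder_def)
qed


text \<open>The scalar counterpart of \<open>elliptic_lower_bound\<close>, for the zero-order
  term.\<close>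

lemma mult_ge_neg_diff_sq: "- ((p - w)\<^sup>2 / 4) \<le> w * (p::real)"
proof -
  have "(p - w)\<^sup>2 + 4 * (w * p) = (p + w)\<^sup>2" by (simp add: power2_eq_square algebra_simps)
  then show ?thesis using zero_le_power2[of "p + w"] by linarith
qed

lemma power2_norm_vec: "(norm (p :: real^'n::finite))\<^sup>2 = (\<Sum>i\<in>UNIV. (p $ i)\<^sup>2)"
  unfolding power2_norm_eq_inner inner_vec_def by (simp add: power2_eq_square)

locale elliptic_heat =
  fixes \<Omega> :: "(real^'n::finite) set"
    and a :: "real^'n \<Rightarrow> real^'n^'n" and c :: "real^'n \<Rightarrow> real" and \<Lambda> :: real
    and dir :: bool
    and lam :: "nat \<Rightarrow> real" and \<phi> :: "nat \<Rightarrow> real^'n \<Rightarrow> real"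
    and W :: "real \<Rightarrow> real^'n \<Rightarrow> real^'n \<Rightarrow> real"
  assumes dom: "open \<Omega>" "bounded \<Omega>"
    and a_meas: "\<forall>i j. (\<lambda>x. a x $ i $ j) \<in> borel_measurable (lebesgue_on \<Omega>)"
    and a_sym: "\<forall>x\<in>\<Omega>. transpose (a x) = a x"
    and a_ell: "\<Lambda> > 0" "\<forall>x\<in>\<Omega>. \<forall>\<xi>. (1 / \<Lambda>) * (norm \<xi>)\<^sup>2 \<le> \<xi> \<bullet> (a x *v \<xi>)
                                  \<and> \<xi> \<bullet> (a x *v \<xi>) \<le> \<Lambda> * (norm \<xi>)\<^sup>2"
    and c_meas: "c \<in> borel_measurable (lebesgue_on \<Omega>)"
    and c_bdd: "AE x in lebesgue_on \<Omega>. 0 \<le> c x" "\<exists>C. AE x in lebesgue_on \<Omega>. c x \<le> C"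
    and eig: "\<forall>k. is_eigenpair a c dir \<Omega> (lam k) (\<phi> k)"
    and onb: "L2_onb \<Omega> \<phi>"
    and hk: "heat_kernel \<Omega> lam \<phi> W"
    and W_sym_pos: "\<forall>\<tau>>0. \<forall>x\<in>\<Omega>. \<forall>z\<in>\<Omega>. W \<tau> x z = W \<tau> z x \<and> 0 \<le> W \<tau> x z"
begin

section \<open>Spectral calculus of the heat semigroup and the Neumann case\<close>

abbreviation "M \<equiv> lebesgue_on \<Omega>"

lemma finM: "finite_measure M"
  by (rule finite_measure_lebesgue_on_open_bounded[OF dom])

sublocale finite_measure M by (rule finM)

lemma on: "orthonormal_in M \<phi>" by (rule L2_onb_orthonormal[OF onb])

lemma sqint_\<phi>: "sqint M (\<phi> k)" by (rule orthonormal_in_sqint[OF on])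

lemma sqint_1: "sqint M (\<lambda>x. 1::real)" by (rule sqint_bounded[OF finM, where B = 1]) auto

definition co :: "(real^'n \<Rightarrow> real) \<Rightarrow> nat \<Rightarrow> real" where
  "co f k = (\<integral>x. f x * \<phi> k x \<partial>M)"

definition heat :: "real \<Rightarrow> (real^'n \<Rightarrow> real) \<Rightarrow> real^'n \<Rightarrow> real" where
  "heat \<tau> f x = (\<integral>z. W \<tau> x z * f z \<partial>M)"

lemma
  assumes "0 < \<tau>" "sqint M f"
  shows heat_AE_integrable: "AE x in M. integrable M (\<lambda>z. W \<tau> x z * f z)"
    and heat_sqint: "sqint M (heat \<tau> f)"
    and heat_expansion: "(\<lambda>N. \<integral>x. (heat \<tau> f x - (\<Sum>k<N. (exp (- \<tau> * lam k) * co f k) * \<phi> k x))\<^sup>2 \<partial>M) \<longlonglongrightarrow> 0"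
  using hk assms unfolding heat_kernel_def heat_def[abs_def] co_def L2_on_iff_sqint by auto

lemma heat_sums:
  assumes "0 < \<tau>" "sqint M f" "sqint M g"
  shows "(\<lambda>k. exp (- \<tau> * lam k) * co f k * co g k) sums (\<integral>x. heat \<tau> f x * g x \<partial>M)"
  using sums_multiplier[OF on heat_sqint[OF assms(1,2)] assms(3) heat_expansion[OF assms(1,2)]] by (simp add: co_def)

lemma Parseval_sums:
  assumes "sqint M f" "sqint M g"
  shows "(\<lambda>k. co f k * co g k) sums (\<integral>x. f x * g x \<partial>M)"
  unfolding co_def by (rule sums_multiplier[OF on assms L2_onb_expansion[OF onb assms(1)]])

text \<open>Both sides have the same series in the coefficients of \<open>f\<close> and
  \<open>g\<close>.\<close>

lemma heat_symmetric:
  assumes "0 < \<tau>" "sqint M f" "sqint M g"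
  shows "(\<integral>x. heat \<tau> f x * g x \<partial>M) = (\<integral>x. heat \<tau> g x * f x \<partial>M)"
proof -
  have "(\<lambda>k. exp (- \<tau> * lam k) * co f k * co g k) sums (\<integral>x. heat \<tau> g x * f x \<partial>M)"
    using heat_sums[OF assms(1,3,2)] by (simp add: mult_ac)
  then show ?thesis by (rule sums_unique2[OF heat_sums[OF assms]])
qed

lemma ell_pos: "x \<in> \<Omega> \<Longrightarrow> 0 \<le> \<xi> \<bullet> (a x *v \<xi>) \<and> \<xi> \<bullet> (a x *v \<xi>) \<le> \<Lambda> * (norm \<xi>)\<^sup>2"
  using a_ell by (meson order_trans divide_nonneg_pos mult_nonneg_nonneg zero_le_one zero_le_power2)

lemma form_measurable:
  fixes p q :: "real^'n \<Rightarrow> real^'n"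
  assumes "\<And>i. (\<lambda>x. p x $ i) \<in> borel_measurable M" "\<And>i. (\<lambda>x. q x $ i) \<in> borel_measurable M"
  shows "(\<lambda>x. (a x *v p x) \<bullet> q x) \<in> borel_measurable M"
  unfolding inner_matrix_vector_expand using a_meas assms by (intro borel_measurable_sum borel_measurable_times) auto

lemma vec_sq_integrable:
  fixes p :: "real^'n \<Rightarrow> real^'n"
  assumes "\<And>i. sqint M (\<lambda>x. p x $ i)"
  shows "integrable M (\<lambda>x. (norm (p x))\<^sup>2)"
  unfolding power2_norm_vec using sqint_integrable[OF assms] by (intro Bochner_Integration.integrable_sum) simp

lemma form_integrable:
  fixes p q :: "real^'n \<Rightarrow> real^'n"
  assumes p: "\<And>i. sqint M (\<lambda>x. p x $ i)" and q: "\<And>i. sqint M (\<lambda>x. q x $ i)"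
  shows "integrable M (\<lambda>x. (a x *v p x) \<bullet> q x)"
proof (rule Bochner_Integration.integrable_bound)
  show "integrable M (\<lambda>x. \<Lambda> / 2 * ((norm (p x))\<^sup>2 + (norm (q x))\<^sup>2))"
    using vec_sq_integrable[OF p] vec_sq_integrable[OF q] by (intro integrable_mult_right Bochner_Integration.integrable_add)
  show "(\<lambda>x. (a x *v p x) \<bullet> q x) \<in> borel_measurable M"
    using p q by (intro form_measurable) (auto simp: sqint_def)
  show "AE x in M. norm ((a x *v p x) \<bullet> q x) \<le> norm (\<Lambda> / 2 * ((norm (p x))\<^sup>2 + (norm (q x))\<^sup>2))"
  proof (rule AE_I2)
    fix x assume "x \<in> space M"
    then have "\<bar>(a x *v p x) \<bullet> q x\<bar> \<le> \<Lambda> / 2 * ((norm (p x))\<^sup>2 + (norm (q x))\<^sup>2)"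
      using a_sym ell_pos[of x] by (intro elliptic_lower_bound(2)) auto
    then show "norm ((a x *v p x) \<bullet> q x) \<le> norm (\<Lambda> / 2 * ((norm (p x))\<^sup>2 + (norm (q x))\<^sup>2))" by simp
  qed
qed

lemma c_bound: obtains C where "0 \<le> C" "AE x in M. 0 \<le> c x \<and> c x \<le> C"
proof -
  obtain C where "AE x in M. c x \<le> C" using c_bdd(2) by blast
  with c_bdd(1) have "AE x in M. 0 \<le> c x \<and> c x \<le> max C 0" by eventually_elim auto
  then show ?thesis by (intro that[of "max C 0"]) auto
qed

lemma sqint_c: "sqint M c"
proof -
  obtain C where C: "AE x in M. 0 \<le> c x \<and> c x \<le> C" using c_bound by metis
  then have "AE x in M. \<bar>c x\<bar> \<le> C" by eventually_elim auto
  then show ?thesis by (intro sqint_bounded[OF finM c_meas])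
qed

lemma c_mult_integrable:
  assumes f: "sqint M f" and g: "sqint M g"
  shows "integrable M (\<lambda>x. c x * f x * g x)"
proof -
  obtain C where C: "AE x in M. 0 \<le> c x \<and> c x \<le> C" using c_bound by metis
  have [measurable]: "f \<in> borel_measurable M" "g \<in> borel_measurable M" "c \<in> borel_measurable M"
    using f g c_meas by (auto simp: sqint_def)
  show ?thesis
  proof (rule Bochner_Integration.integrable_bound)
    show "integrable M (\<lambda>x. C * (f x * g x))" using sqint_mult_integrable[OF f g] by simp
    show "AE x in M. norm (c x * f x * g x) \<le> norm (C * (f x * g x))"
      using C by eventually_elim (auto simp: abs_mult mult.assoc intro!: mult_right_mono)
  qed measurable
qed

lemma \<phi>_H1: "\<phi> k \<in> H1 \<Omega>"
  using eig by (cases dir) (auto simp: is_eigenpair_def form_dom_def H1_0_def)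

lemma sqint_wgrad_\<phi>: "sqint M (\<lambda>x. wgrad \<Omega> (\<phi> k) x $ i)"
  by (rule H1_grad_sqint(2)[OF H1_grad_wgrad[OF \<phi>_H1]])

text \<open>The eigenvalue is the value of the form at its own normalised eigenfunction.\<close>

lemma lam_nonneg: "0 \<le> lam k"
proof -
  have "\<phi> k \<in> form_dom dir \<Omega>" using eig by (simp add: is_eigenpair_def)
  then have "Lform a c \<Omega> (\<phi> k) (\<phi> k) = lam k * (\<integral>x. \<phi> k x * \<phi> k x \<partial>M)"
    using eig by (auto simp: is_eigenpair_def)
  also have "\<dots> = lam k" using on by (simp add: orthonormal_in_def)
  finally have "lam k = Lform a c \<Omega> (\<phi> k) (\<phi> k)" by simp
  also have "0 \<le> \<dots>" unfolding Lform_def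
  proof (rule integral_nonneg_AE)
    show "AE x in M. 0 \<le> (a x *v wgrad \<Omega> (\<phi> k) x) \<bullet> wgrad \<Omega> (\<phi> k) x + c x * \<phi> k x * \<phi> k x"
      using c_bdd(1) AE_space
    proof eventually_elim
      case (elim x)
      then show ?case using ell_pos[of x "wgrad \<Omega> (\<phi> k) x"] by (simp add: inner_commute mult.assoc)
    qed
  qed
  finally show ?thesis .
qed

text \<open>\<open>Lform\<close> is written with chosen gradients. This lets the second one be any
  explicit weak gradient, such as 0 for a constant or the classical gradient for a test
  function.\<close>

lemma Lform_eq:
  assumes h: "H1_grad \<Omega> h q"
  shows "Lform a c \<Omega> (\<phi> k) h = (\<integral>x. (a x *v wgrad \<Omega> (\<phi> k) x) \<bullet> q x + c x * \<phi> k x * h x \<partial>M)"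
  unfolding Lform_def
proof (rule integral_cong_AE)
  have m: "(\<lambda>x. c x * \<phi> k x * h x) \<in> borel_measurable M"
    using c_mult_integrable[OF sqint_\<phi> H1_grad_sqint(1)[OF h]] by (rule borel_measurable_integrable)
  have h': "H1_grad \<Omega> h (wgrad \<Omega> h)" using h by (intro H1_grad_wgrad) (auto simp: H1_def)
  show "(\<lambda>x. (a x *v wgrad \<Omega> (\<phi> k) x) \<bullet> wgrad \<Omega> h x + c x * \<phi> k x * h x) \<in> borel_measurable M"
    by (intro borel_measurable_add m borel_measurable_integrable[OF form_integrable] sqint_wgrad_\<phi> H1_grad_sqint(2)[OF h'])
  show "(\<lambda>x. (a x *v wgrad \<Omega> (\<phi> k) x) \<bullet> q x + c x * \<phi> k x * h x) \<in> borel_measurable M"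
    by (intro borel_measurable_add m borel_measurable_integrable[OF form_integrable] sqint_wgrad_\<phi> H1_grad_sqint(2)[OF h])
  show "AE x in M. (a x *v wgrad \<Omega> (\<phi> k) x) \<bullet> wgrad \<Omega> h x + c x * \<phi> k x * h x =
      (a x *v wgrad \<Omega> (\<phi> k) x) \<bullet> q x + c x * \<phi> k x * h x"
    using wgrad_eq_AE[OF dom h] by eventually_elim simp
qed

lemma heat_nonneg:
  assumes "0 < \<tau>" "AE z in M. 0 \<le> f z" "x \<in> \<Omega>"
  shows "0 \<le> heat \<tau> f x"
  unfolding heat_def
proof (rule integral_nonneg_AE)
  show "AE z in M. 0 \<le> W \<tau> x z * f z"
    using assms(2) AE_space by eventually_elim (use W_sym_pos assms in auto)
qed

text \<open>For the Neumann condition the constant 1 is in the form domain, so that \<open>L 1 = c \<ge> 0\<close>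
  and \<open>1 - heat \<tau> 1\<close> is the time integral of \<open>heat r c \<ge> 0\<close>.\<close>
lemma heat_1_le_Neumann:
  assumes "\<not> dir" and \<tau>: "0 < \<tau>" and g: "sqint M g" and g0: "AE x in M. 0 \<le> g x"
  shows "(\<integral>x. heat \<tau> (\<lambda>_. 1) x * g x \<partial>M) \<le> (\<integral>x. g x \<partial>M)"
proof -
  define d where "d k = co (\<lambda>_. 1) k * co g k" for k
  \<comment> \<open>Testing the eigenpair with the constant 1, whose gradient is 0, leaves only the
    zero-order term.\<close>
  have co_c: "lam k * co (\<lambda>_. 1) k = co c k" for k
  proof -
    have h: "H1_grad \<Omega> (\<lambda>x. 1) (\<lambda>x. 0)" by (rule H1_grad_const[OF dom])
    then have "(\<lambda>x. 1) \<in> form_dom dir \<Omega>" using assms(1) by (auto simp: form_dom_def H1_def)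
    then have "Lform a c \<Omega> (\<phi> k) (\<lambda>x. 1) = lam k * (\<integral>x. \<phi> k x * 1 \<partial>M)"
      using eig unfolding is_eigenpair_def by blast
    then show ?thesis using Lform_eq[OF h, of k] by (simp add: co_def)
  qed
  have lim1: "d sums (\<integral>x. g x \<partial>M)" using Parseval_sums[OF sqint_1 g] by (simp add: d_def[abs_def])
  have lim2: "(\<lambda>k. exp (- \<tau> * lam k) * d k) sums (\<integral>x. heat \<tau> (\<lambda>_. 1) x * g x \<partial>M)"
    using heat_sums[OF \<tau> sqint_1 g] by (simp add: d_def mult.assoc)
  \<comment> \<open>On \<open>{0..\<tau>}\<close> this is minus the derivative in \<open>r\<close>
    of the \<open>k\<close>-th term in the pairing of \<open>heat r 1\<close> with \<open>g\<close>.
    By \<open>co_c\<close> the sum over \<open>k\<close> is the pairing of \<open>heat r c\<close>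
    with \<open>g\<close>.\<close>
  define F where "F k r = lam k * exp (- r * lam k) * d k * indicator {0..\<tau>} r" for k r
  have Fc: "lam k * exp (- r * lam k) * d k = exp (- r * lam k) * co c k * co g k" for k r
    using co_c[of k] by (simp add: d_def mult_ac)
  have DF: "DERIV (\<lambda>r. - exp (- r * lam k) * d k) x :> lam k * exp (- x * lam k) * d k" for k x
    by (auto intro!: derivative_eq_intros)
  have Fhas: "has_bochner_integral lborel (F k) (- exp (- \<tau> * lam k) * d k - (- exp (- 0 * lam k) * d k))" for k
    unfolding F_def
    by (rule has_bochner_integral_FTC_Icc_real[OF _ DF]) (use \<tau> in \<open>auto intro!: continuous_intros\<close>)
  have Fle: "norm (F k r) \<le> \<bar>co c k * co g k\<bar> * indicator {0..\<tau>} r" for k r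
    using lam_nonneg[of k] unfolding F_def Fc by (auto simp: indicator_def abs_mult mult_left_le_one_le mult.assoc)
  have sm: "summable (\<lambda>k. \<bar>co c k * co g k\<bar>)" unfolding co_def by (rule summable_coef_mult[OF on sqint_c g])
  have Fsum: "summable (\<lambda>k. norm (F k r))" for r
  proof (rule summable_comparison_test'[OF sm])
    show "norm (norm (F k r)) \<le> \<bar>co c k * co g k\<bar>" for k
      using Fle[of k r] by (cases "r \<in> {0..\<tau>}") auto
  qed
  have "(\<integral>r. (\<Sum>k. F k r) \<partial>lborel) = (\<Sum>k. \<integral>r. F k r \<partial>lborel)"
  proof (rule integral_suminf)
    show "integrable lborel (F k)" for k using Fhas by (auto simp: has_bochner_integral_iff)
    show "AE r in lborel. summable (\<lambda>k. norm (F k r))" using Fsum by simp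
    show "summable (\<lambda>k. \<integral>r. norm (F k r) \<partial>lborel)"
    proof (rule summable_comparison_test'[OF summable_mult[OF sm, of \<tau>]])
      fix k
      have "(\<integral>r. norm (F k r) \<partial>lborel) \<le> (\<integral>r. \<bar>co c k * co g k\<bar> * indicator {0..\<tau>} r \<partial>lborel)"
        using Fle[of k] Fhas[of k] by (intro integral_mono) (auto simp: has_bochner_integral_iff)
      then show "norm (\<integral>r. norm (F k r) \<partial>lborel) \<le> \<tau> * \<bar>co c k * co g k\<bar>" using \<tau> by (simp add: mult.commute)
    qed
  qed
  also have "\<dots> = (\<Sum>k. d k - exp (- \<tau> * lam k) * d k)"
    using Fhas by (intro suminf_cong) (auto simp: has_bochner_integral_iff)
  also have "\<dots> = (\<integral>x. g x \<partial>M) - (\<integral>x. heat \<tau> (\<lambda>_. 1) x * g x \<partial>M)"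
    using sums_diff[OF lim1 lim2] by (simp add: sums_iff)
  finally have eq: "(\<integral>x. g x \<partial>M) - (\<integral>x. heat \<tau> (\<lambda>_. 1) x * g x \<partial>M) = (\<integral>r. (\<Sum>k. F k r) \<partial>lborel)" by simp
  have "0 \<le> (\<integral>r. (\<Sum>k. F k r) \<partial>lborel)"
  proof (rule integral_nonneg_AE)
    \<comment> \<open>Lag 0 is discarded as a null set because \<open>heat_sums\<close> needs a
      positive time.\<close>
    show "AE r in lborel. 0 \<le> (\<Sum>k. F k r)"
      using AE_lborel_singleton[of 0]
    proof eventually_elim
      case (elim r)
      show ?case
      proof (cases "r \<in> {0..\<tau>}")
        case True
        with elim have r: "0 < r" by simp
        have "(\<Sum>k. F k r) = (\<Sum>k. exp (- r * lam k) * co c k * co g k)"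
          using True unfolding F_def Fc by simp
        also have "\<dots> = (\<integral>x. heat r c x * g x \<partial>M)" using heat_sums[OF r sqint_c g] by (simp add: sums_iff)
        also have "0 \<le> \<dots>"
        proof (rule integral_nonneg_AE)
          show "AE x in M. 0 \<le> heat r c x * g x"
            using g0 AE_space by eventually_elim (auto intro!: mult_nonneg_nonneg heat_nonneg[OF r c_bdd(1)])
        qed
        finally show ?thesis .
      qed (simp add: F_def)
    qed
  qed
  then show ?thesis using eq by simp
qed


section \<open>Contractivity in L1 for the Dirichlet condition\<close>

lemma test_fun_H1_0: "test_fun \<Omega> \<psi> \<Longrightarrow> \<psi> \<in> H1_0 \<Omega>"
proof -
  assume \<psi>: "test_fun \<Omega> \<psi>"
  then have "\<psi> \<in> H1 \<Omega>" using H1_grad_test_fun[OF dom] by (auto simp: H1_def)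
  moreover have "(\<lambda>m::nat. H1_dist \<Omega> \<psi> \<psi>) \<longlonglongrightarrow> 0" by (simp add: H1_dist_def)
  ultimately show ?thesis using \<psi> by (auto simp: H1_0_def)
qed

text \<open>Convergence in \<open>H1_dist\<close> is unpacked into L2 convergence of the functions
  and of each partial derivative, with the chosen gradient of a test function replaced by the
  classical one.\<close>

lemma Dirichlet_approx:
  assumes dir
  obtains \<psi> where "\<And>m. test_fun \<Omega> (\<psi> m)"
    "(\<lambda>m. \<integral>x. (\<psi> m x - \<phi> k x)\<^sup>2 \<partial>M) \<longlonglongrightarrow> 0"
    "\<And>i. (\<lambda>m. \<integral>x. (pder i (\<psi> m) x - wgrad \<Omega> (\<phi> k) x $ i)\<^sup>2 \<partial>M) \<longlonglongrightarrow> 0"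
proof -
  have "\<phi> k \<in> H1_0 \<Omega>" using eig assms by (auto simp: is_eigenpair_def form_dom_def)
  then obtain \<psi> where \<psi>: "\<And>m. test_fun \<Omega> (\<psi> m)" and lim: "(\<lambda>m. H1_dist \<Omega> (\<psi> m) (\<phi> k)) \<longlonglongrightarrow> 0"
    by (auto simp: H1_0_def)
  define A where "A m = (\<integral>x. (\<psi> m x - \<phi> k x)\<^sup>2 \<partial>M)" for m
  define B where "B m i = (\<integral>x. (wgrad \<Omega> (\<psi> m) x $ i - wgrad \<Omega> (\<phi> k) x $ i)\<^sup>2 \<partial>M)" for m i
  have AB0: "0 \<le> A m" "0 \<le> B m i" for m i by (auto simp: A_def B_def)
  have sq: "(H1_dist \<Omega> (\<psi> m) (\<phi> k))\<^sup>2 = A m + (\<Sum>i\<in>UNIV. B m i)" for m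
    unfolding H1_dist_def A_def[symmetric] B_def[symmetric] by (rule real_sqrt_pow2) (auto intro!: add_nonneg_nonneg sum_nonneg AB0)
  have "(\<lambda>m. (H1_dist \<Omega> (\<psi> m) (\<phi> k))\<^sup>2) \<longlonglongrightarrow> 0\<^sup>2" by (intro tendsto_intros lim)
  then have lim2: "(\<lambda>m. A m + (\<Sum>i\<in>UNIV. B m i)) \<longlonglongrightarrow> 0" by (simp add: sq)
  have "A m \<le> A m + (\<Sum>i\<in>UNIV. B m i)" for m by (simp add: sum_nonneg AB0)
  then have "A \<longlonglongrightarrow> 0"
    by (intro tendsto_sandwich[OF _ _ tendsto_const lim2]) (simp_all add: AB0)
  then have hat_product: "(\<lambda>m. \<integral>x. (\<psi> m x - \<phi> k x)\<^sup>2 \<partial>M) \<longlonglongrightarrow> 0" by (simp only: A_def[abs_def])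
  have "(\<lambda>m. \<integral>x. (pder i (\<psi> m) x - wgrad \<Omega> (\<phi> k) x $ i)\<^sup>2 \<partial>M) \<longlonglongrightarrow> 0" for i
  proof -
    have le: "B m i \<le> A m + (\<Sum>i\<in>UNIV. B m i)" for m
      by (rule add_increasing[OF AB0(1)], rule member_le_sum) (simp_all add: AB0)
    have "(\<lambda>m. B m i) \<longlonglongrightarrow> 0"
      by (rule tendsto_sandwich[OF _ _ tendsto_const lim2]) (simp_all add: AB0 le)
    moreover have "B m i = (\<integral>x. (pder i (\<psi> m) x - wgrad \<Omega> (\<phi> k) x $ i)\<^sup>2 \<partial>M)" for m
      unfolding B_def
    proof (rule integral_cong_AE)
      have g: "H1_grad \<Omega> (\<psi> m) (\<lambda>x. \<chi> i. pder i (\<psi> m) x)" by (rule H1_grad_test_fun[OF dom \<psi>])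
      have "\<psi> m \<in> H1 \<Omega>" using g by (auto simp: H1_def)
      then have "sqint M (\<lambda>x. wgrad \<Omega> (\<psi> m) x $ i)" by (intro H1_grad_sqint(2)[OF H1_grad_wgrad])
      then show "(\<lambda>x. (wgrad \<Omega> (\<psi> m) x $ i - wgrad \<Omega> (\<phi> k) x $ i)\<^sup>2) \<in> borel_measurable M"
        using sqint_wgrad_\<phi>[of k i] by (intro borel_measurable_power borel_measurable_diff) (auto simp: sqint_def)
      show "(\<lambda>x. (pder i (\<psi> m) x - wgrad \<Omega> (\<phi> k) x $ i)\<^sup>2) \<in> borel_measurable M"
        using sqint_wgrad_\<phi>[of k i] test_fun_lebesgue_on[OF test_fun_pder[OF \<psi>[of m], of i]]
        by (intro borel_measurable_power borel_measurable_diff) (auto simp: sqint_def)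
      show "AE x in M. (wgrad \<Omega> (\<psi> m) x $ i - wgrad \<Omega> (\<phi> k) x $ i)\<^sup>2 = (pder i (\<psi> m) x - wgrad \<Omega> (\<phi> k) x $ i)\<^sup>2"
        using wgrad_eq_AE[OF dom g] by eventually_elim simp
    qed
    ultimately show ?thesis by simp
  qed
  from that[OF \<psi> hat_product this] show ?thesis .
qed

text \<open>At fixed \<open>K\<close> the Lipschitz bound makes composition with
  \<open>soft_sgn K\<close> continuous in L2.\<close>

lemma soft_sgn_limit:
  assumes K: "0 \<le> K" and w: "sqint M w" and \<Psi>: "\<And>m. sqint M (\<Psi> m)" and f: "sqint M f"
    and lim: "(\<lambda>m. \<integral>x. (\<Psi> m x - w x)\<^sup>2 \<partial>M) \<longlonglongrightarrow> 0"
  shows "(\<lambda>m. \<integral>x. f x * soft_sgn K (\<Psi> m x) \<partial>M) \<longlonglongrightarrow> (\<integral>x. f x * soft_sgn K (w x) \<partial>M)"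
proof (rule sqint_tendsto_mult[OF f _ f])
  have ss: "sqint M (\<lambda>x. soft_sgn K (g x))" if "sqint M g" for g
  proof (rule sqint_bounded[OF finM, where B = 1])
    show "(\<lambda>x. soft_sgn K (g x)) \<in> borel_measurable M"
      by (rule measurable_compose[OF sqint_measurable[OF that]]) simp
  qed (simp add: soft_sgn_bounded)
  show sw: "sqint M (\<lambda>x. soft_sgn K (w x))" by (rule ss[OF w])
  show s\<Psi>: "sqint M (\<lambda>x. soft_sgn K (\<Psi> m x))" for m by (rule ss[OF \<Psi>])
  have "(\<lambda>m. K\<^sup>2 * (\<integral>x. (\<Psi> m x - w x)\<^sup>2 \<partial>M)) \<longlonglongrightarrow> K\<^sup>2 * 0" by (intro tendsto_intros lim)
  then have lim0: "(\<lambda>m. K\<^sup>2 * (\<integral>x. (\<Psi> m x - w x)\<^sup>2 \<partial>M)) \<longlonglongrightarrow> 0" by simp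
  have le: "(\<integral>x. (norm (soft_sgn K (\<Psi> m x) - soft_sgn K (w x)))\<^sup>2 \<partial>M) \<le> K\<^sup>2 * (\<integral>x. (\<Psi> m x - w x)\<^sup>2 \<partial>M)" for m
  proof -
    have "(\<integral>x. (norm (soft_sgn K (\<Psi> m x) - soft_sgn K (w x)))\<^sup>2 \<partial>M) \<le> (\<integral>x. K\<^sup>2 * (\<Psi> m x - w x)\<^sup>2 \<partial>M)"
    proof (rule integral_mono)
      show "integrable M (\<lambda>x. (norm (soft_sgn K (\<Psi> m x) - soft_sgn K (w x)))\<^sup>2)" by (rule sqint_integrable[OF sqint_diff[OF s\<Psi> sw]])
      show "integrable M (\<lambda>x. K\<^sup>2 * (\<Psi> m x - w x)\<^sup>2)" using sqint_integrable[OF sqint_diff[OF \<Psi>[of m] w]] by simp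
      show "(norm (soft_sgn K (\<Psi> m x) - soft_sgn K (w x)))\<^sup>2 \<le> K\<^sup>2 * (\<Psi> m x - w x)\<^sup>2" for x
        using power_mono[OF soft_sgn_Lipschitz[OF K, of "\<Psi> m x" "w x"], of 2] by (simp add: power_mult_distrib)
    qed
    then show ?thesis by simp
  qed
  show "(\<lambda>m. \<integral>x. (norm (soft_sgn K (\<Psi> m x) - soft_sgn K (w x)))\<^sup>2 \<partial>M) \<longlonglongrightarrow> 0"
    by (rule tendsto_sandwich[OF _ always_eventually[OF allI[OF le]] tendsto_const lim0]) simp
qed simp

text \<open>Formally \<open>\<langle>L w, F w\<rangle> = \<integral> F' w (a \<nabla>w \<bullet> \<nabla>w) + c w F w\<close>. Testing with \<open>F \<Psi>\<close> for test functions
  \<open>\<Psi>\<close> close to \<open>w\<close> avoids a chain rule for weak derivatives.\<close>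
lemma Dirichlet_accretive:
  fixes b :: "nat \<Rightarrow> real"
  assumes dir: dir and K: "0 \<le> K"
  shows "0 \<le> (\<integral>x. (\<Sum>k<N. lam k * b k * \<phi> k x) * soft_sgn K (\<Sum>k<N. b k * \<phi> k x) \<partial>M)"
proof -
  \<comment> \<open>All three properties are packed into one predicate so that a single sequence can
    be chosen for each eigenfunction.\<close>
  define Q where "Q k \<psi> \<longleftrightarrow> (\<forall>m. test_fun \<Omega> (\<psi> m)) \<and> (\<lambda>m. \<integral>x. (\<psi> m x - \<phi> k x)\<^sup>2 \<partial>M) \<longlonglongrightarrow> 0 \<and>
      (\<forall>i. (\<lambda>m. \<integral>x. (pder i (\<psi> m) x - wgrad \<Omega> (\<phi> k) x $ i)\<^sup>2 \<partial>M) \<longlonglongrightarrow> 0)" for k \<psi>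
  have "\<exists>\<psi>. Q k \<psi>" for k
    by (rule Dirichlet_approx[OF dir, of k]) (auto simp: Q_def)
  then obtain \<psi> where Q: "Q k (\<psi> k)" for k using choice[of Q] by blast
  have \<psi>: "test_fun \<Omega> (\<psi> k m)" and lim\<psi>: "(\<lambda>m. \<integral>x. (\<psi> k m x - \<phi> k x)\<^sup>2 \<partial>M) \<longlonglongrightarrow> 0"
    and limp: "(\<lambda>m. \<integral>x. (pder i (\<psi> k m) x - wgrad \<Omega> (\<phi> k) x $ i)\<^sup>2 \<partial>M) \<longlonglongrightarrow> 0" for k m i
    using Q[of k] by (auto simp: Q_def)
  define w where "w x = (\<Sum>k<N. b k * \<phi> k x)" for x
  define \<Psi> where "\<Psi> m x = (\<Sum>k<N. b k * \<psi> k m x)" for m x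
  define G where "G x = (\<chi> i. \<Sum>k<N. b k * wgrad \<Omega> (\<phi> k) x $ i)" for x
  define P where "P m x = (\<chi> i. pder i (\<Psi> m) x)" for m x
  have t\<Psi>: "test_fun \<Omega> (\<Psi> m)" for m unfolding \<Psi>_def[abs_def] by (intro test_fun_lincomb \<psi>)
  have sw: "sqint M w" unfolding w_def by (rule sqint_lincomb[OF on])
  have s\<Psi>: "sqint M (\<Psi> m)" for m by (rule sqint_test_fun[OF dom t\<Psi>])
  have sG: "sqint M (\<lambda>x. G x $ i)" for i
    unfolding G_def vec_lambda_beta by (intro sqint_sum sqint_cmult sqint_wgrad_\<phi>)
  have sP: "sqint M (\<lambda>x. P m x $ i)" for m i
    unfolding P_def vec_lambda_beta by (rule sqint_test_fun[OF dom test_fun_pder[OF t\<Psi>]])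
  have limw: "(\<lambda>m. \<integral>x. (\<Psi> m x - w x)\<^sup>2 \<partial>M) \<longlonglongrightarrow> 0"
    unfolding \<Psi>_def w_def by (intro sqint_lincomb_tendsto sqint_test_fun[OF dom] \<psi> sqint_\<phi> lim\<psi>)
  have limGi: "(\<lambda>m. \<integral>x. (P m x $ i - G x $ i)\<^sup>2 \<partial>M) \<longlonglongrightarrow> 0" for i
  proof -
    have "P m x $ i = (\<Sum>k<N. b k * pder i (\<psi> k m) x)" for m x
      unfolding P_def \<Psi>_def[abs_def] vec_lambda_beta by (rule pder_lincomb[OF \<psi>])
    then show ?thesis unfolding G_def vec_lambda_beta
      by (simp only:) (intro sqint_lincomb_tendsto sqint_test_fun[OF dom] test_fun_pder \<psi> sqint_wgrad_\<phi> limp)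
  qed
  have intGP: "integrable M (\<lambda>x. (G x $ i - P m x $ i)\<^sup>2)" for m i
    using sqint_integrable[OF sqint_diff[OF sG sP], of i m] by simp
  have limG: "(\<lambda>m. \<integral>x. (norm (G x - P m x))\<^sup>2 \<partial>M) \<longlonglongrightarrow> 0"
  proof -
    have "(\<integral>x. (norm (G x - P m x))\<^sup>2 \<partial>M) = (\<Sum>i\<in>UNIV. \<integral>x. (P m x $ i - G x $ i)\<^sup>2 \<partial>M)" for m
    proof -
      have "(\<integral>x. (norm (G x - P m x))\<^sup>2 \<partial>M) = (\<Sum>i\<in>UNIV. \<integral>x. (G x $ i - P m x $ i)\<^sup>2 \<partial>M)"
        unfolding power2_norm_vec vector_minus_component by (rule Bochner_Integration.integral_sum) (rule intGP)
      also have "\<dots> = (\<Sum>i\<in>UNIV. \<integral>x. (P m x $ i - G x $ i)\<^sup>2 \<partial>M)"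
        by (intro sum.cong Bochner_Integration.integral_cong refl) (rule power2_commute)
      finally show ?thesis .
    qed
    moreover have "(\<lambda>m. \<Sum>i\<in>(UNIV :: 'n set). \<integral>x. (P m x $ i - G x $ i)\<^sup>2 \<partial>M) \<longlonglongrightarrow> (\<Sum>i\<in>(UNIV :: 'n set). 0)"
      by (intro tendsto_sum limGi)
    ultimately show ?thesis by simp
  qed
  obtain C where C0: "0 \<le> C" and C: "AE x in M. 0 \<le> c x \<and> c x \<le> C" by (rule c_bound)
  define \<eta> where "\<eta> m x = soft_sgn K (\<Psi> m x)" for m x
  have t\<eta>: "test_fun \<Omega> (\<eta> m)" for m unfolding \<eta>_def[abs_def] by (rule test_fun_soft_sgn[OF t\<Psi>])
  have s\<eta>: "sqint M (\<eta> m)" for m by (rule sqint_test_fun[OF dom t\<eta>])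
  define q where "q m x = (\<chi> i. pder i (\<eta> m) x)" for m x
  have q_eq: "q m x = soft_sgn_deriv K (\<Psi> m x) *\<^sub>R P m x" for m x
    unfolding q_def P_def \<eta>_def[abs_def] by (simp add: vec_eq_iff pder_soft_sgn[OF t\<Psi>])
  have gq: "H1_grad \<Omega> (\<eta> m) (q m)" for m unfolding q_def[abs_def] by (rule H1_grad_test_fun[OF dom t\<eta>])
  \<comment> \<open>The eigenvalue equations for \<open>k < N\<close>, tested with
    \<open>\<eta> m\<close> and summed with weights \<open>b k\<close>. The gradient of the
    combination is \<open>G\<close>, whereas that of \<open>\<eta> m\<close> is a multiple of
    \<open>P m\<close>; the two are only close.\<close>
  have main: "(\<integral>x. (\<Sum>k<N. lam k * b k * \<phi> k x) * \<eta> m x \<partial>M) = (\<integral>x. (a x *v G x) \<bullet> q m x + c x * w x * \<eta> m x \<partial>M)" for m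
  proof -
    have i1: "integrable M (\<lambda>x. (a x *v wgrad \<Omega> (\<phi> k) x) \<bullet> q m x)" for k
      by (intro form_integrable sqint_wgrad_\<phi> H1_grad_sqint(2)[OF gq])
    have i2: "integrable M (\<lambda>x. c x * \<phi> k x * \<eta> m x)" for k by (intro c_mult_integrable sqint_\<phi> s\<eta>)
    have e: "lam k * (\<integral>x. \<eta> m x * \<phi> k x \<partial>M) = (\<integral>x. (a x *v wgrad \<Omega> (\<phi> k) x) \<bullet> q m x + c x * \<phi> k x * \<eta> m x \<partial>M)" for k
    proof -
      have "\<eta> m \<in> form_dom dir \<Omega>" using dir test_fun_H1_0[OF t\<eta>] by (simp add: form_dom_def)
      then have "Lform a c \<Omega> (\<phi> k) (\<eta> m) = lam k * (\<integral>x. \<phi> k x * \<eta> m x \<partial>M)"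
        using eig by (auto simp: is_eigenpair_def)
      then show ?thesis using Lform_eq[OF gq, of k m] by (simp add: mult.commute)
    qed
    have "(\<integral>x. (\<Sum>k<N. lam k * b k * \<phi> k x) * \<eta> m x \<partial>M) = (\<Sum>k<N. lam k * b k * (\<integral>x. \<eta> m x * \<phi> k x \<partial>M))"
      by (rule integral_lincomb_mult[OF on s\<eta>])
    also have "\<dots> = (\<Sum>k<N. b k * (\<integral>x. (a x *v wgrad \<Omega> (\<phi> k) x) \<bullet> q m x + c x * \<phi> k x * \<eta> m x \<partial>M))"
      unfolding e[symmetric] by (intro sum.cong refl) simp
    also have "\<dots> = (\<integral>x. (\<Sum>k<N. b k * ((a x *v wgrad \<Omega> (\<phi> k) x) \<bullet> q m x + c x * \<phi> k x * \<eta> m x)) \<partial>M)"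
      using i1 i2 by (subst Bochner_Integration.integral_sum) auto
    also have "\<dots> = (\<integral>x. (a x *v G x) \<bullet> q m x + c x * w x * \<eta> m x \<partial>M)"
    proof (intro Bochner_Integration.integral_cong refl)
      fix x
      have "G x = (\<Sum>k<N. b k *\<^sub>R wgrad \<Omega> (\<phi> k) x)" by (simp add: G_def vec_eq_iff)
      then have "(a x *v G x) \<bullet> q m x = (\<Sum>k<N. b k * ((a x *v wgrad \<Omega> (\<phi> k) x) \<bullet> q m x))"
        by (simp only: linear_sum[OF matrix_vector_mul_linear] matrix_vector_mult_scaleR inner_sum_left inner_scaleR_left)
      then show "(\<Sum>k<N. b k * ((a x *v wgrad \<Omega> (\<phi> k) x) \<bullet> q m x + c x * \<phi> k x * \<eta> m x)) = (a x *v G x) \<bullet> q m x + c x * w x * \<eta> m x"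
        unfolding w_def by (simp only: sum_distrib_left sum_distrib_right distrib_left sum.distrib) (simp add: mult_ac)
    qed
    finally show ?thesis .
  qed
  \<comment> \<open>The loss caused by pairing \<open>G\<close> with \<open>P m\<close> and
    \<open>w\<close> with \<open>\<Psi> m\<close> instead of each with itself. Both products are
    bounded below by a negative multiple, \<Lambda>/4 or 1/4, of the squared difference, and their
    coefficients are at most \<open>K\<close> and \<open>C * K\<close>.\<close>
  define E where "E m = K * \<Lambda> / 4 * (\<integral>x. (norm (G x - P m x))\<^sup>2 \<partial>M) + C * K / 4 * (\<integral>x. (\<Psi> m x - w x)\<^sup>2 \<partial>M)" for m
  have lower: "- E m \<le> (\<integral>x. (\<Sum>k<N. lam k * b k * \<phi> k x) * \<eta> m x \<partial>M)" for m
  proof -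
    have iN: "integrable M (\<lambda>x. (norm (G x - P m x))\<^sup>2)"
      using sqint_diff[OF sG sP] by (intro vec_sq_integrable) (simp only: vector_minus_component)
    have iw: "integrable M (\<lambda>x. (\<Psi> m x - w x)\<^sup>2)" using sqint_integrable[OF sqint_diff[OF s\<Psi> sw]] by simp
    have "- E m = (\<integral>x. - (K * \<Lambda> / 4 * (norm (G x - P m x))\<^sup>2) - C * K / 4 * (\<Psi> m x - w x)\<^sup>2 \<partial>M)"
      unfolding E_def using iN iw by simp
    also have "\<dots> \<le> (\<integral>x. (a x *v G x) \<bullet> q m x + c x * w x * \<eta> m x \<partial>M)"
    proof (rule integral_mono_AE)
      show "integrable M (\<lambda>x. - (K * \<Lambda> / 4 * (norm (G x - P m x))\<^sup>2) - C * K / 4 * (\<Psi> m x - w x)\<^sup>2)"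
        using iN iw by (intro Bochner_Integration.integrable_diff Bochner_Integration.integrable_minus integrable_mult_right)
      show "integrable M (\<lambda>x. (a x *v G x) \<bullet> q m x + c x * w x * \<eta> m x)"
        by (intro Bochner_Integration.integrable_add form_integrable c_mult_integrable sG sw s\<eta> H1_grad_sqint(2)[OF gq])
      show "AE x in M. - (K * \<Lambda> / 4 * (norm (G x - P m x))\<^sup>2) - C * K / 4 * (\<Psi> m x - w x)\<^sup>2 \<le> (a x *v G x) \<bullet> q m x + c x * w x * \<eta> m x"
        using C AE_space
      proof eventually_elim
        case (elim x)
        then have x: "x \<in> \<Omega>" by simp
        define D where "D = soft_sgn_deriv K (\<Psi> m x)"
        have D: "0 \<le> D" "D \<le> K" unfolding D_def by (rule soft_sgn_deriv_bounds[OF K])+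
        have "- (\<Lambda> / 4) * (norm (G x - P m x))\<^sup>2 \<le> (a x *v G x) \<bullet> P m x"
          using a_sym ell_pos x by (intro elliptic_lower_bound(1)) auto
        then have "D * (- (\<Lambda> / 4) * (norm (G x - P m x))\<^sup>2) \<le> D * ((a x *v G x) \<bullet> P m x)"
          using D by (intro mult_left_mono) auto
        moreover have "D * (\<Lambda> / 4 * (norm (G x - P m x))\<^sup>2) \<le> K * (\<Lambda> / 4 * (norm (G x - P m x))\<^sup>2)"
          using D a_ell(1) by (intro mult_right_mono) auto
        moreover have "(a x *v G x) \<bullet> q m x = D * ((a x *v G x) \<bullet> P m x)" by (simp add: q_eq D_def)
        ultimately have 1: "- (K * \<Lambda> / 4 * (norm (G x - P m x))\<^sup>2) \<le> (a x *v G x) \<bullet> q m x"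
          by (simp only: mult_minus_left mult_minus_right mult.assoc[symmetric] times_divide_eq_right)
        \<comment> \<open>With this factor \<open>c x * \<eta> m x\<close> equals
          \<open>r * \<Psi> m x\<close>, so the zero-order term becomes \<open>r\<close> times
          \<open>w x * \<Psi> m x\<close> with \<open>0 \<le> r \<le> C * K\<close>, and the scalar
          inequality applies.\<close>
        define r where "r = c x * (K * (1 / sqrt (1 + (K * \<Psi> m x)\<^sup>2)))"
        have "1 \<le> sqrt (1 + (K * \<Psi> m x)\<^sup>2)" by simp
        then have "1 / sqrt (1 + (K * \<Psi> m x)\<^sup>2) \<le> 1" by (subst divide_le_eq_1_pos) linarith+
        then have "r \<le> C * (K * 1)"
          unfolding r_def using elim K C0 by (intro mult_mono) auto
        then have r: "0 \<le> r" "r \<le> C * K" using elim K by (auto simp: r_def)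
        have "- ((\<Psi> m x - w x)\<^sup>2 / 4) \<le> w x * \<Psi> m x"
          by (rule mult_ge_neg_diff_sq)
        then have "r * (- ((\<Psi> m x - w x)\<^sup>2 / 4)) \<le> r * (w x * \<Psi> m x)" using r by (intro mult_left_mono) auto
        moreover have "r * ((\<Psi> m x - w x)\<^sup>2 / 4) \<le> C * K * ((\<Psi> m x - w x)\<^sup>2 / 4)" using r by (intro mult_right_mono) auto
        moreover have "c x * w x * \<eta> m x = r * (w x * \<Psi> m x)" by (simp add: \<eta>_def soft_sgn_def r_def)
        ultimately have 2: "- (C * K / 4 * (\<Psi> m x - w x)\<^sup>2) \<le> c x * w x * \<eta> m x"
          by (simp only: mult_minus_right times_divide_eq_right times_divide_eq_left)
        show ?case using 1 2 by linarith
      qed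
    qed
    also have "\<dots> = (\<integral>x. (\<Sum>k<N. lam k * b k * \<phi> k x) * \<eta> m x \<partial>M)" by (rule main[symmetric])
    finally show ?thesis .
  qed
  have "(\<lambda>m. - E m) \<longlonglongrightarrow> - (K * \<Lambda> / 4 * 0 + C * K / 4 * 0)"
    unfolding E_def by (intro tendsto_intros limG limw)
  then have E0: "(\<lambda>m. - E m) \<longlonglongrightarrow> 0" by simp
  have "(\<lambda>m. \<integral>x. (\<Sum>k<N. lam k * b k * \<phi> k x) * \<eta> m x \<partial>M) \<longlonglongrightarrow> (\<integral>x. (\<Sum>k<N. lam k * b k * \<phi> k x) * soft_sgn K (w x) \<partial>M)"
    unfolding \<eta>_def by (rule soft_sgn_limit[OF K sw s\<Psi> _ limw]) (rule sqint_lincomb[OF on])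
  then have "0 \<le> (\<integral>x. (\<Sum>k<N. lam k * b k * \<phi> k x) * soft_sgn K (w x) \<partial>M)"
    by (rule LIMSEQ_le[OF E0]) (use lower in auto)
  then show ?thesis unfolding w_def .
qed

lemma sqint_integrable1: "sqint M f \<Longrightarrow> integrable M (f :: _ \<Rightarrow> real)"
  by (rule sqint_imp_integrable[OF finM])

lemma integrable_lincomb: "integrable M (\<lambda>x. \<Sum>k<N. b k * \<phi> k x)"
  by (intro sqint_integrable1 sqint_lincomb[OF on])

text \<open>Test \<open>(1 + \<theta> L) w = g\<close> with \<open>soft_sgn K w\<close> and let \<open>K\<close> tend to infinity.\<close>
lemma resolvent_L1_contraction:
  fixes b :: "nat \<Rightarrow> real"
  assumes dir: dir and \<theta>: "0 \<le> \<theta>"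
  shows "(\<integral>x. \<bar>\<Sum>k<N. b k * \<phi> k x\<bar> \<partial>M) \<le> (\<integral>x. \<bar>\<Sum>k<N. (1 + \<theta> * lam k) * b k * \<phi> k x\<bar> \<partial>M)"
proof -
  define w where "w x = (\<Sum>k<N. b k * \<phi> k x)" for x
  define l where "l x = (\<Sum>k<N. lam k * b k * \<phi> k x)" for x
  define g where "g x = (\<Sum>k<N. (1 + \<theta> * lam k) * b k * \<phi> k x)" for x
  have g: "g x = w x + \<theta> * l x" for x
    unfolding g_def w_def l_def by (simp add: sum_distrib_left sum.distrib[symmetric] algebra_simps)
  have iw: "integrable M w" and ig: "integrable M g" and il: "integrable M l"
    unfolding w_def g_def l_def by (rule integrable_lincomb)+
  have [measurable]: "w \<in> borel_measurable M" "g \<in> borel_measurable M" "l \<in> borel_measurable M"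
    using iw ig il by auto
  have isoft: "integrable M (\<lambda>x. f x * soft_sgn K (w x))" if "integrable M f" for f K
  proof (rule Bochner_Integration.integrable_bound[OF that])
    show "AE x in M. norm (f x * soft_sgn K (w x)) \<le> norm (f x)"
      using soft_sgn_bounded by (intro AE_I2) (simp add: abs_mult mult_left_le)
    show "(\<lambda>x. f x * soft_sgn K (w x)) \<in> borel_measurable M"
      by (intro borel_measurable_times borel_measurable_integrable[OF that] measurable_compose[OF _ soft_sgn_measurable]) simp
  qed
  have le: "(\<integral>x. w x * soft_sgn (real n) (w x) \<partial>M) \<le> (\<integral>x. \<bar>g x\<bar> \<partial>M)" for n
  proof -
    have acc: "0 \<le> (\<integral>x. l x * soft_sgn (real n) (w x) \<partial>M)"
      unfolding l_def w_def by (rule Dirichlet_accretive[OF dir]) simp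
    have "(\<integral>x. g x * soft_sgn (real n) (w x) \<partial>M) = (\<integral>x. w x * soft_sgn (real n) (w x) + \<theta> * (l x * soft_sgn (real n) (w x)) \<partial>M)"
      by (intro Bochner_Integration.integral_cong refl) (simp add: g algebra_simps)
    also have "\<dots> = (\<integral>x. w x * soft_sgn (real n) (w x) \<partial>M) + \<theta> * (\<integral>x. l x * soft_sgn (real n) (w x) \<partial>M)"
      using isoft[OF iw] isoft[OF il] by simp
    finally have "(\<integral>x. w x * soft_sgn (real n) (w x) \<partial>M) \<le> (\<integral>x. g x * soft_sgn (real n) (w x) \<partial>M)"
      using mult_nonneg_nonneg[OF \<theta> acc] by linarith
    also have "\<dots> \<le> (\<integral>x. \<bar>g x\<bar> \<partial>M)"
    proof (rule integral_mono)
      fix x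
      have "g x * soft_sgn (real n) (w x) \<le> \<bar>g x * soft_sgn (real n) (w x)\<bar>" by simp
      also have "\<dots> \<le> \<bar>g x\<bar>" using soft_sgn_bounded by (simp add: abs_mult mult_left_le)
      finally show "g x * soft_sgn (real n) (w x) \<le> \<bar>g x\<bar>" .
    qed (use isoft[OF ig] ig in auto)
    finally show ?thesis .
  qed
  have "(\<lambda>n. \<integral>x. w x * soft_sgn (real n) (w x) \<partial>M) \<longlonglongrightarrow> (\<integral>x. \<bar>w x\<bar> \<partial>M)"
  proof (rule integral_dominated_convergence[where w = "\<lambda>x. \<bar>w x\<bar>"])
    show "AE x in M. (\<lambda>n. w x * soft_sgn (real n) (w x)) \<longlonglongrightarrow> \<bar>w x\<bar>" by (intro AE_I2 soft_sgn_tendsto)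
    show "AE x in M. norm (w x * soft_sgn (real n) (w x)) \<le> \<bar>w x\<bar>" for n
      using soft_sgn_bounded by (intro AE_I2) (simp add: abs_mult mult_left_le)
  qed (use iw in auto)
  then have "(\<integral>x. \<bar>w x\<bar> \<partial>M) \<le> (\<integral>x. \<bar>g x\<bar> \<partial>M)" by (rule LIMSEQ_le_const2) (intro exI allI impI le)
  then show ?thesis by (simp add: w_def g_def)
qed

lemma resolvent_power_L1_contraction:
  fixes b :: "nat \<Rightarrow> real"
  assumes dir: dir and \<theta>: "0 \<le> \<theta>"
  shows "(\<integral>x. \<bar>\<Sum>k<N. b k * \<phi> k x\<bar> \<partial>M) \<le> (\<integral>x. \<bar>\<Sum>k<N. (1 + \<theta> * lam k) ^ n * b k * \<phi> k x\<bar> \<partial>M)"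
proof (induction n)
  case (Suc n)
  note Suc
  also have "(\<integral>x. \<bar>\<Sum>k<N. (1 + \<theta> * lam k) ^ n * b k * \<phi> k x\<bar> \<partial>M)
      \<le> (\<integral>x. \<bar>\<Sum>k<N. (1 + \<theta> * lam k) * ((1 + \<theta> * lam k) ^ n * b k) * \<phi> k x\<bar> \<partial>M)"
    by (rule resolvent_L1_contraction[OF assms])
  finally show ?case by (simp add: mult.assoc)
qed simp

text \<open>The power estimate is used with \<theta> equal to \<open>\<tau> / (n + 1)\<close> and
  coefficients already damped by \<open>exp (- \<tau> * lam k)\<close>. On the right the factors
  \<open>(1 + \<tau> / (n + 1) * lam k) ^ (n + 1)\<close> undo the damping in the limit, so no
  inverse operator has to be constructed.\<close>

lemma semigroup_L1_contraction_finite: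
  fixes b :: "nat \<Rightarrow> real"
  assumes dir: dir and \<tau>: "0 \<le> \<tau>"
  shows "(\<integral>x. \<bar>\<Sum>k<N. exp (- \<tau> * lam k) * b k * \<phi> k x\<bar> \<partial>M) \<le> (\<integral>x. \<bar>\<Sum>k<N. b k * \<phi> k x\<bar> \<partial>M)"
proof -
  define \<beta> where "\<beta> n k = (1 + \<tau> / real (Suc n) * lam k) ^ Suc n * (exp (- \<tau> * lam k) * b k)" for n k
  have le: "(\<integral>x. \<bar>\<Sum>k<N. exp (- \<tau> * lam k) * b k * \<phi> k x\<bar> \<partial>M) \<le> (\<integral>x. \<bar>\<Sum>k<N. \<beta> n k * \<phi> k x\<bar> \<partial>M)" for n
    unfolding \<beta>_def using \<tau> by (intro resolvent_power_L1_contraction[OF dir]) simp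
  have lim: "(\<lambda>n. \<beta> n k) \<longlonglongrightarrow> b k" for k
  proof -
    have "(\<lambda>n. (1 + (\<tau> * lam k) / real n) ^ n) \<longlonglongrightarrow> exp (\<tau> * lam k)"
      by (rule tendsto_exp_limit_sequentially)
    then have "(\<lambda>n. (1 + (\<tau> * lam k) / real (Suc n)) ^ Suc n) \<longlonglongrightarrow> exp (\<tau> * lam k)"
      by (rule LIMSEQ_Suc)
    then have "(\<lambda>n. (1 + (\<tau> * lam k) / real (Suc n)) ^ Suc n * (exp (- \<tau> * lam k) * b k)) \<longlonglongrightarrow> exp (\<tau> * lam k) * (exp (- \<tau> * lam k) * b k)"
      by (intro tendsto_mult tendsto_const)
    moreover have "exp (\<tau> * lam k) * (exp (- \<tau> * lam k) * b k) = b k"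
      by (simp add: mult.assoc[symmetric] exp_add[symmetric])
    ultimately show ?thesis unfolding \<beta>_def by (simp only: times_divide_eq_left)
  qed
  have iphi: "integrable M (\<lambda>x. \<bar>\<phi> k x\<bar>)" for k using sqint_integrable1[OF sqint_\<phi>] by simp
  have bd: "norm ((\<integral>x. \<bar>\<Sum>k<N. \<beta> n k * \<phi> k x\<bar> \<partial>M) - (\<integral>x. \<bar>\<Sum>k<N. b k * \<phi> k x\<bar> \<partial>M)) \<le> (\<Sum>k<N. \<bar>\<beta> n k - b k\<bar> * (\<integral>x. \<bar>\<phi> k x\<bar> \<partial>M))" for n
  proof -
    have "\<bar>(\<integral>x. \<bar>\<Sum>k<N. \<beta> n k * \<phi> k x\<bar> \<partial>M) - (\<integral>x. \<bar>\<Sum>k<N. b k * \<phi> k x\<bar> \<partial>M)\<bar>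
        = \<bar>\<integral>x. \<bar>\<Sum>k<N. \<beta> n k * \<phi> k x\<bar> - \<bar>\<Sum>k<N. b k * \<phi> k x\<bar> \<partial>M\<bar>"
      using integrable_lincomb by (subst Bochner_Integration.integral_diff) auto
    also have "\<dots> \<le> (\<integral>x. \<bar>\<bar>\<Sum>k<N. \<beta> n k * \<phi> k x\<bar> - \<bar>\<Sum>k<N. b k * \<phi> k x\<bar>\<bar> \<partial>M)" by (rule integral_abs_bound)
    also have "\<dots> \<le> (\<integral>x. (\<Sum>k<N. \<bar>\<beta> n k - b k\<bar> * \<bar>\<phi> k x\<bar>) \<partial>M)"
    proof (rule integral_mono)
      show "integrable M (\<lambda>x. \<bar>\<bar>\<Sum>k<N. \<beta> n k * \<phi> k x\<bar> - \<bar>\<Sum>k<N. b k * \<phi> k x\<bar>\<bar>)"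
        by (intro integrable_abs Bochner_Integration.integrable_diff integrable_lincomb)
      show "integrable M (\<lambda>x. \<Sum>k<N. \<bar>\<beta> n k - b k\<bar> * \<bar>\<phi> k x\<bar>)"
        by (intro Bochner_Integration.integrable_sum integrable_mult_right iphi)
      fix x
      have "\<bar>\<bar>\<Sum>k<N. \<beta> n k * \<phi> k x\<bar> - \<bar>\<Sum>k<N. b k * \<phi> k x\<bar>\<bar> \<le> \<bar>(\<Sum>k<N. \<beta> n k * \<phi> k x) - (\<Sum>k<N. b k * \<phi> k x)\<bar>"
        by (rule abs_triangle_ineq3)
      also have "\<dots> = \<bar>\<Sum>k<N. (\<beta> n k - b k) * \<phi> k x\<bar>" by (simp add: sum_subtractf left_diff_distrib)
      also have "\<dots> \<le> (\<Sum>k<N. \<bar>(\<beta> n k - b k) * \<phi> k x\<bar>)" by (rule sum_abs)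
      finally show "\<bar>\<bar>\<Sum>k<N. \<beta> n k * \<phi> k x\<bar> - \<bar>\<Sum>k<N. b k * \<phi> k x\<bar>\<bar> \<le> (\<Sum>k<N. \<bar>\<beta> n k - b k\<bar> * \<bar>\<phi> k x\<bar>)"
        by (simp add: abs_mult)
    qed
    also have "\<dots> = (\<Sum>k<N. \<bar>\<beta> n k - b k\<bar> * (\<integral>x. \<bar>\<phi> k x\<bar> \<partial>M))"
      using iphi by (subst Bochner_Integration.integral_sum) auto
    finally show ?thesis by (simp only: real_norm_def)
  qed
  have "(\<lambda>n. \<Sum>k<N. \<bar>\<beta> n k - b k\<bar> * (\<integral>x. \<bar>\<phi> k x\<bar> \<partial>M)) \<longlonglongrightarrow> (\<Sum>k<N. \<bar>b k - b k\<bar> * (\<integral>x. \<bar>\<phi> k x\<bar> \<partial>M))"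
    by (intro tendsto_intros lim)
  then have "(\<lambda>n. \<Sum>k<N. \<bar>\<beta> n k - b k\<bar> * (\<integral>x. \<bar>\<phi> k x\<bar> \<partial>M)) \<longlonglongrightarrow> 0" by simp
  then have "(\<lambda>n. (\<integral>x. \<bar>\<Sum>k<N. \<beta> n k * \<phi> k x\<bar> \<partial>M) - (\<integral>x. \<bar>\<Sum>k<N. b k * \<phi> k x\<bar> \<partial>M)) \<longlonglongrightarrow> 0"
    by (rule Lim_null_comparison[OF always_eventually[OF allI[OF bd]]])
  then have "(\<lambda>n. \<integral>x. \<bar>\<Sum>k<N. \<beta> n k * \<phi> k x\<bar> \<partial>M) \<longlonglongrightarrow> (\<integral>x. \<bar>\<Sum>k<N. b k * \<phi> k x\<bar> \<partial>M)"
    by (simp add: LIM_zero_iff)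
  then show ?thesis by (rule LIMSEQ_le_const) (intro exI allI impI le)
qed

text \<open>Symmetry moves the semigroup from 1 onto \<open>g\<close>. The contraction holds for
  partial sums and passes to the limit, because on a finite measure space L2 convergence controls
  integrals and L1 norms.\<close>

lemma heat_1_le_Dirichlet:
  assumes dir: dir and \<tau>: "0 < \<tau>" and g: "sqint M g"
  shows "(\<integral>x. heat \<tau> (\<lambda>_. 1) x * g x \<partial>M) \<le> (\<integral>x. \<bar>g x\<bar> \<partial>M)"
proof -
  define G where "G N x = (\<Sum>k<N. co g k * \<phi> k x)" for N x
  define H where "H N x = (\<Sum>k<N. exp (- \<tau> * lam k) * co g k * \<phi> k x)" for N x
  have sG: "sqint M (G N)" and sH: "sqint M (H N)" for N
    unfolding G_def H_def by (rule sqint_lincomb[OF on])+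
  have "(\<lambda>N. \<integral>x. (g x - G N x)\<^sup>2 \<partial>M) \<longlonglongrightarrow> 0"
    unfolding G_def co_def by (rule L2_onb_expansion[OF onb g])
  then have Glim: "(\<lambda>N. \<integral>x. (norm (G N x - g x))\<^sup>2 \<partial>M) \<longlonglongrightarrow> 0" by (simp add: power2_commute)
  have "(\<lambda>N. \<integral>x. (heat \<tau> g x - H N x)\<^sup>2 \<partial>M) \<longlonglongrightarrow> 0"
    unfolding H_def by (rule heat_expansion[OF \<tau> g])
  then have Hlim: "(\<lambda>N. \<integral>x. (norm (H N x - heat \<tau> g x))\<^sup>2 \<partial>M) \<longlonglongrightarrow> 0" by (simp add: power2_commute)
  have lim1: "(\<lambda>N. \<integral>x. H N x * 1 \<partial>M) \<longlonglongrightarrow> (\<integral>x. heat \<tau> g x * 1 \<partial>M)"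
    by (rule sqint_tendsto_mult[OF heat_sqint[OF \<tau> g] sqint_1 sH sqint_1 Hlim]) simp
  have lim2: "(\<lambda>N. \<integral>x. norm (G N x) * 1 \<partial>M) \<longlonglongrightarrow> (\<integral>x. norm (g x) * 1 \<partial>M)"
  proof (rule sqint_tendsto_mult[OF sqint_norm[OF g] sqint_1 sqint_norm[OF sG] sqint_1])
    have le: "(\<integral>x. (norm (norm (G N x) - norm (g x)))\<^sup>2 \<partial>M) \<le> (\<integral>x. (norm (G N x - g x))\<^sup>2 \<partial>M)" for N
    proof (rule integral_mono)
      show "integrable M (\<lambda>x. (norm (norm (G N x) - norm (g x)))\<^sup>2)"
        by (rule sqint_integrable[OF sqint_diff[OF sqint_norm[OF sG] sqint_norm[OF g]]])
      show "integrable M (\<lambda>x. (norm (G N x - g x))\<^sup>2)" by (rule sqint_integrable[OF sqint_diff[OF sG g]])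
      show "(norm (norm (G N x) - norm (g x)))\<^sup>2 \<le> (norm (G N x - g x))\<^sup>2" for x
        unfolding real_norm_def by (intro power_mono abs_triangle_ineq3) simp
    qed
    show "(\<lambda>N. \<integral>x. (norm (norm (G N x) - norm (g x)))\<^sup>2 \<partial>M) \<longlonglongrightarrow> 0"
      by (rule tendsto_sandwich[OF _ always_eventually[OF allI[OF le]] tendsto_const Glim]) simp
  qed simp
  have "(\<integral>x. H N x * 1 \<partial>M) \<le> (\<integral>x. norm (G N x) * 1 \<partial>M)" for N
  proof -
    have "(\<integral>x. H N x \<partial>M) \<le> (\<integral>x. \<bar>H N x\<bar> \<partial>M)"
      using sqint_integrable1[OF sH[of N]] by (intro integral_mono) auto
    also have "\<dots> \<le> (\<integral>x. \<bar>G N x\<bar> \<partial>M)"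
      unfolding H_def G_def using \<tau> by (intro semigroup_L1_contraction_finite[OF dir]) simp
    finally show ?thesis by simp
  qed
  then have "(\<integral>x. heat \<tau> g x * 1 \<partial>M) \<le> (\<integral>x. norm (g x) * 1 \<partial>M)"
    by (intro LIMSEQ_le[OF lim1 lim2]) auto
  then show ?thesis using heat_symmetric[OF \<tau> g sqint_1] by simp
qed

text \<open>Test with the indicator of the set where the function exceeds 1: the integrand
  \<open>(h x - 1) * g x\<close> is nonnegative while its integral is at most 0.\<close>

theorem heat_1_le_1:
  assumes \<tau>: "0 < \<tau>"
  shows "AE x in M. heat \<tau> (\<lambda>_. 1) x \<le> 1"
proof -
  define h where "h = heat \<tau> (\<lambda>_. 1)"
  have sh: "sqint M h" unfolding h_def by (rule heat_sqint[OF \<tau> sqint_1])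
  have [measurable]: "h \<in> borel_measurable M" using sh by (auto simp: sqint_def)
  define g where "g x = (if 1 < h x then 1 else 0 :: real)" for x
  have [measurable]: "g \<in> borel_measurable M" unfolding g_def by measurable
  have g: "sqint M g" by (rule sqint_bounded[OF finM, where B = 1]) (auto simp: g_def)
  have "(\<integral>x. h x * g x \<partial>M) \<le> (\<integral>x. g x \<partial>M)"
  proof (cases dir)
    case True
    have "(\<integral>x. \<bar>g x\<bar> \<partial>M) = (\<integral>x. g x \<partial>M)" by (intro Bochner_Integration.integral_cong) (auto simp: g_def)
    then show ?thesis using heat_1_le_Dirichlet[OF True \<tau> g] by (simp add: h_def)
  next
    case False
    show ?thesis unfolding h_def by (rule heat_1_le_Neumann[OF False \<tau> g]) (simp add: g_def)
  qed
  moreover have ihg: "integrable M (\<lambda>x. h x * g x)" and ig: "integrable M g"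
    using sqint_mult_integrable[OF sh g] sqint_integrable1[OF g] by auto
  ultimately have "(\<integral>x. (h x - 1) * g x \<partial>M) \<le> 0" by (simp add: left_diff_distrib)
  moreover have pos: "0 \<le> (h x - 1) * g x" for x by (simp add: g_def)
  ultimately have "(\<integral>x. (h x - 1) * g x \<partial>M) = 0"
    by (intro antisym integral_nonneg_AE) auto
  moreover have "integrable M (\<lambda>x. (h x - 1) * g x)" using ihg ig by (simp add: left_diff_distrib)
  ultimately have "AE x in M. (h x - 1) * g x = 0"
    using integral_nonneg_eq_0_iff_AE[of M "\<lambda>x. (h x - 1) * g x"] pos by simp
  then show ?thesis unfolding h_def[symmetric] by eventually_elim (auto simp: g_def split: if_splits)
qed

end

section \<open>The bilinear form in space-time\<close>

lemma nn_integral_pair_translate: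
  fixes f :: "real \<times> 'b \<Rightarrow> ennreal"
  assumes N: "sigma_finite_measure N" and [measurable]: "f \<in> borel_measurable (lborel \<Otimes>\<^sub>M N)"
  shows "(\<integral>\<^sup>+z. f (fst z - \<tau>, snd z) \<partial>(lborel \<Otimes>\<^sub>M N)) = (\<integral>\<^sup>+z. f z \<partial>(lborel \<Otimes>\<^sub>M N))"
proof -
  interpret N: sigma_finite_measure N by fact
  interpret P: pair_sigma_finite lborel N ..
  have [measurable]: "(\<lambda>z. f (fst z - \<tau>, snd z)) \<in> borel_measurable (lborel \<Otimes>\<^sub>M N)"
    by (rule measurable_compose[of _ _ "lborel \<Otimes>\<^sub>M N"]) measurable
  have "(\<integral>\<^sup>+z. f (fst z - \<tau>, snd z) \<partial>(lborel \<Otimes>\<^sub>M N)) = (\<integral>\<^sup>+y. \<integral>\<^sup>+t. f (t - \<tau>, y) \<partial>lborel \<partial>N)"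
    by (subst P.nn_integral_snd[symmetric]) auto
  also have "\<dots> = (\<integral>\<^sup>+y. \<integral>\<^sup>+t. f (t, y) \<partial>lborel \<partial>N)"
  proof (rule nn_integral_cong)
    fix y assume "y \<in> space N"
    then have "(\<lambda>t. f (t, y)) \<in> borel_measurable borel"
      using measurable_compose[OF measurable_Pair2'[of y N lborel] assms(2)] by simp
    from nn_integral_real_affine[OF this, of 1 "- \<tau>"]
    show "(\<integral>\<^sup>+t. f (t - \<tau>, y) \<partial>lborel) = (\<integral>\<^sup>+t. f (t, y) \<partial>lborel)" by simp
  qed
  also have "\<dots> = (\<integral>\<^sup>+z. f z \<partial>(lborel \<Otimes>\<^sub>M N))"
    by (subst P.nn_integral_snd[symmetric]) auto
  finally show ?thesis .
qed

text \<open>Invariance is recorded as an equality of measures, so that integrability and the values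
  of Bochner integrals both transfer.\<close>

lemma distr_eq_selfI:
  assumes g: "g \<in> measurable M M"
    and nn: "\<And>f. f \<in> borel_measurable M \<Longrightarrow> (\<integral>\<^sup>+x. f (g x) \<partial>M) = (\<integral>\<^sup>+x. f x \<partial>M)"
  shows "distr M M g = M"
proof (rule measure_eqI)
  fix A assume "A \<in> sets (distr M M g)"
  then have A: "A \<in> sets M" by simp
  have "emeasure (distr M M g) A = (\<integral>\<^sup>+x. indicator A x \<partial>distr M M g)" using A by simp
  also have "\<dots> = (\<integral>\<^sup>+x. indicator A (g x) \<partial>M)" using A by (intro nn_integral_distr g) simp
  also have "\<dots> = (\<integral>\<^sup>+x. indicator A x \<partial>M)" using A by (intro nn) simp
  finally show "emeasure (distr M M g) A = emeasure M A" using A by simp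
qed simp

lemma distr_translate:
  fixes \<tau> :: real
  assumes "sigma_finite_measure N'"
  shows "distr (lborel \<Otimes>\<^sub>M N') (lborel \<Otimes>\<^sub>M N') (\<lambda>z. (fst z - \<tau>, snd z)) = lborel \<Otimes>\<^sub>M N'"
proof (rule distr_eq_selfI)
  show "(\<lambda>z. (fst z - \<tau>, snd z)) \<in> measurable (lborel \<Otimes>\<^sub>M N') (lborel \<Otimes>\<^sub>M N')" by measurable
qed (rule nn_integral_pair_translate[OF assms])

lemma (in pair_sigma_finite) AE_snd:
  assumes "AE y in M2. Q y"
  shows "AE z in M1 \<Otimes>\<^sub>M M2. Q (snd z)"
proof -
  obtain A where A: "{y \<in> space M2. \<not> Q y} \<subseteq> A" "emeasure M2 A = 0" "A \<in> sets M2"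
    using assms by (rule AE_E)
  have "emeasure (M1 \<Otimes>\<^sub>M M2) (space M1 \<times> A) = 0"
    using A by (simp add: M2.emeasure_pair_measure_Times)
  moreover have "{z \<in> space (M1 \<Otimes>\<^sub>M M2). \<not> Q (snd z)} \<subseteq> space M1 \<times> A"
    using A(1) by (auto simp: space_pair_measure)
  ultimately show ?thesis using A(3) by (intro AE_I) auto
qed

section \<open>Kernel integrals over time and pairs of points\<close>

context elliptic_heat
begin

abbreviation "N \<equiv> lborel \<Otimes>\<^sub>M M :: (real \<times> (real^'n)) measure"
abbreviation "MM \<equiv> M \<Otimes>\<^sub>M M"
abbreviation "T \<equiv> lborel \<Otimes>\<^sub>M MM :: (real \<times> (real^'n) \<times> (real^'n)) measure"

sublocale MM: pair_sigma_finite M M ..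
sublocale N: pair_sigma_finite lborel M ..

lemma sigma_finite_MM: "sigma_finite_measure MM"
  by (rule sigma_finite_pair_measure) unfold_locales

sublocale T: pair_sigma_finite lborel MM
  using sigma_finite_MM by (intro pair_sigma_finite.intro) unfold_locales

definition h :: "real \<Rightarrow> real^'n \<Rightarrow> real" where "h \<tau> x = heat1 \<Omega> W \<tau> x"

lemma h_eq_heat: "h \<tau> = heat \<tau> (\<lambda>_. 1)"
  by (simp add: h_def heat1_def heat_def fun_eq_iff)

lemma W_measurable:
  assumes "0 < \<tau>"
  shows "(\<lambda>z. W \<tau> (fst z) (snd z)) \<in> borel_measurable MM"
  using hk assms by (simp add: heat_kernel_def case_prod_beta')

lemma W_nonneg: "0 < \<tau> \<Longrightarrow> x \<in> \<Omega> \<Longrightarrow> z \<in> \<Omega> \<Longrightarrow> 0 \<le> W \<tau> x z"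
  using W_sym_pos by auto

lemma W_sym: "0 < \<tau> \<Longrightarrow> x \<in> \<Omega> \<Longrightarrow> z \<in> \<Omega> \<Longrightarrow> W \<tau> x z = W \<tau> z x"
  using W_sym_pos by auto

lemma h_measurable: "0 < \<tau> \<Longrightarrow> h \<tau> \<in> borel_measurable M"
  unfolding h_eq_heat by (rule sqint_measurable[OF heat_sqint[OF _ sqint_1]])

lemma h_bounds:
  assumes \<tau>: "0 < \<tau>"
  shows "AE x in M. 0 \<le> h \<tau> x \<and> h \<tau> x \<le> 1"
  using heat_1_le_1[OF \<tau>] AE_space
proof eventually_elim
  case (elim x)
  then show ?case unfolding h_eq_heat using heat_nonneg[OF \<tau>, of "\<lambda>_. 1" x] by auto
qed

lemma h_bounds_N: "0 < \<tau> \<Longrightarrow> AE z in N. 0 \<le> h \<tau> (snd z) \<and> h \<tau> (snd z) \<le> 1"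
  by (rule N.AE_snd[OF h_bounds])

text \<open>Almost every \<open>x\<close> only, because \<open>heat_kernel\<close> provides
  integrability of \<open>W \<tau> x\<close> in that sense.\<close>

lemma nn_integral_W:
  assumes \<tau>: "0 < \<tau>"
  shows "AE x in M. (\<integral>\<^sup>+z. ennreal (W \<tau> x z) \<partial>M) = ennreal (h \<tau> x)"
  using heat_AE_integrable[OF \<tau> sqint_1] AE_space
proof eventually_elim
  case (elim x)
  then have x: "x \<in> \<Omega>" by simp
  have "integrable M (\<lambda>z. W \<tau> x z)" using elim(1) by simp
  then have "(\<integral>\<^sup>+z. ennreal (W \<tau> x z) \<partial>M) = ennreal (\<integral>z. W \<tau> x z \<partial>M)"
    by (rule nn_integral_eq_integral) (auto intro!: AE_I2 W_nonneg[OF \<tau> x])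
  then show ?case by (simp add: h_def heat1_def)
qed

text \<open>Integrating out the second point replaces the kernel by the weight
  \<open>h \<tau>\<close>. In terms of nonnegative integrals this yields integrability without
  presupposing it.\<close>

lemma nn_integral_T_x:
  assumes \<tau>: "0 < \<tau>" and [measurable]: "f \<in> borel_measurable N"
  shows "(\<integral>\<^sup>+y. ennreal (W \<tau> (fst (snd y)) (snd (snd y))) * f (fst y, fst (snd y)) \<partial>T)
    = (\<integral>\<^sup>+z. ennreal (h \<tau> (snd z)) * f z \<partial>N)"
proof -
  have [measurable]: "(\<lambda>z. W \<tau> (fst z) (snd z)) \<in> borel_measurable MM" by (rule W_measurable[OF \<tau>])
  have [measurable]: "h \<tau> \<in> borel_measurable M" by (rule h_measurable[OF \<tau>])
  have "(\<integral>\<^sup>+y. ennreal (W \<tau> (fst (snd y)) (snd (snd y))) * f (fst y, fst (snd y)) \<partial>T)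
      = (\<integral>\<^sup>+t. \<integral>\<^sup>+p. ennreal (W \<tau> (fst p) (snd p)) * f (t, fst p) \<partial>MM \<partial>lborel)"
    by (subst sigma_finite_measure.nn_integral_fst[OF sigma_finite_MM, symmetric]) auto
  also have "\<dots> = (\<integral>\<^sup>+t. \<integral>\<^sup>+x. \<integral>\<^sup>+z. ennreal (W \<tau> x z) * f (t, x) \<partial>M \<partial>M \<partial>lborel)"
    by (intro nn_integral_cong) (subst nn_integral_fst[symmetric], auto)
  also have "\<dots> = (\<integral>\<^sup>+t. \<integral>\<^sup>+x. ennreal (h \<tau> x) * f (t, x) \<partial>M \<partial>lborel)"
  proof (rule nn_integral_cong, rule nn_integral_cong_AE)
    fix t :: real
    show "AE x in M. (\<integral>\<^sup>+z. ennreal (W \<tau> x z) * f (t, x) \<partial>M) = ennreal (h \<tau> x) * f (t, x)"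
      using nn_integral_W[OF \<tau>] AE_space
    proof eventually_elim
      case (elim x)
      have "(\<lambda>z. W \<tau> x z) \<in> borel_measurable M"
        using measurable_compose[OF measurable_Pair1'[OF elim(2)] W_measurable[OF \<tau>]] by simp
      then show ?case using elim by (simp add: nn_integral_multc)
    qed
  qed
  also have "\<dots> = (\<integral>\<^sup>+z. ennreal (h \<tau> (snd z)) * f z \<partial>N)"
    by (subst nn_integral_fst[symmetric]) auto
  finally show ?thesis .
qed

lemma nn_integral_T_swap:
  assumes [measurable]: "f \<in> borel_measurable T"
  shows "(\<integral>\<^sup>+y. f (fst y, snd (snd y), fst (snd y)) \<partial>T) = (\<integral>\<^sup>+y. f y \<partial>T)"
proof -
  have "(\<integral>\<^sup>+y. f (fst y, snd (snd y), fst (snd y)) \<partial>T) = (\<integral>\<^sup>+t. \<integral>\<^sup>+p. f (t, snd p, fst p) \<partial>MM \<partial>lborel)"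
    by (subst sigma_finite_measure.nn_integral_fst[OF sigma_finite_MM, symmetric]) auto
  also have "\<dots> = (\<integral>\<^sup>+t. \<integral>\<^sup>+p. f (t, p) \<partial>MM \<partial>lborel)"
  proof (rule nn_integral_cong)
    fix t :: real
    have "(\<lambda>p. f (t, p)) \<in> borel_measurable MM" by measurable
    then have "(\<integral>\<^sup>+p. f (t, p) \<partial>distr MM MM (\<lambda>(x, y). (y, x))) = (\<integral>\<^sup>+p. f (t, (\<lambda>(x, y). (y, x)) p) \<partial>MM)"
      by (intro nn_integral_distr) auto
    then show "(\<integral>\<^sup>+p. f (t, snd p, fst p) \<partial>MM) = (\<integral>\<^sup>+p. f (t, p) \<partial>MM)"
      unfolding MM.distr_pair_swap[symmetric] by (simp add: case_prod_beta')
  qed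
  also have "\<dots> = (\<integral>\<^sup>+y. f y \<partial>T)"
    by (subst sigma_finite_measure.nn_integral_fst[OF sigma_finite_MM, symmetric]) auto
  finally show ?thesis .
qed

lemma distr_T_swap: "distr T T (\<lambda>y. (fst y, snd (snd y), fst (snd y))) = T"
proof (rule distr_eq_selfI)
  show "(\<lambda>y. (fst y, snd (snd y), fst (snd y))) \<in> measurable T T" by measurable
qed (rule nn_integral_T_swap)

lemma integral_T_swap:
  fixes f :: "_ \<Rightarrow> real"
  assumes "f \<in> borel_measurable T"
  shows "(\<integral>y. f (fst y, snd (snd y), fst (snd y)) \<partial>T) = (\<integral>y. f y \<partial>T)"
proof -
  have "(\<integral>y. f y \<partial>distr T T (\<lambda>y. (fst y, snd (snd y), fst (snd y)))) = (\<integral>y. f (fst y, snd (snd y), fst (snd y)) \<partial>T)"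
    by (rule integral_distr[OF _ assms]) measurable
  then show ?thesis unfolding distr_T_swap by simp
qed

lemma sqint_N_translate:
  fixes u :: "real \<Rightarrow> real^'n \<Rightarrow> real"
  assumes u: "sqint N (\<lambda>z. u (fst z) (snd z))"
  shows "sqint N (\<lambda>z. u (fst z - \<tau>) (snd z))"
    "(\<integral>z. (u (fst z - \<tau>) (snd z))\<^sup>2 \<partial>N) = (\<integral>z. (u (fst z) (snd z))\<^sup>2 \<partial>N)"
proof -
  have M: "sigma_finite_measure M" by unfold_locales
  have g: "(\<lambda>z. (fst z - \<tau>, snd z)) \<in> measurable N N" by measurable
  have m: "(\<lambda>z. u (fst z) (snd z)) \<in> borel_measurable N" using u by (simp add: sqint_def)
  have m2: "(\<lambda>z. (u (fst z) (snd z))\<^sup>2) \<in> borel_measurable N" using m by simp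
  have "integrable N (\<lambda>z. (u (fst z) (snd z))\<^sup>2)" using u by (simp add: sqint_def)
  then have "integrable (distr N N (\<lambda>z. (fst z - \<tau>, snd z))) (\<lambda>z. (u (fst z) (snd z))\<^sup>2)"
    by (simp only: distr_translate[OF M])
  then have "integrable N (\<lambda>z. (u (fst z - \<tau>) (snd z))\<^sup>2)"
    by (subst (asm) integrable_distr_eq[OF g m2]) simp
  then show "sqint N (\<lambda>z. u (fst z - \<tau>) (snd z))"
    using measurable_compose[OF g m] by (simp add: sqint_def)
  have "(\<integral>z. (u (fst z) (snd z))\<^sup>2 \<partial>distr N N (\<lambda>z. (fst z - \<tau>, snd z))) = (\<integral>z. (u (fst z - \<tau>) (snd z))\<^sup>2 \<partial>N)"
    by (subst integral_distr[OF g m2]) simp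
  then show "(\<integral>z. (u (fst z - \<tau>) (snd z))\<^sup>2 \<partial>N) = (\<integral>z. (u (fst z) (snd z))\<^sup>2 \<partial>N)"
    unfolding distr_translate[OF M] by simp
qed

abbreviation px :: "real \<times> (real^'n) \<times> (real^'n) \<Rightarrow> real \<times> (real^'n)" where "px y \<equiv> (fst y, fst (snd y))"
abbreviation pz :: "real \<times> (real^'n) \<times> (real^'n) \<Rightarrow> real \<times> (real^'n)" where "pz y \<equiv> (fst y, snd (snd y))"
abbreviation "WT \<tau> y \<equiv> W \<tau> (fst (snd y)) (snd (snd y))"

lemma WT_measurable: "0 < \<tau> \<Longrightarrow> (\<lambda>y. WT \<tau> y) \<in> borel_measurable T"
  using measurable_compose[OF measurable_snd W_measurable[of \<tau>]] by simp

lemma WT_nonneg: "0 < \<tau> \<Longrightarrow> y \<in> space T \<Longrightarrow> 0 \<le> WT \<tau> y"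
  by (auto simp: space_pair_measure intro: W_nonneg)

text \<open>Once the free point is integrated out the weight is \<open>h \<tau>\<close>, at most 1
  a.e., so the square of an L2 function stays integrable against the kernel. The second claim is the
  first under exchange of the two points and symmetry of \<open>W\<close>.\<close>

lemma WT_sq_integrable:
  assumes \<tau>: "0 < \<tau>" and p: "sqint N p"
  shows "integrable T (\<lambda>y. WT \<tau> y * (p (px y))\<^sup>2)" "integrable T (\<lambda>y. WT \<tau> y * (p (pz y))\<^sup>2)"
proof -
  note [measurable] = WT_measurable[OF \<tau>] h_measurable[OF \<tau>]
  have [measurable]: "p \<in> borel_measurable N" using p by (simp add: sqint_def)
  have [measurable]: "(\<lambda>y. p (px y)) \<in> borel_measurable T" by measurable
  show i: "integrable T (\<lambda>y. WT \<tau> y * (p (px y))\<^sup>2)"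
  proof (rule integrableI_bounded)
    have "(\<integral>\<^sup>+y. ennreal (norm (WT \<tau> y * (p (px y))\<^sup>2)) \<partial>T) = (\<integral>\<^sup>+y. ennreal (WT \<tau> y) * ennreal ((p (px y))\<^sup>2) \<partial>T)"
      using WT_nonneg[OF \<tau>] by (intro nn_integral_cong) (auto simp: abs_mult ennreal_mult)
    also have "\<dots> = (\<integral>\<^sup>+z. ennreal (h \<tau> (snd z)) * ennreal ((p z)\<^sup>2) \<partial>N)"
      by (rule nn_integral_T_x[OF \<tau>]) simp
    also have "\<dots> \<le> (\<integral>\<^sup>+z. ennreal ((p z)\<^sup>2) \<partial>N)"
    proof (rule nn_integral_mono_AE)
      show "AE z in N. ennreal (h \<tau> (snd z)) * ennreal ((p z)\<^sup>2) \<le> ennreal ((p z)\<^sup>2)"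
        using h_bounds_N[OF \<tau>] by eventually_elim (auto simp: ennreal_mult[symmetric] intro!: ennreal_leI mult_left_le_one_le)
    qed
    also have "\<dots> < \<infinity>" using sqint_integrable[OF p] by (simp add: integrable_iff_bounded)
    finally show "(\<integral>\<^sup>+y. ennreal (norm (WT \<tau> y * (p (px y))\<^sup>2)) \<partial>T) < \<infinity>" .
  qed measurable
  have sw: "(\<lambda>y. (fst y, snd (snd y), fst (snd y))) \<in> measurable T T" by measurable
  have "integrable (distr T T (\<lambda>y. (fst y, snd (snd y), fst (snd y)))) (\<lambda>y. WT \<tau> y * (p (px y))\<^sup>2)"
    unfolding distr_T_swap by (rule i)
  then have "integrable T (\<lambda>y. W \<tau> (snd (snd y)) (fst (snd y)) * (p (pz y))\<^sup>2)"
    by (subst (asm) integrable_distr_eq[OF sw]) simp_all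
  moreover have "W \<tau> (snd (snd y)) (fst (snd y)) * (p (pz y))\<^sup>2 = WT \<tau> y * (p (pz y))\<^sup>2" if "y \<in> space T" for y
    using that W_sym[OF \<tau>] by (auto simp: space_pair_measure)
  ultimately show "integrable T (\<lambda>y. WT \<tau> y * (p (pz y))\<^sup>2)"
    by (subst (asm) Bochner_Integration.integrable_cong[OF refl]) auto
qed

lemma WT_mult_integrable:
  assumes \<tau>: "0 < \<tau>" and p: "sqint N p" and q: "sqint N q"
  shows "integrable T (\<lambda>y. WT \<tau> y * (p (px y) * q (px y)))" "integrable T (\<lambda>y. WT \<tau> y * (p (pz y) * q (px y)))"
    "integrable T (\<lambda>y. WT \<tau> y * (p (px y) * q (pz y)))" "integrable T (\<lambda>y. WT \<tau> y * (p (pz y) * q (pz y)))"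
proof -
  note [measurable] = WT_measurable[OF \<tau>]
  have [measurable]: "p \<in> borel_measurable N" "q \<in> borel_measurable N" using p q by (auto simp: sqint_def)
  have gen: "integrable T (\<lambda>y. WT \<tau> y * (f y * g y))"
    if "integrable T (\<lambda>y. WT \<tau> y * (f y)\<^sup>2)" "integrable T (\<lambda>y. WT \<tau> y * (g y)\<^sup>2)"
      and [measurable]: "f \<in> borel_measurable T" "g \<in> borel_measurable T" for f g
  proof (rule Bochner_Integration.integrable_bound)
    show "integrable T (\<lambda>y. WT \<tau> y * (f y)\<^sup>2 + WT \<tau> y * (g y)\<^sup>2)" using that by simp
    show "AE y in T. norm (WT \<tau> y * (f y * g y)) \<le> norm (WT \<tau> y * (f y)\<^sup>2 + WT \<tau> y * (g y)\<^sup>2)"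
    proof (rule AE_I2)
      fix y assume "y \<in> space T"
      then have W: "0 \<le> WT \<tau> y" by (rule WT_nonneg[OF \<tau>])
      have "\<bar>f y * g y\<bar> \<le> (f y)\<^sup>2 + (g y)\<^sup>2"
        using sum_squares_bound[of "\<bar>f y\<bar>" "\<bar>g y\<bar>"] mult_nonneg_nonneg[OF abs_ge_zero[of "f y"] abs_ge_zero[of "g y"]]
        unfolding abs_mult power2_abs by linarith
      from mult_left_mono[OF this W] show "norm (WT \<tau> y * (f y * g y)) \<le> norm (WT \<tau> y * (f y)\<^sup>2 + WT \<tau> y * (g y)\<^sup>2)"
        using W by (simp add: abs_mult distrib_left)
    qed
  qed measurable
  have m: "(\<lambda>y. p (px y)) \<in> borel_measurable T" "(\<lambda>y. p (pz y)) \<in> borel_measurable T"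
    "(\<lambda>y. q (px y)) \<in> borel_measurable T" "(\<lambda>y. q (pz y)) \<in> borel_measurable T" by measurable
  note i = WT_sq_integrable[OF \<tau> p] WT_sq_integrable[OF \<tau> q]
  show "integrable T (\<lambda>y. WT \<tau> y * (p (px y) * q (px y)))" by (rule gen[OF i(1,3) m(1,3)])
  show "integrable T (\<lambda>y. WT \<tau> y * (p (pz y) * q (px y)))" by (rule gen[OF i(2,3) m(2,3)])
  show "integrable T (\<lambda>y. WT \<tau> y * (p (px y) * q (pz y)))" by (rule gen[OF i(1,4) m(1,4)])
  show "integrable T (\<lambda>y. WT \<tau> y * (p (pz y) * q (pz y)))" by (rule gen[OF i(2,4) m(2,4)])
qed

text \<open>The theorem is stated with iterated integrals, while the estimates live on the product
  space.\<close>

lemma integral_T_iterated: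
  fixes f :: "_ \<Rightarrow> real"
  assumes f: "integrable T f"
  shows "(\<integral>y. f y \<partial>T) = (\<integral>t. \<integral>x. \<integral>z. f (t, x, z) \<partial>M \<partial>M \<partial>lborel)"
proof -
  have [measurable]: "f \<in> borel_measurable T" using f by auto
  have "(\<integral>y. f y \<partial>T) = (\<integral>t. \<integral>p. f (t, p) \<partial>MM \<partial>lborel)" by (rule T.integral_fst'[OF f, symmetric])
  also have "\<dots> = (\<integral>t. \<integral>x. \<integral>z. f (t, x, z) \<partial>M \<partial>M \<partial>lborel)"
  proof (rule integral_cong_AE)
    show "AE t in lborel. (\<integral>p. f (t, p) \<partial>MM) = (\<integral>x. \<integral>z. f (t, x, z) \<partial>M \<partial>M)"
      using T.AE_integrable_fst'[OF f] by eventually_elim (rule MM.integral_fst'[symmetric])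
  qed measurable
  finally show ?thesis .
qed

lemma integral_N_iterated:
  fixes f :: "_ \<Rightarrow> real"
  assumes f: "integrable N f"
  shows "(\<integral>z. f z \<partial>N) = (\<integral>t. \<integral>x. f (t, x) \<partial>M \<partial>lborel)"
  by (rule N.integral_fst'[OF f, symmetric])

end

lemma abs_mult_le_sq: "\<bar>a * b\<bar> \<le> a\<^sup>2 + (b::real)\<^sup>2"
  using sum_squares_bound[of "\<bar>a\<bar>" "\<bar>b\<bar>"] mult_nonneg_nonneg[OF abs_ge_zero[of a] abs_ge_zero[of b]]
  unfolding abs_mult power2_abs by linarith

section \<open>Eigenfunction coefficients of functions on space-time and the jump form\<close>

context elliptic_heat
begin

lemma section_measurable:
  fixes u :: "real \<Rightarrow> real^'n \<Rightarrow> real"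
  assumes "(\<lambda>z. u (fst z) (snd z)) \<in> borel_measurable N"
  shows "u t \<in> borel_measurable M"
  using measurable_compose[OF measurable_Pair1'[of t lborel M] assms] by simp

lemma AE_sqint_section:
  fixes u :: "real \<Rightarrow> real^'n \<Rightarrow> real"
  assumes u: "sqint N (\<lambda>z. u (fst z) (snd z))"
  shows "AE t in lborel. sqint M (u t)"
proof -
  have m: "(\<lambda>z. u (fst z) (snd z)) \<in> borel_measurable N" using u by (simp add: sqint_def)
  have "AE t in lborel. integrable M (\<lambda>x. (norm (u (fst (t, x)) (snd (t, x))))\<^sup>2)"
    by (rule N.AE_integrable_fst'[OF sqint_integrable[OF u]])
  then show ?thesis by eventually_elim (use section_measurable[OF m] in \<open>simp add: sqint_def\<close>)
qed

lemma coef_eq_co: "coef \<Omega> \<phi> u k t = co (u t) k"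
  by (simp add: coef_def co_def)

lemma coef_measurable:
  fixes u :: "real \<Rightarrow> real^'n \<Rightarrow> real"
  assumes u: "sqint N (\<lambda>z. u (fst z) (snd z))"
  shows "coef \<Omega> \<phi> u k \<in> borel_measurable borel"
proof -
  have [measurable]: "(\<lambda>z. u (fst z) (snd z)) \<in> borel_measurable N" "\<phi> k \<in> borel_measurable M"
    using u sqint_\<phi>[of k] by (auto simp: sqint_def)
  have "(\<lambda>(t, x). u t x * \<phi> k x) \<in> borel_measurable N" unfolding case_prod_beta' by measurable
  then have "(\<lambda>t. \<integral>x. u t x * \<phi> k x \<partial>M) \<in> borel_measurable lborel"
    by (rule borel_measurable_lebesgue_integral)
  then show ?thesis by (simp add: coef_def[abs_def])
qed

definition coef_energy :: "(real \<Rightarrow> real^'n \<Rightarrow> real) \<Rightarrow> nat \<Rightarrow> real" where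
  "coef_energy u k = (\<integral>t. (coef \<Omega> \<phi> u k t)\<^sup>2 \<partial>lborel)"

lemma coef_energy_nonneg: "0 \<le> coef_energy u k" by (simp add: coef_energy_def)

text \<open>Parseval in space at almost every time, summed under the time integral. Nonnegative
  integrals are used because square integrability of the single coefficients is derived from this
  identity.\<close>

lemma nn_integral_coef_sum:
  fixes u :: "real \<Rightarrow> real^'n \<Rightarrow> real"
  assumes u: "sqint N (\<lambda>z. u (fst z) (snd z))"
  shows "(\<Sum>k. \<integral>\<^sup>+t. ennreal ((coef \<Omega> \<phi> u k t)\<^sup>2) \<partial>lborel) = ennreal (\<integral>z. (u (fst z) (snd z))\<^sup>2 \<partial>N)"
proof -
  have [measurable]: "(\<lambda>z. u (fst z) (snd z)) \<in> borel_measurable N" using u by (auto simp: sqint_def)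
  note [measurable] = coef_measurable[OF u]
  have "(\<Sum>k. \<integral>\<^sup>+t. ennreal ((coef \<Omega> \<phi> u k t)\<^sup>2) \<partial>lborel) = (\<integral>\<^sup>+t. (\<Sum>k. ennreal ((coef \<Omega> \<phi> u k t)\<^sup>2)) \<partial>lborel)"
    by (rule nn_integral_suminf[symmetric]) simp
  also have "\<dots> = (\<integral>\<^sup>+t. \<integral>\<^sup>+x. ennreal ((u t x)\<^sup>2) \<partial>M \<partial>lborel)"
  proof (rule nn_integral_cong_AE)
    show "AE t in lborel. (\<Sum>k. ennreal ((coef \<Omega> \<phi> u k t)\<^sup>2)) = (\<integral>\<^sup>+x. ennreal ((u t x)\<^sup>2) \<partial>M)"
      using AE_sqint_section[OF u]
    proof eventually_elim
      case (elim t)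
      have s: "(\<lambda>k. (coef \<Omega> \<phi> u k t)\<^sup>2) sums (\<integral>x. (u t x)\<^sup>2 \<partial>M)"
        using Parseval_sums[OF elim elim] by (simp add: coef_eq_co power2_eq_square)
      have "(\<Sum>k. ennreal ((coef \<Omega> \<phi> u k t)\<^sup>2)) = ennreal (\<integral>x. (u t x)\<^sup>2 \<partial>M)"
        using s by (subst suminf_ennreal2) (auto simp: sums_iff)
      also have "\<dots> = (\<integral>\<^sup>+x. ennreal ((u t x)\<^sup>2) \<partial>M)"
        using sqint_integrable[OF elim] by (intro nn_integral_eq_integral[symmetric]) auto
      finally show ?case .
    qed
  qed
  also have "\<dots> = (\<integral>\<^sup>+z. ennreal ((u (fst z) (snd z))\<^sup>2) \<partial>N)"
    by (subst nn_integral_fst[symmetric]) auto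
  also have "\<dots> = ennreal (\<integral>z. (u (fst z) (snd z))\<^sup>2 \<partial>N)"
    using sqint_integrable[OF u] by (intro nn_integral_eq_integral) auto
  finally show ?thesis .
qed

lemma sqint_coef:
  fixes u :: "real \<Rightarrow> real^'n \<Rightarrow> real"
  assumes u: "sqint N (\<lambda>z. u (fst z) (snd z))"
  shows "sqint lborel (coef \<Omega> \<phi> u k)"
  unfolding sqint_def
proof
  note [measurable] = coef_measurable[OF u]
  show "coef \<Omega> \<phi> u k \<in> borel_measurable lborel" by simp
  have "(\<integral>\<^sup>+t. ennreal ((coef \<Omega> \<phi> u k t)\<^sup>2) \<partial>lborel) \<le> (\<Sum>k. \<integral>\<^sup>+t. ennreal ((coef \<Omega> \<phi> u k t)\<^sup>2) \<partial>lborel)"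
    using sum_le_suminf[of "\<lambda>k. \<integral>\<^sup>+t. ennreal ((coef \<Omega> \<phi> u k t)\<^sup>2) \<partial>lborel" "{k}"] by simp
  also have "\<dots> < \<infinity>" by (simp add: nn_integral_coef_sum[OF u])
  finally show "integrable lborel (\<lambda>t. (norm (coef \<Omega> \<phi> u k t))\<^sup>2)"
    by (intro integrableI_bounded) auto
qed

lemma coef_energy_sums:
  fixes u :: "real \<Rightarrow> real^'n \<Rightarrow> real"
  assumes u: "sqint N (\<lambda>z. u (fst z) (snd z))"
  shows "coef_energy u sums (\<integral>z. (u (fst z) (snd z))\<^sup>2 \<partial>N)"
proof -
  have e: "(\<integral>\<^sup>+t. ennreal ((coef \<Omega> \<phi> u k t)\<^sup>2) \<partial>lborel) = ennreal (coef_energy u k)" for k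
    unfolding coef_energy_def using sqint_integrable[OF sqint_coef[OF u, of k]] by (intro nn_integral_eq_integral) auto
  have s: "(\<Sum>k. ennreal (coef_energy u k)) = ennreal (\<integral>z. (u (fst z) (snd z))\<^sup>2 \<partial>N)"
    using nn_integral_coef_sum[OF u] by (simp add: e)
  then have sm: "summable (coef_energy u)" by (intro summable_suminf_not_top) (auto simp: coef_energy_nonneg)
  have "ennreal (\<Sum>k. coef_energy u k) = ennreal (\<integral>z. (u (fst z) (snd z))\<^sup>2 \<partial>N)"
    using s by (subst (asm) suminf_ennreal2[OF coef_energy_nonneg sm])
  then have "(\<Sum>k. coef_energy u k) = (\<integral>z. (u (fst z) (snd z))\<^sup>2 \<partial>N)"
    by (subst (asm) ennreal_inj) (auto intro!: suminf_nonneg sm coef_energy_nonneg)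
  then show ?thesis using sm by (simp add: sums_iff)
qed

lemma coef_translate: "coef \<Omega> \<phi> (\<lambda>t. u (t - \<tau>)) k t = coef \<Omega> \<phi> u k (t - \<tau>)"
  by (simp add: coef_def)

text \<open>Since a shift in time preserves the energies, bounds for \<open>u\<close> serve for
  \<open>u (t - \<tau>)\<close> at every lag.\<close>

lemma coef_energy_translate: "coef_energy (\<lambda>t. u (t - \<tau>)) k = coef_energy u k"
  unfolding coef_energy_def coef_translate using integral_lborel_translate[of "\<lambda>t. (coef \<Omega> \<phi> u k t)\<^sup>2" "- \<tau>"] by simp

lemma coef_mult_integrable:
  fixes p q :: "real \<Rightarrow> real^'n \<Rightarrow> real"
  assumes p: "sqint N (\<lambda>z. p (fst z) (snd z))" and q: "sqint N (\<lambda>z. q (fst z) (snd z))"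
  shows "integrable lborel (\<lambda>t. coef \<Omega> \<phi> p k t * coef \<Omega> \<phi> q k t)"
    "(\<integral>t. \<bar>coef \<Omega> \<phi> p k t * coef \<Omega> \<phi> q k t\<bar> \<partial>lborel) \<le> coef_energy p k + coef_energy q k"
proof -
  show i: "integrable lborel (\<lambda>t. coef \<Omega> \<phi> p k t * coef \<Omega> \<phi> q k t)"
    by (rule sqint_mult_integrable[OF sqint_coef[OF p] sqint_coef[OF q]])
  have i2: "integrable lborel (\<lambda>t. (coef \<Omega> \<phi> p k t)\<^sup>2)" "integrable lborel (\<lambda>t. (coef \<Omega> \<phi> q k t)\<^sup>2)"
    using sqint_integrable[OF sqint_coef[OF p, of k]] sqint_integrable[OF sqint_coef[OF q, of k]] by auto
  have "(\<integral>t. \<bar>coef \<Omega> \<phi> p k t * coef \<Omega> \<phi> q k t\<bar> \<partial>lborel) \<le> (\<integral>t. (coef \<Omega> \<phi> p k t)\<^sup>2 + (coef \<Omega> \<phi> q k t)\<^sup>2 \<partial>lborel)"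
    using i i2 by (intro integral_mono integrable_abs Bochner_Integration.integrable_add abs_mult_le_sq)
  then show "(\<integral>t. \<bar>coef \<Omega> \<phi> p k t * coef \<Omega> \<phi> q k t\<bar> \<partial>lborel) \<le> coef_energy p k + coef_energy q k"
    using i2 by (simp add: coef_energy_def)
qed

text \<open>Common core of two expansions, with multipliers \<open>1\<close> and
  \<open>exp (- \<tau> * lam k)\<close>. The terms are dominated by products of coefficients, whose
  time integrals are bounded by summable energies; this justifies integrating the series term by
  term.\<close>

lemma coef_series_integral:
  fixes p q :: "real \<Rightarrow> real^'n \<Rightarrow> real"
  assumes p: "sqint N (\<lambda>z. p (fst z) (snd z))" and q: "sqint N (\<lambda>z. q (fst z) (snd z))"
    and m: "\<And>k. 0 \<le> m k \<and> m k \<le> (1::real)"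
    and G: "AE t in lborel. (\<lambda>k. m k * (coef \<Omega> \<phi> p k t * coef \<Omega> \<phi> q k t)) sums G t"
    and [measurable]: "G \<in> borel_measurable borel"
  shows "(\<lambda>k. m k * (\<integral>t. coef \<Omega> \<phi> p k t * coef \<Omega> \<phi> q k t \<partial>lborel)) sums (\<integral>t. G t \<partial>lborel)"
proof -
  note [measurable] = coef_measurable[OF p] coef_measurable[OF q]
  define f where "f k t = m k * (coef \<Omega> \<phi> p k t * coef \<Omega> \<phi> q k t)" for k t
  have [measurable]: "f k \<in> borel_measurable borel" for k unfolding f_def by measurable
  have f_le: "norm (f k t) \<le> \<bar>coef \<Omega> \<phi> p k t * coef \<Omega> \<phi> q k t\<bar>" for k t
    unfolding f_def using m[of k] by (simp add: abs_mult mult_left_le_one_le)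
  have "(\<lambda>k. \<integral>t. f k t \<partial>lborel) sums (\<integral>t. (\<Sum>k. f k t) \<partial>lborel)"
  proof (rule sums_integral)
    show fi: "integrable lborel (f k)" for k unfolding f_def using coef_mult_integrable(1)[OF p q] by simp
    show "AE t in lborel. summable (\<lambda>k. norm (f k t))"
      using AE_sqint_section[OF p] AE_sqint_section[OF q]
    proof eventually_elim
      case (elim t)
      have "summable (\<lambda>k. \<bar>coef \<Omega> \<phi> p k t * coef \<Omega> \<phi> q k t\<bar>)"
        unfolding coef_eq_co co_def by (rule summable_coef_mult[OF on elim])
      then show ?case by (rule summable_comparison_test') (simp only: real_norm_def abs_abs f_le[unfolded real_norm_def])
    qed
    show "summable (\<lambda>k. \<integral>t. norm (f k t) \<partial>lborel)"
    proof (rule summable_comparison_test')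
      show "summable (\<lambda>k. coef_energy p k + coef_energy q k)"
        using coef_energy_sums[OF p] coef_energy_sums[OF q] by (intro summable_add) (auto simp: sums_iff)
      fix k
      have "(\<integral>t. norm (f k t) \<partial>lborel) \<le> (\<integral>t. \<bar>coef \<Omega> \<phi> p k t * coef \<Omega> \<phi> q k t\<bar> \<partial>lborel)"
        using fi coef_mult_integrable(1)[OF p q] f_le by (intro integral_mono integrable_norm integrable_abs)
      also have "\<dots> \<le> coef_energy p k + coef_energy q k" by (rule coef_mult_integrable(2)[OF p q])
      finally show "norm (\<integral>t. norm (f k t) \<partial>lborel) \<le> coef_energy p k + coef_energy q k" by simp
    qed
  qed
  moreover have "(\<integral>t. (\<Sum>k. f k t) \<partial>lborel) = (\<integral>t. G t \<partial>lborel)"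
  proof (rule integral_cong_AE)
    show "AE t in lborel. (\<Sum>k. f k t) = G t" using G by eventually_elim (simp add: f_def sums_iff)
  qed measurable
  ultimately show ?thesis by (simp add: f_def)
qed

lemma integral_N_sums:
  fixes p q :: "real \<Rightarrow> real^'n \<Rightarrow> real"
  assumes p: "sqint N (\<lambda>z. p (fst z) (snd z))" and q: "sqint N (\<lambda>z. q (fst z) (snd z))"
  shows "(\<lambda>k. \<integral>t. coef \<Omega> \<phi> p k t * coef \<Omega> \<phi> q k t \<partial>lborel) sums (\<integral>z. p (fst z) (snd z) * q (fst z) (snd z) \<partial>N)"
proof -
  have [measurable]: "(\<lambda>z. p (fst z) (snd z)) \<in> borel_measurable N" "(\<lambda>z. q (fst z) (snd z)) \<in> borel_measurable N"
    using p q by (auto simp: sqint_def)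
  define G where "G t = (\<integral>x. p t x * q t x \<partial>M)" for t
  have "(\<lambda>(t, x). p t x * q t x) \<in> borel_measurable N" unfolding case_prod_beta' by measurable
  then have Gm: "G \<in> borel_measurable borel"
    unfolding G_def[abs_def] using borel_measurable_lebesgue_integral[of "\<lambda>t x. p t x * q t x" lborel] by simp
  have "(\<lambda>k. 1 * (\<integral>t. coef \<Omega> \<phi> p k t * coef \<Omega> \<phi> q k t \<partial>lborel)) sums (\<integral>t. G t \<partial>lborel)"
  proof (rule coef_series_integral[OF p q _ _ Gm])
    show "AE t in lborel. (\<lambda>k. 1 * (coef \<Omega> \<phi> p k t * coef \<Omega> \<phi> q k t)) sums G t"
      using AE_sqint_section[OF p] AE_sqint_section[OF q]
    proof eventually_elim
      case (elim t)
      from Parseval_sums[OF elim] show ?case by (simp add: G_def coef_eq_co)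
    qed
  qed simp
  moreover have "(\<integral>z. p (fst z) (snd z) * q (fst z) (snd z) \<partial>N) = (\<integral>t. G t \<partial>lborel)"
    using integral_N_iterated[OF sqint_mult_integrable[OF p q]] by (simp add: G_def)
  ultimately show ?thesis by simp
qed

text \<open>At almost every fixed time the integral over both points is the pairing of
  \<open>heat \<tau> (p t)\<close> with \<open>q t\<close>, expanded by
  \<open>heat_sums\<close>.\<close>

lemma integral_T_XZ_sums:
  fixes p q :: "real \<Rightarrow> real^'n \<Rightarrow> real"
  assumes \<tau>: "0 < \<tau>" and p: "sqint N (\<lambda>z. p (fst z) (snd z))" and q: "sqint N (\<lambda>z. q (fst z) (snd z))"
  shows "(\<lambda>k. exp (- \<tau> * lam k) * (\<integral>t. coef \<Omega> \<phi> p k t * coef \<Omega> \<phi> q k t \<partial>lborel))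
    sums (\<integral>y. WT \<tau> y * (p (fst y) (snd (snd y)) * q (fst y) (fst (snd y))) \<partial>T)"
proof -
  have i: "integrable T (\<lambda>y. WT \<tau> y * (p (fst y) (snd (snd y)) * q (fst y) (fst (snd y))))"
    using WT_mult_integrable(2)[OF \<tau> p q] by simp
  have [measurable]: "(\<lambda>y. WT \<tau> y * (p (fst y) (snd (snd y)) * q (fst y) (fst (snd y)))) \<in> borel_measurable T"
    using i by (rule borel_measurable_integrable)
  define G where "G t = (\<integral>x. \<integral>z. W \<tau> x z * (p t z * q t x) \<partial>M \<partial>M)" for t
  have eq: "(\<integral>y. WT \<tau> y * (p (fst y) (snd (snd y)) * q (fst y) (fst (snd y))) \<partial>T) = (\<integral>t. G t \<partial>lborel)"
    using integral_T_iterated[OF i] by (simp add: G_def)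
  have Gh: "G t = (\<integral>x. heat \<tau> (p t) x * q t x \<partial>M)" for t
    unfolding G_def heat_def by (simp only: mult.assoc[symmetric] integral_mult_left_zero)
  \<comment> \<open>The product is reassociated from \<open>T\<close> to \<open>N\<close> times
    \<open>M\<close>, so that \<open>z\<close> and \<open>x\<close> can be integrated out one after
    the other.\<close>
  have Gm: "G \<in> borel_measurable borel"
  proof -
    have 1: "(\<lambda>((t, x), z). W \<tau> x z * (p t z * q t x)) \<in> borel_measurable (N \<Otimes>\<^sub>M M)"
    proof -
      have "(\<lambda>w. (fst (fst w), snd (fst w), snd w)) \<in> measurable (N \<Otimes>\<^sub>M M) T" by measurable
      from measurable_compose[OF this borel_measurable_integrable[OF i]] show ?thesis by (simp add: case_prod_beta')
    qed
    have "(\<lambda>w. \<integral>z. W \<tau> (snd w) z * (p (fst w) z * q (fst w) (snd w)) \<partial>M) \<in> borel_measurable N"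
      by (rule borel_measurable_lebesgue_integral) (use 1 in \<open>simp add: case_prod_beta'\<close>)
    then have "(\<lambda>(t, x). \<integral>z. W \<tau> x z * (p t z * q t x) \<partial>M) \<in> borel_measurable N" by (simp add: case_prod_beta')
    then have "G \<in> borel_measurable lborel" unfolding G_def[abs_def] by (rule borel_measurable_lebesgue_integral)
    then show ?thesis by simp
  qed
  show ?thesis unfolding eq
  proof (rule coef_series_integral[OF p q _ _ Gm])
    show "0 \<le> exp (- \<tau> * lam k) \<and> exp (- \<tau> * lam k) \<le> 1" for k using \<tau> lam_nonneg[of k] by simp
    show "AE t in lborel. (\<lambda>k. exp (- \<tau> * lam k) * (coef \<Omega> \<phi> p k t * coef \<Omega> \<phi> q k t)) sums G t"
      using AE_sqint_section[OF p] AE_sqint_section[OF q]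
    proof eventually_elim
      case (elim t)
      from heat_sums[OF \<tau> elim] show ?case by (simp add: Gh coef_eq_co mult.assoc)
    qed
  qed
qed

lemma h_mult_integrable:
  assumes \<tau>: "0 < \<tau>" and p: "sqint N p" and q: "sqint N q"
  shows "integrable N (\<lambda>z. h \<tau> (snd z) * (p z * q z))"
proof (rule Bochner_Integration.integrable_bound)
  note [measurable] = h_measurable[OF \<tau>]
  have [measurable]: "p \<in> borel_measurable N" "q \<in> borel_measurable N" using p q by (auto simp: sqint_def)
  show "integrable N (\<lambda>z. p z * q z)" by (rule sqint_mult_integrable[OF p q])
  show "(\<lambda>z. h \<tau> (snd z) * (p z * q z)) \<in> borel_measurable N" by measurable
  show "AE z in N. norm (h \<tau> (snd z) * (p z * q z)) \<le> norm (p z * q z)"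
    using h_bounds_N[OF \<tau>] by eventually_elim (simp add: abs_mult mult_left_le_one_le)
qed

lemma integral_T_XX:
  assumes \<tau>: "0 < \<tau>" and p: "sqint N p" and q: "sqint N q"
  shows "(\<integral>y. WT \<tau> y * (p (px y) * q (px y)) \<partial>T) = (\<integral>z. h \<tau> (snd z) * (p z * q z) \<partial>N)"
  using integral_T_iterated[OF WT_mult_integrable(1)[OF \<tau> p q]] integral_N_iterated[OF h_mult_integrable[OF \<tau> p q]]
  by (simp add: h_def heat1_def)

text \<open>Exchanging the two points identifies the two diagonal terms of an expanded jump form
  with each other, and likewise the two mixed ones.\<close>

lemma integral_T_swap_W:
  assumes \<tau>: "0 < \<tau>" and [measurable]: "p \<in> borel_measurable N" "q \<in> borel_measurable N"
  shows "(\<integral>y. WT \<tau> y * (p (pz y) * q (pz y)) \<partial>T) = (\<integral>y. WT \<tau> y * (p (px y) * q (px y)) \<partial>T)"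
    "(\<integral>y. WT \<tau> y * (p (px y) * q (pz y)) \<partial>T) = (\<integral>y. WT \<tau> y * (p (pz y) * q (px y)) \<partial>T)"
proof -
  note [measurable] = WT_measurable[OF \<tau>]
  have W: "WT \<tau> y = W \<tau> (snd (snd y)) (fst (snd y))" if "y \<in> space T" for y
    using that W_sym[OF \<tau>] by (auto simp: space_pair_measure)
  have m: "(\<lambda>y. WT \<tau> y * (p (px y) * q (px y))) \<in> borel_measurable T"
    "(\<lambda>y. WT \<tau> y * (p (pz y) * q (px y))) \<in> borel_measurable T" by measurable
  have "(\<integral>y. WT \<tau> y * (p (pz y) * q (pz y)) \<partial>T) = (\<integral>y. W \<tau> (snd (snd y)) (fst (snd y)) * (p (pz y) * q (pz y)) \<partial>T)"
    by (intro Bochner_Integration.integral_cong refl) (simp add: W)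
  also have "\<dots> = (\<integral>y. WT \<tau> y * (p (px y) * q (px y)) \<partial>T)" using integral_T_swap[OF m(1)] by simp
  finally show "(\<integral>y. WT \<tau> y * (p (pz y) * q (pz y)) \<partial>T) = (\<integral>y. WT \<tau> y * (p (px y) * q (px y)) \<partial>T)" .
  have "(\<integral>y. WT \<tau> y * (p (px y) * q (pz y)) \<partial>T) = (\<integral>y. W \<tau> (snd (snd y)) (fst (snd y)) * (p (px y) * q (pz y)) \<partial>T)"
    by (intro Bochner_Integration.integral_cong refl) (simp add: W)
  also have "\<dots> = (\<integral>y. WT \<tau> y * (p (pz y) * q (px y)) \<partial>T)" using integral_T_swap[OF m(2)] by simp
  finally show "(\<integral>y. WT \<tau> y * (p (px y) * q (pz y)) \<partial>T) = (\<integral>y. WT \<tau> y * (p (pz y) * q (px y)) \<partial>T)" .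
qed

text \<open>The four terms of the expanded product coincide in pairs. The resulting factor 2 is the
  one that the \<open>2\<close> in the denominator of \<open>Ks\<close> compensates.\<close>

lemma energy_identity:
  assumes \<tau>: "0 < \<tau>" and p: "sqint N p" and q: "sqint N q"
  shows "integrable T (\<lambda>y. WT \<tau> y * ((p (px y) - p (pz y)) * (q (px y) - q (pz y))))"
    "(\<integral>y. WT \<tau> y * ((p (px y) - p (pz y)) * (q (px y) - q (pz y))) \<partial>T)
      = 2 * ((\<integral>z. h \<tau> (snd z) * (p z * q z) \<partial>N) - (\<integral>y. WT \<tau> y * (p (pz y) * q (px y)) \<partial>T))"
proof -
  have m: "p \<in> borel_measurable N" "q \<in> borel_measurable N" using p q by (auto simp: sqint_def)
  note i = WT_mult_integrable[OF \<tau> p q]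
  have e: "WT \<tau> y * ((p (px y) - p (pz y)) * (q (px y) - q (pz y)))
    = (WT \<tau> y * (p (px y) * q (px y)) + WT \<tau> y * (p (pz y) * q (pz y))) - (WT \<tau> y * (p (pz y) * q (px y)) + WT \<tau> y * (p (px y) * q (pz y)))" for y
    by (simp add: algebra_simps)
  show "integrable T (\<lambda>y. WT \<tau> y * ((p (px y) - p (pz y)) * (q (px y) - q (pz y))))"
    unfolding e by (intro Bochner_Integration.integrable_diff Bochner_Integration.integrable_add i)
  have "(\<integral>y. WT \<tau> y * ((p (px y) - p (pz y)) * (q (px y) - q (pz y))) \<partial>T)
     = ((\<integral>y. WT \<tau> y * (p (px y) * q (px y)) \<partial>T) + (\<integral>y. WT \<tau> y * (p (pz y) * q (pz y)) \<partial>T))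
      - ((\<integral>y. WT \<tau> y * (p (pz y) * q (px y)) \<partial>T) + (\<integral>y. WT \<tau> y * (p (px y) * q (pz y)) \<partial>T))"
    unfolding e by (subst Bochner_Integration.integral_diff, (intro Bochner_Integration.integrable_add i)+)
      (simp only: Bochner_Integration.integral_add[OF i(1,4)] Bochner_Integration.integral_add[OF i(2,3)])
  then show "(\<integral>y. WT \<tau> y * ((p (px y) - p (pz y)) * (q (px y) - q (pz y))) \<partial>T)
      = 2 * ((\<integral>z. h \<tau> (snd z) * (p z * q z) \<partial>N) - (\<integral>y. WT \<tau> y * (p (pz y) * q (px y)) \<partial>T))"
    unfolding integral_T_swap_W[OF \<tau> m] integral_T_XX[OF \<tau> p q] by simp
qed

text \<open>With \<open>h \<tau>\<close> replaced by its upper bound 1, the diagonal term is the sum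
  of all energies, and subtracting the damped series leaves the factors
  \<open>1 - exp (- \<tau> * lam k)\<close>. The 2 is inherited from
  \<open>energy_identity\<close>.\<close>

lemma energy_le:
  fixes p :: "real \<Rightarrow> real^'n \<Rightarrow> real"
  assumes \<tau>: "0 < \<tau>" and p: "sqint N (\<lambda>z. p (fst z) (snd z))"
  shows "(\<integral>y. WT \<tau> y * (p (fst y) (fst (snd y)) - p (fst y) (snd (snd y)))\<^sup>2 \<partial>T) \<le> 2 * (\<Sum>k. (1 - exp (- \<tau> * lam k)) * coef_energy p k)"
    "summable (\<lambda>k. (1 - exp (- \<tau> * lam k)) * coef_energy p k)"
proof -
  let ?P = "\<lambda>z. p (fst z) (snd z)"
  have eq: "(\<integral>y. WT \<tau> y * (p (fst y) (fst (snd y)) - p (fst y) (snd (snd y)))\<^sup>2 \<partial>T)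
     = 2 * ((\<integral>z. h \<tau> (snd z) * (?P z * ?P z) \<partial>N) - (\<integral>y. WT \<tau> y * (?P (pz y) * ?P (px y)) \<partial>T))"
    using energy_identity(2)[OF \<tau> p p] by (simp add: power2_eq_square)
  have s1: "coef_energy p sums (\<integral>z. (?P z)\<^sup>2 \<partial>N)" by (rule coef_energy_sums[OF p])
  have s2: "(\<lambda>k. exp (- \<tau> * lam k) * coef_energy p k) sums (\<integral>y. WT \<tau> y * (?P (pz y) * ?P (px y)) \<partial>T)"
    using integral_T_XZ_sums[OF \<tau> p p] by (simp add: coef_energy_def power2_eq_square)
  have s3: "(\<lambda>k. (1 - exp (- \<tau> * lam k)) * coef_energy p k) sums ((\<integral>z. (?P z)\<^sup>2 \<partial>N) - (\<integral>y. WT \<tau> y * (?P (pz y) * ?P (px y)) \<partial>T))"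
    using sums_diff[OF s1 s2] by (simp add: left_diff_distrib)
  then show "summable (\<lambda>k. (1 - exp (- \<tau> * lam k)) * coef_energy p k)" by (simp add: sums_iff)
  have "(\<integral>z. h \<tau> (snd z) * (?P z * ?P z) \<partial>N) \<le> (\<integral>z. (?P z)\<^sup>2 \<partial>N)"
  proof (rule integral_mono_AE)
    show "integrable N (\<lambda>z. h \<tau> (snd z) * (?P z * ?P z))" by (rule h_mult_integrable[OF \<tau> p p])
    show "integrable N (\<lambda>z. (?P z)\<^sup>2)" using sqint_integrable[OF p] by simp
    show "AE z in N. h \<tau> (snd z) * (?P z * ?P z) \<le> (?P z)\<^sup>2"
      using h_bounds_N[OF \<tau>] by eventually_elim (simp add: power2_eq_square mult_left_le_one_le)
  qed
  then show "(\<integral>y. WT \<tau> y * (p (fst y) (fst (snd y)) - p (fst y) (snd (snd y)))\<^sup>2 \<partial>T) \<le> 2 * (\<Sum>k. (1 - exp (- \<tau> * lam k)) * coef_energy p k)"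
    unfolding eq using s3 by (simp add: sums_iff)
qed

end

section \<open>Integration over the time lag\<close>

text \<open>Series over \<open>k\<close> are treated as integrals over counting measure, so that one
  application of Fubini covers index, frequency and lag.\<close>

interpretation count_lborel: pair_sigma_finite "count_space (UNIV :: nat set)" "lborel :: real measure"
  by (intro pair_sigma_finite.intro sigma_finite_measure_count_space lborel.sigma_finite_measure_axioms)

lemma nn_integral_count_lborel:
  fixes f :: "nat \<Rightarrow> real \<Rightarrow> ennreal"
  assumes "\<And>k. f k \<in> borel_measurable borel"
  shows "(\<integral>\<^sup>+y. f (fst y) (snd y) \<partial>(count_space UNIV \<Otimes>\<^sub>M lborel)) = (\<Sum>k. \<integral>\<^sup>+\<rho>. f k \<rho> \<partial>lborel)"
    and "(\<integral>\<^sup>+y. f (fst y) (snd y) \<partial>(count_space UNIV \<Otimes>\<^sub>M lborel)) = (\<integral>\<^sup>+\<rho>. (\<Sum>k. f k \<rho>) \<partial>lborel)"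
proof -
  have m: "(\<lambda>y. f (fst y) (snd y)) \<in> borel_measurable (count_space UNIV \<Otimes>\<^sub>M lborel)"
    by (rule measurable_pair_measure_countable1) (use assms in auto)
  show "(\<integral>\<^sup>+y. f (fst y) (snd y) \<partial>(count_space UNIV \<Otimes>\<^sub>M lborel)) = (\<Sum>k. \<integral>\<^sup>+\<rho>. f k \<rho> \<partial>lborel)"
    using lborel.nn_integral_fst[OF m] by (simp add: nn_integral_count_space_nat)
  also have "\<dots> = (\<integral>\<^sup>+\<rho>. (\<Sum>k. f k \<rho>) \<partial>lborel)"
    using assms by (intro nn_integral_suminf[symmetric]) simp
  finally show "(\<integral>\<^sup>+y. f (fst y) (snd y) \<partial>(count_space UNIV \<Otimes>\<^sub>M lborel)) = (\<integral>\<^sup>+\<rho>. (\<Sum>k. f k \<rho>) \<partial>lborel)" .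
qed

lemma integral_count_lborel_sums:
  fixes f :: "nat \<Rightarrow> real \<Rightarrow> complex"
  assumes f: "integrable (count_space UNIV \<Otimes>\<^sub>M lborel) (\<lambda>y. f (fst y) (snd y))"
  shows "(\<lambda>k. \<integral>\<rho>. f k \<rho> \<partial>lborel) sums (\<integral>y. f (fst y) (snd y) \<partial>(count_space UNIV \<Otimes>\<^sub>M lborel))"
proof -
  have "integrable (count_space UNIV) (\<lambda>k. \<integral>\<rho>. f k \<rho> \<partial>lborel)"
    using count_lborel.integrable_fst'[OF f] by simp
  from sums_integral_count_space_nat[OF this] show ?thesis
    using count_lborel.integral_fst'[OF f] by simp
qed

text \<open>The series stands inside the frequency integral, as in \<open>Hs_pair\<close>;
  \<open>integral_count_lborel_sums\<close> handles the opposite order.\<close>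

lemma integral_count_lborel_suminf:
  fixes f :: "nat \<Rightarrow> real \<Rightarrow> complex"
  assumes f: "integrable (count_space UNIV \<Otimes>\<^sub>M lborel) (\<lambda>y. f (fst y) (snd y))"
    and [measurable]: "\<And>k. f k \<in> borel_measurable borel"
  shows "(\<integral>\<rho>. (\<Sum>k. f k \<rho>) \<partial>lborel) = (\<integral>y. f (fst y) (snd y) \<partial>(count_space UNIV \<Otimes>\<^sub>M lborel))"
proof -
  have f': "integrable (count_space UNIV \<Otimes>\<^sub>M lborel) (case_prod f)" using f by (simp add: case_prod_beta')
  have "(\<integral>y. f (fst y) (snd y) \<partial>(count_space UNIV \<Otimes>\<^sub>M lborel)) = (\<integral>\<rho>. \<integral>k. f k \<rho> \<partial>count_space UNIV \<partial>lborel)"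
    using count_lborel.integral_snd[OF f'] by (simp add: case_prod_beta')
  also have "\<dots> = (\<integral>\<rho>. (\<Sum>k. f k \<rho>) \<partial>lborel)"
  proof (rule integral_cong_AE)
    show "(\<lambda>\<rho>. \<integral>k. f k \<rho> \<partial>count_space UNIV) \<in> borel_measurable lborel"
      using count_lborel.integrable_snd[OF f'] by (rule borel_measurable_integrable)
    show "AE \<rho> in lborel. (\<integral>k. f k \<rho> \<partial>count_space UNIV) = (\<Sum>k. f k \<rho>)"
      using count_lborel.AE_integrable_snd[OF f'] by eventually_elim (rule integral_count_space_nat)
  qed simp
  finally show ?thesis by simp
qed

lemma ennreal_mult_plus:
  assumes "0 \<le> a" "0 \<le> x" "0 \<le> y"
  shows "ennreal (a * (x + y)) = ennreal a * (ennreal x + ennreal y)"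
  using assms by (simp add: ennreal_mult)

section \<open>The pairing on the Fourier side\<close>

context elliptic_heat
begin

abbreviation "CL \<equiv> count_space (UNIV :: nat set) \<Otimes>\<^sub>M (lborel :: real measure)"

abbreviation "Z k \<rho> \<equiv> \<i> * complex_of_real \<rho> + complex_of_real (lam k)"

lemma hat_fourier:
  assumes "sqint N (\<lambda>z. u (fst z) (snd z))"
  shows "fourier_L2 (coef \<Omega> \<phi> u k) (hat \<Omega> \<phi> u k)"
  unfolding hat_def by (rule someI_ex[OF fourier_L2_exists[OF sqint_coef[OF assms]]])

lemma sqint_hat:
  assumes "sqint N (\<lambda>z. u (fst z) (snd z))"
  shows "sqint lborel (hat \<Omega> \<phi> u k)"
  by (rule fourier_L2_sqint(1)[OF sqint_coef[OF assms] hat_fourier[OF assms]])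

lemma hat_measurable:
  assumes "sqint N (\<lambda>z. u (fst z) (snd z))"
  shows "hat \<Omega> \<phi> u k \<in> borel_measurable borel"
  using sqint_hat[OF assms] by (simp add: sqint_def)

lemma Parseval_hat:
  assumes u: "sqint N (\<lambda>z. u (fst z) (snd z))" and v: "sqint N (\<lambda>z. v (fst z) (snd z))"
  shows "(\<integral>\<rho>. exp (- \<i> * complex_of_real (\<rho> * \<tau>)) * hat \<Omega> \<phi> u k \<rho> * cnj (hat \<Omega> \<phi> v k \<rho>) \<partial>lborel)
      = complex_of_real (\<integral>t. coef \<Omega> \<phi> u k (t - \<tau>) * coef \<Omega> \<phi> v k t \<partial>lborel)"
  by (rule Parseval_fourier_L2[OF sqint_coef[OF u] sqint_coef[OF v] hat_fourier[OF u] hat_fourier[OF v]])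

text \<open>Plancherel for a single coefficient, read off from \<open>Parseval_hat\<close> at lag
  0.\<close>

lemma nn_integral_hat:
  assumes u: "sqint N (\<lambda>z. u (fst z) (snd z))"
  shows "(\<integral>\<^sup>+\<rho>. ennreal ((cmod (hat \<Omega> \<phi> u k \<rho>))\<^sup>2) \<partial>lborel) = ennreal (coef_energy u k)"
proof -
  have "complex_of_real (\<integral>\<rho>. (cmod (hat \<Omega> \<phi> u k \<rho>))\<^sup>2 \<partial>lborel) = (\<integral>\<rho>. hat \<Omega> \<phi> u k \<rho> * cnj (hat \<Omega> \<phi> u k \<rho>) \<partial>lborel)"
    by (simp only: complex_norm_square[symmetric] integral_complex_of_real)
  also have "\<dots> = complex_of_real (coef_energy u k)"
    using Parseval_hat[OF u u, of 0 k] by (simp add: coef_energy_def power2_eq_square)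
  finally have "(\<integral>\<rho>. (cmod (hat \<Omega> \<phi> u k \<rho>))\<^sup>2 \<partial>lborel) = coef_energy u k" by (simp only: of_real_eq_iff)
  then show ?thesis
    using nn_integral_eq_integral[OF sqint_integrable[OF sqint_hat[OF u, of k]]] by simp
qed

definition fin_energy :: "real \<Rightarrow> (real \<Rightarrow> real^'n \<Rightarrow> real) \<Rightarrow> bool" where
  "fin_energy s u \<longleftrightarrow> (\<integral>\<^sup>+\<rho>. (\<Sum>k. ennreal (cmod (Z k \<rho>) powr s * (cmod (hat \<Omega> \<phi> u k \<rho>))\<^sup>2)) \<partial>lborel) < \<infinity>"

lemma sqint_hat_CL:
  assumes u: "sqint N (\<lambda>z. u (fst z) (snd z))"
  shows "sqint CL (\<lambda>y. hat \<Omega> \<phi> u (fst y) (snd y))"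
  unfolding sqint_def
proof
  note hm = hat_measurable[OF u]
  show m: "(\<lambda>y. hat \<Omega> \<phi> u (fst y) (snd y)) \<in> borel_measurable CL"
    by (rule measurable_pair_measure_countable1) (use hm in auto)
  have "(\<integral>\<^sup>+y. ennreal ((cmod (hat \<Omega> \<phi> u (fst y) (snd y)))\<^sup>2) \<partial>CL) = (\<Sum>k. ennreal (coef_energy u k))"
    using nn_integral_count_lborel(1)[of "\<lambda>k \<rho>. ennreal ((cmod (hat \<Omega> \<phi> u k \<rho>))\<^sup>2)"] hm by (simp add: nn_integral_hat[OF u])
  also have "\<dots> < \<infinity>"
    using coef_energy_sums[OF u] by (subst suminf_ennreal2) (auto simp: coef_energy_nonneg sums_iff)
  finally show "integrable CL (\<lambda>y. (cmod (hat \<Omega> \<phi> u (fst y) (snd y)))\<^sup>2)"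
    using m by (intro integrableI_bounded) auto
qed

definition hat_product :: "(real \<Rightarrow> real^'n \<Rightarrow> real) \<Rightarrow> (real \<Rightarrow> real^'n \<Rightarrow> real) \<Rightarrow> nat \<Rightarrow> real \<Rightarrow> complex" where
  "hat_product u v k \<rho> = hat \<Omega> \<phi> u k \<rho> * cnj (hat \<Omega> \<phi> v k \<rho>)"

lemma hat_product_measurable:
  assumes u: "sqint N (\<lambda>z. u (fst z) (snd z))" and v: "sqint N (\<lambda>z. v (fst z) (snd z))"
  shows "hat_product u v k \<in> borel_measurable borel"
  using sqint_mult_integrable[OF sqint_hat[OF u] sqint_cnj[OF sqint_hat[OF v]], of k k]
  by (auto simp: hat_product_def[abs_def] dest: borel_measurable_integrable)

lemma hat_product_integrable:
  assumes u: "sqint N (\<lambda>z. u (fst z) (snd z))" and v: "sqint N (\<lambda>z. v (fst z) (snd z))"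
  shows "integrable CL (\<lambda>y. hat_product u v (fst y) (snd y))"
  unfolding hat_product_def by (rule sqint_mult_integrable[OF sqint_hat_CL[OF u] sqint_cnj[OF sqint_hat_CL[OF v]]])

lemma exp_hat_product_integrable:
  assumes u: "sqint N (\<lambda>z. u (fst z) (snd z))" and v: "sqint N (\<lambda>z. v (fst z) (snd z))" and \<tau>: "0 \<le> \<tau>"
  shows "integrable CL (\<lambda>y. exp (- complex_of_real \<tau> * Z (fst y) (snd y)) * hat_product u v (fst y) (snd y))"
proof (rule Bochner_Integration.integrable_bound[OF hat_product_integrable[OF u v]])
  note [measurable] = hat_product_measurable[OF u v]
  show "(\<lambda>y. exp (- complex_of_real \<tau> * Z (fst y) (snd y)) * hat_product u v (fst y) (snd y)) \<in> borel_measurable CL"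
    by (rule measurable_pair_measure_countable1) auto
  show "AE y in CL. norm (exp (- complex_of_real \<tau> * Z (fst y) (snd y)) * hat_product u v (fst y) (snd y)) \<le> norm (hat_product u v (fst y) (snd y))"
    using \<tau> lam_nonneg by (intro AE_I2) (auto simp: norm_mult norm_exp_eq_Re intro!: mult_left_le_one_le)
qed

text \<open>This is \<open>\<langle>u - exp (- \<tau> H) u, v\<rangle>\<close>, computed on the Fourier side.\<close>
lemma integral_CL_semigroup:
  assumes u: "sqint N (\<lambda>z. u (fst z) (snd z))" and v: "sqint N (\<lambda>z. v (fst z) (snd z))" and \<tau>: "0 < \<tau>"
  shows "(\<integral>y. (1 - exp (- complex_of_real \<tau> * Z (fst y) (snd y))) * hat_product u v (fst y) (snd y) \<partial>CL)
    = complex_of_real ((\<integral>z. u (fst z) (snd z) * v (fst z) (snd z) \<partial>N)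
        - (\<integral>y. WT \<tau> y * (u (fst y - \<tau>) (snd (snd y)) * v (fst y) (fst (snd y))) \<partial>T))"
proof -
  have 1: "(\<integral>y. hat_product u v (fst y) (snd y) \<partial>CL) = complex_of_real (\<integral>z. u (fst z) (snd z) * v (fst z) (snd z) \<partial>N)"
  proof (rule sums_unique2)
    show "(\<lambda>k. \<integral>\<rho>. hat_product u v k \<rho> \<partial>lborel) sums (\<integral>y. hat_product u v (fst y) (snd y) \<partial>CL)"
      by (rule integral_count_lborel_sums[OF hat_product_integrable[OF u v]])
    have "(\<integral>\<rho>. hat_product u v k \<rho> \<partial>lborel) = complex_of_real (\<integral>t. coef \<Omega> \<phi> u k t * coef \<Omega> \<phi> v k t \<partial>lborel)" for k
      using Parseval_hat[OF u v, of 0 k] by (simp add: hat_product_def)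
    then show "(\<lambda>k. \<integral>\<rho>. hat_product u v k \<rho> \<partial>lborel) sums complex_of_real (\<integral>z. u (fst z) (snd z) * v (fst z) (snd z) \<partial>N)"
      using sums_of_real[OF integral_N_sums[OF u v]] by simp
  qed
  have 2: "(\<integral>y. exp (- complex_of_real \<tau> * Z (fst y) (snd y)) * hat_product u v (fst y) (snd y) \<partial>CL)
      = complex_of_real (\<integral>y. WT \<tau> y * (u (fst y - \<tau>) (snd (snd y)) * v (fst y) (fst (snd y))) \<partial>T)"
  proof (rule sums_unique2)
    show "(\<lambda>k. \<integral>\<rho>. exp (- complex_of_real \<tau> * Z k \<rho>) * hat_product u v k \<rho> \<partial>lborel) sums
        (\<integral>y. exp (- complex_of_real \<tau> * Z (fst y) (snd y)) * hat_product u v (fst y) (snd y) \<partial>CL)"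
      using \<tau> by (intro integral_count_lborel_sums[where f = "\<lambda>k \<rho>. exp (- complex_of_real \<tau> * Z k \<rho>) * hat_product u v k \<rho>"] exp_hat_product_integrable[OF u v]) simp
    have "(\<integral>\<rho>. exp (- complex_of_real \<tau> * Z k \<rho>) * hat_product u v k \<rho> \<partial>lborel)
        = complex_of_real (exp (- \<tau> * lam k) * (\<integral>t. coef \<Omega> \<phi> (\<lambda>t. u (t - \<tau>)) k t * coef \<Omega> \<phi> v k t \<partial>lborel))" for k
    proof -
      have "exp (- complex_of_real \<tau> * Z k \<rho>) * hat_product u v k \<rho> = complex_of_real (exp (- \<tau> * lam k)) *
          (exp (- \<i> * complex_of_real (\<rho> * \<tau>)) * hat \<Omega> \<phi> u k \<rho> * cnj (hat \<Omega> \<phi> v k \<rho>))" for \<rho>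
      proof -
        \<comment> \<open>The real part of the exponent is the damping of the semigroup, the
          imaginary part the modulation that shifts time by \<tau>.\<close>
        have "- complex_of_real \<tau> * Z k \<rho> = complex_of_real (- \<tau> * lam k) + (- \<i> * complex_of_real (\<rho> * \<tau>))"
          by (simp add: algebra_simps)
        then have "exp (- complex_of_real \<tau> * Z k \<rho>) = complex_of_real (exp (- \<tau> * lam k)) * exp (- \<i> * complex_of_real (\<rho> * \<tau>))"
          by (simp only: exp_add exp_of_real)
        then show ?thesis by (simp only: hat_product_def mult.assoc)
      qed
      then show ?thesis
        by (simp only: integral_mult_right_zero Parseval_hat[OF u v, unfolded of_real_mult] of_real_mult coef_translate)
    qed
    then show "(\<lambda>k. \<integral>\<rho>. exp (- complex_of_real \<tau> * Z k \<rho>) * hat_product u v k \<rho> \<partial>lborel) sums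
        complex_of_real (\<integral>y. WT \<tau> y * (u (fst y - \<tau>) (snd (snd y)) * v (fst y) (fst (snd y))) \<partial>T)"
      using sums_of_real[OF integral_T_XZ_sums[OF \<tau> sqint_N_translate(1)[OF u] v]] by simp
  qed
  have "(\<integral>y. (1 - exp (- complex_of_real \<tau> * Z (fst y) (snd y))) * hat_product u v (fst y) (snd y) \<partial>CL)
      = (\<integral>y. hat_product u v (fst y) (snd y) - exp (- complex_of_real \<tau> * Z (fst y) (snd y)) * hat_product u v (fst y) (snd y) \<partial>CL)"
    by (simp only: left_diff_distrib mult_1)
  also have "\<dots> = (\<integral>y. hat_product u v (fst y) (snd y) \<partial>CL) - (\<integral>y. exp (- complex_of_real \<tau> * Z (fst y) (snd y)) * hat_product u v (fst y) (snd y) \<partial>CL)"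
    using \<tau> by (intro Bochner_Integration.integral_diff hat_product_integrable[OF u v] exp_hat_product_integrable[OF u v]) simp
  finally show ?thesis unfolding 1 2 by simp
qed

lemma fin_energy_CL:
  assumes u: "sqint N (\<lambda>z. u (fst z) (snd z))" and e: "fin_energy s u"
  shows "(\<integral>\<^sup>+y. ennreal (cmod (Z (fst y) (snd y)) powr s * (cmod (hat \<Omega> \<phi> u (fst y) (snd y)))\<^sup>2) \<partial>CL) < \<infinity>"
proof -
  note [measurable] = hat_measurable[OF u]
  have "(\<integral>\<^sup>+y. ennreal (cmod (Z (fst y) (snd y)) powr s * (cmod (hat \<Omega> \<phi> u (fst y) (snd y)))\<^sup>2) \<partial>CL)
      = (\<integral>\<^sup>+\<rho>. (\<Sum>k. ennreal (cmod (Z k \<rho>) powr s * (cmod (hat \<Omega> \<phi> u k \<rho>))\<^sup>2)) \<partial>lborel)"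
    by (rule nn_integral_count_lborel(2)) measurable
  then show ?thesis using e by (simp add: fin_energy_def)
qed

lemma sigma_finite_CL: "sigma_finite_measure CL"
  by (intro sigma_finite_pair_measure sigma_finite_measure_count_space lborel.sigma_finite_measure_axioms)

text \<open>Fubini on lag, index and frequency. For fixed \<open>k\<close> and \<rho> the lag
  integral of the modulus of \<open>frac_integrand\<close> is at most a multiple of
  \<open>cmod (Z k \<rho>) powr s\<close>, so finite energy of \<open>u\<close> and \<open>v\<close>
  gives absolute integrability. One order of integration yields the integral over \<tau>; in the
  other the inner integral is evaluated by \<open>frac_power_integral\<close>.\<close>

lemma
  assumes s: "0 < s" "s < 1"
    and u: "sqint N (\<lambda>z. u (fst z) (snd z))" and v: "sqint N (\<lambda>z. v (fst z) (snd z))"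
    and eu: "fin_energy s u" and ev: "fin_energy s v"
  shows total_integrable: "integrable lborel (\<lambda>\<tau>. \<integral>y. frac_integrand s (Z (fst y) (snd y)) \<tau> * (complex_of_real (1 / \<bar>Gamma (- s)\<bar>) * hat_product u v (fst y) (snd y)) \<partial>CL)"
    and total_integral: "(\<integral>\<tau>. \<integral>y. frac_integrand s (Z (fst y) (snd y)) \<tau> * (complex_of_real (1 / \<bar>Gamma (- s)\<bar>) * hat_product u v (fst y) (snd y)) \<partial>CL \<partial>lborel) = Hs_pair \<Omega> lam \<phi> s u v"
proof -
  interpret P: pair_sigma_finite lborel CL
    by (intro pair_sigma_finite.intro sigma_finite_CL lborel.sigma_finite_measure_axioms)
  note [measurable] = hat_product_measurable[OF u v]
  define \<kappa> where "\<kappa> = complex_of_real (1 / \<bar>Gamma (- s)\<bar>)"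
  define \<Psi> where "\<Psi> \<tau> y = frac_integrand s (Z (fst y) (snd y)) \<tau> * (\<kappa> * hat_product u v (fst y) (snd y))" for \<tau> y
  have Re_Z: "0 \<le> Re (Z k \<rho>)" for k \<rho> using lam_nonneg[of k] by simp
  have Zm [measurable]: "(\<lambda>y. Z (fst y) (snd y)) \<in> borel_measurable CL"
    by (rule measurable_pair_measure_countable1) auto
  have Am [measurable]: "(\<lambda>y. hat_product u v (fst y) (snd y)) \<in> borel_measurable CL"
    by (rule measurable_pair_measure_countable1) auto
  have km [measurable]: "(\<lambda>w. frac_kernel s (fst w)) \<in> borel_measurable (lborel \<Otimes>\<^sub>M CL)"
    by (rule measurable_compose[OF measurable_fst]) simp
  have \<Psi>m [measurable]: "(\<lambda>w. \<Psi> (fst w) (snd w)) \<in> borel_measurable (lborel \<Otimes>\<^sub>M CL)"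
  proof -
    have "(\<lambda>w. Z (fst (snd w)) (snd (snd w))) \<in> borel_measurable (lborel \<Otimes>\<^sub>M CL)"
      "(\<lambda>w. hat_product u v (fst (snd w)) (snd (snd w))) \<in> borel_measurable (lborel \<Otimes>\<^sub>M CL)"
      using measurable_compose[OF measurable_snd Zm] measurable_compose[OF measurable_snd Am] by auto
    then show ?thesis unfolding \<Psi>_def frac_integrand_def by measurable
  qed
  have G0: "0 < \<bar>Gamma (- s)\<bar>" using s by (simp add: abs_Gamma_neg)
  have int: "integrable (lborel \<Otimes>\<^sub>M CL) (\<lambda>w. \<Psi> (fst w) (snd w))"
  proof (rule integrableI_bounded[OF \<Psi>m])
    have [measurable]: "(\<lambda>w. ennreal (norm (\<Psi> (fst w) (snd w)))) \<in> borel_measurable (lborel \<Otimes>\<^sub>M CL)" by measurable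
    have "(\<integral>\<^sup>+w. ennreal (norm (\<Psi> (fst w) (snd w))) \<partial>(lborel \<Otimes>\<^sub>M CL)) = (\<integral>\<^sup>+y. \<integral>\<^sup>+\<tau>. ennreal (norm (\<Psi> \<tau> y)) \<partial>lborel \<partial>CL)"
      by (subst P.nn_integral_snd[symmetric]) simp_all
    also have "\<dots> \<le> (\<integral>\<^sup>+y. ennreal 4 * (ennreal (cmod (Z (fst y) (snd y)) powr s * (cmod (hat \<Omega> \<phi> u (fst y) (snd y)))\<^sup>2)
        + ennreal (cmod (Z (fst y) (snd y)) powr s * (cmod (hat \<Omega> \<phi> v (fst y) (snd y)))\<^sup>2)) \<partial>CL)"
    proof (rule nn_integral_mono)
      fix y :: "nat \<times> real"
      obtain k \<rho> where y: "y = (k, \<rho>)" by (cases y)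
      define c where "c = norm (\<kappa> * hat_product u v k \<rho>)"
      have "(\<integral>\<^sup>+\<tau>. ennreal (norm (\<Psi> \<tau> y)) \<partial>lborel) = (\<integral>\<^sup>+\<tau>. ennreal (norm (frac_integrand s (Z k \<rho>) \<tau>)) * ennreal c \<partial>lborel)"
        by (intro nn_integral_cong) (simp add: \<Psi>_def y norm_mult c_def ennreal_mult mult.assoc)
      also have "\<dots> = (\<integral>\<^sup>+\<tau>. ennreal (norm (frac_integrand s (Z k \<rho>) \<tau>)) \<partial>lborel) * ennreal c"
        by (rule nn_integral_multc) simp
      also have "\<dots> \<le> ennreal (4 * \<bar>Gamma (- s)\<bar> * cmod (Z k \<rho>) powr s) * ennreal c"
        by (intro mult_right_mono nn_integral_norm_frac_integrand_le[OF s Re_Z]) simp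
      also have "\<dots> = ennreal (4 * \<bar>Gamma (- s)\<bar> * cmod (Z k \<rho>) powr s * c)"
        by (rule ennreal_mult[symmetric]) (simp_all add: c_def)
      also have "4 * \<bar>Gamma (- s)\<bar> * cmod (Z k \<rho>) powr s * c = 4 * (cmod (Z k \<rho>) powr s * (cmod (hat \<Omega> \<phi> u k \<rho>) * cmod (hat \<Omega> \<phi> v k \<rho>)))"
        using G0 by (simp add: c_def \<kappa>_def hat_product_def norm_mult norm_divide)
      also have "\<dots> \<le> 4 * (cmod (Z k \<rho>) powr s * ((cmod (hat \<Omega> \<phi> u k \<rho>))\<^sup>2 + (cmod (hat \<Omega> \<phi> v k \<rho>))\<^sup>2))"
        using abs_mult_le_sq[of "cmod (hat \<Omega> \<phi> u k \<rho>)" "cmod (hat \<Omega> \<phi> v k \<rho>)"]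
        by (intro mult_left_mono) auto
      finally have "(\<integral>\<^sup>+\<tau>. ennreal (norm (\<Psi> \<tau> y)) \<partial>lborel) \<le> ennreal (4 * (cmod (Z k \<rho>) powr s * ((cmod (hat \<Omega> \<phi> u k \<rho>))\<^sup>2 + (cmod (hat \<Omega> \<phi> v k \<rho>))\<^sup>2)))"
        by (simp add: ennreal_leI)
      also have "\<dots> = ennreal 4 * (ennreal (cmod (Z k \<rho>) powr s * (cmod (hat \<Omega> \<phi> u k \<rho>))\<^sup>2)
        + ennreal (cmod (Z k \<rho>) powr s * (cmod (hat \<Omega> \<phi> v k \<rho>))\<^sup>2))"
        by (subst distrib_left[of "cmod (Z k \<rho>) powr s"], rule ennreal_mult_plus) auto
      finally show "(\<integral>\<^sup>+\<tau>. ennreal (norm (\<Psi> \<tau> y)) \<partial>lborel) \<le> ennreal 4 * (ennreal (cmod (Z (fst y) (snd y)) powr s * (cmod (hat \<Omega> \<phi> u (fst y) (snd y)))\<^sup>2)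
        + ennreal (cmod (Z (fst y) (snd y)) powr s * (cmod (hat \<Omega> \<phi> v (fst y) (snd y)))\<^sup>2))" by (simp add: y)
    qed
    also have "\<dots> = ennreal 4 * ((\<integral>\<^sup>+y. ennreal (cmod (Z (fst y) (snd y)) powr s * (cmod (hat \<Omega> \<phi> u (fst y) (snd y)))\<^sup>2) \<partial>CL)
        + (\<integral>\<^sup>+y. ennreal (cmod (Z (fst y) (snd y)) powr s * (cmod (hat \<Omega> \<phi> v (fst y) (snd y)))\<^sup>2) \<partial>CL))"
    proof -
      have [measurable]: "(\<lambda>y. hat \<Omega> \<phi> u (fst y) (snd y)) \<in> borel_measurable CL" "(\<lambda>y. hat \<Omega> \<phi> v (fst y) (snd y)) \<in> borel_measurable CL"
        using sqint_hat_CL[OF u] sqint_hat_CL[OF v] by (auto simp: sqint_def)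
      show ?thesis by (subst nn_integral_cmult, measurable, subst nn_integral_add) measurable
    qed
    also have "\<dots> < \<infinity>"
      using fin_energy_CL[OF u eu] fin_energy_CL[OF v ev] by (simp add: ennreal_mult_less_top)
    finally show "(\<integral>\<^sup>+w. ennreal (norm (\<Psi> (fst w) (snd w))) \<partial>(lborel \<Otimes>\<^sub>M CL)) < \<infinity>" .
  qed
  then have int': "integrable (lborel \<Otimes>\<^sub>M CL) (case_prod \<Psi>)" by (simp add: case_prod_beta')
  have "integrable lborel (\<lambda>\<tau>. \<integral>y. \<Psi> \<tau> y \<partial>CL)" using P.integrable_fst'[OF int] by simp
  then show "integrable lborel (\<lambda>\<tau>. \<integral>y. frac_integrand s (Z (fst y) (snd y)) \<tau> * (complex_of_real (1 / \<bar>Gamma (- s)\<bar>) * hat_product u v (fst y) (snd y)) \<partial>CL)"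
    by (simp only: \<Psi>_def \<kappa>_def)
  define K where "K k \<rho> = (\<integral>\<tau>. \<Psi> \<tau> (k, \<rho>) \<partial>lborel)" for k \<rho>
  have K_int: "integrable CL (\<lambda>y. K (fst y) (snd y))"
    using P.integrable_snd[OF int'] by (simp add: K_def)
  have Km: "K k \<in> borel_measurable borel" for k
    using measurable_compose[OF measurable_Pair1'[of k "count_space UNIV" lborel] borel_measurable_integrable[OF K_int]] by simp
  \<comment> \<open>The spectral point \<open>Z k \<rho>\<close> can vanish only at
    \<open>\<rho> = 0\<close>, which is a null set.\<close>
  have K_eq: "K k \<rho> = Z k \<rho> powr complex_of_real s * hat \<Omega> \<phi> u k \<rho> * cnj (hat \<Omega> \<phi> v k \<rho>)" if "\<rho> \<noteq> 0" for k \<rho>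
  proof -
    have "Z k \<rho> \<noteq> 0" using that by (simp add: complex_eq_iff)
    have "K k \<rho> = (\<integral>\<tau>. frac_integrand s (Z k \<rho>) \<tau> \<partial>lborel) * (\<kappa> * hat_product u v k \<rho>)"
      unfolding K_def \<Psi>_def fst_conv snd_conv by (rule integral_mult_left_zero)
    also have "(\<integral>\<tau>. frac_integrand s (Z k \<rho>) \<tau> \<partial>lborel) = complex_of_real \<bar>Gamma (- s)\<bar> * Z k \<rho> powr complex_of_real s"
      by (rule frac_power_integral[OF s Re_Z \<open>Z k \<rho> \<noteq> 0\<close>])
    also have "complex_of_real \<bar>Gamma (- s)\<bar> * Z k \<rho> powr complex_of_real s * (\<kappa> * hat_product u v k \<rho>)
       = (complex_of_real \<bar>Gamma (- s)\<bar> * \<kappa>) * (Z k \<rho> powr complex_of_real s * hat_product u v k \<rho>)" by (simp only: mult_ac)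
    also have "complex_of_real \<bar>Gamma (- s)\<bar> * \<kappa> = 1"
      unfolding \<kappa>_def of_real_mult[symmetric] using G0 by simp
    finally show ?thesis by (simp only: hat_product_def mult_1 mult.assoc)
  qed
  have "(\<integral>\<tau>. \<integral>y. \<Psi> \<tau> y \<partial>CL \<partial>lborel) = integral\<^sup>L (lborel \<Otimes>\<^sub>M CL) (case_prod \<Psi>)"
    using P.integral_fst'[OF int'] by simp
  also have "\<dots> = (\<integral>y. K (fst y) (snd y) \<partial>CL)" using P.integral_snd[OF int'] by (simp add: K_def)
  also have "\<dots> = (\<integral>\<rho>. (\<Sum>k. K k \<rho>) \<partial>lborel)" by (rule integral_count_lborel_suminf[OF K_int Km, symmetric])
  also have "\<dots> = (\<integral>\<rho>. (\<Sum>k. Z k \<rho> powr complex_of_real s * hat \<Omega> \<phi> u k \<rho> * cnj (hat \<Omega> \<phi> v k \<rho>)) \<partial>lborel)"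
  proof (rule integral_cong_AE)
    note [measurable] = Km hat_measurable[OF u] hat_measurable[OF v]
    show "(\<lambda>\<rho>. \<Sum>k. K k \<rho>) \<in> borel_measurable lborel" by measurable
    have "(\<lambda>\<rho>. Z k \<rho> powr complex_of_real s * hat \<Omega> \<phi> u k \<rho> * cnj (hat \<Omega> \<phi> v k \<rho>)) \<in> borel_measurable lborel" for k
    proof -
      \<comment> \<open>Away from one point the target function equals \<open>K k\<close>, which
        gives its measurability without a separate study of the complex power.\<close>
      have "(\<lambda>\<rho>. if \<rho> = 0 then Z k 0 powr complex_of_real s * hat \<Omega> \<phi> u k 0 * cnj (hat \<Omega> \<phi> v k 0) else K k \<rho>) \<in> borel_measurable lborel"
        by measurable
      also have "(\<lambda>\<rho>. if \<rho> = 0 then Z k 0 powr complex_of_real s * hat \<Omega> \<phi> u k 0 * cnj (hat \<Omega> \<phi> v k 0) else K k \<rho>)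
        = (\<lambda>\<rho>. Z k \<rho> powr complex_of_real s * hat \<Omega> \<phi> u k \<rho> * cnj (hat \<Omega> \<phi> v k \<rho>))"
        by (rule ext) (simp add: K_eq del: of_real_mult)
      finally show ?thesis .
    qed
    then show "(\<lambda>\<rho>. \<Sum>k. Z k \<rho> powr complex_of_real s * hat \<Omega> \<phi> u k \<rho> * cnj (hat \<Omega> \<phi> v k \<rho>)) \<in> borel_measurable lborel"
      by (rule borel_measurable_suminf)
    show "AE \<rho> in lborel. (\<Sum>k. K k \<rho>) = (\<Sum>k. Z k \<rho> powr complex_of_real s * hat \<Omega> \<phi> u k \<rho> * cnj (hat \<Omega> \<phi> v k \<rho>))"
      using AE_lborel_singleton[of 0] by eventually_elim (simp only: K_eq not_False_eq_True)
  qed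
  finally show "(\<integral>\<tau>. \<integral>y. frac_integrand s (Z (fst y) (snd y)) \<tau> * (complex_of_real (1 / \<bar>Gamma (- s)\<bar>) * hat_product u v (fst y) (snd y)) \<partial>CL \<partial>lborel) = Hs_pair \<Omega> lam \<phi> s u v"
    by (simp only: \<Psi>_def \<kappa>_def Hs_pair_def)
qed

section \<open>Integrability and measurability in the lag\<close>

definition energy_series :: "(real \<Rightarrow> real^'n \<Rightarrow> real) \<Rightarrow> real \<Rightarrow> real" where
  "energy_series u \<tau> = (\<Sum>k. (1 - exp (- \<tau> * lam k)) * coef_energy u k)"

text \<open>Tonelli term by term: the lag integral of the \<open>k\<close>-th term is
  \<open>\<bar>Gamma (- s)\<bar> * (lam k powr s * coef_energy u k)\<close>, and
  \<open>lam k \<le> cmod (Z k \<rho>)\<close> bounds the sum by the energy of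
  \<open>u\<close>.\<close>

lemma energy_series_integrable:
  assumes s: "0 < s" "s < 1" and u: "sqint N (\<lambda>z. u (fst z) (snd z))" and e: "fin_energy s u"
  shows "integrable lborel (\<lambda>\<tau>. frac_kernel s \<tau> * energy_series u \<tau>)"
proof (rule integrableI_bounded)
  have nn: "0 \<le> frac_kernel s \<tau> * ((1 - exp (- \<tau> * lam k)) * coef_energy u k)" for \<tau> k
    using lam_nonneg[of k] coef_energy_nonneg[of u k] by (cases "0 < \<tau>") auto
  have sm: "summable (\<lambda>k. (1 - exp (- \<tau> * lam k)) * coef_energy u k)" if "0 < \<tau>" for \<tau> by (rule energy_le(2)[OF that u])
  have "(\<integral>\<^sup>+\<tau>. ennreal (norm (frac_kernel s \<tau> * energy_series u \<tau>)) \<partial>lborel)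
      = (\<integral>\<^sup>+\<tau>. (\<Sum>k. ennreal (frac_kernel s \<tau> * ((1 - exp (- \<tau> * lam k)) * coef_energy u k))) \<partial>lborel)"
  proof (rule nn_integral_cong)
    fix \<tau> :: real
    show "ennreal (norm (frac_kernel s \<tau> * energy_series u \<tau>)) = (\<Sum>k. ennreal (frac_kernel s \<tau> * ((1 - exp (- \<tau> * lam k)) * coef_energy u k)))"
    proof (cases "0 < \<tau>")
      case True
      have "(\<Sum>k. ennreal (frac_kernel s \<tau> * ((1 - exp (- \<tau> * lam k)) * coef_energy u k))) = ennreal (\<Sum>k. frac_kernel s \<tau> * ((1 - exp (- \<tau> * lam k)) * coef_energy u k))"
        by (rule suminf_ennreal2[OF nn summable_mult[OF sm[OF True]]])
      also have "(\<Sum>k. frac_kernel s \<tau> * ((1 - exp (- \<tau> * lam k)) * coef_energy u k)) = frac_kernel s \<tau> * energy_series u \<tau>"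
        unfolding energy_series_def by (rule suminf_mult[OF sm[OF True]])
      moreover have "0 \<le> energy_series u \<tau>"
        unfolding energy_series_def using True lam_nonneg coef_energy_nonneg by (intro suminf_nonneg sm) auto
      ultimately show ?thesis by (simp add: abs_mult)
    qed simp
  qed
  also have "\<dots> = (\<Sum>k. \<integral>\<^sup>+\<tau>. ennreal (frac_kernel s \<tau> * ((1 - exp (- \<tau> * lam k)) * coef_energy u k)) \<partial>lborel)"
    by (rule nn_integral_suminf) measurable
  also have "\<dots> = (\<Sum>k. ennreal \<bar>Gamma (- s)\<bar> * ennreal (lam k powr s * coef_energy u k))"
  proof (rule suminf_cong)
    fix k
    have "(\<integral>\<^sup>+\<tau>. ennreal (frac_kernel s \<tau> * ((1 - exp (- \<tau> * lam k)) * coef_energy u k)) \<partial>lborel)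
        = (\<integral>\<^sup>+\<tau>. ennreal (coef_energy u k) * ennreal ((1 - exp (- \<tau> * lam k)) * frac_kernel s \<tau>) \<partial>lborel)"
      by (intro nn_integral_cong) (simp add: ennreal_mult'[OF coef_energy_nonneg, symmetric] mult_ac)
    also have "\<dots> = ennreal (coef_energy u k) * (\<integral>\<^sup>+\<tau>. ennreal ((1 - exp (- \<tau> * lam k)) * frac_kernel s \<tau>) \<partial>lborel)"
      by (rule nn_integral_cmult) measurable
    also have "\<dots> = ennreal (coef_energy u k) * ennreal (\<bar>Gamma (- s)\<bar> * lam k powr s)"
      by (simp only: nn_integral_frac_kernel[OF s lam_nonneg])
    also have "\<dots> = ennreal \<bar>Gamma (- s)\<bar> * ennreal (lam k powr s * coef_energy u k)"
      using coef_energy_nonneg[of u k] by (simp add: ennreal_mult[symmetric] mult_ac)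
    finally show "(\<integral>\<^sup>+\<tau>. ennreal (frac_kernel s \<tau> * ((1 - exp (- \<tau> * lam k)) * coef_energy u k)) \<partial>lborel) = ennreal \<bar>Gamma (- s)\<bar> * ennreal (lam k powr s * coef_energy u k)" .
  qed
  also have "\<dots> = ennreal \<bar>Gamma (- s)\<bar> * (\<Sum>k. ennreal (lam k powr s * coef_energy u k))" by (rule ennreal_suminf_cmult)
  also have "\<dots> < \<infinity>"
  proof -
    note [measurable] = hat_measurable[OF u]
    have "(\<Sum>k. ennreal (lam k powr s * coef_energy u k)) \<le> (\<Sum>k. \<integral>\<^sup>+\<rho>. ennreal (cmod (Z k \<rho>) powr s * (cmod (hat \<Omega> \<phi> u k \<rho>))\<^sup>2) \<partial>lborel)"
    proof (intro suminf_le allI)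
      fix k
      have "ennreal (lam k powr s * coef_energy u k) = ennreal (lam k powr s) * (\<integral>\<^sup>+\<rho>. ennreal ((cmod (hat \<Omega> \<phi> u k \<rho>))\<^sup>2) \<partial>lborel)"
        by (simp add: nn_integral_hat[OF u] ennreal_mult coef_energy_nonneg)
      also have "\<dots> = (\<integral>\<^sup>+\<rho>. ennreal (lam k powr s) * ennreal ((cmod (hat \<Omega> \<phi> u k \<rho>))\<^sup>2) \<partial>lborel)"
        by (rule nn_integral_cmult[symmetric]) measurable
      also have "\<dots> \<le> (\<integral>\<^sup>+\<rho>. ennreal (cmod (Z k \<rho>) powr s * (cmod (hat \<Omega> \<phi> u k \<rho>))\<^sup>2) \<partial>lborel)"
      proof (rule nn_integral_mono)
        fix \<rho>
        have "lam k \<le> cmod (Z k \<rho>)" using complex_Re_le_cmod[of "Z k \<rho>"] by simp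
        then have "lam k powr s \<le> cmod (Z k \<rho>) powr s" using s lam_nonneg by (intro powr_mono2) auto
        then show "ennreal (lam k powr s) * ennreal ((cmod (hat \<Omega> \<phi> u k \<rho>))\<^sup>2) \<le> ennreal (cmod (Z k \<rho>) powr s * (cmod (hat \<Omega> \<phi> u k \<rho>))\<^sup>2)"
          by (simp add: ennreal_mult[symmetric] ennreal_leI mult_right_mono)
      qed
      finally show "ennreal (lam k powr s * coef_energy u k) \<le> (\<integral>\<^sup>+\<rho>. ennreal (cmod (Z k \<rho>) powr s * (cmod (hat \<Omega> \<phi> u k \<rho>))\<^sup>2) \<partial>lborel)" .
    qed auto
    also have "\<dots> = (\<integral>\<^sup>+\<rho>. (\<Sum>k. ennreal (cmod (Z k \<rho>) powr s * (cmod (hat \<Omega> \<phi> u k \<rho>))\<^sup>2)) \<partial>lborel)"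
      by (rule nn_integral_suminf[symmetric]) measurable
    also have "\<dots> < \<infinity>" using e by (simp add: fin_energy_def)
    finally show ?thesis by (simp add: ennreal_mult_less_top)
  qed
  finally show "(\<integral>\<^sup>+\<tau>. ennreal (norm (frac_kernel s \<tau> * energy_series u \<tau>)) \<partial>lborel) < \<infinity>" .
qed (simp add: energy_series_def[abs_def])

text \<open>Measurability in \<tau> is taken from the eigenfunction series, each term of which is
  explicit in the lag. The indicator confines the claim to positive lags, where the expansion
  holds.\<close>

lemma XZ_measurable:
  assumes u: "sqint N (\<lambda>z. u (fst z) (snd z))" and v: "sqint N (\<lambda>z. v (fst z) (snd z))"
  shows "(\<lambda>\<tau>. indicator {0<..} \<tau> * (\<integral>y. WT \<tau> y * (u (fst y - \<tau>) (snd (snd y)) * v (fst y) (fst (snd y))) \<partial>T)) \<in> borel_measurable borel"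
proof -
  note [measurable] = coef_measurable[OF u] coef_measurable[OF v]
  have "(\<lambda>\<tau>. \<integral>t. coef \<Omega> \<phi> u k (t - \<tau>) * coef \<Omega> \<phi> v k t \<partial>lborel) \<in> borel_measurable borel" for k
    by (rule lborel.borel_measurable_lebesgue_integral) measurable
  then have "(\<lambda>\<tau>. indicator {0<..} \<tau> * (\<Sum>k. exp (- \<tau> * lam k) * (\<integral>t. coef \<Omega> \<phi> u k (t - \<tau>) * coef \<Omega> \<phi> v k t \<partial>lborel))) \<in> borel_measurable borel"
    by (intro borel_measurable_times borel_measurable_suminf borel_measurable_exp) auto
  also have "(\<lambda>\<tau>. indicator {0<..} \<tau> * (\<Sum>k. exp (- \<tau> * lam k) * (\<integral>t. coef \<Omega> \<phi> u k (t - \<tau>) * coef \<Omega> \<phi> v k t \<partial>lborel)))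
    = (\<lambda>\<tau>. indicator {0<..} \<tau> * (\<integral>y. WT \<tau> y * (u (fst y - \<tau>) (snd (snd y)) * v (fst y) (fst (snd y))) \<partial>T))"
  proof (rule ext)
    fix \<tau> :: real
    show "indicator {0<..} \<tau> * (\<Sum>k. exp (- \<tau> * lam k) * (\<integral>t. coef \<Omega> \<phi> u k (t - \<tau>) * coef \<Omega> \<phi> v k t \<partial>lborel))
      = indicator {0<..} \<tau> * (\<integral>y. WT \<tau> y * (u (fst y - \<tau>) (snd (snd y)) * v (fst y) (fst (snd y))) \<partial>T)"
    proof (cases "0 < \<tau>")
      case True
      from integral_T_XZ_sums[OF True sqint_N_translate(1)[OF u] v] show ?thesis by (simp add: sums_iff coef_translate)
    qed simp
  qed
  finally show ?thesis .
qed

definition trunc :: "nat \<Rightarrow> (real \<Rightarrow> real^'n \<Rightarrow> real) \<Rightarrow> real \<Rightarrow> real^'n \<Rightarrow> real" where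
  "trunc n u t x = (if \<bar>t\<bar> \<le> real n \<and> \<bar>u t x\<bar> \<le> real n then u t x else 0)"

lemma trunc_measurable:
  assumes [measurable]: "(\<lambda>z. u (fst z) (snd z)) \<in> borel_measurable N"
  shows "(\<lambda>z. trunc n u (fst z) (snd z)) \<in> borel_measurable N"
  unfolding trunc_def by measurable

lemma trunc_le: "\<bar>trunc n u t x\<bar> \<le> \<bar>u t x\<bar>" "\<bar>trunc n u t x\<bar> \<le> real n * indicator {- real n..real n} t"
  by (auto simp: trunc_def indicator_def abs_le_iff)

lemma trunc_tendsto: "(\<lambda>n. trunc n u t x) \<longlonglongrightarrow> u t x"
proof (rule tendsto_eventually)
  show "\<forall>\<^sub>F n in sequentially. trunc n u t x = u t x"
    using eventually_ge_at_top[of "nat \<lceil>\<bar>t\<bar> + \<bar>u t x\<bar>\<rceil>"]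
  proof eventually_elim
    case (elim n)
    then have "\<bar>t\<bar> + \<bar>u t x\<bar> \<le> real n" by linarith
    then show ?case by (auto simp: trunc_def)
  qed
qed

lemma sqint_trunc:
  assumes u: "sqint N (\<lambda>z. u (fst z) (snd z))"
  shows "sqint N (\<lambda>z. trunc n u (fst z) (snd z))"
proof (rule sqint_bound[OF _ sqint_integrable[OF u]])
  show "(\<lambda>z. trunc n u (fst z) (snd z)) \<in> borel_measurable N" using u by (intro trunc_measurable) (simp add: sqint_def)
  show "AE z in N. (norm (trunc n u (fst z) (snd z)))\<^sup>2 \<le> (norm (u (fst z) (snd z)))\<^sup>2"
    using trunc_le(1) by (intro AE_I2 power_mono) auto
qed

text \<open>Only for bounded data with bounded support in time can \<open>h \<tau>\<close> be paired through its \<open>L\<^sup>2\<close> expansion;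
  joint measurability of \<open>h\<close> in \<open>(\<tau>, x)\<close> is not available.\<close>
lemma XX_trunc_measurable:
  assumes u: "sqint N (\<lambda>z. u (fst z) (snd z))" and v: "sqint N (\<lambda>z. v (fst z) (snd z))"
  shows "(\<lambda>\<tau>. indicator {0<..} \<tau> * (\<integral>z. h \<tau> (snd z) * (trunc n u (fst z - \<tau>) (snd z) * trunc n v (fst z) (snd z)) \<partial>N)) \<in> borel_measurable borel"
proof -
  \<comment> \<open>The time integral is taken before the space integral, which leaves the pairing
    of \<open>h \<tau>\<close> with \<open>g \<tau>\<close> in space. Truncation keeps
    \<open>g \<tau>\<close> bounded, hence square integrable.\<close>
  define g where "g \<tau> x = (\<integral>t. trunc n u (t - \<tau>) x * trunc n v t x \<partial>lborel)" for \<tau> x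
  have um: "(\<lambda>z. trunc n u (fst z) (snd z)) \<in> borel_measurable N" and vm: "(\<lambda>z. trunc n v (fst z) (snd z)) \<in> borel_measurable N"
    using sqint_trunc[OF u] sqint_trunc[OF v] by (auto simp: sqint_def)
  have gm: "(\<lambda>w. g (fst w) (snd w)) \<in> borel_measurable N"
    unfolding g_def
  proof (rule lborel.borel_measurable_lebesgue_integral)
    have 1: "(\<lambda>w. (snd w - fst (fst w), snd (fst w))) \<in> measurable (N \<Otimes>\<^sub>M lborel) N"
      and 2: "(\<lambda>w. (snd w, snd (fst w))) \<in> measurable (N \<Otimes>\<^sub>M lborel) N" by measurable
    from borel_measurable_times[OF measurable_compose[OF 1 um] measurable_compose[OF 2 vm]]
    show "(\<lambda>(w, t). trunc n u (t - fst w) (snd w) * trunc n v t (snd w)) \<in> borel_measurable (N \<Otimes>\<^sub>M lborel)"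
      by (simp add: case_prod_beta')
  qed
  have gs: "sqint M (g \<tau>)" for \<tau>
  proof (rule sqint_bounded[OF finM section_measurable[OF gm]])
    have "\<bar>g \<tau> x\<bar> \<le> (\<integral>t. (real n)\<^sup>2 * indicator {- real n..real n} t \<partial>lborel)" for x
    proof -
      have "\<bar>g \<tau> x\<bar> \<le> (\<integral>t. \<bar>trunc n u (t - \<tau>) x * trunc n v t x\<bar> \<partial>lborel)"
        unfolding g_def by (rule integral_abs_bound)
      also have "\<dots> \<le> (\<integral>t. (real n)\<^sup>2 * indicator {- real n..real n} t \<partial>lborel)"
      proof (rule integral_mono')
        show "integrable lborel (\<lambda>t. (real n)\<^sup>2 * indicator {- real n..real n} t)" by simp
        fix t
        have "\<bar>trunc n u (t - \<tau>) x\<bar> \<le> real n" by (auto simp: trunc_def)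
        then show "\<bar>trunc n u (t - \<tau>) x * trunc n v t x\<bar> \<le> (real n)\<^sup>2 * indicator {- real n..real n} t"
          unfolding abs_mult power2_eq_square mult.assoc using trunc_le(2)[of n v t x] by (intro mult_mono) auto
      qed simp
      finally show ?thesis .
    qed
    then show "AE x in M. \<bar>g \<tau> x\<bar> \<le> (\<integral>t. (real n)\<^sup>2 * indicator {- real n..real n} t \<partial>lborel)" by simp
  qed
  have cm: "(\<lambda>\<tau>. co (g \<tau>) k) \<in> borel_measurable borel" for k
  proof -
    have [measurable]: "\<phi> k \<in> borel_measurable M" using sqint_\<phi>[of k] by (simp add: sqint_def)
    have "(\<lambda>(\<tau>, x). g \<tau> x * \<phi> k x) \<in> borel_measurable N"
      using gm unfolding case_prod_beta' by measurable
    then have "(\<lambda>\<tau>. \<integral>x. g \<tau> x * \<phi> k x \<partial>M) \<in> borel_measurable lborel" by (rule borel_measurable_lebesgue_integral)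
    then show ?thesis by (simp add: co_def)
  qed
  have "(\<lambda>\<tau>. indicator {0<..} \<tau> * (\<Sum>k. exp (- \<tau> * lam k) * co (\<lambda>_. 1) k * co (g \<tau>) k)) \<in> borel_measurable borel"
    using cm by (intro borel_measurable_times borel_measurable_suminf borel_measurable_exp) auto
  also have "(\<lambda>\<tau>. indicator {0<..} \<tau> * (\<Sum>k. exp (- \<tau> * lam k) * co (\<lambda>_. 1) k * co (g \<tau>) k))
    = (\<lambda>\<tau>. indicator {0<..} \<tau> * (\<integral>z. h \<tau> (snd z) * (trunc n u (fst z - \<tau>) (snd z) * trunc n v (fst z) (snd z)) \<partial>N))"
  proof (rule ext)
    fix \<tau> :: real
    show "indicator {0<..} \<tau> * (\<Sum>k. exp (- \<tau> * lam k) * co (\<lambda>_. 1) k * co (g \<tau>) k)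
      = indicator {0<..} \<tau> * (\<integral>z. h \<tau> (snd z) * (trunc n u (fst z - \<tau>) (snd z) * trunc n v (fst z) (snd z)) \<partial>N)"
    proof (cases "0 < \<tau>")
      case True
      have i: "integrable N (case_prod (\<lambda>t x. h \<tau> x * (trunc n u (t - \<tau>) x * trunc n v t x)))"
        using h_mult_integrable[OF True sqint_N_translate(1)[OF sqint_trunc[OF u]] sqint_trunc[OF v]] by (simp add: case_prod_beta')
      have "(\<integral>z. h \<tau> (snd z) * (trunc n u (fst z - \<tau>) (snd z) * trunc n v (fst z) (snd z)) \<partial>N)
          = (\<integral>x. \<integral>t. h \<tau> x * (trunc n u (t - \<tau>) x * trunc n v t x) \<partial>lborel \<partial>M)"
        using N.integral_snd[OF i] by (simp add: case_prod_beta')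
      also have "\<dots> = (\<integral>x. heat \<tau> (\<lambda>_. 1) x * g \<tau> x \<partial>M)"
        by (simp add: g_def h_eq_heat)
      also have "\<dots> = (\<Sum>k. exp (- \<tau> * lam k) * co (\<lambda>_. 1) k * co (g \<tau>) k)"
        using heat_sums[OF True sqint_1 gs] by (simp add: sums_iff)
      finally show ?thesis by simp
    qed simp
  qed
  finally show ?thesis .
qed

text \<open>At each lag the truncated expressions converge by dominated convergence, using the
  bounds on \<open>h \<tau>\<close>, and pointwise limits of measurable functions are
  measurable.\<close>

lemma XX_measurable:
  assumes u: "sqint N (\<lambda>z. u (fst z) (snd z))" and v: "sqint N (\<lambda>z. v (fst z) (snd z))"
  shows "(\<lambda>\<tau>. indicator {0<..} \<tau> * (\<integral>z. h \<tau> (snd z) * (u (fst z - \<tau>) (snd z) * v (fst z) (snd z)) \<partial>N)) \<in> borel_measurable borel"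
proof (rule borel_measurable_LIMSEQ_metric[OF XX_trunc_measurable[OF u v]])
  fix \<tau> :: real
  show "(\<lambda>n. indicator {0<..} \<tau> * (\<integral>z. h \<tau> (snd z) * (trunc n u (fst z - \<tau>) (snd z) * trunc n v (fst z) (snd z)) \<partial>N))
      \<longlonglongrightarrow> indicator {0<..} \<tau> * (\<integral>z. h \<tau> (snd z) * (u (fst z - \<tau>) (snd z) * v (fst z) (snd z)) \<partial>N)"
  proof (cases "0 < \<tau>")
    case True
    note u' = sqint_N_translate(1)[OF u, of \<tau>]
    have "(\<lambda>n. \<integral>z. h \<tau> (snd z) * (trunc n u (fst z - \<tau>) (snd z) * trunc n v (fst z) (snd z)) \<partial>N)
        \<longlonglongrightarrow> (\<integral>z. h \<tau> (snd z) * (u (fst z - \<tau>) (snd z) * v (fst z) (snd z)) \<partial>N)"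
    proof (rule integral_dominated_convergence[where w = "\<lambda>z. \<bar>u (fst z - \<tau>) (snd z) * v (fst z) (snd z)\<bar>"])
      show "(\<lambda>z. h \<tau> (snd z) * (u (fst z - \<tau>) (snd z) * v (fst z) (snd z))) \<in> borel_measurable N"
        by (rule borel_measurable_integrable[OF h_mult_integrable[OF True u' v]])
      show "(\<lambda>z. h \<tau> (snd z) * (trunc n u (fst z - \<tau>) (snd z) * trunc n v (fst z) (snd z))) \<in> borel_measurable N" for n
        by (rule borel_measurable_integrable[OF h_mult_integrable[OF True sqint_N_translate(1)[OF sqint_trunc[OF u]] sqint_trunc[OF v]]])
      show "integrable N (\<lambda>z. \<bar>u (fst z - \<tau>) (snd z) * v (fst z) (snd z)\<bar>)"
        using sqint_mult_integrable[OF u' v] by (rule integrable_abs)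
      show "AE z in N. (\<lambda>n. h \<tau> (snd z) * (trunc n u (fst z - \<tau>) (snd z) * trunc n v (fst z) (snd z)))
          \<longlonglongrightarrow> h \<tau> (snd z) * (u (fst z - \<tau>) (snd z) * v (fst z) (snd z))"
        by (intro AE_I2 tendsto_mult tendsto_const trunc_tendsto)
      show "AE z in N. norm (h \<tau> (snd z) * (trunc n u (fst z - \<tau>) (snd z) * trunc n v (fst z) (snd z)))
          \<le> \<bar>u (fst z - \<tau>) (snd z) * v (fst z) (snd z)\<bar>" for n
        using h_bounds_N[OF True]
      proof eventually_elim
        case (elim z)
        have "\<bar>h \<tau> (snd z)\<bar> * (\<bar>trunc n u (fst z - \<tau>) (snd z)\<bar> * \<bar>trunc n v (fst z) (snd z)\<bar>)
            \<le> 1 * (\<bar>u (fst z - \<tau>) (snd z)\<bar> * \<bar>v (fst z) (snd z)\<bar>)"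
          using elim by (intro mult_mono trunc_le(1)) auto
        then show ?case by (simp add: abs_mult)
      qed
    qed
    then show ?thesis using True by simp
  qed simp
qed


section \<open>Splitting the pairing into jump part and remainder\<close>

definition jump_part :: "(real \<Rightarrow> real^'n \<Rightarrow> real) \<Rightarrow> (real \<Rightarrow> real^'n \<Rightarrow> real) \<Rightarrow> real \<Rightarrow> real" where
  "jump_part u v \<tau> = (\<integral>z. h \<tau> (snd z) * (u (fst z - \<tau>) (snd z) * v (fst z) (snd z)) \<partial>N)
      - (\<integral>y. WT \<tau> y * (u (fst y - \<tau>) (snd (snd y)) * v (fst y) (fst (snd y))) \<partial>T)"

text \<open>The bracket of the theorem up to the kernel factor, with the equal-time term
  \<open>h \<tau> * u * v\<close> already cancelled. In
  \<open>jump_part u v \<tau> + rest_part u v \<tau>\<close> the remaining terms with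
  \<open>h \<tau>\<close> cancel as well.\<close>

definition rest_part :: "(real \<Rightarrow> real^'n \<Rightarrow> real) \<Rightarrow> (real \<Rightarrow> real^'n \<Rightarrow> real) \<Rightarrow> real \<Rightarrow> real" where
  "rest_part u v \<tau> = (\<integral>z. u (fst z) (snd z) * v (fst z) (snd z) \<partial>N)
      - (\<integral>z. h \<tau> (snd z) * (u (fst z - \<tau>) (snd z) * v (fst z) (snd z)) \<partial>N)"

text \<open>By \<open>energy_identity\<close> the jump part is half the integral of a product of
  differences. That product is bounded by the sum of the two squares, so only the quadratic jump
  forms of the shifted \<open>u\<close> and of \<open>v\<close> remain, and \<open>energy_le\<close>
  applies to both.\<close>

lemma jump_part_integrable:
  assumes s: "0 < s" "s < 1"
    and u: "sqint N (\<lambda>z. u (fst z) (snd z))" and v: "sqint N (\<lambda>z. v (fst z) (snd z))"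
    and eu: "fin_energy s u" and ev: "fin_energy s v"
  shows "integrable lborel (\<lambda>\<tau>. frac_kernel s \<tau> * jump_part u v \<tau>)"
proof (rule Bochner_Integration.integrable_bound)
  show "integrable lborel (\<lambda>\<tau>. frac_kernel s \<tau> * energy_series u \<tau> + frac_kernel s \<tau> * energy_series v \<tau>)"
    by (intro Bochner_Integration.integrable_add energy_series_integrable[OF s u eu] energy_series_integrable[OF s v ev])
  have "(\<lambda>\<tau>. frac_kernel s \<tau> * (indicator {0<..} \<tau> * (\<integral>z. h \<tau> (snd z) * (u (fst z - \<tau>) (snd z) * v (fst z) (snd z)) \<partial>N)
      - indicator {0<..} \<tau> * (\<integral>y. WT \<tau> y * (u (fst y - \<tau>) (snd (snd y)) * v (fst y) (fst (snd y))) \<partial>T))) \<in> borel_measurable borel"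
    by (intro borel_measurable_times borel_measurable_diff XX_measurable[OF u v] XZ_measurable[OF u v]) simp
  also have "(\<lambda>\<tau>. frac_kernel s \<tau> * (indicator {0<..} \<tau> * (\<integral>z. h \<tau> (snd z) * (u (fst z - \<tau>) (snd z) * v (fst z) (snd z)) \<partial>N)
      - indicator {0<..} \<tau> * (\<integral>y. WT \<tau> y * (u (fst y - \<tau>) (snd (snd y)) * v (fst y) (fst (snd y))) \<partial>T)))
    = (\<lambda>\<tau>. frac_kernel s \<tau> * jump_part u v \<tau>)"
  proof (rule ext)
    fix \<tau> :: real
    show "frac_kernel s \<tau> * (indicator {0<..} \<tau> * (\<integral>z. h \<tau> (snd z) * (u (fst z - \<tau>) (snd z) * v (fst z) (snd z)) \<partial>N)
      - indicator {0<..} \<tau> * (\<integral>y. WT \<tau> y * (u (fst y - \<tau>) (snd (snd y)) * v (fst y) (fst (snd y))) \<partial>T)) = frac_kernel s \<tau> * jump_part u v \<tau>"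
      by (cases "0 < \<tau>") (simp_all add: jump_part_def)
  qed
  finally show "(\<lambda>\<tau>. frac_kernel s \<tau> * jump_part u v \<tau>) \<in> borel_measurable lborel" by simp
  show "AE \<tau> in lborel. norm (frac_kernel s \<tau> * jump_part u v \<tau>) \<le> norm (frac_kernel s \<tau> * energy_series u \<tau> + frac_kernel s \<tau> * energy_series v \<tau>)"
  proof (rule AE_I2)
    fix \<tau> :: real
    show "norm (frac_kernel s \<tau> * jump_part u v \<tau>) \<le> norm (frac_kernel s \<tau> * energy_series u \<tau> + frac_kernel s \<tau> * energy_series v \<tau>)"
    proof (cases "0 < \<tau>")
      case \<tau>: True
      \<comment> \<open>The lag is absorbed into \<open>p\<close>, whose energies are those of
        \<open>u\<close> by \<open>coef_energy_translate\<close>.\<close>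
      define p where "p t = u (t - \<tau>)" for t
      have p: "sqint N (\<lambda>z. p (fst z) (snd z))" unfolding p_def by (rule sqint_N_translate(1)[OF u])
      define a where "a y = p (fst y) (fst (snd y)) - p (fst y) (snd (snd y))" for y :: "real \<times> (real^'n) \<times> (real^'n)"
      define b where "b y = v (fst y) (fst (snd y)) - v (fst y) (snd (snd y))" for y :: "real \<times> (real^'n) \<times> (real^'n)"
      have ip: "integrable T (\<lambda>y. WT \<tau> y * (a y)\<^sup>2)"
        using energy_identity(1)[OF \<tau> p p] by (simp add: a_def power2_eq_square)
      have iv: "integrable T (\<lambda>y. WT \<tau> y * (b y)\<^sup>2)"
        using energy_identity(1)[OF \<tau> v v] by (simp add: b_def power2_eq_square)
      have iab: "integrable T (\<lambda>y. WT \<tau> y * (a y * b y))"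
        using energy_identity(1)[OF \<tau> p v] by (simp add: a_def b_def)
      have jump_part: "2 * jump_part u v \<tau> = (\<integral>y. WT \<tau> y * (a y * b y) \<partial>T)"
        using energy_identity(2)[OF \<tau> p v] by (simp add: a_def b_def jump_part_def p_def)
      have "\<bar>\<integral>y. WT \<tau> y * (a y * b y) \<partial>T\<bar> \<le> (\<integral>y. \<bar>WT \<tau> y * (a y * b y)\<bar> \<partial>T)" by (rule integral_abs_bound)
      also have "\<dots> \<le> (\<integral>y. WT \<tau> y * (a y)\<^sup>2 + WT \<tau> y * (b y)\<^sup>2 \<partial>T)"
      proof (rule integral_mono)
        show "integrable T (\<lambda>y. \<bar>WT \<tau> y * (a y * b y)\<bar>)" using iab by (rule integrable_abs)
        show "integrable T (\<lambda>y. WT \<tau> y * (a y)\<^sup>2 + WT \<tau> y * (b y)\<^sup>2)" using ip iv by (rule Bochner_Integration.integrable_add)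
        fix y assume "y \<in> space T"
        from mult_left_mono[OF abs_mult_le_sq[of "a y" "b y"] WT_nonneg[OF \<tau> this]] WT_nonneg[OF \<tau> this]
        show "\<bar>WT \<tau> y * (a y * b y)\<bar> \<le> WT \<tau> y * (a y)\<^sup>2 + WT \<tau> y * (b y)\<^sup>2"
          by (simp add: abs_mult distrib_left)
      qed
      also have "\<dots> = (\<integral>y. WT \<tau> y * (a y)\<^sup>2 \<partial>T) + (\<integral>y. WT \<tau> y * (b y)\<^sup>2 \<partial>T)"
        by (rule Bochner_Integration.integral_add[OF ip iv])
      also have "\<dots> \<le> 2 * energy_series u \<tau> + 2 * energy_series v \<tau>"
        using energy_le(1)[OF \<tau> p] energy_le(1)[OF \<tau> v] coef_energy_translate[of u \<tau>]
        by (simp add: a_def b_def energy_series_def p_def[abs_def])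
      finally have "\<bar>jump_part u v \<tau>\<bar> \<le> energy_series u \<tau> + energy_series v \<tau>" using jump_part by simp
      from mult_left_mono[OF this frac_kernel_nonneg[of s \<tau>]]
      show ?thesis by (simp add: abs_mult distrib_left)
    qed simp
  qed
qed

text \<open>At each lag the integral over index and frequency is a real number by
  \<open>integral_CL_semigroup\<close>; hence the pairing of real functions is real.\<close>

lemma total_real:
  assumes s: "0 < s" "s < 1"
    and u: "sqint N (\<lambda>z. u (fst z) (snd z))" and v: "sqint N (\<lambda>z. v (fst z) (snd z))"
    and eu: "fin_energy s u" and ev: "fin_energy s v"
  shows "integrable lborel (\<lambda>\<tau>. frac_kernel s \<tau> / \<bar>Gamma (- s)\<bar> * (jump_part u v \<tau> + rest_part u v \<tau>))"
    "Hs_pair \<Omega> lam \<phi> s u v = complex_of_real (\<integral>\<tau>. frac_kernel s \<tau> / \<bar>Gamma (- s)\<bar> * (jump_part u v \<tau> + rest_part u v \<tau>) \<partial>lborel)"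
proof -
  have eq: "(\<integral>y. frac_integrand s (Z (fst y) (snd y)) \<tau> * (complex_of_real (1 / \<bar>Gamma (- s)\<bar>) * hat_product u v (fst y) (snd y)) \<partial>CL)
     = complex_of_real (frac_kernel s \<tau> / \<bar>Gamma (- s)\<bar> * (jump_part u v \<tau> + rest_part u v \<tau>))" for \<tau>
  proof (cases "0 < \<tau>")
    case True
    have "(\<integral>y. frac_integrand s (Z (fst y) (snd y)) \<tau> * (complex_of_real (1 / \<bar>Gamma (- s)\<bar>) * hat_product u v (fst y) (snd y)) \<partial>CL)
       = (\<integral>y. complex_of_real (frac_kernel s \<tau> / \<bar>Gamma (- s)\<bar>) * ((1 - exp (- complex_of_real \<tau> * Z (fst y) (snd y))) * hat_product u v (fst y) (snd y)) \<partial>CL)"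
      by (intro Bochner_Integration.integral_cong refl) (simp add: frac_integrand_def)
    also have "\<dots> = complex_of_real (frac_kernel s \<tau> / \<bar>Gamma (- s)\<bar>) * (\<integral>y. (1 - exp (- complex_of_real \<tau> * Z (fst y) (snd y))) * hat_product u v (fst y) (snd y) \<partial>CL)"
      by (rule integral_mult_right_zero)
    also have "\<dots> = complex_of_real (frac_kernel s \<tau> / \<bar>Gamma (- s)\<bar>) * complex_of_real (jump_part u v \<tau> + rest_part u v \<tau>)"
      unfolding integral_CL_semigroup[OF u v True] by (simp add: jump_part_def rest_part_def)
    finally show ?thesis by (simp only: of_real_mult)
  qed (simp add: frac_integrand_def)
  have "integrable lborel (\<lambda>\<tau>. complex_of_real (frac_kernel s \<tau> / \<bar>Gamma (- s)\<bar> * (jump_part u v \<tau> + rest_part u v \<tau>)))"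
    using total_integrable[OF s u v eu ev] by (simp only: eq)
  then have "integrable lborel (\<lambda>\<tau>. Re (complex_of_real (frac_kernel s \<tau> / \<bar>Gamma (- s)\<bar> * (jump_part u v \<tau> + rest_part u v \<tau>))))"
    by (rule integrable_Re)
  then show "integrable lborel (\<lambda>\<tau>. frac_kernel s \<tau> / \<bar>Gamma (- s)\<bar> * (jump_part u v \<tau> + rest_part u v \<tau>))"
    by (simp only: Re_complex_of_real)
  show "Hs_pair \<Omega> lam \<phi> s u v = complex_of_real (\<integral>\<tau>. frac_kernel s \<tau> / \<bar>Gamma (- s)\<bar> * (jump_part u v \<tau> + rest_part u v \<tau>) \<partial>lborel)"
    unfolding total_integral[OF s u v eu ev, symmetric] eq by (rule integral_complex_of_real)
qed

text \<open>Integrability in \<tau> is known for the jump part and for the total, and the remainder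
  inherits it as their difference. \<open>K1\<close>, \<open>K2\<close> and \<open>K3\<close>
  rewrite the integrands of the theorem in the notation of the product spaces; they hold at positive
  lags, which is all that the integral over \<open>{0<..}\<close> sees.\<close>

theorem fractional_pairing:
  assumes s: "0 < s" "s < 1"
    and u: "sqint N (\<lambda>z. u (fst z) (snd z))" and v: "sqint N (\<lambda>z. v (fst z) (snd z))"
    and eu: "fin_energy s u" and ev: "fin_energy s v"
  shows "(\<forall>\<tau>>0. integrable T (\<lambda>(t, x, z). Ks W s \<tau> x z * (u (t - \<tau>) x - u (t - \<tau>) z) * (v t x - v t z))
          \<and> integrable N (\<lambda>(t, x). (1 - heat1 \<Omega> W \<tau> x) / (\<bar>Gamma (- s)\<bar> * \<tau> powr (1 + s)) * u t x * v t x)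
          \<and> integrable N (\<lambda>(t, x). heat1 \<Omega> W \<tau> x * (u (t - \<tau>) x - u t x) / (\<bar>Gamma (- s)\<bar> * \<tau> powr (1 + s)) * v t x))
    \<and> (\<exists>I1 I2.
        ((\<lambda>\<tau>. \<integral>t. \<integral>x. \<integral>z. Ks W s \<tau> x z * (u (t - \<tau>) x - u (t - \<tau>) z) * (v t x - v t z) \<partial>M \<partial>M \<partial>lborel) has_integral I1) {0<..}
      \<and> ((\<lambda>\<tau>. (\<integral>t. \<integral>x. (1 - heat1 \<Omega> W \<tau> x) / (\<bar>Gamma (- s)\<bar> * \<tau> powr (1 + s)) * u t x * v t x \<partial>M \<partial>lborel)
              - (\<integral>t. \<integral>x. heat1 \<Omega> W \<tau> x * (u (t - \<tau>) x - u t x) / (\<bar>Gamma (- s)\<bar> * \<tau> powr (1 + s)) * v t x \<partial>M \<partial>lborel)) has_integral I2) {0<..}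
      \<and> Hs_pair \<Omega> lam \<phi> s u v = complex_of_real (I1 + I2))"
proof -
  define \<kappa> where "\<kappa> \<tau> = frac_kernel s \<tau> / \<bar>Gamma (- s)\<bar>" for \<tau>
  have \<kappa>: "1 / (\<bar>Gamma (- s)\<bar> * \<tau> powr (1 + s)) = \<kappa> \<tau>" if "0 < \<tau>" for \<tau>
    using that by (simp add: \<kappa>_def frac_kernel_pos)
  have K1: "(case y of (t, x, z) \<Rightarrow> Ks W s \<tau> x z * (u (t - \<tau>) x - u (t - \<tau>) z) * (v t x - v t z))
      = \<kappa> \<tau> / 2 * (WT \<tau> y * ((u (fst y - \<tau>) (fst (snd y)) - u (fst y - \<tau>) (snd (snd y))) * (v (fst y) (fst (snd y)) - v (fst y) (snd (snd y)))))"
    if "0 < \<tau>" for \<tau> y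
    unfolding \<kappa>[OF that, symmetric] by (simp add: Ks_def case_prod_beta')
  have K2: "(case z of (t, x) \<Rightarrow> (1 - heat1 \<Omega> W \<tau> x) / (\<bar>Gamma (- s)\<bar> * \<tau> powr (1 + s)) * u t x * v t x)
      = \<kappa> \<tau> * (u (fst z) (snd z) * v (fst z) (snd z) - h \<tau> (snd z) * (u (fst z) (snd z) * v (fst z) (snd z)))"
    if "0 < \<tau>" for \<tau> z
    unfolding \<kappa>[OF that, symmetric] h_def by (simp add: case_prod_beta' field_simps)
  have K3: "(case z of (t, x) \<Rightarrow> heat1 \<Omega> W \<tau> x * (u (t - \<tau>) x - u t x) / (\<bar>Gamma (- s)\<bar> * \<tau> powr (1 + s)) * v t x)
      = \<kappa> \<tau> * (h \<tau> (snd z) * (u (fst z - \<tau>) (snd z) * v (fst z) (snd z)) - h \<tau> (snd z) * (u (fst z) (snd z) * v (fst z) (snd z)))"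
    if "0 < \<tau>" for \<tau> z
    unfolding \<kappa>[OF that, symmetric] h_def by (simp add: case_prod_beta' field_simps)
  note u' = sqint_N_translate(1)[OF u]
  have I1: "integrable T (\<lambda>(t, x, z). Ks W s \<tau> x z * (u (t - \<tau>) x - u (t - \<tau>) z) * (v t x - v t z))" if "0 < \<tau>" for \<tau>
    unfolding K1[OF that] using energy_identity(1)[OF that u' v] by simp
  have iuv: "integrable N (\<lambda>z. u (fst z) (snd z) * v (fst z) (snd z))" by (rule sqint_mult_integrable[OF u v])
  have I2: "integrable N (\<lambda>(t, x). (1 - heat1 \<Omega> W \<tau> x) / (\<bar>Gamma (- s)\<bar> * \<tau> powr (1 + s)) * u t x * v t x)" if "0 < \<tau>" for \<tau>
    unfolding K2[OF that]
    by (intro integrable_mult_right Bochner_Integration.integrable_diff iuv h_mult_integrable[OF that u v])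
  have I3: "integrable N (\<lambda>(t, x). heat1 \<Omega> W \<tau> x * (u (t - \<tau>) x - u t x) / (\<bar>Gamma (- s)\<bar> * \<tau> powr (1 + s)) * v t x)" if "0 < \<tau>" for \<tau>
    unfolding K3[OF that]
    by (intro integrable_mult_right Bochner_Integration.integrable_diff h_mult_integrable[OF that u v] h_mult_integrable[OF that u' v])
  have F1: "(\<integral>t. \<integral>x. \<integral>z. Ks W s \<tau> x z * (u (t - \<tau>) x - u (t - \<tau>) z) * (v t x - v t z) \<partial>M \<partial>M \<partial>lborel) = \<kappa> \<tau> * jump_part u v \<tau>" if "0 < \<tau>" for \<tau>
  proof -
    have "(\<integral>t. \<integral>x. \<integral>z. Ks W s \<tau> x z * (u (t - \<tau>) x - u (t - \<tau>) z) * (v t x - v t z) \<partial>M \<partial>M \<partial>lborel)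
        = (\<integral>y. (case y of (t, x, z) \<Rightarrow> Ks W s \<tau> x z * (u (t - \<tau>) x - u (t - \<tau>) z) * (v t x - v t z)) \<partial>T)"
      using integral_T_iterated[OF I1[OF that]] by simp
    also have "\<dots> = \<kappa> \<tau> / 2 * (\<integral>y. WT \<tau> y * ((u (fst y - \<tau>) (fst (snd y)) - u (fst y - \<tau>) (snd (snd y))) * (v (fst y) (fst (snd y)) - v (fst y) (snd (snd y)))) \<partial>T)"
      unfolding K1[OF that] by (rule integral_mult_right_zero)
    also have "\<dots> = \<kappa> \<tau> / 2 * (2 * jump_part u v \<tau>)"
      using energy_identity(2)[OF that u' v] by (simp add: jump_part_def)
    finally show ?thesis by simp
  qed
  have F2: "(\<integral>t. \<integral>x. (1 - heat1 \<Omega> W \<tau> x) / (\<bar>Gamma (- s)\<bar> * \<tau> powr (1 + s)) * u t x * v t x \<partial>M \<partial>lborel)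
              - (\<integral>t. \<integral>x. heat1 \<Omega> W \<tau> x * (u (t - \<tau>) x - u t x) / (\<bar>Gamma (- s)\<bar> * \<tau> powr (1 + s)) * v t x \<partial>M \<partial>lborel) = \<kappa> \<tau> * rest_part u v \<tau>" if "0 < \<tau>" for \<tau>
  proof -
    have 1: "(\<integral>t. \<integral>x. (1 - heat1 \<Omega> W \<tau> x) / (\<bar>Gamma (- s)\<bar> * \<tau> powr (1 + s)) * u t x * v t x \<partial>M \<partial>lborel)
       = \<kappa> \<tau> * ((\<integral>z. u (fst z) (snd z) * v (fst z) (snd z) \<partial>N) - (\<integral>z. h \<tau> (snd z) * (u (fst z) (snd z) * v (fst z) (snd z)) \<partial>N))"
    proof -
      have "(\<integral>t. \<integral>x. (1 - heat1 \<Omega> W \<tau> x) / (\<bar>Gamma (- s)\<bar> * \<tau> powr (1 + s)) * u t x * v t x \<partial>M \<partial>lborel)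
        = (\<integral>z. (case z of (t, x) \<Rightarrow> (1 - heat1 \<Omega> W \<tau> x) / (\<bar>Gamma (- s)\<bar> * \<tau> powr (1 + s)) * u t x * v t x) \<partial>N)"
        using integral_N_iterated[OF I2[OF that]] by simp
      then show ?thesis
        unfolding K2[OF that] integral_mult_right_zero Bochner_Integration.integral_diff[OF iuv h_mult_integrable[OF that u v]] .
    qed
    have 2: "(\<integral>t. \<integral>x. heat1 \<Omega> W \<tau> x * (u (t - \<tau>) x - u t x) / (\<bar>Gamma (- s)\<bar> * \<tau> powr (1 + s)) * v t x \<partial>M \<partial>lborel)
       = \<kappa> \<tau> * ((\<integral>z. h \<tau> (snd z) * (u (fst z - \<tau>) (snd z) * v (fst z) (snd z)) \<partial>N) - (\<integral>z. h \<tau> (snd z) * (u (fst z) (snd z) * v (fst z) (snd z)) \<partial>N))"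
    proof -
      have "(\<integral>t. \<integral>x. heat1 \<Omega> W \<tau> x * (u (t - \<tau>) x - u t x) / (\<bar>Gamma (- s)\<bar> * \<tau> powr (1 + s)) * v t x \<partial>M \<partial>lborel)
        = (\<integral>z. (case z of (t, x) \<Rightarrow> heat1 \<Omega> W \<tau> x * (u (t - \<tau>) x - u t x) / (\<bar>Gamma (- s)\<bar> * \<tau> powr (1 + s)) * v t x) \<partial>N)"
        using integral_N_iterated[OF I3[OF that]] by simp
      then show ?thesis
        unfolding K3[OF that] integral_mult_right_zero Bochner_Integration.integral_diff[OF h_mult_integrable[OF that u' v] h_mult_integrable[OF that u v]] .
    qed
    \<comment> \<open>The equal-time term \<open>h \<tau> * u * v\<close> occurs in both integrals
      with the same sign and cancels in their difference.\<close>
    show ?thesis unfolding 1 2 rest_part_def by (simp add: algebra_simps)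
  qed
  have i1: "integrable lborel (\<lambda>\<tau>. \<kappa> \<tau> * jump_part u v \<tau>)"
    using jump_part_integrable[OF s u v eu ev] by (simp add: \<kappa>_def)
  have itot: "integrable lborel (\<lambda>\<tau>. \<kappa> \<tau> * (jump_part u v \<tau> + rest_part u v \<tau>))"
    using total_real(1)[OF s u v eu ev] by (simp only: \<kappa>_def)
  have i2: "integrable lborel (\<lambda>\<tau>. \<kappa> \<tau> * rest_part u v \<tau>)"
    using Bochner_Integration.integrable_diff[OF itot i1] by (simp add: distrib_left)
  have z: "\<kappa> \<tau> = 0" if "\<tau> \<le> 0" for \<tau> using that by (simp add: \<kappa>_def)
  have H1: "((\<lambda>\<tau>. \<integral>t. \<integral>x. \<integral>z. Ks W s \<tau> x z * (u (t - \<tau>) x - u (t - \<tau>) z) * (v t x - v t z) \<partial>M \<partial>M \<partial>lborel)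
      has_integral (\<integral>\<tau>. \<kappa> \<tau> * jump_part u v \<tau> \<partial>lborel)) {0<..}"
    by (rule has_integral_pos_lborel[OF i1 F1]) (simp_all add: z)
  have H2: "((\<lambda>\<tau>. (\<integral>t. \<integral>x. (1 - heat1 \<Omega> W \<tau> x) / (\<bar>Gamma (- s)\<bar> * \<tau> powr (1 + s)) * u t x * v t x \<partial>M \<partial>lborel)
              - (\<integral>t. \<integral>x. heat1 \<Omega> W \<tau> x * (u (t - \<tau>) x - u t x) / (\<bar>Gamma (- s)\<bar> * \<tau> powr (1 + s)) * v t x \<partial>M \<partial>lborel))
      has_integral (\<integral>\<tau>. \<kappa> \<tau> * rest_part u v \<tau> \<partial>lborel)) {0<..}"
    by (rule has_integral_pos_lborel[OF i2 F2]) (simp_all add: z)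
  have "Hs_pair \<Omega> lam \<phi> s u v = complex_of_real ((\<integral>\<tau>. \<kappa> \<tau> * jump_part u v \<tau> \<partial>lborel) + (\<integral>\<tau>. \<kappa> \<tau> * rest_part u v \<tau> \<partial>lborel))"
    unfolding total_real(2)[OF s u v eu ev] Bochner_Integration.integral_add[OF i1 i2, symmetric]
    by (simp add: \<kappa>_def distrib_left)
  with H1 H2 I1 I2 I3 show ?thesis by blast
qed

end

theorem theorem2p2:
  fixes \<Omega> :: "(real^'n::finite) set"
    and a :: "real^'n \<Rightarrow> real^'n^'n" and c :: "real^'n \<Rightarrow> real" and \<Lambda> :: real
    and dir :: bool
    and lam :: "nat \<Rightarrow> real" and \<phi> :: "nat \<Rightarrow> real^'n \<Rightarrow> real"
    and W :: "real \<Rightarrow> real^'n \<Rightarrow> real^'n \<Rightarrow> real"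
    and s :: real and u v :: "real \<Rightarrow> real^'n \<Rightarrow> real"
  assumes dom: "open \<Omega>" "connected \<Omega>" "bounded \<Omega>" "\<Omega> \<noteq> {}"
    and a_meas: "\<forall>i j. (\<lambda>x. a x $ i $ j) \<in> borel_measurable (lebesgue_on \<Omega>)"
    and a_sym: "\<forall>x\<in>\<Omega>. transpose (a x) = a x"
    and a_ell: "\<Lambda> > 0" "\<forall>x\<in>\<Omega>. \<forall>\<xi>. (1 / \<Lambda>) * (norm \<xi>)\<^sup>2 \<le> \<xi> \<bullet> (a x *v \<xi>)
                                  \<and> \<xi> \<bullet> (a x *v \<xi>) \<le> \<Lambda> * (norm \<xi>)\<^sup>2"
    and c_meas: "c \<in> borel_measurable (lebesgue_on \<Omega>)"
    and c_bdd: "AE x in lebesgue_on \<Omega>. 0 \<le> c x" "\<exists>C. AE x in lebesgue_on \<Omega>. c x \<le> C"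
    and lam_mono: "mono lam" and lam_inf: "filterlim lam at_top sequentially"
    and eig: "\<forall>k. is_eigenpair a c dir \<Omega> (lam k) (\<phi> k)"
    and onb: "L2_onb \<Omega> \<phi>"
    and hk: "heat_kernel \<Omega> lam \<phi> W"
    and W_sym_pos: "\<forall>\<tau>>0. \<forall>x\<in>\<Omega>. \<forall>z\<in>\<Omega>. W \<tau> x z = W \<tau> z x \<and> 0 \<le> W \<tau> x z"
    and s: "0 < s" "s < 1"
    and uv: "u \<in> Dom_Hs \<Omega> lam \<phi> s" "v \<in> Dom_Hs \<Omega> lam \<phi> s"
    and mean0: "lam 0 = 0 \<longrightarrow>
        (AE t in lborel. (\<integral>x. u t x \<partial>lebesgue_on \<Omega>) = 0) \<and>
        (AE t in lborel. (\<integral>x. v t x \<partial>lebesgue_on \<Omega>) = 0)"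
  shows "(\<forall>\<tau>>0. integrable (lborel \<Otimes>\<^sub>M (lebesgue_on \<Omega> \<Otimes>\<^sub>M lebesgue_on \<Omega>))
            (\<lambda>(t, x, z). Ks W s \<tau> x z * (u (t - \<tau>) x - u (t - \<tau>) z) * (v t x - v t z))
          \<and> integrable (lborel \<Otimes>\<^sub>M lebesgue_on \<Omega>)
            (\<lambda>(t, x). (1 - heat1 \<Omega> W \<tau> x) / (\<bar>Gamma (- s)\<bar> * \<tau> powr (1 + s)) * u t x * v t x)
          \<and> integrable (lborel \<Otimes>\<^sub>M lebesgue_on \<Omega>)
            (\<lambda>(t, x). heat1 \<Omega> W \<tau> x * (u (t - \<tau>) x - u t x) / (\<bar>Gamma (- s)\<bar> * \<tau> powr (1 + s)) * v t x))
    \<and> (\<exists>I1 I2.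
        ((\<lambda>\<tau>. \<integral>t. \<integral>x. \<integral>z. Ks W s \<tau> x z * (u (t - \<tau>) x - u (t - \<tau>) z) * (v t x - v t z)
               \<partial>lebesgue_on \<Omega> \<partial>lebesgue_on \<Omega> \<partial>lborel) has_integral I1) {0<..}
      \<and> ((\<lambda>\<tau>. (\<integral>t. \<integral>x. (1 - heat1 \<Omega> W \<tau> x) / (\<bar>Gamma (- s)\<bar> * \<tau> powr (1 + s)) * u t x * v t x
                   \<partial>lebesgue_on \<Omega> \<partial>lborel)
              - (\<integral>t. \<integral>x. heat1 \<Omega> W \<tau> x * (u (t - \<tau>) x - u t x) / (\<bar>Gamma (- s)\<bar> * \<tau> powr (1 + s)) * v t x
                   \<partial>lebesgue_on \<Omega> \<partial>lborel)) has_integral I2) {0<..}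
      \<and> Hs_pair \<Omega> lam \<phi> s u v = complex_of_real (I1 + I2))"
proof -
  interpret elliptic_heat \<Omega> a c \<Lambda> dir lam \<phi> W
    by unfold_locales (fact dom a_meas a_sym a_ell c_meas c_bdd eig onb hk W_sym_pos)+
  have "sqint (lborel \<Otimes>\<^sub>M lebesgue_on \<Omega>) (\<lambda>z. u (fst z) (snd z))" "fin_energy s u"
    "sqint (lborel \<Otimes>\<^sub>M lebesgue_on \<Omega>) (\<lambda>z. v (fst z) (snd z))" "fin_energy s v"
    using uv by (auto simp: Dom_Hs_def L2_st_def sqint_def fin_energy_def case_prod_beta')
  then show ?thesis by (intro fractional_pairing[OF s])
qed

end
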